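(* Let $(E,\{S_\alpha,g_\alpha\}_{\alpha\in I})$ be a stratified Riemannian state space and suppose that Assumptions (D), (J) and (L) stated in the context hold; let $\pi$ be the unique invariant probability measure of the stratified jump-diffusion $X$. Assume in addition that there exists a measurable function $G:E\to\mathbb R$ such that $A^*_mV=G$ on $O_m$ for all $m\ge1$. If, furthermore, $X$ is aperiodic, then it is $V$-uniformly geometrically ergodic: there exist constants $M<\infty$ and $c>0$ such that $$\|P_t(x,\cdot)-\pi\|_V:=\sup_{|f|\le V}\left|P_tf(x)-\pi(f)\right|\le M\,V(x)\,e^{-ct},\qquad x\in E,\ t\ge0.$$
   Context: **Notation.** $(E,d)$ is a locally compact separable metric space, $\mathcal B(E)$ its Borel $\sigma$-algebra, $B_b(E)$ the bounded Borel functions, $D_E=D([0,\infty);E)$ the Skorokhod space, $\mathcal P(\cdot)$ the space of Borel probability measures. $\pi(f)=\int f\,d\pi$; the supremum is over measurable $f$. **Stratified Riemannian state space.** $I$ is countable and $E=\bigsqcup_{\alpha\in I}S_\alpha$ is a partition such that each $S_\alpha$ is a connected smooth finite-dimensional manifold without boundary with a Riemannian metric $g_\alpha$; each inclusion $S_\alpha\hookrightarrow E$ is a homeomorphism onto its image, which is a Borel subset of $E$. **Assumption (D).** For every $\alpha\in I$ there is a conservative càdlàg Markov family $(\mathbb Q^\alpha_x)_{x\in S_\alpha}$ on $D([0,\infty);S_\alpha)$, with canonical process $\eta$, such that: (D1) $x\mapsto\mathbb Q^\alpha_x\in\mathcal P(D([0,\infty);S_\alpha))$ is Borel measurable; (D2)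 $\mathbb Q^\alpha_x(\eta_0=x)=1$, $\mathbb Q^\alpha_x(\eta_t\in S_\alpha\ \forall t\ge0)=1$, and the paths are continuous in $S_\alpha$; (D3) $P^\alpha_tg(x):=\mathbb E_{\mathbb Q^\alpha_x}[g(\eta_t)]$ restricts to a strongly continuous contraction semigroup on $C_0(S_\alpha)$; (D4) with $L_\alpha$ the generator of $(P^\alpha_t)$ on $C_0(S_\alpha)$, there is a linear subspace $\mathcal C_\alpha\subset D(L_\alpha)$ which is a core for $L_\alpha$ and is measure determining on $S_\alpha$ (for finite Borel measures). **Assumption (J).** There is a directed graph $(I,\mathcal E)$ with countable edge set; $e$ has tail $\alpha(e)$ and head $\beta(e)$. For each $e$ there are a Borel probability kernel $K_e:S_{\alpha(e)}\times\mathcal B(E)\to[0,1]$ with $K_e(x,S_{\beta(e)})=1$, $K_e(x,\{x\})=0$, and a Borel rate $\lambda_e:S_{\alpha(e)}\to[0,\infty)$. For $x\in S_\alpha$, $\Lambda(x):=\sum_{e:\alpha(e)=\alpha}\lambda_e(x)$, $\nu(x,B):=\sum_{e:\alpha(e)=\alpha}\lambda_e(x)K_e(x,B)$; assume $\sup_E\Lambda\le\overline\Lambda<\infty$. **The process $X$.** $\mathcal D_0$ is the set of bounded Borel $f:E\to\mathbb R$ with $f|_{S_\alpha}\in\mathcal C_\alpha$ for all $\alpha$ and $f|_{S_\alpha}=0$ for all but finitely many $\alpha$; for $x\in S_\alpha$, $Af(x):=L_\alpha(f|_{S_\alpha})(x)+\int_E(f(y)-f(x))\nu(x,dy)$. Under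 (D) and (J), for each $x\in E$ there is a unique $\mathbb P_x\in\mathcal P(D_E)$ such that, for the canonical process $X_t(\omega)=\omega(t)$, $\mathbb P_x(X_0=x)=1$ and $f(X_t)-f(X_0)-\int_0^tAf(X_s)ds$ is a $\mathbb P_x$-martingale (natural filtration of $X$) for all $f\in\mathcal D_0$; moreover $x\mapsto\mathbb P_x$ is Borel and $(\mathbb P_x)$ is a conservative strong Markov family. The stratified jump-diffusion is $X$ under $(\mathbb P_x)$; $P_t(x,B)=\mathbb P_x(X_t\in B)$, $P_tf(x)=\mathbb E_x[f(X_t)]$. Under (D), (J), (L), $X$ has a unique invariant probability measure $\pi$, and $\int V\,d\pi<\infty$. **Truncated extended generator.** Fix open relatively compact sets $O_m\subset E$ ($m\ge1$) with $\overline{O_m}\subset O_{m+1}$, $\bigcup_mO_m=E$; $T_m:=\inf\{t\ge0:X_t\notin O_m\}$, $X^{(m)}_t:=X_{t\wedge T_m}$. A measurable $V:E\to\mathbb R$ is in $D(A^*_m)$ if there is a measurable $G_m:E\to\mathbb R$ with $\mathbb E_x[\int_0^{t\wedge T_m}|G_m(X_s)|ds]<\infty$ and $\mathbb E_x[V(X^{(m)}_t)]=V(x)+\mathbb E_x[\int_0^{t\wedge T_m}G_m(X_s)ds]$ for all $t\ge0$, $x\in E$; then write $A^*_mV:=G_m$ on $O_m$. **Petite set.** $C\in\mathcal B(E)$ is petite if there are a probability measure $a$ on $(0,\infty)$ and a non-zero measure $\nu'$ on $(E,\mathcal B(E))$ with $\int_0^\infty P_t(x,B)\,a(dt)\ge\nu'(B)$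 for all $x\in C$, $B\in\mathcal B(E)$. **Assumption (L).** There exist a measurable $V:E\to[1,\infty)$, a closed petite set $C$ and constants $\lambda,b>0$ such that $V$ is bounded on $C$ and, for all $m\ge1$, $V\in D(A^*_m)$ and $A^*_mV(x)\le-\lambda V(x)+b\mathbf 1_C(x)$ for $x\in O_m$. **Aperiodicity.** $X$ is $\psi$-irreducible ($\psi$ a non-zero $\sigma$-finite measure on $E$) if $\psi(B)>0$ implies $\mathbb E_x[\int_0^\infty\mathbf 1_{\{X_t\in B\}}dt]>0$ for all $x\in E$. A $\psi$-irreducible $X$ is aperiodic if there exist $D,\varepsilon>0$, a compact set $K\subset E$ with $\psi(K)>0$ and a probability measure $\rho$ with $\rho(K)>0$ such that $P_D(x,\cdot)\ge\varepsilon\rho(\cdot)$ for all $x\in K$. *)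

theory Defs
  imports "HOL-Probability.Probability"
begin

text \<open>
  Dimensions vary with the stratum, so coordinates live in the library's
  \<^const>\<open>Euclidean_space\<close> \<open>n\<close>, i.e. \<open>\<real>\<^sup>n\<close> as the functions \<^typ>\<open>nat \<Rightarrow> real\<close> vanishing from
  index \<open>n\<close> on.
\<close>

definition partial :: "nat \<Rightarrow> ((nat \<Rightarrow> real) \<Rightarrow> real) \<Rightarrow> (nat \<Rightarrow> real) \<Rightarrow> real" where
  "partial i f y = deriv (\<lambda>t. f (y(i := t))) (y i)"

primrec Ck_on :: "nat \<Rightarrow> (nat \<Rightarrow> real) set \<Rightarrow> nat \<Rightarrow> ((nat \<Rightarrow> real) \<Rightarrow> real) \<Rightarrow> bool" where
  "Ck_on n W 0 f \<longleftrightarrow>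
     continuous_map (subtopology (Euclidean_space n) W) euclideanreal f"
| "Ck_on n W (Suc k) f \<longleftrightarrow>
     continuous_map (subtopology (Euclidean_space n) W) euclideanreal f \<and>
     (\<forall>i<n. (\<forall>y\<in>W. (\<lambda>t. f (y(i := t))) field_differentiable (at (y i))) \<and>
            Ck_on n W k (partial i f))"

text \<open>To be used for open \<open>W\<close> only: then only the values of \<open>f\<close> on \<open>W\<close> matter.\<close>

definition smooth_on :: "nat \<Rightarrow> (nat \<Rightarrow> real) set \<Rightarrow> ((nat \<Rightarrow> real) \<Rightarrow> real) \<Rightarrow> bool" where
  "smooth_on n W f \<longleftrightarrow> (\<forall>k. Ck_on n W k f)"

type_synonym 'a chart = "'a set \<times> ('a \<Rightarrow> nat \<Rightarrow> real)"

definition is_chart :: "'a::topological_space set \<Rightarrow> nat \<Rightarrow> 'a chart \<Rightarrow> bool" where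
  "is_chart S n c \<longleftrightarrow>
     openin (top_of_set S) (fst c) \<and>
     openin (Euclidean_space n) (snd c ` fst c) \<and>
     homeomorphic_map (top_of_set (fst c))
       (subtopology (Euclidean_space n) (snd c ` fst c)) (snd c)"

definition transition :: "'a chart \<Rightarrow> 'a chart \<Rightarrow> (nat \<Rightarrow> real) \<Rightarrow> nat \<Rightarrow> real" where
  "transition c c' y = snd c' (inv_into (fst c) (snd c) y)"

text \<open>
  A smooth structure on \<open>S\<close>, whose manifold topology is the subspace topology. Hausdorffness and
  second countability are inherited from the ambient space.
\<close>

definition smooth_atlas :: "'a::topological_space set \<Rightarrow> nat \<Rightarrow> 'a chart set \<Rightarrow> bool" where
  "smooth_atlas S n A \<longleftrightarrow>
     (\<forall>c\<in>A. is_chart S n c) \<and> (\<Union>c\<in>A. fst c) = S \<and>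
     (\<forall>c\<in>A. \<forall>c'\<in>A. \<forall>j<n.
        smooth_on n (snd c ` (fst c \<inter> fst c')) (\<lambda>y. transition c c' y j))"

text \<open>
  \<open>g c x i j\<close> are the components at \<open>x\<close> of the metric in the chart \<open>c\<close>; the last clause is the
  transformation law of a twice covariant tensor.
\<close>

definition riemannian_metric ::
    "nat \<Rightarrow> 'a chart set \<Rightarrow> ('a chart \<Rightarrow> 'a \<Rightarrow> nat \<Rightarrow> nat \<Rightarrow> real) \<Rightarrow> bool" where
  "riemannian_metric n A g \<longleftrightarrow>
     (\<forall>c\<in>A. \<forall>x\<in>fst c.
        (\<forall>i<n. \<forall>j<n. g c x i j = g c x j i) \<and>
        (\<forall>v::nat \<Rightarrow> real. (\<exists>i<n. v i \<noteq> 0) \<longrightarrow> (\<Sum>i<n. \<Sum>j<n. g c x i j * v i * v j) > 0)) \<and>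
     (\<forall>c\<in>A. \<forall>i<n. \<forall>j<n.
        smooth_on n (snd c ` fst c) (\<lambda>y. g c (inv_into (fst c) (snd c) y) i j)) \<and>
     (\<forall>c\<in>A. \<forall>c'\<in>A. \<forall>x\<in>fst c \<inter> fst c'. \<forall>i<n. \<forall>j<n.
        g c x i j =
          (\<Sum>k<n. \<Sum>l<n. g c' x k l * partial i (\<lambda>y. transition c c' y k) (snd c x)
                                     * partial j (\<lambda>y. transition c c' y l) (snd c x)))"

text \<open>
  The state space \<open>E\<close> is the whole type \<open>'a\<close>; separability is second countability.
\<close>

definition stratified_riemannian_space ::
    "'i set \<Rightarrow> ('i \<Rightarrow> 'a::{metric_space,second_countable_topology} set) \<Rightarrow> ('i \<Rightarrow> nat) \<Rightarrow>
     ('i \<Rightarrow> 'a chart set) \<Rightarrow> ('i \<Rightarrow> 'a chart \<Rightarrow> 'a \<Rightarrow> nat \<Rightarrow> nat \<Rightarrow> real) \<Rightarrow> bool" where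
  "stratified_riemannian_space I S sdim atlas g \<longleftrightarrow>
     locally compact (UNIV :: 'a set) \<and>
     countable I \<and> disjoint_family_on S I \<and> (\<Union>\<alpha>\<in>I. S \<alpha>) = UNIV \<and>
     (\<forall>\<alpha>\<in>I. S \<alpha> \<noteq> {} \<and> S \<alpha> \<in> sets borel \<and> connected (S \<alpha>) \<and>
            smooth_atlas (S \<alpha>) (sdim \<alpha>) (atlas \<alpha>) \<and>
            riemannian_metric (sdim \<alpha>) (atlas \<alpha>) (g \<alpha>))"

definition stratum_of :: "'i set \<Rightarrow> ('i \<Rightarrow> 'a set) \<Rightarrow> 'a \<Rightarrow> 'i" where
  "stratum_of I S x = (THE \<alpha>. \<alpha> \<in> I \<and> x \<in> S \<alpha>)"

definition cadlag_paths :: "'a::metric_space set \<Rightarrow> (real \<Rightarrow> 'a) set" where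
  "cadlag_paths S = {\<omega> \<in> {0..} \<rightarrow>\<^sub>E S.
     (\<forall>t\<ge>0. (\<omega> \<longlongrightarrow> \<omega> t) (at_right t)) \<and>
     (\<forall>t>0. \<exists>l\<in>S. (\<omega> \<longlongrightarrow> l) (at_left t))}"

text \<open>
  \<open>D([0,\<infinity>);S)\<close> with the \<open>\<sigma>\<close>-algebra generated by the coordinate maps, which for separable \<open>S\<close>
  is the Borel \<open>\<sigma>\<close>-algebra of the Skorokhod topology. Paths are \<^const>\<open>undefined\<close> at negative times.
\<close>

definition path_space :: "'a::metric_space set \<Rightarrow> (real \<Rightarrow> 'a) measure" where
  "path_space S = restrict_space (PiM {0..} (\<lambda>_. borel)) (cadlag_paths S)"

definition natural_filtration :: "(real \<Rightarrow> 'a::metric_space) measure \<Rightarrow> real \<Rightarrow> (real \<Rightarrow> 'a) measure" where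
  "natural_filtration M t =
     sigma (space M) {(\<lambda>\<omega>. \<omega> s) -` B \<inter> space M | s B. s \<in> {0..t} \<and> B \<in> sets borel}"

definition martingale ::
    "(real \<Rightarrow> 'a::metric_space) measure \<Rightarrow> (real \<Rightarrow> (real \<Rightarrow> 'a) \<Rightarrow> real) \<Rightarrow> bool" where
  "martingale M Y \<longleftrightarrow>
     (\<forall>t\<ge>0. Y t \<in> borel_measurable (natural_filtration M t) \<and> integrable M (Y t)) \<and>
     (\<forall>s\<ge>0. \<forall>t\<ge>s. AE \<omega> in M. real_cond_exp M (natural_filtration M s) (Y t) \<omega> = Y s \<omega>)"

text \<open>
  Functions on a stratum \<open>S\<close> are represented by their extension by zero, so that \<open>C\<^sub>0(S)\<close> and
  its subspaces are genuine sets of functions on \<open>E\<close>.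
\<close>

definition C0 :: "'a::metric_space set \<Rightarrow> ('a \<Rightarrow> real) set" where
  "C0 S = {f. continuous_on S f \<and> (\<forall>x. x \<notin> S \<longrightarrow> f x = 0) \<and>
     (\<forall>\<epsilon>>0. \<exists>K. compact K \<and> K \<subseteq> S \<and> (\<forall>x\<in>S - K. \<bar>f x\<bar> < \<epsilon>))}"

definition restrict0 :: "('a \<Rightarrow> real) \<Rightarrow> 'a set \<Rightarrow> 'a \<Rightarrow> real" where
  "restrict0 f S x = (if x \<in> S then f x else 0)"

definition semigroup_of ::
    "'a set \<Rightarrow> ('a \<Rightarrow> (real \<Rightarrow> 'a) measure) \<Rightarrow> real \<Rightarrow> ('a \<Rightarrow> real) \<Rightarrow> 'a \<Rightarrow> real" where
  "semigroup_of S Q t f = restrict0 (\<lambda>x. \<integral>\<eta>. f (\<eta> t) \<partial>Q x) S"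

definition C0_contraction_semigroup ::
    "'a::metric_space set \<Rightarrow> (real \<Rightarrow> ('a \<Rightarrow> real) \<Rightarrow> 'a \<Rightarrow> real) \<Rightarrow> bool" where
  "C0_contraction_semigroup S T \<longleftrightarrow>
     (\<forall>t\<ge>0. \<forall>f\<in>C0 S. T t f \<in> C0 S) \<and>
     (\<forall>t\<ge>0. \<forall>f\<in>C0 S. \<forall>h\<in>C0 S. \<forall>a b.
        T t (\<lambda>x. a * f x + b * h x) = (\<lambda>x. a * T t f x + b * T t h x)) \<and>
     (\<forall>f\<in>C0 S. T 0 f = f) \<and>
     (\<forall>s\<ge>0. \<forall>t\<ge>0. \<forall>f\<in>C0 S. T (s + t) f = T s (T t f)) \<and>
     (\<forall>t\<ge>0. \<forall>f\<in>C0 S. (SUP x\<in>S. \<bar>T t f x\<bar>) \<le> (SUP x\<in>S. \<bar>f x\<bar>)) \<and>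
     (\<forall>f\<in>C0 S. uniform_limit S (\<lambda>t. T t f) f (at_right 0))"

definition gen_rel ::
    "'a::metric_space set \<Rightarrow> (real \<Rightarrow> ('a \<Rightarrow> real) \<Rightarrow> 'a \<Rightarrow> real) \<Rightarrow>
     ('a \<Rightarrow> real) \<Rightarrow> ('a \<Rightarrow> real) \<Rightarrow> bool" where
  "gen_rel S T f h \<longleftrightarrow> f \<in> C0 S \<and> h \<in> C0 S \<and>
     uniform_limit S (\<lambda>t x. (T t f x - f x) / t) h (at_right 0)"

definition gen_dom ::
    "'a::metric_space set \<Rightarrow> (real \<Rightarrow> ('a \<Rightarrow> real) \<Rightarrow> 'a \<Rightarrow> real) \<Rightarrow> ('a \<Rightarrow> real) set" where
  "gen_dom S T = {f. \<exists>h. gen_rel S T f h}"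

definition gen ::
    "'a::metric_space set \<Rightarrow> (real \<Rightarrow> ('a \<Rightarrow> real) \<Rightarrow> 'a \<Rightarrow> real) \<Rightarrow> ('a \<Rightarrow> real) \<Rightarrow> 'a \<Rightarrow> real" where
  "gen S T f = (THE h. gen_rel S T f h)"

definition linear_subspace :: "('a \<Rightarrow> real) set \<Rightarrow> bool" where
  "linear_subspace C \<longleftrightarrow> (\<lambda>_. 0) \<in> C \<and>
     (\<forall>f\<in>C. \<forall>h\<in>C. \<forall>a b. (\<lambda>x. a * f x + b * h x) \<in> C)"

definition is_core ::
    "'a::metric_space set \<Rightarrow> (real \<Rightarrow> ('a \<Rightarrow> real) \<Rightarrow> 'a \<Rightarrow> real) \<Rightarrow> ('a \<Rightarrow> real) set \<Rightarrow> bool" where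
  "is_core S T C \<longleftrightarrow> C \<subseteq> gen_dom S T \<and>
     (\<forall>f\<in>gen_dom S T. \<exists>u::nat \<Rightarrow> 'a \<Rightarrow> real. (\<forall>k. u k \<in> C) \<and>
        uniform_limit S u f sequentially \<and>
        uniform_limit S (\<lambda>k. gen S T (u k)) (gen S T f) sequentially)"

definition measure_determining :: "'a::metric_space set \<Rightarrow> ('a \<Rightarrow> real) set \<Rightarrow> bool" where
  "measure_determining S C \<longleftrightarrow>
     (\<forall>\<mu> \<nu>. finite_measure \<mu> \<and> finite_measure \<nu> \<and>
        sets \<mu> = sets (restrict_space borel S) \<and> sets \<nu> = sets (restrict_space borel S) \<and>
        (\<forall>f\<in>C. (\<integral>x. f x \<partial>\<mu>) = (\<integral>x. f x \<partial>\<nu>)) \<longrightarrow> \<mu> = \<nu>)"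

definition markov_property :: "'a::metric_space set \<Rightarrow> ('a \<Rightarrow> (real \<Rightarrow> 'a) measure) \<Rightarrow> bool" where
  "markov_property S Q \<longleftrightarrow>
     (\<forall>x\<in>S. \<forall>s\<ge>0. \<forall>t\<ge>0. \<forall>B\<in>sets borel.
        AE \<eta> in Q x. real_cond_exp (Q x) (natural_filtration (Q x) s) (\<lambda>\<eta>. indicator B (\<eta> (s + t))) \<eta>
          = measure (Q (\<eta> s)) {\<zeta> \<in> space (Q (\<eta> s)). \<zeta> t \<in> B})"

definition assumption_D ::
    "'i set \<Rightarrow> ('i \<Rightarrow> 'a::metric_space set) \<Rightarrow> ('i \<Rightarrow> 'a \<Rightarrow> (real \<Rightarrow> 'a) measure) \<Rightarrow>
     ('i \<Rightarrow> ('a \<Rightarrow> real) set) \<Rightarrow> bool" where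
  "assumption_D I S Q C \<longleftrightarrow>
     (\<forall>\<alpha>\<in>I.
        Q \<alpha> \<in> restrict_space borel (S \<alpha>) \<rightarrow>\<^sub>M prob_algebra (path_space (S \<alpha>)) \<and>
        markov_property (S \<alpha>) (Q \<alpha>) \<and>
        (\<forall>x\<in>S \<alpha>. AE \<eta> in Q \<alpha> x. \<eta> 0 = x \<and> (\<forall>t\<ge>0. \<eta> t \<in> S \<alpha>) \<and> continuous_on {0..} \<eta>) \<and>
        C0_contraction_semigroup (S \<alpha>) (semigroup_of (S \<alpha>) (Q \<alpha>)) \<and>
        linear_subspace (C \<alpha>) \<and>
        is_core (S \<alpha>) (semigroup_of (S \<alpha>) (Q \<alpha>)) (C \<alpha>) \<and>
        measure_determining (S \<alpha>) (C \<alpha>))"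

definition out_edges :: "'e set \<Rightarrow> ('e \<Rightarrow> 'i) \<Rightarrow> 'i \<Rightarrow> 'e set" where
  "out_edges Edges tail \<alpha> = {e \<in> Edges. tail e = \<alpha>}"

text \<open>
  The sums over the (possibly infinitely many) outgoing edges are integrals against the counting
  measure with values in \<open>[0,\<infinity>]\<close>.
\<close>

definition total_rate ::
    "'i set \<Rightarrow> ('i \<Rightarrow> 'a set) \<Rightarrow> 'e set \<Rightarrow> ('e \<Rightarrow> 'i) \<Rightarrow> ('e \<Rightarrow> 'a \<Rightarrow> real) \<Rightarrow> 'a \<Rightarrow> ennreal" where
  "total_rate I S Edges tail rate x =
     (\<integral>\<^sup>+e. ennreal (rate e x) \<partial>count_space (out_edges Edges tail (stratum_of I S x)))"

definition jump_measure ::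
    "'i set \<Rightarrow> ('i \<Rightarrow> 'a::metric_space set) \<Rightarrow> 'e set \<Rightarrow> ('e \<Rightarrow> 'i) \<Rightarrow>
     ('e \<Rightarrow> 'a \<Rightarrow> 'a measure) \<Rightarrow> ('e \<Rightarrow> 'a \<Rightarrow> real) \<Rightarrow> 'a \<Rightarrow> 'a measure" where
  "jump_measure I S Edges tail K rate x =
     measure_of UNIV (sets borel)
       (\<lambda>B. \<integral>\<^sup>+e. ennreal (rate e x) * emeasure (K e x) B
              \<partial>count_space (out_edges Edges tail (stratum_of I S x)))"

definition assumption_J ::
    "'i set \<Rightarrow> ('i \<Rightarrow> 'a::metric_space set) \<Rightarrow> 'e set \<Rightarrow> ('e \<Rightarrow> 'i) \<Rightarrow> ('e \<Rightarrow> 'i) \<Rightarrow>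
     ('e \<Rightarrow> 'a \<Rightarrow> 'a measure) \<Rightarrow> ('e \<Rightarrow> 'a \<Rightarrow> real) \<Rightarrow> bool" where
  "assumption_J I S Edges tail head K rate \<longleftrightarrow>
     countable Edges \<and> tail ` Edges \<subseteq> I \<and> head ` Edges \<subseteq> I \<and>
     (\<forall>e\<in>Edges.
        K e \<in> restrict_space borel (S (tail e)) \<rightarrow>\<^sub>M prob_algebra borel \<and>
        rate e \<in> borel_measurable (restrict_space borel (S (tail e))) \<and>
        (\<forall>x\<in>S (tail e). emeasure (K e x) (S (head e)) = 1 \<and> emeasure (K e x) {x} = 0 \<and>
           0 \<le> rate e x)) \<and>
     (\<exists>R::real. \<forall>x. total_rate I S Edges tail rate x \<le> ennreal R)"

definition D0 ::
    "'i set \<Rightarrow> ('i \<Rightarrow> 'a::metric_space set) \<Rightarrow> ('i \<Rightarrow> ('a \<Rightarrow> real) set) \<Rightarrow> ('a \<Rightarrow> real) set" where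
  "D0 I S C = {f \<in> borel_measurable borel. bounded (range f) \<and>
     (\<forall>\<alpha>\<in>I. restrict0 f (S \<alpha>) \<in> C \<alpha>) \<and> finite {\<alpha>\<in>I. \<exists>x\<in>S \<alpha>. f x \<noteq> 0}}"

definition full_generator ::
    "'i set \<Rightarrow> ('i \<Rightarrow> 'a::metric_space set) \<Rightarrow> ('i \<Rightarrow> 'a \<Rightarrow> (real \<Rightarrow> 'a) measure) \<Rightarrow>
     ('a \<Rightarrow> 'a measure) \<Rightarrow> ('a \<Rightarrow> real) \<Rightarrow> 'a \<Rightarrow> real" where
  "full_generator I S Q \<nu> f x =
     (let \<alpha> = stratum_of I S x
      in gen (S \<alpha>) (semigroup_of (S \<alpha>) (Q \<alpha>)) (restrict0 f (S \<alpha>)) x)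
     + (\<integral>y. (f y - f x) \<partial>\<nu> x)"

text \<open>
  \<open>M\<close> is a solution, started at \<open>x\<close>, of the martingale problem for the operator \<open>A\<close> with
  domain \<open>\<D>\<close>.
\<close>

definition solves_martingale_problem ::
    "('a::metric_space \<Rightarrow> real) set \<Rightarrow> (('a \<Rightarrow> real) \<Rightarrow> 'a \<Rightarrow> real) \<Rightarrow> 'a \<Rightarrow> (real \<Rightarrow> 'a) measure \<Rightarrow> bool" where
  "solves_martingale_problem \<D> A x M \<longleftrightarrow>
     prob_space M \<and> sets M = sets (path_space UNIV) \<and> (AE \<omega> in M. \<omega> 0 = x) \<and>
     (\<forall>f\<in>\<D>. martingale M (\<lambda>t \<omega>. f (\<omega> t) - f (\<omega> 0) - (LBINT s:{0..t}. A f (\<omega> s))))"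

text \<open>
  The martingale problem is well-posed under the standing assumptions, so this determines the laws
  \<open>P x\<close>; their uniqueness, the measurability in \<open>x\<close> and the strong Markov property are consequences
  and not part of the definition.
\<close>

definition stratified_jump_diffusion ::
    "'i set \<Rightarrow> ('i \<Rightarrow> 'a::metric_space set) \<Rightarrow> ('i \<Rightarrow> 'a \<Rightarrow> (real \<Rightarrow> 'a) measure) \<Rightarrow>
     ('i \<Rightarrow> ('a \<Rightarrow> real) set) \<Rightarrow> 'e set \<Rightarrow> ('e \<Rightarrow> 'i) \<Rightarrow> ('e \<Rightarrow> 'a \<Rightarrow> 'a measure) \<Rightarrow>
     ('e \<Rightarrow> 'a \<Rightarrow> real) \<Rightarrow> ('a \<Rightarrow> (real \<Rightarrow> 'a) measure) \<Rightarrow> bool" where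
  "stratified_jump_diffusion I S Q C Edges tail K rate P \<longleftrightarrow>
     (\<forall>x. solves_martingale_problem (D0 I S C)
            (full_generator I S Q (jump_measure I S Edges tail K rate)) x (P x))"

definition trans_prob :: "('a::metric_space \<Rightarrow> (real \<Rightarrow> 'a) measure) \<Rightarrow> real \<Rightarrow> 'a \<Rightarrow> 'a measure" where
  "trans_prob P t x = distr (P x) borel (\<lambda>\<omega>. \<omega> t)"

definition invariant_prob :: "('a::metric_space \<Rightarrow> (real \<Rightarrow> 'a) measure) \<Rightarrow> 'a measure \<Rightarrow> bool" where
  "invariant_prob P \<pi> \<longleftrightarrow> prob_space \<pi> \<and> sets \<pi> = sets borel \<and>
     (\<forall>t\<ge>0. \<forall>B\<in>sets borel. (\<integral>\<^sup>+x. emeasure (trans_prob P t x) B \<partial>\<pi>) = emeasure \<pi> B)"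

text \<open>Only the members with index \<open>m \<ge> 1\<close> are relevant.\<close>

definition exhaustion :: "(nat \<Rightarrow> 'a::metric_space set) \<Rightarrow> bool" where
  "exhaustion U \<longleftrightarrow>
     (\<forall>m\<ge>1. open (U m) \<and> compact (closure (U m)) \<and> closure (U m) \<subseteq> U (Suc m)) \<and>
     (\<Union>m\<in>{1..}. U m) = UNIV"

definition exit_time :: "'a set \<Rightarrow> (real \<Rightarrow> 'a) \<Rightarrow> ereal" where
  "exit_time U \<omega> = Inf (ereal ` {t. 0 \<le> t \<and> \<omega> t \<notin> U})"

definition min_exit :: "'a set \<Rightarrow> real \<Rightarrow> (real \<Rightarrow> 'a) \<Rightarrow> real" where
  "min_exit U t \<omega> = real_of_ereal (min (ereal t) (exit_time U \<omega>))"

text \<open>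
  \<open>V \<in> D(A\<^sup>*\<^sub>m)\<close> with witness \<open>G\<close>, for \<open>U = O\<^sub>m\<close>. The exit time of a cadlag path from an
  open set is in general measurable only for the completed \<open>\<sigma>\<close>-algebra, hence the completions.
\<close>

definition trunc_ext_gen ::
    "('a::metric_space \<Rightarrow> (real \<Rightarrow> 'a) measure) \<Rightarrow> 'a set \<Rightarrow> ('a \<Rightarrow> real) \<Rightarrow> ('a \<Rightarrow> real) \<Rightarrow> bool" where
  "trunc_ext_gen P U V G \<longleftrightarrow>
     V \<in> borel_measurable borel \<and> G \<in> borel_measurable borel \<and>
     (\<forall>x. \<forall>t\<ge>0.
        (\<integral>\<^sup>+\<omega>. (\<integral>\<^sup>+s\<in>{0..min_exit U t \<omega>}. ennreal \<bar>G (\<omega> s)\<bar> \<partial>lborel) \<partial>completion (P x)) < \<infinity> \<and>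
        integrable (completion (P x)) (\<lambda>\<omega>. V (\<omega> (min_exit U t \<omega>))) \<and>
        (\<integral>\<omega>. V (\<omega> (min_exit U t \<omega>)) \<partial>completion (P x)) =
          V x + (\<integral>\<omega>. (LBINT s:{0..min_exit U t \<omega>}. G (\<omega> s)) \<partial>completion (P x)))"

definition petite :: "('a::metric_space \<Rightarrow> (real \<Rightarrow> 'a) measure) \<Rightarrow> 'a set \<Rightarrow> bool" where
  "petite P C \<longleftrightarrow> C \<in> sets borel \<and>
     (\<exists>(a::real measure) \<nu>. prob_space a \<and> sets a = sets borel \<and> emeasure a {0<..} = 1 \<and>
        sets \<nu> = sets borel \<and> emeasure \<nu> UNIV \<noteq> 0 \<and>
        (\<forall>x\<in>C. \<forall>B\<in>sets borel.
           emeasure \<nu> B \<le> (\<integral>\<^sup>+t\<in>{0<..}. emeasure (trans_prob P t x) B \<partial>a)))"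

text \<open>
  \<open>A\<^sup>*\<^sub>mV\<close> is determined only up to the choice of the witness \<open>G\<^sub>m\<close>: the drift inequality is
  required of some witness, for each \<open>m\<close>.
\<close>

definition assumption_L ::
    "('a::metric_space \<Rightarrow> (real \<Rightarrow> 'a) measure) \<Rightarrow> (nat \<Rightarrow> 'a set) \<Rightarrow> ('a \<Rightarrow> real) \<Rightarrow> bool" where
  "assumption_L P U V \<longleftrightarrow>
     V \<in> borel_measurable borel \<and> (\<forall>x. 1 \<le> V x) \<and>
     (\<exists>C \<kappa> b. closed C \<and> petite P C \<and> 0 < \<kappa> \<and> 0 < b \<and> bounded (V ` C) \<and>
        (\<forall>m\<ge>1. \<exists>G. trunc_ext_gen P (U m) V G \<and>
           (\<forall>x\<in>U m. G x \<le> - \<kappa> * V x + b * indicator C x)))"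

definition psi_irreducible ::
    "('a::metric_space \<Rightarrow> (real \<Rightarrow> 'a) measure) \<Rightarrow> 'a measure \<Rightarrow> bool" where
  "psi_irreducible P \<psi> \<longleftrightarrow>
     sets \<psi> = sets borel \<and> sigma_finite_measure \<psi> \<and> emeasure \<psi> UNIV \<noteq> 0 \<and>
     (\<forall>B\<in>sets borel. emeasure \<psi> B > 0 \<longrightarrow>
        (\<forall>x. (\<integral>\<^sup>+\<omega>. (\<integral>\<^sup>+t\<in>{0..}. indicator B (\<omega> t) \<partial>lborel) \<partial>P x) > 0))"

definition aperiodic :: "('a::metric_space \<Rightarrow> (real \<Rightarrow> 'a) measure) \<Rightarrow> bool" where
  "aperiodic P \<longleftrightarrow>
     (\<exists>\<psi>. psi_irreducible P \<psi> \<and>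
        (\<exists>d>0. \<exists>\<epsilon>>0. \<exists>K \<rho>. compact K \<and> emeasure \<psi> K > 0 \<and>
           prob_space \<rho> \<and> sets \<rho> = sets borel \<and> emeasure \<rho> K > 0 \<and>
           (\<forall>x\<in>K. \<forall>B\<in>sets borel. ennreal \<epsilon> * emeasure \<rho> B \<le> emeasure (trans_prob P d x) B)))"

text \<open>The weighted norm of \<open>\<mu> - \<pi>\<close>, for measures that integrate the weight \<open>V\<close>.\<close>

definition V_dist :: "('a::metric_space \<Rightarrow> real) \<Rightarrow> 'a measure \<Rightarrow> 'a measure \<Rightarrow> ennreal" where
  "V_dist V \<mu> \<pi> =
     (SUP f\<in>{f \<in> borel_measurable borel. \<forall>y. \<bar>f y\<bar> \<le> V y}.
        ennreal \<bar>(\<integral>y. f y \<partial>\<mu>) - (\<integral>y. f y \<partial>\<pi>)\<bar>)"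

text \<open>
  The integrability clauses say that \<open>P\<^sub>t f(x)\<close> and \<open>\<pi>(f)\<close> exist for all \<open>\<bar>f\<bar> \<le> V\<close>;
  without them the bound would also range over the default value 0 of undefined integrals.
\<close>

definition V_uniformly_geometrically_ergodic ::
    "('a::metric_space \<Rightarrow> (real \<Rightarrow> 'a) measure) \<Rightarrow> 'a measure \<Rightarrow> ('a \<Rightarrow> real) \<Rightarrow> bool" where
  "V_uniformly_geometrically_ergodic P \<pi> V \<longleftrightarrow>
     integrable \<pi> V \<and> (\<forall>x. \<forall>t\<ge>0. integrable (trans_prob P t x) V) \<and>
     (\<exists>(M::real) c. 0 < c \<and>
        (\<forall>x. \<forall>t\<ge>0. V_dist V (trans_prob P t x) \<pi> \<le> ennreal (M * V x * exp (- c * t))))"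

end

theory Submission
  imports Defs
begin

text \<open>
  Between jumps the process is a Feller diffusion and the jump rates are bounded, so a uniformised
  resolvent equation, whose solution is a fixed point of a contraction, determines the Laplace
  transforms of the one-dimensional marginals of any solution of the martingale problem. Inverting
  them by polynomial approximation yields measurability in the starting point and the
  Chapman--Kolmogorov equation from the martingale property alone, although the martingale problem
  only speaks about the law of each starting point separately.

  The local drift condition integrates to a global inequality along the exit times of the
  exhaustion, which are measurable by the debut theorem, and makes \<open>P\<^sub>t V\<close> contract up to a
  constant. Petiteness, aperiodicity and irreducibility combine, through a Steinhaus argument on
  the set of times at which a minorisation holds, to a common minorisation at one fixed time on a
  sublevel set of \<open>V\<close>. Harris' theorem in the form of Hairer and Mattingly then gives a
  contraction in a weighted total variation norm.
\<close>

subsection \<open>Paths\<close>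

text \<open>The hypotheses describe a law \<open>P x\<close> for each starting point separately:
  neither measurability in \<open>x\<close> nor a Markov property is available, yet Harris' argument
  composes kernels. The way out is that the resolvent equation is linear in the initial law. For
  \<open>\<theta>\<close> at least four times the jump rate bound its solution is a Neumann series
  \<open>Psi\<close>, a Borel function on the state space that does not depend on the flow of laws.
  Integrating it against the law at time \<open>s\<close> describes the future after
  \<open>s\<close>, which is the Chapman--Kolmogorov equation in Laplace form. Only large Laplace
  parameters are reached in this way, but \<open>\<theta> + i\<close> for natural \<open>i\<close>
  are enough: they are moments in the variable \<open>exp (- t)\<close> on the unit interval, and
  right continuity in time recovers the value at a single time. A second obstacle is that the
  minorisations occur at random times (in the petite set, under the sampling law; in the compact
  set, during an occupation time), whereas Harris' theorem needs a single time for a whole sublevel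
  set; a lower bound on an interval of times absorbs the uncertainty.\<close>

lemma cadlag_pathsD:
  assumes "\<omega> \<in> cadlag_paths S" "0 \<le> t"
  shows "\<omega> t \<in> S" "(\<omega> \<longlongrightarrow> \<omega> t) (at_right t)"
  using assms by (auto simp: cadlag_paths_def PiE_iff)

lemma space_path_space [simp]: "space (path_space S) = cadlag_paths S"
  by (auto simp: path_space_def space_restrict_space space_PiM cadlag_paths_def)

lemma measurable_path_eval: "0 \<le> t \<Longrightarrow> (\<lambda>\<omega>. \<omega> t) \<in> path_space S \<rightarrow>\<^sub>M borel"
  unfolding path_space_def by (intro measurable_restrict_space1 measurable_component_singleton) auto

text \<open>The mesh is 1/(n+1), and the grid point lies strictly to the right of \<open>t\<close>:
  right continuity is then all that is needed in the limit, and at each stage only countably many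
  times occur.\<close>

definition dyadic_above :: "nat \<Rightarrow> real \<Rightarrow> real" where
  "dyadic_above n t = (of_nat (nat \<lfloor>real (Suc n) * t\<rfloor>) + 1) / real (Suc n)"

lemma dyadic_above_bounds:
  assumes "0 \<le> t" shows "t < dyadic_above n t" "dyadic_above n t \<le> t + 1 / real (Suc n)"
proof -
  have "of_nat (nat \<lfloor>real (Suc n) * t\<rfloor>) = real_of_int \<lfloor>real (Suc n) * t\<rfloor>"
    using assms by simp
  then have *: "dyadic_above n t = (real_of_int \<lfloor>real (Suc n) * t\<rfloor> + 1) / real (Suc n)"
    by (simp add: dyadic_above_def)
  show "t < dyadic_above n t" unfolding *
    by (simp only: pos_less_divide_eq of_nat_0_less_iff zero_less_Suc) (simp add: mult.commute)
  have "real_of_int \<lfloor>real (Suc n) * t\<rfloor> \<le> real (Suc n) * t" by linarith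
  then have "dyadic_above n t \<le> (real (Suc n) * t + 1) / real (Suc n)"
    unfolding * by (intro divide_right_mono) auto
  also have "\<dots> = t + 1 / real (Suc n)" by (simp add: field_simps)
  finally show "dyadic_above n t \<le> t + 1 / real (Suc n)" .
qed

lemma dyadic_above_nonneg [simp]: "0 \<le> dyadic_above n t"
  by (simp add: dyadic_above_def)

lemma filterlim_dyadic_above:
  assumes "0 \<le> t" shows "filterlim (\<lambda>n. dyadic_above n t) (at_right t) sequentially"
proof -
  have "(\<lambda>n. dyadic_above n t) \<longlonglongrightarrow> t"
  proof (rule tendsto_sandwich[OF _ _ tendsto_const])
    show "(\<lambda>n. t + 1 / real (Suc n)) \<longlonglongrightarrow> t"
      using tendsto_add[OF tendsto_const lim_inverse_n', of t]
      by (subst (asm) filterlim_sequentially_Suc[symmetric]) simp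
  qed (use dyadic_above_bounds[OF assms] in \<open>auto intro!: always_eventually less_imp_le\<close>)
  then show ?thesis
    using dyadic_above_bounds(1)[OF assms] by (simp add: filterlim_at less_imp_neq[symmetric])
qed

text \<open>With time rounded up to the grid the map is glued from countably many measurable pieces,
  and right continuity is what makes these approximations converge. The clamp \<open>max 0 t\<close>
  extends it to the whole line, where negative times carry no information.\<close>

lemma measurable_right_continuous:
  fixes F :: "real \<Rightarrow> 'b \<Rightarrow> 'c::metric_space"
  assumes meas: "\<And>t. 0 \<le> t \<Longrightarrow> F t \<in> M \<rightarrow>\<^sub>M borel"
    and rc: "\<And>t x. 0 \<le> t \<Longrightarrow> x \<in> space M \<Longrightarrow> ((\<lambda>s. F s x) \<longlongrightarrow> F t x) (at_right t)"
  shows "(\<lambda>(t, x). F (max 0 t) x) \<in> borel \<Otimes>\<^sub>M M \<rightarrow>\<^sub>M borel"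
proof (rule borel_measurable_LIMSEQ_metric)
  fix n
  let ?g = "\<lambda>p::real \<times> 'b. nat \<lfloor>real (Suc n) * max 0 (fst p)\<rfloor>"
  have "(\<lambda>p. F ((of_nat (?g p) + 1) / real (Suc n)) (snd p)) \<in> borel \<Otimes>\<^sub>M M \<rightarrow>\<^sub>M borel"
  proof (rule measurable_compose_countable[where g = ?g and
        f = "\<lambda>i p. F ((of_nat i + 1) / real (Suc n)) (snd p)"])
    fix i :: nat
    have "F ((of_nat i + 1) / real (Suc n)) \<in> M \<rightarrow>\<^sub>M borel" by (intro meas) auto
    then show "(\<lambda>p. F ((of_nat i + 1) / real (Suc n)) (snd p)) \<in> borel \<Otimes>\<^sub>M M \<rightarrow>\<^sub>M borel"
      by measurable
  qed measurable
  then show "(\<lambda>p. F (dyadic_above n (max 0 (fst p))) (snd p)) \<in> borel \<Otimes>\<^sub>M M \<rightarrow>\<^sub>M borel"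
    by (simp add: dyadic_above_def)
next
  fix p assume p: "p \<in> space (borel \<Otimes>\<^sub>M M :: (real \<times> 'b) measure)"
  then have "snd p \<in> space M" by (auto simp: space_pair_measure)
  from filterlim_compose[OF rc[of "max 0 (fst p)", OF _ this] filterlim_dyadic_above[of "max 0 (fst p)"]]
  show "(\<lambda>n. F (dyadic_above n (max 0 (fst p))) (snd p)) \<longlonglongrightarrow> (case p of (t, x) \<Rightarrow> F (max 0 t) x)"
    by (auto simp: split_beta)
qed

lemma measurable_path_eval_pair:
  "(\<lambda>(t, \<omega>). \<omega> (max 0 t)) \<in> borel \<Otimes>\<^sub>M path_space S \<rightarrow>\<^sub>M borel"
  using measurable_right_continuous[where F = "\<lambda>t \<omega>. \<omega> t" and M = "path_space S"]
  by (simp add: cadlag_pathsD measurable_path_eval)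

section \<open>Closed sets along a cadlag path and the debut theorem\<close>

lemma cadlag_in_closed:
  assumes \<omega>: "\<omega> \<in> cadlag_paths UNIV" and "closed N" "0 \<le> s" "s < r"
    and D: "\<And>a b. s \<le> a \<Longrightarrow> a < b \<Longrightarrow> b \<le> r \<Longrightarrow> \<exists>v\<in>{a<..<b}. \<omega> v \<in> N"
  shows "\<omega> s \<in> N"
proof -
  have "\<exists>v. \<forall>n. v n \<in> {s<..<min r (s + 1 / real (Suc n))} \<and> \<omega> (v n) \<in> N"
  proof (rule choice, rule allI)
    fix n
    show "\<exists>v. v \<in> {s<..<min r (s + 1 / real (Suc n))} \<and> \<omega> v \<in> N"
      using D[of s "min r (s + 1 / real (Suc n))"] \<open>s < r\<close> by auto
  qed
  then obtain v where v: "\<And>n. v n \<in> {s<..<min r (s + 1 / real (Suc n))}" "\<And>n. \<omega> (v n) \<in> N"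
    by blast
  have "v \<longlonglongrightarrow> s"
  proof (rule tendsto_sandwich[OF _ _ tendsto_const])
    show "(\<lambda>n. s + 1 / real (Suc n)) \<longlonglongrightarrow> s"
      using tendsto_add[OF tendsto_const lim_inverse_n', of s]
      by (subst (asm) filterlim_sequentially_Suc[symmetric]) simp
  qed (use v(1) in \<open>auto intro!: always_eventually less_imp_le\<close>)
  then have "filterlim v (at_right s) sequentially"
    using v(1) by (auto simp: filterlim_at less_imp_neq[symmetric])
  from filterlim_compose[OF cadlag_pathsD(2)[OF \<omega> \<open>0 \<le> s\<close>] this]
  show ?thesis
    by (rule closed_sequentially[OF \<open>closed N\<close> v(2)])
qed

text \<open>The set is empty or an interval ending at \<open>r\<close>: with \<open>s\<close> it
  contains every later time up to \<open>r\<close>. So only its left end has to be checked, and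
  there the path is approached from the right.\<close>

lemma closed_last_excursion:
  assumes \<omega>: "\<omega> \<in> cadlag_paths UNIV" and "closed N"
  shows "closed {s. 0 \<le> s \<and> s \<le> r \<and> (\<forall>v\<in>{s..r}. \<omega> v \<in> N)}" (is "closed ?B")
proof (cases "?B = {}")
  case False
  define i where "i = Inf ?B"
  have bdd: "bdd_below ?B" by (rule bdd_belowI[of _ 0]) simp
  have i0: "0 \<le> i" unfolding i_def using False by (intro cInf_greatest) auto
  have le: "i \<le> s" if "s \<in> ?B" for s
    unfolding i_def using that bdd by (rule cInf_lower)
  obtain s0 where s0: "s0 \<in> ?B" using False by blast
  have ir: "i \<le> r" using le[OF s0] s0 by simp
  have gt: "\<omega> v \<in> N" if v: "i < v" "v \<le> r" for v
  proof -
    obtain s where "s \<in> ?B" "s < v" using cInf_lessD[OF False v(1)[unfolded i_def]] by blast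
    then show ?thesis using v(2) by simp
  qed
  have "\<omega> i \<in> N"
  \<comment> \<open>At \<open>i = r\<close> nothing lies to the right within the interval, but then
    \<open>s0\<close>, squeezed between \<open>i\<close> and \<open>r\<close>, is \<open>r\<close>
    itself.\<close>
  proof (cases "i = r")
    case True
    then show ?thesis using s0 le[OF s0] by simp
  next
    case False
    show ?thesis
    proof (rule cadlag_in_closed[OF \<omega> \<open>closed N\<close> i0, of r])
      show "i < r" using ir False by simp
      fix a b assume "i \<le> a" "a < b" "b \<le> r"
      then show "\<exists>v\<in>{a<..<b}. \<omega> v \<in> N"
        by (intro bexI[of _ "(a + b) / 2"] gt) auto
    qed
  qed
  then have "\<omega> v \<in> N" if "i \<le> v" "v \<le> r" for v
    using gt[of v] that by (cases "v = i") auto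
  then have "s \<in> ?B" if "s \<in> {i..r}" for s
    using that i0 by simp
  moreover have "s \<in> {i..r}" if "s \<in> ?B" for s
    using that le[OF that] by simp
  ultimately have "?B = {i..r}" by blast
  then show ?thesis by simp
qed (simp del: Collect_empty_eq)

text \<open>
  The capacitability argument behind the debut theorem. For a closed set \<open>F\<close> the random set
  of times at which the path is in \<open>F\<close> is a countable intersection of countable
  unions of random compact intervals \<open>[\<sigma>, r]\<close> with rational right end point: the path stays on
  \<open>[\<sigma>, r]\<close> in a closed neighbourhood of \<open>F\<close>. Choosing finite subunions that lose little outer
  measure leaves a random compact set, whose projection is an event.
\<close>

theorem debut_measurable:
  fixes M :: "(real \<Rightarrow> 'a::metric_space) measure"
  assumes fin: "finite_measure M" and sM: "sets M = sets (path_space UNIV)" and F: "closed F" "F \<noteq> {}"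
    and a: "0 < a"
  shows "{\<omega> \<in> space M. \<exists>s. 0 \<le> s \<and> s < a \<and> \<omega> s \<in> F} \<in> sets (completion M)" (is "?D \<in> _")
proof -
  interpret finite_measure M by fact
  have spM: "space M = cadlag_paths UNIV"
    using sets_eq_imp_space_eq[OF sM] by simp
  have eval[measurable]: "(\<lambda>\<omega>. \<omega> t) \<in> M \<rightarrow>\<^sub>M borel" if "0 \<le> t" for t
    using measurable_path_eval[OF that] by (subst measurable_cong_sets[OF sM refl])
  \<comment> \<open>Closed neighbourhoods that shrink to \<open>F\<close>: by right continuity a
    path that is in \<open>F\<close> at time \<open>s\<close> stays in \<open>N n\<close> on some
    \<open>{s..q i}\<close>, which fails in general for \<open>F\<close> itself.\<close>
  define N where "N n = {y. infdist y F \<le> 1 / real (Suc n)}" for n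
  have clN: "closed (N n)" for n
    unfolding N_def by (intro closed_Collect_le continuous_intros)
  define q :: "nat \<Rightarrow> real" where "q = from_nat_into (\<rat> \<inter> {0<..<a})"
  have "\<exists>x\<in>\<rat>. 0 < x \<and> x < a" using Rats_dense_in_real[OF a] by blast
  then have ne: "\<rat> \<inter> {0<..<a} \<noteq> {}" by auto
  have rq: "range q = \<rat> \<inter> {0<..<a}"
    unfolding q_def using ne by (intro range_from_nat_into countable_Int1 countable_rat)
  have q0: "0 \<le> q i" "q i < a" for i using rangeI[of q i] unfolding rq by auto
  have qdense: "\<exists>i. u < q i \<and> q i < v" if "0 \<le> u" "u < v" "v \<le> a" for u v
  proof -
    obtain x where "x \<in> \<rat>" "u < x" "x < v" using Rats_dense_in_real[OF \<open>u < v\<close>] by blast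
    then have "x \<in> range q" unfolding rq using that by auto
    with \<open>u < x\<close> \<open>x < v\<close> show ?thesis by auto
  qed
  \<comment> \<open>\<open>s\<close> starts a stretch inside \<open>N n\<close> that lasts until one
    of the first \<open>k + 1\<close> rational end points. For fixed \<open>n\<close> and
    \<open>k\<close> these \<open>s\<close> form a compact set, and the condition weakens as
    \<open>k\<close> grows.\<close>
  define W where "W n k s \<omega> \<longleftrightarrow> (\<exists>j\<le>k. 0 \<le> s \<and> s \<le> q j \<and> (\<forall>v\<in>{s..q j}. \<omega> v \<in> N n))"
    for n k s and \<omega> :: "real \<Rightarrow> 'a"
  have W_mono: "W n k s \<omega> \<Longrightarrow> k \<le> k' \<Longrightarrow> W n k' s \<omega>" for n k k' s \<omega>
    unfolding W_def by (meson order_trans)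
  have closed_W: "closed {s. W n k s \<omega>}" if "\<omega> \<in> space M" for n k \<omega>
  proof -
    have "{s. W n k s \<omega>} = (\<Union>j\<le>k. {s. 0 \<le> s \<and> s \<le> q j \<and> (\<forall>v\<in>{s..q j}. \<omega> v \<in> N n)})"
      by (auto simp: W_def)
    then show ?thesis
      using that clN by (auto simp: spM intro!: closed_UN closed_last_excursion)
  qed
  have bnd_W: "0 \<le> s \<and> s < a" if "W n k s \<omega>" for n k s \<omega>
    using that q0 unfolding W_def by (meson order_le_less_trans)
  have meas1: "{\<omega> \<in> space M. \<forall>v\<in>{q i..q j}. \<omega> v \<in> N n} \<in> sets M" for i j n
  proof -
    \<comment> \<open>Since \<open>N n\<close> is closed, rational times decide the condition; the
      right end point is itself one of them, so the lack of room to its right does no harm.\<close>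
    have "(\<forall>v\<in>{q i..q j}. \<omega> v \<in> N n) \<longleftrightarrow> (\<forall>l. q i \<le> q l \<and> q l \<le> q j \<longrightarrow> \<omega> (q l) \<in> N n)"
      if \<omega>: "\<omega> \<in> space M" for \<omega>
    proof safe
      fix v assume *: "\<forall>l. q i \<le> q l \<and> q l \<le> q j \<longrightarrow> \<omega> (q l) \<in> N n" and v: "v \<in> {q i..q j}"
      show "\<omega> v \<in> N n"
      proof (cases "v = q j")
        case True with * v show ?thesis by auto
      next
        case False
        show ?thesis
        proof (rule cadlag_in_closed[of \<omega> "N n" v "q j"])
          fix s t assume "v \<le> s" "s < t" "t \<le> q j"
          with qdense[of s t] v q0[of i] q0[of j] obtain l where "s < q l" "q l < t" by auto
          with * v \<open>v \<le> s\<close> \<open>t \<le> q j\<close> show "\<exists>v\<in>{s<..<t}. \<omega> v \<in> N n" by (intro bexI[of _ "q l"]) auto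
        qed (use \<omega> clN v False q0[of i] in \<open>auto simp: spM\<close>)
      qed
    qed auto
    then have "{\<omega> \<in> space M. \<forall>v\<in>{q i..q j}. \<omega> v \<in> N n} =
        {\<omega> \<in> space M. \<forall>l. q i \<le> q l \<and> q l \<le> q j \<longrightarrow> \<omega> (q l) \<in> N n}" by auto
    also have "\<dots> \<in> sets M"
    proof -
      have "{\<omega> \<in> space M. \<omega> (q l) \<in> N n} \<in> sets M" for l
        using measurable_sets[OF eval[OF q0(1)[of l]] borel_closed[OF clN[of n]]]
        by (simp add: vimage_def Int_def conj_commute)
      then show ?thesis by (intro sets.sets_Collect_countable_All sets.sets_Collect_imp sets.sets_Collect_const)
    qed
    finally show ?thesis .
  qed
  have A_eq: "(0 \<le> s \<and> s < a \<and> \<omega> s \<in> F) \<longleftrightarrow> (\<forall>n. \<exists>k. W n k s \<omega>)" if \<omega>: "\<omega> \<in> space M" for s \<omega>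
  proof safe
    fix n assume s: "0 \<le> s" "s < a" "\<omega> s \<in> F"
    have "((\<lambda>v. infdist (\<omega> v) F) \<longlongrightarrow> infdist (\<omega> s) F) (at_right s)"
      using \<omega> s by (intro tendsto_infdist cadlag_pathsD) (auto simp: spM)
    moreover have "infdist (\<omega> s) F = 0" using s F by simp
    ultimately have "eventually (\<lambda>v. infdist (\<omega> v) F < 1 / real (Suc n)) (at_right s)"
      by (intro order_tendstoD(2)) auto
    then obtain b where b: "s < b" "\<And>v. s < v \<Longrightarrow> v < b \<Longrightarrow> infdist (\<omega> v) F < 1 / real (Suc n)"
      unfolding eventually_at_right_field by auto
    obtain i where i: "s < q i" "q i < min a b" using qdense[of s "min a b"] s b(1) by auto
    have "\<forall>v\<in>{s..q i}. \<omega> v \<in> N n"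
    proof
      fix v assume "v \<in> {s..q i}"
      then show "\<omega> v \<in> N n"
        using b(2)[of v] i \<open>infdist (\<omega> s) F = 0\<close> by (cases "v = s") (auto simp: N_def intro: less_imp_le)
    qed
    then show "\<exists>k. W n k s \<omega>" using i s unfolding W_def by (intro exI[of _ i]) auto
  next
    assume *: "\<forall>n. \<exists>k. W n k s \<omega>"
    then obtain k where "W 0 k s \<omega>" by blast
    from bnd_W[OF this] show "0 \<le> s" "s < a" by auto
    have "infdist (\<omega> s) F \<le> 1 / real (Suc n)" for n
      using * by (auto simp: W_def N_def dest!: spec[of _ n])
    then have "infdist (\<omega> s) F \<le> 0"
      by (intro LIMSEQ_le_const[OF lim_inverse_n']) (metis Suc_pred' gr0I less_Suc_eq_0_disj not_less_eq_eq)
    then show "\<omega> s \<in> F" using F infdist_nonneg[of "\<omega> s" F] by (simp add: in_closed_iff_infdist_zero)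
  qed
  \<comment> \<open>Outer measure is continuous along increasing sequences of arbitrary sets, so at
    each stage \<open>n\<close> the union over \<open>k\<close> can be cut down to one value while
    the projection keeps outer measure above \<open>c\<close>. Measurability has to be settled only
    after the cuts are made.\<close>
  have inner: "\<exists>E\<in>sets M. E \<subseteq> ?D \<and> c \<le> emeasure M E" if c: "c < outer_measure_of M ?D" for c
  proof -
    define pr where "pr Z = {\<omega> \<in> space M. \<exists>s. (s, \<omega>) \<in> Z}" for Z :: "(real \<times> (real \<Rightarrow> 'a)) set"
    define A where "A = {(s, \<omega>). \<omega> \<in> space M \<and> 0 \<le> s \<and> s < a \<and> \<omega> s \<in> F}"
    have prA: "pr A = ?D" by (auto simp: pr_def A_def)
    have "\<exists>Z. \<forall>n::nat. (Z n \<subseteq> A \<and> c < outer_measure_of M (pr (Z n)) \<and> (n = 0 \<longrightarrow> Z n = A)) \<and>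
        (\<exists>k. Z (Suc n) = Z n \<inter> {(s, \<omega>). W n k s \<omega>})"
    proof (rule dependent_nat_choice)
      show "\<exists>Z. Z \<subseteq> A \<and> c < outer_measure_of M (pr Z) \<and> ((0::nat) = 0 \<longrightarrow> Z = A)"
        using c by (intro exI[of _ A]) (simp add: prA)
      fix Z and n :: nat assume Z: "Z \<subseteq> A \<and> c < outer_measure_of M (pr Z) \<and> (n = 0 \<longrightarrow> Z = A)"
      define Z' where "Z' k = Z \<inter> {(s, \<omega>). W n k s \<omega>}" for k
      have "pr Z = (\<Union>k. pr (Z' k))"
      proof -
        have "\<exists>k. W n k s \<omega>" if "(s, \<omega>) \<in> Z" for s \<omega>
          using Z that A_eq[of \<omega> s] by (auto simp: A_def)
        then show ?thesis unfolding pr_def Z'_def by blast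
      qed
      moreover have "incseq (\<lambda>k. pr (Z' k))"
        unfolding pr_def Z'_def incseq_def using W_mono by blast
      ultimately have "(SUP k. outer_measure_of M (pr (Z' k))) = outer_measure_of M (pr Z)"
        by (subst SUP_outer_measure_of_incseq) (auto simp: pr_def)
      then obtain k where "c < outer_measure_of M (pr (Z' k))"
        using Z by (metis less_SUP_iff)
      then show "\<exists>Y. (Y \<subseteq> A \<and> c < outer_measure_of M (pr Y) \<and> (Suc n = 0 \<longrightarrow> Y = A)) \<and>
          (\<exists>k. Y = Z \<inter> {(s, \<omega>). W n k s \<omega>})"
        using Z by (intro exI[of _ "Z' k"]) (auto simp: Z'_def)
    qed
    then obtain Z where Z: "\<And>n. c < outer_measure_of M (pr (Z n))" "Z 0 = A"
      and "\<forall>n. \<exists>k. Z (Suc n) = Z n \<inter> {(s, \<omega>). W n k s \<omega>}" by metis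
    then obtain k where k: "\<And>n. Z (Suc n) = Z n \<inter> {(s, \<omega>). W n (k n) s \<omega>}" by metis
    have Z_eq: "Z n = A \<inter> {(s, \<omega>). \<forall>m<n. W m (k m) s \<omega>}" for n
      by (induction n) (auto simp: Z(2) k less_Suc_eq)
    \<comment> \<open>Dropping the condition \<open>\<omega> s \<in> F\<close> enlarges the
      projection but makes it an event; in the limit over \<open>n\<close> the condition comes
      back.\<close>
    define E where "E n = {\<omega> \<in> space M. \<exists>s. \<forall>m\<le>n. W m (k m) s \<omega>}" for n
    have E_eq: "E n = {\<omega> \<in> space M. \<exists>i. \<forall>m\<le>n. \<exists>j\<le>k m. q i \<le> q j \<and> (\<forall>v\<in>{q i..q j}. \<omega> v \<in> N m)}" for n
    proof -
      have "(\<exists>s. \<forall>m\<le>n. W m (k m) s \<omega>) \<longleftrightarrow>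
          (\<exists>i. \<forall>m\<le>n. \<exists>j\<le>k m. q i \<le> q j \<and> (\<forall>v\<in>{q i..q j}. \<omega> v \<in> N m))" for \<omega>
      proof
        assume "\<exists>s. \<forall>m\<le>n. W m (k m) s \<omega>"
        then obtain s where "\<forall>m\<le>n. \<exists>j. j \<le> k m \<and> 0 \<le> s \<and> s \<le> q j \<and> (\<forall>v\<in>{s..q j}. \<omega> v \<in> N m)"
          unfolding W_def by blast
        then obtain j where j: "\<And>m. m \<le> n \<Longrightarrow> j m \<le> k m \<and> 0 \<le> s \<and> s \<le> q (j m) \<and> (\<forall>v\<in>{s..q (j m)}. \<omega> v \<in> N m)"
          by metis
        \<comment> \<open>The smallest of the end points lies in all the stretches
          \<open>{s..q (j m)}\<close>, so it can replace \<open>s\<close>; this makes the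
          existential over \<open>s\<close> a countable one.\<close>
        obtain m0 where m0: "m0 \<le> n" "\<And>m. m \<le> n \<Longrightarrow> q (j m0) \<le> q (j m)"
        proof -
          have "Min ((\<lambda>m. q (j m)) ` {..n}) \<in> (\<lambda>m. q (j m)) ` {..n}" by (intro Min_in) auto
          then obtain m0 where m0: "Min ((\<lambda>m. q (j m)) ` {..n}) = q (j m0)" "m0 \<in> {..n}"
            by (rule imageE)
          then have "q (j m0) \<le> q (j m)" if "m \<le> n" for m
            unfolding m0(1)[symmetric] using that by (intro Min_le) auto
          with m0(2) show ?thesis by (intro that[of m0]) auto
        qed
        show "\<exists>i. \<forall>m\<le>n. \<exists>j\<le>k m. q i \<le> q j \<and> (\<forall>v\<in>{q i..q j}. \<omega> v \<in> N m)"
        proof (rule exI[of _ "j m0"], intro allI impI)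
          fix m assume "m \<le> n"
          then show "\<exists>j'\<le>k m. q (j m0) \<le> q j' \<and> (\<forall>v\<in>{q (j m0)..q j'}. \<omega> v \<in> N m)"
            using j[OF \<open>m \<le> n\<close>] j[OF m0(1)] m0(2)[OF \<open>m \<le> n\<close>] by (intro exI[of _ "j m"]) auto
        qed
      next
        assume "\<exists>i. \<forall>m\<le>n. \<exists>j\<le>k m. q i \<le> q j \<and> (\<forall>v\<in>{q i..q j}. \<omega> v \<in> N m)"
        then show "\<exists>s. \<forall>m\<le>n. W m (k m) s \<omega>"
          unfolding W_def using q0(1) by meson
      qed
      then show ?thesis unfolding E_def by simp
    qed
    have E_meas: "E n \<in> sets M" for n
    proof -
      define X where "X i j m = {\<omega> \<in> space M. q i \<le> q j \<and> (\<forall>v\<in>{q i..q j}. \<omega> v \<in> N m)}" for i j m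
      have "X i j m \<in> sets M" for i j m
        unfolding X_def by (intro sets.sets_Collect_conj sets.sets_Collect_const meas1)
      moreover have "E n = (\<Union>i. \<Inter>m\<in>{..n}. \<Union>j\<in>{..k m}. X i j m)"
      proof -
        have "\<omega> \<in> E n \<longleftrightarrow> (\<exists>i. \<forall>m\<le>n. \<exists>j\<le>k m. \<omega> \<in> X i j m)" for \<omega>
          unfolding E_eq X_def mem_Collect_eq by (meson order_refl)
        then show ?thesis by (simp only: set_eq_iff UN_iff INT_iff UNIV_I Bex_def Ball_def atMost_iff simp_thms)
      qed
      ultimately show ?thesis by (auto intro!: sets.countable_UN sets.finite_INT)
    qed
    have "decseq E" unfolding E_def decseq_def by (blast intro: order_trans)
    have "c \<le> emeasure M (E n)" for n
    proof -
      have "pr (Z (Suc n)) \<subseteq> E n"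
        by (auto simp: pr_def Z_eq E_def less_Suc_eq_le)
      then have "outer_measure_of M (pr (Z (Suc n))) \<le> emeasure M (E n)"
        using outer_measure_of_mono[of "pr (Z (Suc n))" "E n" M] outer_measure_of_eq[OF E_meas] by simp
      then show ?thesis using Z(1)[of "Suc n"] by (meson less_imp_le less_le_trans)
    qed
    then have "c \<le> (INF n. emeasure M (E n))" by (intro INF_greatest)
    also have "\<dots> = emeasure M (\<Inter>n. E n)"
      using E_meas by (intro INF_emeasure_decseq \<open>decseq E\<close>) (auto simp: emeasure_eq_measure)
    finally have "c \<le> emeasure M (\<Inter>n. E n)" .
    moreover have "(\<Inter>n. E n) \<in> sets M" using E_meas by auto
    moreover have "(\<Inter>n. E n) \<subseteq> ?D"
    proof
      fix \<omega> assume \<omega>: "\<omega> \<in> (\<Inter>n. E n)"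
      then have \<omega>M: "\<omega> \<in> space M" by (auto simp: E_def)
      define Q where "Q n = {s. \<forall>m\<le>n. W m (k m) s \<omega>}" for n
      \<comment> \<open>Nested nonempty compact sets of times have a common point; this is why the
        stretches were taken with closed neighbourhoods and finitely many end points.\<close>
      have "\<exists>s. s \<in> (\<Inter>n. Q n)"
      proof -
        have "compact (Q n)" for n
        proof -
          have "Q n = (\<Inter>m\<in>{..n}. {s. W m (k m) s \<omega>})" by (auto simp: Q_def)
          then have "closed (Q n)" using closed_W[OF \<omega>M] by auto
          moreover have "Q n \<subseteq> {0..a}" unfolding Q_def using bnd_W by force
          ultimately show ?thesis by (metis compact_Icc compact_Int_closed inf.absorb_iff2)
        qed
        moreover have "Q n \<noteq> {}" for n using \<omega> by (auto simp: E_def Q_def)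
        moreover have "Q n \<subseteq> Q m" if "m \<le> n" for m n using that by (auto simp: Q_def)
        ultimately have "(\<Inter>n. Q n) \<noteq> {}" by (intro compact_nest) auto
        then show ?thesis by blast
      qed
      then obtain s where "\<And>m. W m (k m) s \<omega>" by (auto simp: Q_def)
      then show "\<omega> \<in> ?D" using A_eq[OF \<omega>M, of s] \<omega>M by auto
    qed
    ultimately show ?thesis by blast
  qed
  define D where "D = ?D"
  note inner = inner[folded D_def]
  have sub: "D \<subseteq> space M" by (auto simp: D_def)
  \<comment> \<open>\<open>O'\<close> is a measurable cover of the debut set. Inner events reach the
    same measure, so the completion contains what lies between them.\<close>
  obtain O' where O: "O' \<in> sets M" "D \<subseteq> O'" "outer_measure_of M D = emeasure M O'"
    using outer_measure_of_attain[OF sub] by blast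
  have "\<exists>E\<in>sets M. E \<subseteq> D \<and> emeasure M E = emeasure M O'"
  proof (cases "outer_measure_of M D = 0")
    case True then show ?thesis using O by (intro bexI[of _ "{}"]) auto
  next
    case False
    define m where "m = measure M O'"
    have m: "outer_measure_of M D = ennreal m" using O by (simp add: m_def emeasure_eq_measure)
    then have "0 < m" using False by (cases "m \<le> 0") (auto simp: ennreal_neg)
    have "\<exists>E\<in>sets M. E \<subseteq> D \<and> ennreal (m - m / real (Suc n)) \<le> emeasure M E" for n
      using \<open>0 < m\<close> by (intro inner) (auto simp: m ennreal_less_iff field_simps)
    then obtain E where E: "\<And>n. E n \<in> sets M" "\<And>n. E n \<subseteq> D" "\<And>n. ennreal (m - m / real (Suc n)) \<le> emeasure M (E n)"
      by metis
    have EM: "(\<Union>n. E n) \<in> sets M" using E by auto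
    have "m - m / real (Suc n) \<le> measure M (\<Union>n. E n)" for n
    proof -
      have "ennreal (m - m / real (Suc n)) \<le> ennreal (measure M (\<Union>n. E n))"
        using E(3)[of n] emeasure_mono[of "E n" "\<Union>n. E n" M] EM
        by (auto simp: emeasure_eq_measure intro: order_trans)
      then show ?thesis by (simp add: ennreal_le_iff)
    qed
    moreover have "(\<lambda>n. m - m / real (Suc n)) \<longlonglongrightarrow> m - 0"
      by (intro tendsto_intros LIMSEQ_Suc lim_const_over_n)
    ultimately have "m \<le> measure M (\<Union>n. E n)"
      by (intro LIMSEQ_le_const2[of "\<lambda>n. m - m / real (Suc n)"]) auto
    moreover have "measure M (\<Union>n. E n) \<le> m"
      unfolding m_def using E(2) O EM by (intro finite_measure_mono) auto
    ultimately have "emeasure M (\<Union>n. E n) = emeasure M O'"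
      by (simp add: m_def emeasure_eq_measure)
    then show ?thesis using EM E(2) by blast
  qed
  then obtain E where E: "E \<in> sets M" "E \<subseteq> D" "emeasure M E = emeasure M O'" by blast
  have "D \<in> sets (completion M)"
  proof (rule completion.complete_sets_sandwich)
    show "E \<in> sets (completion M)" "O' \<in> sets (completion M)"
      using E(1) O(1) by (auto intro: sets_completionI_sets)
    show "emeasure (completion M) E = emeasure (completion M) O'"
      using E O by simp
    show "emeasure (completion M) E < \<infinity>"
      using E(1) by (simp add: emeasure_eq_measure)
  qed fact+
  then show ?thesis by (simp add: D_def)
qed

subsection \<open>The integrated drift inequality\<close>

lemma ereal_min_exit:
  assumes "0 \<le> t"
  shows "ereal (min_exit U t \<omega>) = min (ereal t) (exit_time U \<omega>)"
proof -
  have "0 \<le> exit_time U \<omega>"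
    unfolding exit_time_def by (intro Inf_greatest) auto
  then have "0 \<le> min (ereal t) (exit_time U \<omega>)" "min (ereal t) (exit_time U \<omega>) \<le> ereal t"
    using assms by auto
  then show ?thesis
    unfolding min_exit_def by (cases "min (ereal t) (exit_time U \<omega>)") auto
qed

text \<open>Strictness is the point: the infimum is below \<open>a\<close> exactly if some time
  before \<open>a\<close> is outside \<open>U\<close>, whether or not the infimum is attained. The
  second alternative on the right is the event of the debut theorem.\<close>

lemma min_exit_less_iff:
  assumes "0 \<le> t"
  shows "min_exit U t \<omega> < a \<longleftrightarrow> t < a \<or> (\<exists>s. 0 \<le> s \<and> s < a \<and> \<omega> s \<notin> U)"
proof -
  have "min_exit U t \<omega> < a \<longleftrightarrow> ereal (min_exit U t \<omega>) < ereal a" by simp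
  also have "\<dots> \<longleftrightarrow> t < a \<or> exit_time U \<omega> < ereal a"
    unfolding ereal_min_exit[OF assms] by (simp add: min_less_iff_disj)
  also have "exit_time U \<omega> < ereal a \<longleftrightarrow> (\<exists>s. 0 \<le> s \<and> s < a \<and> \<omega> s \<notin> U)"
    unfolding exit_time_def Inf_less_iff by auto
  finally show ?thesis .
qed

lemma min_exit_bounds:
  assumes "0 \<le> t"
  shows "0 \<le> min_exit U t \<omega>" "min_exit U t \<omega> \<le> t"
proof -
  show "0 \<le> min_exit U t \<omega>"
    using min_exit_less_iff[OF assms, of U \<omega> 0] assms by (simp add: not_less[symmetric])
  show "min_exit U t \<omega> \<le> t"
    using ereal_min_exit[OF assms, of U \<omega>] by (metis ereal_less_eq(3) min.cobounded1)
qed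

lemma in_before_min_exit: "0 \<le> t \<Longrightarrow> 0 \<le> s \<Longrightarrow> s < min_exit U t \<omega> \<Longrightarrow> \<omega> s \<in> U"
proof (rule ccontr)
  assume *: "0 \<le> t" "0 \<le> s" "s < min_exit U t \<omega>" "\<omega> s \<notin> U"
  have "min_exit U t \<omega> < a" if "s < a" for a
    using * that unfolding min_exit_less_iff[OF *(1)] by blast
  from this[OF *(3)] show False by simp
qed

lemma min_exit_eqI: "0 \<le> t \<Longrightarrow> (\<And>s. 0 \<le> s \<Longrightarrow> s < t \<Longrightarrow> \<omega> s \<in> U) \<Longrightarrow> min_exit U t \<omega> = t"
  using min_exit_less_iff[of t U \<omega> t] min_exit_bounds(2)[of t U \<omega>] by auto

text \<open>Completeness enters here: the sublevel sets are, up to trivial cases, debut events of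
  the closed complement of \<open>U\<close>.\<close>

lemma measurable_min_exit:
  fixes M :: "(real \<Rightarrow> 'a::metric_space) measure"
  assumes "finite_measure M" "sets M = sets (path_space UNIV)" "open U" "0 \<le> t"
  shows "min_exit U t \<in> borel_measurable (completion M)"
proof (subst borel_measurable_iff_less, rule allI)
  fix a
  let ?D = "{\<omega> \<in> space M. \<exists>s. 0 \<le> s \<and> s < a \<and> \<omega> s \<in> - U}"
  have D: "?D \<in> sets (completion M)"
  proof (cases "0 < a \<and> - U \<noteq> {}")
    case True
    then show ?thesis using debut_measurable[OF assms(1,2), of "- U" a] assms(3) by auto
  next
    case False
    then have e: "?D = {}" by auto
    show ?thesis unfolding e by simp
  qed
  have "{\<omega> \<in> space (completion M). min_exit U t \<omega> < a} = (if t < a then space M else ?D)"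
    unfolding min_exit_less_iff[OF assms(4)] by auto
  with D show "{\<omega> \<in> space (completion M). min_exit U t \<omega> < a} \<in> sets (completion M)"
    by (auto intro: sets_completionI_sets)
qed

lemma measurable_path_eval_completion:
  assumes "sets M = sets (path_space UNIV)"
  shows "(\<lambda>(\<omega>, s). \<omega> (max 0 s)) \<in> completion M \<Otimes>\<^sub>M lborel \<rightarrow>\<^sub>M borel"
proof -
  have "(\<lambda>\<omega>. \<omega>) \<in> completion M \<rightarrow>\<^sub>M M" by (intro measurable_completion measurable_ident_sets refl)
  then have "(\<lambda>\<omega>. \<omega>) \<in> completion M \<rightarrow>\<^sub>M path_space UNIV"
    by (subst measurable_cong_sets[OF refl assms[symmetric]])
  then have "(\<lambda>p. (snd p, fst p)) \<in> completion M \<Otimes>\<^sub>M lborel \<rightarrow>\<^sub>M borel \<Otimes>\<^sub>M path_space UNIV"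
    by (intro measurable_Pair measurable_snd'' measurable_compose[OF measurable_fst]) auto
  from measurable_compose[OF this measurable_path_eval_pair] show ?thesis
    by (simp add: split_beta)
qed

text \<open>The time integral of \<open>V\<close> along the path is not known to be integrable, so
  \<open>\<kappa> * V\<close> cannot be moved across the equation by subtraction. \<open>G\<close>
  is split into positive and negative part, and the drift condition is used as an inequality between
  sums in \<open>[0,\<infinity>]\<close>.\<close>

lemma ext_gen_drift:
  fixes M :: "(real \<Rightarrow> 'a::metric_space) measure"
  assumes "prob_space M" and sM: "sets M = sets (path_space UNIV)" and U: "open U" and t: "0 \<le> t"
    and V[measurable]: "V \<in> borel_measurable borel" and V0: "\<And>y. 0 \<le> V y"
    and G[measurable]: "G \<in> borel_measurable borel" and C[measurable]: "C \<in> sets borel"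
    and \<kappa>: "0 \<le> \<kappa>" and b: "0 \<le> b" and v: "0 \<le> v"
    and fin: "(\<integral>\<^sup>+\<omega>. (\<integral>\<^sup>+s\<in>{0..min_exit U t \<omega>}. ennreal \<bar>G (\<omega> s)\<bar> \<partial>lborel) \<partial>completion M) < \<infinity>"
    and int: "integrable (completion M) (\<lambda>\<omega>. V (\<omega> (min_exit U t \<omega>)))"
    and eq: "(\<integral>\<omega>. V (\<omega> (min_exit U t \<omega>)) \<partial>completion M) =
          v + (\<integral>\<omega>. (LBINT s:{0..min_exit U t \<omega>}. G (\<omega> s)) \<partial>completion M)"
    and drift: "\<And>y. y \<in> U \<Longrightarrow> G y \<le> - \<kappa> * V y + b * indicator C y"
  shows "(\<integral>\<^sup>+\<omega>. ennreal (V (\<omega> (min_exit U t \<omega>))) +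
        ennreal \<kappa> * (\<integral>\<^sup>+s\<in>{0..<min_exit U t \<omega>}. ennreal (V (\<omega> s)) \<partial>lborel) \<partial>completion M)
     \<le> ennreal v + ennreal b * (\<integral>\<^sup>+\<omega>. (\<integral>\<^sup>+s\<in>{0..t}. indicator C (\<omega> s) \<partial>lborel) \<partial>completion M)"
    (is "?L \<le> _ + _ * ?R")
proof -
  interpret prob_space M by fact
  have "emeasure (completion M) (space (completion M)) = 1"
    by (simp add: emeasure_space_1)
  then interpret cM: prob_space "completion M" by (rule prob_spaceI)
  interpret pr: pair_sigma_finite "completion M" lborel ..
  let ?c = "completion M" and ?T = "min_exit U t"
  have T[measurable]: "?T \<in> borel_measurable ?c"
    using sM U t by (intro measurable_min_exit) (auto simp: finite_measure_axioms)
  have E: "(\<lambda>p. fst p (max 0 (snd p))) \<in> ?c \<Otimes>\<^sub>M lborel \<rightarrow>\<^sub>M borel"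
    using measurable_path_eval_completion[OF sM] by (simp add: split_beta)
  \<comment> \<open>Half-open, because at the exit time the path may be outside \<open>U\<close>,
    where no drift bound holds; the closed interval of the definition differs by a null set.\<close>
  define w where "w p = (indicator {0..<?T (fst p)} (snd p) :: real)" for p :: "(real \<Rightarrow> 'a) \<times> real"
  have w[measurable]: "w \<in> borel_measurable (?c \<Otimes>\<^sub>M lborel)"
  proof -
    have "w = (\<lambda>p. if 0 \<le> snd p \<and> snd p < ?T (fst p) then 1 else 0)"
      by (auto simp: w_def fun_eq_iff)
    then show ?thesis by simp
  qed
  define e where "e p = fst p (max 0 (snd p))" for p :: "(real \<Rightarrow> 'a) \<times> real"
  have e[measurable]: "e \<in> ?c \<Otimes>\<^sub>M lborel \<rightarrow>\<^sub>M borel" unfolding e_def by (rule E)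
  define F where "F p = w p * G (e p)" for p
  have F[measurable]: "F \<in> borel_measurable (?c \<Otimes>\<^sub>M lborel)"
    unfolding F_def by measurable
  have e_eq: "e (\<omega>, s) = \<omega> s" if "w (\<omega>, s) \<noteq> 0" for \<omega> s
    using that by (auto simp: w_def e_def max_def indicator_def split: if_splits)
  have AET: "AE s in lborel. indicator {0..?T \<omega>} s = w (\<omega>, s)" for \<omega>
    using AE_lborel_singleton[of "?T \<omega>"] by eventually_elim (auto simp: w_def indicator_def)
  have intF: "integrable (?c \<Otimes>\<^sub>M lborel) F"
  proof (rule integrableI_bounded)
    have "(\<integral>\<^sup>+p. ennreal (norm (F p)) \<partial>(?c \<Otimes>\<^sub>M lborel)) = (\<integral>\<^sup>+\<omega>. (\<integral>\<^sup>+s. ennreal (norm (F (\<omega>, s))) \<partial>lborel) \<partial>?c)"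
      by (intro lborel.nn_integral_fst[symmetric]) measurable
    also have "\<dots> = (\<integral>\<^sup>+\<omega>. (\<integral>\<^sup>+s\<in>{0..?T \<omega>}. ennreal \<bar>G (\<omega> s)\<bar> \<partial>lborel) \<partial>?c)"
    proof (rule nn_integral_cong, rule nn_integral_cong_AE)
      fix \<omega>
      show "AE s in lborel. ennreal (norm (F (\<omega>, s))) = ennreal \<bar>G (\<omega> s)\<bar> * indicator {0..?T \<omega>} s"
        using AE_lborel_singleton[of "?T \<omega>"]
        by eventually_elim (auto simp: F_def w_def e_def indicator_def max_def)
    qed
    finally show "(\<integral>\<^sup>+p. ennreal (norm (F p)) \<partial>(?c \<Otimes>\<^sub>M lborel)) < \<infinity>" using fin by simp
  qed measurable
  have "(\<integral>\<omega>. (LBINT s:{0..?T \<omega>}. G (\<omega> s)) \<partial>?c) = (\<integral>\<omega>. (\<integral>s. F (\<omega>, s) \<partial>lborel) \<partial>?c)"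
  proof (rule Bochner_Integration.integral_cong[OF refl])
    fix \<omega> assume \<omega>: "\<omega> \<in> space ?c"
    have m1: "(\<lambda>s. F (\<omega>, s)) \<in> borel_measurable lborel"
      using F by (rule measurable_Pair2) (use \<omega> in simp)
    have m2: "(\<lambda>s. indicator {0..?T \<omega>} s *\<^sub>R G (\<omega> s)) \<in> borel_measurable lborel"
    proof -
      have "(\<lambda>s. e (\<omega>, s)) \<in> lborel \<rightarrow>\<^sub>M borel"
        using e by (rule measurable_Pair2) (use \<omega> in simp)
      then have "(\<lambda>s. indicator {0..?T \<omega>} s *\<^sub>R G (e (\<omega>, s))) \<in> borel_measurable lborel"
        by measurable
      also have "(\<lambda>s. indicator {0..?T \<omega>} s *\<^sub>R G (e (\<omega>, s))) = (\<lambda>s. indicator {0..?T \<omega>} s *\<^sub>R G (\<omega> s))"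
        by (auto simp: fun_eq_iff e_def indicator_def)
      finally show ?thesis .
    qed
    show "(LBINT s:{0..?T \<omega>}. G (\<omega> s)) = (\<integral>s. F (\<omega>, s) \<partial>lborel)"
      unfolding set_lebesgue_integral_def
    proof (rule integral_cong_AE[OF m2 m1])
      show "AE s in lborel. indicator {0..?T \<omega>} s *\<^sub>R G (\<omega> s) = F (\<omega>, s)"
        using AE_lborel_singleton[of "?T \<omega>"]
        by eventually_elim (auto simp: F_def w_def e_def indicator_def max_def)
    qed
  qed
  also have "\<dots> = integral\<^sup>L (?c \<Otimes>\<^sub>M lborel) F" by (rule pr.integral_fst'[OF intF])
  finally have J: "(\<integral>\<omega>. (LBINT s:{0..?T \<omega>}. G (\<omega> s)) \<partial>?c) = integral\<^sup>L (?c \<Otimes>\<^sub>M lborel) F" .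
  define Ap where "Ap = (\<integral>\<^sup>+p. ennreal (F p) \<partial>(?c \<Otimes>\<^sub>M lborel))"
  define Am where "Am = (\<integral>\<^sup>+p. ennreal (- F p) \<partial>(?c \<Otimes>\<^sub>M lborel))"
  have Afin: "Ap < \<infinity>" "Am < \<infinity>"
    using intF unfolding real_integrable_def Ap_def Am_def by (auto simp: less_top)
  have "integral\<^sup>L (?c \<Otimes>\<^sub>M lborel) F = enn2real Ap - enn2real Am"
    unfolding Ap_def Am_def by (rule real_lebesgue_integral_def[OF intF])
  then have h: "(\<integral>\<omega>. V (\<omega> (?T \<omega>)) \<partial>?c) + enn2real Am = v + enn2real Ap"
    using eq J by simp
  define H where "H = (\<integral>\<^sup>+\<omega>. ennreal (V (\<omega> (?T \<omega>))) \<partial>?c)"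
  have H: "H = ennreal (\<integral>\<omega>. V (\<omega> (?T \<omega>)) \<partial>?c)"
    unfolding H_def by (rule nn_integral_eq_integral[OF int]) (simp add: V0)
  have I0: "0 \<le> (\<integral>\<omega>. V (\<omega> (?T \<omega>)) \<partial>?c)"
    by (rule integral_nonneg_AE) (simp add: V0)
  have h': "H + Am = ennreal v + Ap"
  proof -
    have "H + Am = ennreal ((\<integral>\<omega>. V (\<omega> (?T \<omega>)) \<partial>?c) + enn2real Am)"
      unfolding H using Afin by (subst ennreal_plus) (auto simp: I0)
    also have "\<dots> = ennreal v + Ap"
      unfolding h using Afin v by (subst ennreal_plus) auto
    finally show ?thesis .
  qed
  define VV where "VV = (\<integral>\<^sup>+p. ennreal (w p * V (e p)) \<partial>(?c \<Otimes>\<^sub>M lborel))"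
  define CC where "CC = (\<integral>\<^sup>+p. ennreal (w p * indicator C (e p)) \<partial>(?c \<Otimes>\<^sub>M lborel))"
  \<comment> \<open>The drift bound with every term on the side where it is nonnegative. Combined
    with the identity \<open>h'\<close> it lets the finite \<open>Ap\<close> cancel.\<close>
  have "ennreal \<kappa> * VV + Ap \<le> ennreal b * CC + Am"
  proof -
    have "ennreal \<kappa> * VV + Ap = (\<integral>\<^sup>+p. ennreal \<kappa> * ennreal (w p * V (e p)) + ennreal (F p) \<partial>(?c \<Otimes>\<^sub>M lborel))"
      unfolding VV_def Ap_def by (subst nn_integral_add) (auto simp: nn_integral_cmult)
    also have "\<dots> \<le> (\<integral>\<^sup>+p. ennreal b * ennreal (w p * indicator C (e p)) + ennreal (- F p) \<partial>(?c \<Otimes>\<^sub>M lborel))"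
    proof (rule nn_integral_mono)
      fix p :: "(real \<Rightarrow> 'a) \<times> real"
      obtain \<omega> s where p: "p = (\<omega>, s)" by (cases p)
      show "ennreal \<kappa> * ennreal (w p * V (e p)) + ennreal (F p)
          \<le> ennreal b * ennreal (w p * indicator C (e p)) + ennreal (- F p)"
      proof (cases "w p = 0")
        case False
        then have w1: "w p = 1" and s: "0 \<le> s" "s < ?T \<omega>"
          by (auto simp: p w_def indicator_def split: if_splits)
        have "e p \<in> U" using in_before_min_exit[OF t s] s by (simp add: e_def p)
        from drift[OF this] have d: "G (e p) \<le> - \<kappa> * V (e p) + b * indicator C (e p)" .
        have pos: "ennreal (max 0 r) = ennreal r" for r :: real
          by (cases "0 \<le> r") (auto simp: ennreal_neg max_def)
        have "ennreal \<kappa> * ennreal (w p * V (e p)) + ennreal (F p) = ennreal (\<kappa> * V (e p) + max 0 (G (e p)))"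
          using \<kappa> V0 by (subst ennreal_plus) (auto simp: w1 F_def ennreal_mult' pos)
        also have "\<dots> \<le> ennreal (b * indicator C (e p) + max 0 (- G (e p)))"
          using d by (intro ennreal_leI) (auto simp: max_def)
        also have "\<dots> = ennreal b * ennreal (w p * indicator C (e p)) + ennreal (- F p)"
          using b by (subst ennreal_plus) (auto simp: w1 F_def ennreal_mult' pos)
        finally show ?thesis .
      qed (simp add: F_def)
    qed
    also have "\<dots> = ennreal b * CC + Am"
      unfolding CC_def Am_def by (subst nn_integral_add) (auto simp: nn_integral_cmult)
    finally show ?thesis .
  qed
  then have "H + ennreal \<kappa> * VV + Ap \<le> H + (ennreal b * CC + Am)"
    by (simp add: add.assoc add_left_mono)
  also have "\<dots> = ennreal v + ennreal b * CC + Ap"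
    using h' by (metis add.assoc add.commute)
  finally have main: "H + ennreal \<kappa> * VV \<le> ennreal v + ennreal b * CC"
    using Afin(1) by (auto simp: ennreal_add_left_cancel_le add.commute[of _ Ap])
  have V2: "VV = (\<integral>\<^sup>+\<omega>. (\<integral>\<^sup>+s\<in>{0..<?T \<omega>}. ennreal (V (\<omega> s)) \<partial>lborel) \<partial>?c)"
  proof -
    have "VV = (\<integral>\<^sup>+\<omega>. (\<integral>\<^sup>+s. ennreal (w (\<omega>, s) * V (e (\<omega>, s))) \<partial>lborel) \<partial>?c)"
      unfolding VV_def by (rule lborel.nn_integral_fst[symmetric]) measurable
    also have "\<dots> = (\<integral>\<^sup>+\<omega>. (\<integral>\<^sup>+s\<in>{0..<?T \<omega>}. ennreal (V (\<omega> s)) \<partial>lborel) \<partial>?c)"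
      by (intro nn_integral_cong) (auto simp: w_def e_def max_def indicator_def)
    finally show ?thesis .
  qed
  have C2: "CC \<le> ?R"
  proof -
    have "CC = (\<integral>\<^sup>+\<omega>. (\<integral>\<^sup>+s. ennreal (w (\<omega>, s) * indicator C (e (\<omega>, s))) \<partial>lborel) \<partial>?c)"
      unfolding CC_def by (rule lborel.nn_integral_fst[symmetric]) measurable
    also have "\<dots> \<le> ?R"
    proof (intro nn_integral_mono)
      fix \<omega> s
      show "ennreal (w (\<omega>, s) * indicator C (e (\<omega>, s))) \<le> indicator C (\<omega> s) * indicator {0..t} s"
        using min_exit_bounds(2)[OF t, of U \<omega>] by (auto simp: w_def e_def max_def indicator_def)
    qed
    finally show ?thesis .
  qed
  have m1: "(\<lambda>\<omega>. ennreal (V (\<omega> (?T \<omega>)))) \<in> borel_measurable ?c"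
    using int by (intro measurable_compose[OF _ measurable_ennreal]) auto
  have m2: "(\<lambda>\<omega>. (\<integral>\<^sup>+s\<in>{0..<?T \<omega>}. ennreal (V (\<omega> s)) \<partial>lborel)) \<in> borel_measurable ?c"
  proof -
    have "(\<lambda>\<omega>. \<integral>\<^sup>+s. ennreal (w (\<omega>, s) * V (e (\<omega>, s))) \<partial>lborel) \<in> borel_measurable ?c"
      by measurable
    also have "(\<lambda>\<omega>. \<integral>\<^sup>+s. ennreal (w (\<omega>, s) * V (e (\<omega>, s))) \<partial>lborel) =
        (\<lambda>\<omega>. (\<integral>\<^sup>+s\<in>{0..<?T \<omega>}. ennreal (V (\<omega> s)) \<partial>lborel))"
      by (intro ext nn_integral_cong) (auto simp: w_def e_def max_def indicator_def)
    finally show ?thesis .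
  qed
  have "?L = H + ennreal \<kappa> * VV"
    unfolding H_def V2 using m1 m2 by (subst nn_integral_add) (auto simp: nn_integral_cmult)
  also have "\<dots> \<le> ennreal v + ennreal b * ?R"
    using main C2 by (meson add_left_mono mult_left_mono order_trans zero_le)
  finally show ?thesis .
qed

text \<open>Near each time both one-sided limits lie in some member of the exhaustion, hence so does
  the path; bisection patches finitely many such pieces together. This is where the left limits are
  used.\<close>

lemma cadlag_path_in_exhaustion:
  assumes \<omega>: "\<omega> \<in> cadlag_paths UNIV" and U: "exhaustion U" and t: "0 \<le> t"
  obtains m where "1 \<le> m" "\<And>s. 0 \<le> s \<Longrightarrow> s \<le> t \<Longrightarrow> \<omega> s \<in> U m"
proof -
  have mono: "U m \<subseteq> U n" if "1 \<le> m" "m \<le> n" for m n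
    using that(2,1)
  proof (induction rule: dec_induct)
    case (step n)
    then have "closure (U n) \<subseteq> U (Suc n)" using U by (auto simp: exhaustion_def)
    then show ?case using step closure_subset[of "U n"] by auto
  qed simp
  have op: "open (U m)" if "1 \<le> m" for m using U that by (auto simp: exhaustion_def)
  have cov: "\<exists>m\<ge>1. y \<in> U m" for y
  proof -
    have "y \<in> (\<Union>m\<in>{1..}. U m)" using U by (simp only: exhaustion_def UNIV_I)
    then show ?thesis by auto
  qed
  \<comment> \<open>The guard \<open>0 \<le> s\<close> lets the intervals around time 0 reach to
    negative times, as the bisection principle asks for two-sided neighbourhoods.\<close>
  define Q where "Q a b \<longleftrightarrow> (\<exists>m\<ge>1. \<forall>s\<in>{a..b}. 0 \<le> s \<longrightarrow> \<omega> s \<in> U m)" for a b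
  have "Q 0 t"
    using t
  proof (rule Bolzano)
    fix a b c assume "Q a b" "Q b c"
    then obtain m n where mn: "1 \<le> m" "1 \<le> n" "\<forall>s\<in>{a..b}. 0 \<le> s \<longrightarrow> \<omega> s \<in> U m"
      "\<forall>s\<in>{b..c}. 0 \<le> s \<longrightarrow> \<omega> s \<in> U n"
      unfolding Q_def by blast
    have "\<omega> s \<in> U (max m n)" if "s \<in> {a..c}" "0 \<le> s" for s
      using mn that mono[of m "max m n"] mono[of n "max m n"] by (cases "s \<le> b") auto
    then show "Q a c" unfolding Q_def using mn(1) by (intro exI[of _ "max m n"]) auto
  next
    fix x :: real assume "0 \<le> x"
    obtain m where m: "1 \<le> m" "\<omega> x \<in> U m" using cov by blast
    have "eventually (\<lambda>s. \<omega> s \<in> U m) (at_right x)"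
      using cadlag_pathsD(2)[OF \<omega> \<open>0 \<le> x\<close>] op[OF m(1)] m(2) by (rule topological_tendstoD)
    then obtain d1 where d1: "x < d1" "\<And>s. x < s \<Longrightarrow> s < d1 \<Longrightarrow> \<omega> s \<in> U m"
      unfolding eventually_at_right_field by auto
    obtain n d2 where n: "1 \<le> n" "d2 < x" "\<And>s. d2 < s \<Longrightarrow> s < x \<Longrightarrow> 0 \<le> s \<Longrightarrow> \<omega> s \<in> U n"
    proof (cases "x = 0")
      case True
      then show ?thesis by (intro that[of 1 "-1"]) auto
    next
      case False
      then have "0 < x" using \<open>0 \<le> x\<close> by simp
      then obtain l where l: "(\<omega> \<longlongrightarrow> l) (at_left x)"
        using \<omega> unfolding cadlag_paths_def by blast
      obtain n where n: "1 \<le> n" "l \<in> U n" using cov by blast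
      have "eventually (\<lambda>s. \<omega> s \<in> U n) (at_left x)"
        using l op[OF n(1)] n(2) by (rule topological_tendstoD)
      then obtain d2 where "d2 < x" "\<And>s. d2 < s \<Longrightarrow> s < x \<Longrightarrow> \<omega> s \<in> U n"
        unfolding eventually_at_left_field by auto
      then show ?thesis using that n(1) by blast
    qed
    have in_max: "\<omega> s \<in> U (max m n)" if s: "d2 < s" "s < d1" "0 \<le> s" for s
    proof -
      have "\<omega> s \<in> U m \<or> \<omega> s \<in> U n"
        using d1(2)[of s] n(3)[of s] m(2) s by (cases s x rule: linorder_cases) auto
      then show ?thesis using mono[of m "max m n"] mono[of n "max m n"] m(1) n(1) by auto
    qed
    show "\<exists>d>0. \<forall>a b. a \<le> x \<and> x \<le> b \<and> b - a < d \<longrightarrow> Q a b"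
    proof (rule exI[of _ "min (d1 - x) (x - d2)"], intro conjI allI impI)
      fix a b assume ab: "a \<le> x \<and> x \<le> b \<and> b - a < min (d1 - x) (x - d2)"
      then have "\<forall>s\<in>{a..b}. 0 \<le> s \<longrightarrow> \<omega> s \<in> U (max m n)"
        by (intro ballI impI in_max) auto
      then show "Q a b"
        unfolding Q_def using m(1) by (intro exI[of _ "max m n"]) auto
    qed (use d1 n in auto)
  qed
  then show ?thesis using that unfolding Q_def by auto
qed

text \<open>Fatou's lemma along the exit times: a fixed path stays in some \<open>U m\<close> up to
  time \<open>t\<close>, so its functional is eventually constant in the index. Only an inequality
  survives the limit, since \<open>V\<close> at the exit times need not be uniformly
  integrable.\<close>

lemma drift_integrated:
  fixes P :: "'a::metric_space \<Rightarrow> (real \<Rightarrow> 'a) measure" and V :: "'a \<Rightarrow> real" and \<kappa> b t :: real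
  assumes P: "prob_space (P x)" "sets (P x) = sets (path_space UNIV)"
    and U: "exhaustion U" and t: "0 \<le> t"
    and V[measurable]: "V \<in> borel_measurable borel" and V0: "\<And>y. 0 \<le> V y"
    and C[measurable]: "C \<in> sets borel" and \<kappa>: "0 \<le> \<kappa>" and b: "0 \<le> b"
    and L: "\<And>m. 1 \<le> m \<Longrightarrow> \<exists>G. trunc_ext_gen P (U m) V G \<and>
           (\<forall>x\<in>U m. G x \<le> - \<kappa> * V x + b * indicator C x)"
  shows "(\<integral>\<^sup>+y. ennreal (V y) \<partial>trans_prob P t x) +
        ennreal \<kappa> * (\<integral>\<^sup>+s\<in>{0..t}. (\<integral>\<^sup>+y. ennreal (V y) \<partial>trans_prob P s x) \<partial>lborel)
     \<le> ennreal (V x) + ennreal b * (\<integral>\<^sup>+s\<in>{0..t}. emeasure (trans_prob P s x) C \<partial>lborel)"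
proof -
  let ?c = "completion (P x)"
  interpret prob_space "P x" by fact
  interpret pr: pair_sigma_finite "P x" lborel ..
  have spM: "space (P x) = cadlag_paths UNIV"
    using sets_eq_imp_space_eq[OF P(2)] by simp
  have ev: "(\<lambda>\<omega>. \<omega> s) \<in> P x \<rightarrow>\<^sub>M borel" if "0 \<le> s" for s
    using measurable_path_eval[OF that] by (subst measurable_cong_sets[OF P(2) refl])
  have evp: "(\<lambda>p. fst p (max 0 (snd p))) \<in> P x \<Otimes>\<^sub>M lborel \<rightarrow>\<^sub>M borel"
  proof -
    have "(\<lambda>p. (snd p, fst p)) \<in> P x \<Otimes>\<^sub>M lborel \<rightarrow>\<^sub>M borel \<Otimes>\<^sub>M P x" by measurable
    then have "(\<lambda>p. (snd p, fst p)) \<in> P x \<Otimes>\<^sub>M lborel \<rightarrow>\<^sub>M borel \<Otimes>\<^sub>M path_space UNIV"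
      by (subst measurable_cong_sets[OF refl sets_pair_measure_cong[OF refl P(2)[symmetric]]])
    from measurable_compose[OF this measurable_path_eval_pair] show ?thesis by (simp add: split_beta)
  qed
  have swap: "(\<integral>\<^sup>+\<omega>. (\<integral>\<^sup>+s\<in>{0..t}. f (\<omega> s) \<partial>lborel) \<partial>P x) = (\<integral>\<^sup>+s\<in>{0..t}. (\<integral>\<^sup>+y. f y \<partial>trans_prob P s x) \<partial>lborel)"
    if [measurable]: "f \<in> borel_measurable borel" for f :: "'a \<Rightarrow> ennreal"
  proof -
    have "(\<integral>\<^sup>+\<omega>. (\<integral>\<^sup>+s\<in>{0..t}. f (\<omega> s) \<partial>lborel) \<partial>P x) =
        (\<integral>\<^sup>+\<omega>. (\<integral>\<^sup>+s. f (\<omega> (max 0 s)) * indicator {0..t} s \<partial>lborel) \<partial>P x)"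
      by (intro nn_integral_cong) (auto simp: indicator_def max_def)
    also have "\<dots> = (\<integral>\<^sup>+s. (\<integral>\<^sup>+\<omega>. f (\<omega> (max 0 s)) * indicator {0..t} s \<partial>P x) \<partial>lborel)"
    proof (rule pr.Fubini'[symmetric])
      have "(\<lambda>p. f (fst p (max 0 (snd p))) * indicator {0..t} (snd p)) \<in> borel_measurable (P x \<Otimes>\<^sub>M lborel)"
        using measurable_compose[OF evp that] by measurable
      then show "(\<lambda>(\<omega>, s). f (\<omega> (max 0 s)) * indicator {0..t} s) \<in> borel_measurable (P x \<Otimes>\<^sub>M lborel)"
        by (simp add: split_beta)
    qed
    also have "\<dots> = (\<integral>\<^sup>+s\<in>{0..t}. (\<integral>\<^sup>+y. f y \<partial>trans_prob P s x) \<partial>lborel)"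
    proof (rule nn_integral_cong)
      fix s
      show "(\<integral>\<^sup>+\<omega>. f (\<omega> (max 0 s)) * indicator {0..t} s \<partial>P x) =
          (\<integral>\<^sup>+y. f y \<partial>trans_prob P s x) * indicator {0..t} s"
        using ev[of s] by (cases "s \<in> {0..t}") (auto simp: trans_prob_def nn_integral_distr max_def)
    qed
    finally show ?thesis .
  qed
  \<comment> \<open>Shifted by one, as the exhaustion says nothing about the member with index
    0.\<close>
  define T where "T n \<omega> = min_exit (U (Suc n)) t \<omega>" for n \<omega>
  define \<Phi> where "\<Phi> n \<omega> = ennreal (V (\<omega> (T n \<omega>))) +
        ennreal \<kappa> * (\<integral>\<^sup>+s\<in>{0..<T n \<omega>}. ennreal (V (\<omega> s)) \<partial>lborel)" for n \<omega>
  define R where "R = ennreal (V x) + ennreal b * (\<integral>\<^sup>+s\<in>{0..t}. emeasure (trans_prob P s x) C \<partial>lborel)"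
  have op: "open (U (Suc n))" for n using U by (auto simp: exhaustion_def)
  have \<Phi>_le: "(\<integral>\<^sup>+\<omega>. \<Phi> n \<omega> \<partial>?c) \<le> R" and \<Phi>_meas: "\<Phi> n \<in> borel_measurable ?c" for n
  proof -
    obtain G where G: "trunc_ext_gen P (U (Suc n)) V G"
      "\<And>y. y \<in> U (Suc n) \<Longrightarrow> G y \<le> - \<kappa> * V y + b * indicator C y"
      using L[of "Suc n"] by auto
    note G1 = G(1)[unfolded trunc_ext_gen_def]
    have "(\<integral>\<^sup>+\<omega>. \<Phi> n \<omega> \<partial>?c) \<le>
        ennreal (V x) + ennreal b * (\<integral>\<^sup>+\<omega>. (\<integral>\<^sup>+s\<in>{0..t}. indicator C (\<omega> s) \<partial>lborel) \<partial>?c)"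
      unfolding \<Phi>_def T_def using G1 t
      by (intro ext_gen_drift[OF P op t V V0 _ C \<kappa> b V0 _ _ _ G(2)]) auto
    also have "(\<integral>\<^sup>+\<omega>. (\<integral>\<^sup>+s\<in>{0..t}. indicator C (\<omega> s) \<partial>lborel) \<partial>?c) =
        (\<integral>\<^sup>+s\<in>{0..t}. emeasure (trans_prob P s x) C \<partial>lborel)"
      unfolding nn_integral_completion by (subst swap) (auto simp: trans_prob_def)
    finally show "(\<integral>\<^sup>+\<omega>. \<Phi> n \<omega> \<partial>?c) \<le> R" by (simp add: R_def)
    have [measurable]: "T n \<in> borel_measurable ?c"
      unfolding T_def[abs_def] using P op t
      by (intro measurable_min_exit) (auto simp: finite_measure_axioms)
    have [measurable]: "(\<lambda>p. fst p (max 0 (snd p))) \<in> ?c \<Otimes>\<^sub>M lborel \<rightarrow>\<^sub>M borel"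
      using measurable_path_eval_completion[OF P(2)] by (simp add: split_beta)
    have "(\<lambda>\<omega>. \<integral>\<^sup>+s. ennreal (V (fst (\<omega>, s) (max 0 (snd (\<omega>, s))))) * (if 0 \<le> s \<and> s < T n \<omega> then 1 else 0) \<partial>lborel)
        \<in> borel_measurable ?c" by measurable
    also have "(\<lambda>\<omega>. \<integral>\<^sup>+s. ennreal (V (fst (\<omega>, s) (max 0 (snd (\<omega>, s))))) * (if 0 \<le> s \<and> s < T n \<omega> then 1 else 0) \<partial>lborel)
        = (\<lambda>\<omega>. \<integral>\<^sup>+s\<in>{0..<T n \<omega>}. ennreal (V (\<omega> s)) \<partial>lborel)"
      by (intro ext nn_integral_cong) (auto simp: indicator_def max_def)
    finally have [measurable]: "(\<lambda>\<omega>. \<integral>\<^sup>+s\<in>{0..<T n \<omega>}. ennreal (V (\<omega> s)) \<partial>lborel) \<in> borel_measurable ?c" .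
    have [measurable]: "(\<lambda>\<omega>. V (\<omega> (T n \<omega>))) \<in> borel_measurable ?c"
      using G1 t unfolding T_def by (auto intro: borel_measurable_integrable)
    show "\<Phi> n \<in> borel_measurable ?c" unfolding \<Phi>_def[abs_def] by measurable
  qed
  define \<Psi> where "\<Psi> \<omega> = ennreal (V (\<omega> t)) + ennreal \<kappa> * (\<integral>\<^sup>+s\<in>{0..t}. ennreal (V (\<omega> s)) \<partial>lborel)" for \<omega>
  have lim: "liminf (\<lambda>n. \<Phi> n \<omega>) = \<Psi> \<omega>" if \<omega>: "\<omega> \<in> space (P x)" for \<omega>
  proof -
    obtain m where m: "1 \<le> m" "\<And>s. 0 \<le> s \<Longrightarrow> s \<le> t \<Longrightarrow> \<omega> s \<in> U m"
      using cadlag_path_in_exhaustion[OF _ U t, of \<omega>] \<omega> spM by auto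
    have "U m \<subseteq> U (Suc n)" if "m \<le> n" for n
      using that
    proof (induction rule: dec_induct)
      case base
      then show ?case using U m(1) closure_subset[of "U m"] by (auto simp: exhaustion_def)
    next
      case (step n)
      have "closure (U (Suc n)) \<subseteq> U (Suc (Suc n))" using U by (auto simp: exhaustion_def)
      then show ?case using step closure_subset[of "U (Suc n)"] by auto
    qed
    then have T: "T n \<omega> = t" if "m \<le> n" for n
      unfolding T_def using m that t by (intro min_exit_eqI) (auto simp: less_imp_le subset_iff)
    have "(\<integral>\<^sup>+s\<in>{0..<t}. ennreal (V (\<omega> s)) \<partial>lborel) = (\<integral>\<^sup>+s\<in>{0..t}. ennreal (V (\<omega> s)) \<partial>lborel)"
    proof (rule nn_integral_cong_AE)
      show "AE s in lborel. ennreal (V (\<omega> s)) * indicator {0..<t} s = ennreal (V (\<omega> s)) * indicator {0..t} s"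
        using AE_lborel_singleton[of t] by eventually_elim (auto simp: indicator_def)
    qed
    then have "\<Phi> n \<omega> = \<Psi> \<omega>" if "m \<le> n" for n
      unfolding \<Phi>_def \<Psi>_def T[OF that] by simp
    then have "eventually (\<lambda>n. \<Phi> n \<omega> = \<Psi> \<omega>) sequentially"
      by (auto simp: eventually_sequentially)
    then have "(\<lambda>n. \<Phi> n \<omega>) \<longlonglongrightarrow> \<Psi> \<omega>" by (rule tendsto_eventually)
    then show ?thesis by (intro lim_imp_Liminf) auto
  qed
  have "(\<integral>\<^sup>+\<omega>. \<Psi> \<omega> \<partial>P x) = (\<integral>\<^sup>+\<omega>. liminf (\<lambda>n. \<Phi> n \<omega>) \<partial>?c)"
    unfolding nn_integral_completion by (intro nn_integral_cong) (simp add: lim)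
  also have "\<dots> \<le> liminf (\<lambda>n. \<integral>\<^sup>+\<omega>. \<Phi> n \<omega> \<partial>?c)"
    by (rule nn_integral_liminf) (rule \<Phi>_meas)
  also have "\<dots> \<le> R"
    using Liminf_mono[of "\<lambda>n. \<integral>\<^sup>+\<omega>. \<Phi> n \<omega> \<partial>?c" "\<lambda>_. R" sequentially] \<Phi>_le by (simp add: Liminf_const)
  finally have fin: "(\<integral>\<^sup>+\<omega>. \<Psi> \<omega> \<partial>P x) \<le> R" .
  have [measurable]: "(\<lambda>\<omega>. \<integral>\<^sup>+s\<in>{0..t}. ennreal (V (\<omega> s)) \<partial>lborel) \<in> borel_measurable (P x)"
  proof -
    have [measurable]: "(\<lambda>p. V (fst p (max 0 (snd p)))) \<in> borel_measurable (P x \<Otimes>\<^sub>M lborel)"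
      using measurable_compose[OF evp V] .
    have "(\<lambda>\<omega>. \<integral>\<^sup>+s. ennreal (V (fst (\<omega>, s) (max 0 (snd (\<omega>, s))))) * indicator {0..t} s \<partial>lborel)
        \<in> borel_measurable (P x)" by measurable
    also have "(\<lambda>\<omega>. \<integral>\<^sup>+s. ennreal (V (fst (\<omega>, s) (max 0 (snd (\<omega>, s))))) * indicator {0..t} s \<partial>lborel)
        = (\<lambda>\<omega>. \<integral>\<^sup>+s\<in>{0..t}. ennreal (V (\<omega> s)) \<partial>lborel)"
      by (intro ext nn_integral_cong) (auto simp: indicator_def max_def)
    finally show ?thesis .
  qed
  have "(\<integral>\<^sup>+\<omega>. \<Psi> \<omega> \<partial>P x) = (\<integral>\<^sup>+\<omega>. ennreal (V (\<omega> t)) \<partial>P x) +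
      ennreal \<kappa> * (\<integral>\<^sup>+\<omega>. (\<integral>\<^sup>+s\<in>{0..t}. ennreal (V (\<omega> s)) \<partial>lborel) \<partial>P x)"
    unfolding \<Psi>_def using ev[OF t] by (subst nn_integral_add) (auto simp: nn_integral_cmult)
  also have "\<dots> = (\<integral>\<^sup>+y. ennreal (V y) \<partial>trans_prob P t x) +
      ennreal \<kappa> * (\<integral>\<^sup>+s\<in>{0..t}. (\<integral>\<^sup>+y. ennreal (V y) \<partial>trans_prob P s x) \<partial>lborel)"
    using ev[OF t] by (subst swap) (auto simp: trans_prob_def nn_integral_distr)
  finally show ?thesis using fin by (simp add: R_def)
qed

subsection \<open>Markov kernels\<close>

lemma prob_kernelD:
  assumes "k \<in> M \<rightarrow>\<^sub>M prob_algebra N" "x \<in> space M"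
  shows "prob_space (k x)" "sets (k x) = sets N"
  using measurable_space[OF assms] by (auto simp: space_prob_algebra)

lemma kernelD_borel:
  assumes "k \<in> borel \<rightarrow>\<^sub>M prob_algebra (N :: 'b measure)"
  shows "prob_space (k x)" "sets (k x) = sets N"
  using prob_kernelD[OF assms, of x] by auto

lemma measurable_kernel_integral:
  fixes f :: "'b \<Rightarrow> real"
  assumes "k \<in> M \<rightarrow>\<^sub>M prob_algebra N" "f \<in> borel_measurable N"
  shows "(\<lambda>x. \<integral>y. f y \<partial>k x) \<in> borel_measurable M"
  using measurable_compose[OF measurable_prob_algebraD[OF assms(1)] integral_measurable_subprob_algebra[OF assms(2)]] .

lemma measurable_kernel_nn_integral:
  assumes "k \<in> M \<rightarrow>\<^sub>M prob_algebra N" "f \<in> borel_measurable N"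
  shows "(\<lambda>x. \<integral>\<^sup>+y. f y \<partial>k x) \<in> borel_measurable M"
  using measurable_compose[OF measurable_prob_algebraD[OF assms(1)] nn_integral_measurable_subprob_algebra[OF assms(2)]] .

lemma measurable_kernel_emeasure:
  assumes "k \<in> M \<rightarrow>\<^sub>M prob_algebra N" "B \<in> sets N"
  shows "(\<lambda>x. emeasure (k x) B) \<in> borel_measurable M"
  using measurable_compose[OF measurable_prob_algebraD[OF assms(1)] measurable_emeasure_subprob_algebra[OF assms(2)]] .

lemma (in prob_space) integrable_bounded:
  fixes f :: "'a \<Rightarrow> real"
  assumes "f \<in> borel_measurable M" "\<And>x. x \<in> space M \<Longrightarrow> \<bar>f x\<bar> \<le> b"
  shows "integrable M f"
  using assms by (intro integrable_const_bound[of _ b] AE_I2) auto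

lemma (in prob_space) abs_integral_le:
  fixes f :: "'a \<Rightarrow> real"
  assumes "f \<in> borel_measurable M" "\<And>x. x \<in> space M \<Longrightarrow> \<bar>f x\<bar> \<le> b"
  shows "\<bar>\<integral>x. f x \<partial>M\<bar> \<le> b"
proof -
  have "\<bar>\<integral>x. f x \<partial>M\<bar> \<le> (\<integral>x. \<bar>f x\<bar> \<partial>M)" by (rule integral_abs_bound)
  also have "\<dots> \<le> (\<integral>x. b \<partial>M)"
    using assms integrable_bounded[of "\<lambda>x. \<bar>f x\<bar>" b] by (intro integral_mono) auto
  finally show ?thesis by (simp add: prob_space)
qed

text \<open>Adding the bound \<open>b\<close> makes a bounded function nonnegative, so that
  identities for nonnegative integrals transfer to signed ones without splitting into parts.\<close>

lemma (in prob_space) shifted_integral: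
  fixes g :: "'a \<Rightarrow> real"
  assumes "g \<in> borel_measurable M" "\<And>y. y \<in> space M \<Longrightarrow> \<bar>g y\<bar> \<le> b"
  shows "ennreal ((\<integral>y. g y \<partial>M) + b) = (\<integral>\<^sup>+y. ennreal (g y + b) \<partial>M)"
proof -
  have i: "integrable M g" by (rule integrable_bounded[OF assms])
  have "(\<integral>\<^sup>+y. ennreal (g y + b) \<partial>M) = ennreal (\<integral>y. g y + b \<partial>M)"
  proof (intro nn_integral_eq_integral AE_I2)
    fix y assume "y \<in> space M"
    from assms(2)[OF this] show "0 \<le> g y + b" by linarith
  qed (use i in simp)
  also have "(\<integral>y. g y + b \<partial>M) = (\<integral>y. g y \<partial>M) + b"
    using i by (simp add: prob_space)
  finally show ?thesis by simp
qed

lemma integral_bind_bounded: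
  fixes f :: "'b \<Rightarrow> real"
  assumes M: "prob_space M" and k: "k \<in> M \<rightarrow>\<^sub>M prob_algebra N"
    and f[measurable]: "f \<in> borel_measurable N" and b: "\<And>y. y \<in> space N \<Longrightarrow> \<bar>f y\<bar> \<le> b"
  shows "(\<integral>y. f y \<partial>(M \<bind> k)) = (\<integral>x. (\<integral>y. f y \<partial>k x) \<partial>M)"
proof -
  interpret prob_space M by fact
  have k': "k \<in> M \<rightarrow>\<^sub>M subprob_algebra N" by (rule measurable_prob_algebraD[OF k])
  have "M \<in> space (prob_algebra M)" using M by (simp add: space_prob_algebra)
  have pb: "prob_space (M \<bind> k)"
    by (rule prob_space_bind[OF _ k']) (use prob_kernelD(1)[OF k] in auto)
  have sb: "sets (M \<bind> k) = sets N" "space (M \<bind> k) = space N"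
    using k' not_empty by (auto simp: sets_bind[OF sets_kernel[OF k']] space_bind[OF sets_kernel[OF k']])
  have shift: "ennreal ((\<integral>y. g y \<partial>Q) + b) = (\<integral>\<^sup>+y. ennreal (g y + b) \<partial>Q)"
    if "prob_space Q" "g \<in> borel_measurable Q" "\<And>y. y \<in> space Q \<Longrightarrow> \<bar>g y\<bar> \<le> b" for Q :: "'b measure" and g
    using that by (rule prob_space.shifted_integral)
  have kf: "\<bar>\<integral>y. f y \<partial>k x\<bar> \<le> b" if "x \<in> space M" for x
    using prob_kernelD[OF k that] sets_eq_imp_space_eq[OF prob_kernelD(2)[OF k that]] b f
    by (intro prob_space.abs_integral_le) (auto cong: measurable_cong_sets)
  have "ennreal ((\<integral>y. f y \<partial>(M \<bind> k)) + b) = (\<integral>\<^sup>+y. ennreal (f y + b) \<partial>(M \<bind> k))"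
    using sb b f by (intro shift pb) (auto cong: measurable_cong_sets)
  also have "\<dots> = (\<integral>\<^sup>+x. \<integral>\<^sup>+y. ennreal (f y + b) \<partial>k x \<partial>M)"
    by (rule nn_integral_bind[OF _ k']) measurable
  also have "\<dots> = (\<integral>\<^sup>+x. ennreal ((\<integral>y. f y \<partial>k x) + b) \<partial>M)"
  proof (rule nn_integral_cong)
    fix x assume x: "x \<in> space M"
    show "(\<integral>\<^sup>+y. ennreal (f y + b) \<partial>k x) = ennreal ((\<integral>y. f y \<partial>k x) + b)"
      using prob_kernelD[OF k x] sets_eq_imp_space_eq[OF prob_kernelD(2)[OF k x]] b f
      by (intro shift[symmetric]) (auto cong: measurable_cong_sets)
  qed
  also have "\<dots> = ennreal ((\<integral>x. (\<integral>y. f y \<partial>k x) \<partial>M) + b)"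
    using kf by (intro shifted_integral[symmetric] measurable_kernel_integral[OF k f])
  finally have e: "ennreal ((\<integral>y. f y \<partial>(M \<bind> k)) + b) = ennreal ((\<integral>x. (\<integral>y. f y \<partial>k x) \<partial>M) + b)" .
  have "\<bar>\<integral>x. (\<integral>y. f y \<partial>k x) \<partial>M\<bar> \<le> b"
    using kf by (intro abs_integral_le measurable_kernel_integral[OF k f])
  moreover have "\<bar>\<integral>y. f y \<partial>(M \<bind> k)\<bar> \<le> b"
    using sb b f pb by (intro prob_space.abs_integral_le) (auto cong: measurable_cong_sets)
  ultimately show ?thesis using e by (subst (asm) ennreal_inj) auto
qed

lemma nn_integral_mono_setwise:
  assumes s: "sets \<rho> = sets \<mu>" and f: "f \<in> borel_measurable \<mu>"
    and le: "\<And>B. B \<in> sets \<mu> \<Longrightarrow> c * emeasure \<rho> B \<le> emeasure \<mu> B"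
  shows "c * (\<integral>\<^sup>+y. f y \<partial>\<rho>) \<le> (\<integral>\<^sup>+y. f y \<partial>\<mu>)"
proof -
  have f': "f \<in> borel_measurable \<rho>" using f s by (simp cong: measurable_cong_sets)
  have "c * (\<integral>\<^sup>+y. f y \<partial>\<rho>) = (\<integral>\<^sup>+y. f y \<partial>scale_measure c \<rho>)"
    by (simp add: nn_integral_scale_measure[OF f'])
  also have "\<dots> \<le> (\<integral>\<^sup>+y. f y \<partial>\<mu>)"
    using s le by (intro nn_integral_mono_measure) (auto simp: le_measure)
  finally show ?thesis .
qed

subsection \<open>Harris' theorem\<close>

text \<open>The choice of \<open>\<beta>\<close> gives \<open>\<beta> * K = \<delta> / 2\<close>.
  The drift then costs at most \<open>\<delta>\<close> for the two starting points together, on top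
  of half of \<open>S = \<beta> * V x + \<beta> * V y\<close>. If
  \<open>V x + V y \<ge> 8 * K\<close>, then \<open>S \<ge> 4 * \<delta>\<close> and the half of
  \<open>S\<close> that is gained pays for this; otherwise both points are in the sublevel set and
  the common part \<open>\<delta> * \<rho>\<close> saves \<open>2 * \<delta>\<close>. The rate
  \<open>1 - \<delta> / 6\<close> is what the first case allows: for \<open>\<delta> = 1\<close> and
  \<open>S = 4\<close> its estimate holds with equality.\<close>

lemma harris_contraction:
  fixes V \<phi> :: "'a::topological_space \<Rightarrow> real"
  assumes q: "\<And>x. prob_space (q x)" "\<And>x. sets (q x) = sets borel"
    and V[measurable]: "V \<in> borel_measurable borel" "\<And>x. 0 \<le> V x"
    and drift: "\<And>x. integrable (q x) V" "\<And>x. (\<integral>y. V y \<partial>q x) \<le> V x / 2 + K"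
    and K: "0 < K" and \<delta>: "0 < \<delta>" "\<delta> \<le> 1"
    and \<rho>: "prob_space \<rho>" "sets \<rho> = sets borel"
    and minor: "\<And>x B. V x \<le> 8 * K \<Longrightarrow> B \<in> sets borel \<Longrightarrow> ennreal \<delta> * emeasure \<rho> B \<le> emeasure (q x) B"
    and \<beta>: "\<beta> = \<delta> / (2 * K)"
    and \<phi>[measurable]: "\<phi> \<in> borel_measurable borel" and L: "0 \<le> L"
    and osc: "\<And>x y. \<phi> x - \<phi> y \<le> L * (2 + \<beta> * V x + \<beta> * V y)"
  shows "(\<integral>z. \<phi> z \<partial>q x) - (\<integral>z. \<phi> z \<partial>q y) \<le> (1 - \<delta> / 6) * L * (2 + \<beta> * V x + \<beta> * V y)"
proof -
  have [measurable_cong]: "sets (q x) = sets borel" for x by (rule q)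
  note [measurable_cong] = \<rho>(2)
  interpret \<rho>: prob_space \<rho> by fact
  have \<beta>0: "0 < \<beta>" and \<beta>K: "\<beta> * K = \<delta> / 2" using \<beta> K \<delta> by auto
  \<comment> \<open>Subtracting this constant turns the bound on the oscillation into the pointwise
    bound \<open>\<bar>\<psi> x\<bar> \<le> L * W x\<close>: the oscillation seminorm is the
    weighted sup norm modulo constants.\<close>
  define c where "c = (SUP x. \<phi> x - L * (1 + \<beta> * V x))"
  have pre: "\<phi> x - L * (1 + \<beta> * V x) \<le> \<phi> y + L * (1 + \<beta> * V y)" for x y
    using osc[of x y] by (simp add: algebra_simps)
  have bdd: "bdd_above (range (\<lambda>x. \<phi> x - L * (1 + \<beta> * V x)))"
    using pre by (intro bdd_aboveI[of _ "\<phi> undefined + L * (1 + \<beta> * V undefined)"]) auto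
  define \<psi> where "\<psi> x = \<phi> x - c" for x
  define W where "W x = 1 + \<beta> * V x" for x
  have [measurable]: "\<psi> \<in> borel_measurable borel" "W \<in> borel_measurable borel"
    unfolding \<psi>_def[abs_def] W_def[abs_def] by measurable
  have up: "\<psi> x \<le> L * W x" for x
    using cSUP_upper[OF _ bdd, of x] unfolding \<psi>_def W_def c_def by simp
  have low: "- \<psi> x \<le> L * W x" for x
    using cSUP_least[of UNIV "\<lambda>x. \<phi> x - L * (1 + \<beta> * V x)" "\<phi> x + L * W x"] pre
    unfolding \<psi>_def W_def c_def by auto
  have W1: "1 \<le> W x" for x unfolding W_def using V(2)[of x] \<beta>0 by simp
  have iW: "integrable (q x) W" for x
  proof -
    interpret prob_space "q x" by (rule q)
    show ?thesis unfolding W_def using drift(1)[of x] by auto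
  qed
  have i\<psi>: "integrable (q x) \<psi>" for x
    by (rule Bochner_Integration.integrable_bound[OF integrable_mult_right[OF iW[of x], of L]])
       (use up low in \<open>auto intro!: AE_I2 simp: abs_le_iff intro: order_trans[OF _ abs_ge_self]\<close>)
  have intW: "(\<integral>z. W z \<partial>q x) \<le> 1 + \<beta> * V x / 2 + \<delta> / 2" for x
  proof -
    interpret prob_space "q x" by (rule q)
    have "(\<integral>z. W z \<partial>q x) = 1 + \<beta> * (\<integral>y. V y \<partial>q x)"
      unfolding W_def using drift(1)[of x] by (simp add: prob_space)
    also have "\<dots> \<le> 1 + \<beta> * (V x / 2 + K)"
      using drift(2)[of x] \<beta>0 by simp
    finally show ?thesis using \<beta>K by (simp add: algebra_simps)
  qed
  have diff: "(\<integral>z. \<phi> z \<partial>q x) - (\<integral>z. \<phi> z \<partial>q y) = (\<integral>z. \<psi> z \<partial>q x) - (\<integral>z. \<psi> z \<partial>q y)"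
  proof -
    have "(\<integral>z. \<phi> z \<partial>q x) = (\<integral>z. \<psi> z \<partial>q x) + c" for x
    proof -
      interpret prob_space "q x" by (rule q)
      have "(\<integral>z. \<phi> z \<partial>q x) = (\<integral>z. \<psi> z + c \<partial>q x)" by (simp add: \<psi>_def)
      also have "\<dots> = (\<integral>z. \<psi> z \<partial>q x) + c" using i\<psi>[of x] by (simp add: prob_space)
      finally show ?thesis .
    qed
    then show ?thesis by simp
  qed
  define S where "S = \<beta> * V x + \<beta> * V y"
  have S0: "0 \<le> S" unfolding S_def using V(2) \<beta>0 by simp
  have sumW: "(\<integral>z. W z \<partial>q x) + (\<integral>z. W z \<partial>q y) \<le> 2 + S / 2 + \<delta>"
    using intW[of x] intW[of y] by (simp add: S_def add_divide_distrib)
  have "(\<integral>z. \<psi> z \<partial>q x) - (\<integral>z. \<psi> z \<partial>q y) \<le> (1 - \<delta> / 6) * L * (2 + S)"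
  proof (cases "V x + V y \<ge> 8 * K")
    case True
    have "\<beta> * (8 * K) \<le> \<beta> * (V x + V y)" using True \<beta>0 by simp
    then have S4: "4 * \<delta> \<le> S" using \<beta>K by (simp add: S_def algebra_simps)
    have "(\<integral>z. \<psi> z \<partial>q x) \<le> (\<integral>z. L * W z \<partial>q x)"
      using i\<psi> iW up by (intro integral_mono) auto
    moreover have "- (\<integral>z. \<psi> z \<partial>q y) \<le> (\<integral>z. L * W z \<partial>q y)"
    proof -
      have "(\<integral>z. - \<psi> z \<partial>q y) \<le> (\<integral>z. L * W z \<partial>q y)"
        using i\<psi> iW low by (intro integral_mono) auto
      then show ?thesis by simp
    qed
    ultimately have "(\<integral>z. \<psi> z \<partial>q x) - (\<integral>z. \<psi> z \<partial>q y) \<le> L * ((\<integral>z. W z \<partial>q x) + (\<integral>z. W z \<partial>q y))"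
      by (simp add: algebra_simps)
    also have "\<dots> \<le> L * (2 + S / 2 + \<delta>)" using sumW L by (rule mult_left_mono)
    also have "\<dots> \<le> L * ((1 - \<delta> / 6) * (2 + S))"
    proof (rule mult_left_mono[OF _ L])
      have "(1/2 - \<delta>/6) * (4 * \<delta>) \<le> (1/2 - \<delta>/6) * S"
        using S4 \<delta> by (intro mult_left_mono) auto
      moreover have "\<delta> * \<delta> \<le> \<delta> * 1" using \<delta> by (intro mult_left_mono) auto
      ultimately show "2 + S / 2 + \<delta> \<le> (1 - \<delta> / 6) * (2 + S)"
        by (simp add: field_simps)
    qed
    finally show ?thesis by (simp add: algebra_simps)
  next
    case False
    then have small: "V x \<le> 8 * K" "V y \<le> 8 * K" using V(2)[of x] V(2)[of y] by linarith+
    \<comment> \<open>Integrability with respect to \<open>\<rho>\<close> is inherited from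
      \<open>q u\<close>, which dominates \<open>\<delta> * \<rho>\<close>.\<close>
    have mono: "\<delta> * (\<integral>z. h z \<partial>\<rho>) \<le> (\<integral>z. h z \<partial>q u)" and int\<rho>: "integrable \<rho> h"
      if h[measurable]: "h \<in> borel_measurable borel" and h0: "\<And>z. 0 \<le> h z" and hi: "integrable (q u) h" and u: "V u \<le> 8 * K" for h u
    proof -
      have le: "ennreal \<delta> * (\<integral>\<^sup>+z. ennreal (h z) \<partial>\<rho>) \<le> (\<integral>\<^sup>+z. ennreal (h z) \<partial>q u)"
        using minor[OF u] by (intro nn_integral_mono_setwise) (auto simp: \<rho> q)
      have qh: "(\<integral>\<^sup>+z. ennreal (h z) \<partial>q u) = ennreal (\<integral>z. h z \<partial>q u)"
        using hi h0 by (intro nn_integral_eq_integral) auto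
      have "(\<integral>\<^sup>+z. ennreal (h z) \<partial>\<rho>) \<noteq> \<infinity>"
        using le \<delta> unfolding qh by (auto simp: ennreal_mult_eq_top_iff top_unique)
      then show i: "integrable \<rho> h"
        using h0 by (intro integrableI_nonneg) (auto simp: less_top)
      have "(\<integral>\<^sup>+z. ennreal (h z) \<partial>\<rho>) = ennreal (\<integral>z. h z \<partial>\<rho>)"
        using i h0 by (intro nn_integral_eq_integral) auto
      with le qh \<delta> have "ennreal (\<delta> * (\<integral>z. h z \<partial>\<rho>)) \<le> ennreal (\<integral>z. h z \<partial>q u)"
        by (simp add: ennreal_mult')
      then show "\<delta> * (\<integral>z. h z \<partial>\<rho>) \<le> (\<integral>z. h z \<partial>q u)"
        using h0 by (subst (asm) ennreal_le_iff) (auto intro: integral_nonneg_AE)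
    qed
    have W\<rho>: "integrable \<rho> W"
      by (rule int\<rho>[OF _ _ iW[of x] small(1)]) (use W1 order_trans[OF zero_le_one] in auto)
    have i1: "integrable \<rho> (\<lambda>z. L * W z - \<psi> z)"
      using iW i\<psi> up small(1) by (intro int\<rho>[of _ x]) auto
    then have \<psi>\<rho>: "integrable \<rho> \<psi>"
      using Bochner_Integration.integrable_diff[OF integrable_mult_right[OF W\<rho>, of L] i1] by simp
    have "\<delta> * (\<integral>z. L * W z - \<psi> z \<partial>\<rho>) \<le> (\<integral>z. L * W z - \<psi> z \<partial>q x)"
      using iW i\<psi> up small(1) by (intro mono) auto
    moreover have "\<delta> * (\<integral>z. L * W z + \<psi> z \<partial>\<rho>) \<le> (\<integral>z. L * W z + \<psi> z \<partial>q y)"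
    proof (rule mono)
      show "0 \<le> L * W z + \<psi> z" for z using low[of z] by linarith
    qed (use iW i\<psi> small(2) in auto)
    moreover have "(\<integral>z. L * W z - \<psi> z \<partial>\<rho>) = L * (\<integral>z. W z \<partial>\<rho>) - (\<integral>z. \<psi> z \<partial>\<rho>)"
      "(\<integral>z. L * W z + \<psi> z \<partial>\<rho>) = L * (\<integral>z. W z \<partial>\<rho>) + (\<integral>z. \<psi> z \<partial>\<rho>)"
      "(\<integral>z. L * W z - \<psi> z \<partial>q x) = L * (\<integral>z. W z \<partial>q x) - (\<integral>z. \<psi> z \<partial>q x)"
      "(\<integral>z. L * W z + \<psi> z \<partial>q y) = L * (\<integral>z. W z \<partial>q y) + (\<integral>z. \<psi> z \<partial>q y)"
      using W\<rho> \<psi>\<rho> iW i\<psi> by auto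
    ultimately have "(\<integral>z. \<psi> z \<partial>q x) - (\<integral>z. \<psi> z \<partial>q y) \<le>
        L * ((\<integral>z. W z \<partial>q x) + (\<integral>z. W z \<partial>q y)) - 2 * \<delta> * L * (\<integral>z. W z \<partial>\<rho>)"
      by (simp add: algebra_simps)
    also have "\<dots> \<le> L * (2 + S / 2 + \<delta>) - 2 * \<delta> * L * 1"
    proof (rule diff_mono)
      show "L * ((\<integral>z. W z \<partial>q x) + (\<integral>z. W z \<partial>q y)) \<le> L * (2 + S / 2 + \<delta>)"
        using sumW L by (rule mult_left_mono)
      \<comment> \<open>Only \<open>W \<ge> 1\<close> enters here, so the bound does not depend on
        the integral of \<open>V\<close> under \<open>\<rho>\<close>.\<close>
      have "(\<integral>z. 1 \<partial>\<rho>) \<le> (\<integral>z. W z \<partial>\<rho>)" using W\<rho> W1 by (intro integral_mono) auto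
      then show "2 * \<delta> * L * 1 \<le> 2 * \<delta> * L * (\<integral>z. W z \<partial>\<rho>)"
        using \<delta> L by (intro mult_left_mono) (auto simp: \<rho>.prob_space)
    qed
    also have "\<dots> = L * (2 + S / 2 - \<delta>)" by (simp add: algebra_simps)
    also have "\<dots> \<le> L * ((1 - \<delta> / 6) * (2 + S))"
    proof (rule mult_left_mono[OF _ L])
      have "\<delta> * S \<le> 1 * S" using \<delta> S0 by (intro mult_right_mono) auto
      then show "2 + S / 2 - \<delta> \<le> (1 - \<delta> / 6) * (2 + S)"
        using \<delta> S0 by (simp add: field_simps)
    qed
    finally show ?thesis by (simp add: algebra_simps)
  qed
  then show ?thesis unfolding diff by (simp add: S_def add.assoc)
qed

subsection \<open>Supermultiplicative functions are bounded below on long intervals\<close>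

text \<open>Steinhaus for compact sets: a neighbourhood \<open>W n\<close> of less than twice the
  measure of \<open>B\<close> contains both \<open>B\<close> and its translate by a small
  \<open>h\<close>, which therefore cannot be disjoint.\<close>

lemma compact_meets_translate:
  fixes B :: "real set"
  assumes "compact B" "0 < emeasure lborel B"
  obtains \<delta> where "0 < \<delta>" "\<And>h. \<bar>h\<bar> < \<delta> \<Longrightarrow> \<exists>s\<in>B. s - h \<in> B"
proof -
  have B: "closed B" "bounded B" "B \<in> sets borel" using assms by (auto simp: compact_imp_closed compact_imp_bounded borel_closed)
  have "B \<noteq> {}" using assms(2) by auto
  define W where "W n = {x. infdist x B < 1 / real (Suc n)}" for n
  have W_open: "open (W n)" for n unfolding W_def by (intro open_Collect_less continuous_intros)
  obtain R where R: "\<And>y. y \<in> B \<Longrightarrow> \<bar>y\<bar> \<le> R" using \<open>bounded B\<close> by (auto simp: bounded_iff)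
  have W0: "W 0 \<subseteq> {-R-1..R+1}"
  proof
    fix x assume "x \<in> W 0"
    then have "infdist x B < 1" by (simp add: W_def)
    moreover obtain y where "y \<in> B" "infdist x B = dist x y" using infdist_attains_inf[OF B(1) \<open>B \<noteq> {}\<close>] by blast
    ultimately show "x \<in> {-R-1..R+1}" using R[of y] by (auto simp: dist_real_def)
  qed
  have Wfin: "emeasure lborel (W n) < \<infinity>" for n
  proof -
    have "W n \<subseteq> W 0" by (auto simp: W_def intro: less_le_trans)
    then have "emeasure lborel (W n) \<le> emeasure lborel {-R-1..R+1}" using W0 by (intro emeasure_mono) auto
    also have "\<dots> < \<infinity>" by (simp add: emeasure_lborel_Icc_eq)
    finally show ?thesis .
  qed
  have "decseq W" unfolding W_def decseq_def by (auto intro: less_le_trans simp: frac_le)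
  moreover have "(\<Inter>n. W n) = B"
  proof -
    have "x \<in> B" if "x \<in> (\<Inter>n. W n)" for x
    proof -
      have "infdist x B \<le> 1 / real (Suc n)" for n using that by (auto simp: W_def intro: less_imp_le)
      then have "infdist x B \<le> 0"
        by (intro LIMSEQ_le_const[OF LIMSEQ_Suc[OF lim_inverse_n']]) auto
      then show ?thesis using B(1) \<open>B \<noteq> {}\<close> infdist_nonneg[of x B] by (simp add: in_closed_iff_infdist_zero)
    qed
    moreover have "B \<subseteq> W n" for n by (auto simp: W_def)
    ultimately show ?thesis by blast
  qed
  ultimately have lim: "(\<lambda>n. emeasure lborel (W n)) \<longlonglongrightarrow> emeasure lborel B"
    using Lim_emeasure_decseq[of W lborel] borel_open[OF W_open] Wfin by (auto simp: less_top image_subset_iff)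
  have Bfin: "emeasure lborel B < \<infinity>"
  proof -
    have "B \<subseteq> W 0" by (auto simp: W_def)
    then have "emeasure lborel B \<le> emeasure lborel (W 0)" using W_open by (intro emeasure_mono) auto
    then show ?thesis using Wfin[of 0] by (rule le_less_trans)
  qed
  have "emeasure lborel B < emeasure lborel B + emeasure lborel B"
    using assms(2) Bfin by (cases "emeasure lborel B") (auto simp: ennreal_less_iff ennreal_plus[symmetric] simp del: ennreal_plus)
  from order_tendstoD(2)[OF lim this] obtain n where n: "emeasure lborel (W n) < emeasure lborel B + emeasure lborel B"
    by (auto simp: eventually_sequentially)
  show ?thesis
  proof (rule that[of "1 / real (Suc n)"])
    fix h :: real assume h: "\<bar>h\<bar> < 1 / real (Suc n)"
    show "\<exists>s\<in>B. s - h \<in> B"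
    proof (rule ccontr)
      assume no: "\<not> (\<exists>s\<in>B. s - h \<in> B)"
      \<comment> \<open>\<open>B'\<close> is \<open>B\<close> translated by \<open>h\<close>; the
        assumption to be refuted says that it is disjoint from \<open>B\<close>.\<close>
      define B' where "B' = (\<lambda>x. - h + x) -` B \<inter> space lborel"
      have B'm: "B' \<in> sets borel" unfolding B'_def using B(3) by measurable
      have "emeasure lborel B' = emeasure (distr lborel borel ((+) (- h))) B"
        unfolding B'_def using B(3) by (subst emeasure_distr) auto
      then have eB': "emeasure lborel B' = emeasure lborel B" by (simp add: lborel_distr_plus)
      have "emeasure lborel (B \<union> B') = emeasure lborel B + emeasure lborel B'"
        using no B(3) B'm by (intro plus_emeasure[symmetric]) (auto simp: B'_def)
      moreover have "B \<union> B' \<subseteq> W n"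
      proof -
        have "x \<in> W n" if "x \<in> B'" for x
        proof -
          have "infdist x B \<le> dist x (- h + x)" using that by (intro infdist_le) (auto simp: B'_def)
          then show ?thesis using h by (simp add: W_def dist_real_def)
        qed
        moreover have "B \<subseteq> W n" by (auto simp: W_def)
        ultimately show ?thesis by blast
      qed
      then have "emeasure lborel (B \<union> B') \<le> emeasure lborel (W n)"
        using W_open by (intro emeasure_mono) auto
      ultimately show False using n eB' by simp
    qed
  qed simp
qed

text \<open>
  The superlevel sets of \<open>\<psi>\<close> behave like a semigroup of times with positive Lebesgue measure, so by
  Steinhaus' theorem they contain an interval, and then arbitrarily long ones.
\<close>

lemma supermultiplicative_lower_bound:
  fixes \<psi> :: "real \<Rightarrow> ennreal"
  assumes [measurable]: "\<psi> \<in> borel_measurable borel" and pos: "0 < (\<integral>\<^sup>+t\<in>{0..}. \<psi> t \<partial>lborel)"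
    and \<epsilon>: "0 < \<epsilon>" and d: "0 \<le> d"
    and super: "\<And>s t. 0 \<le> s \<Longrightarrow> 0 \<le> t \<Longrightarrow> \<epsilon> * \<psi> s * \<psi> t \<le> \<psi> (s + d + t)"
  obtains p c where "0 \<le> p" "0 < c" "\<And>t. t \<in> {p..p + L} \<Longrightarrow> c \<le> \<psi> t"
proof -
  \<comment> \<open>Cutting both time and level makes the sets bounded; their union over
    \<open>n\<close> is the set of nonnegative times at which \<open>\<psi>\<close> is positive, so
    one of them has positive measure.\<close>
  define A where "A n = {t. 0 \<le> t \<and> t \<le> real n \<and> ennreal (1 / real (Suc n)) \<le> \<psi> t}" for n
  have [measurable]: "A n \<in> sets borel" for n unfolding A_def by measurable
  have "\<exists>n. 0 < emeasure lborel (A n)"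
  proof (rule ccontr)
    assume "\<not> ?thesis"
    then have "A n \<in> null_sets lborel" for n by (auto simp: null_sets_def)
    then have "AE t in lborel. \<forall>n. t \<notin> A n" by (auto simp: AE_all_countable AE_not_in)
    then have "AE t in lborel. \<psi> t * indicator {0..} t = 0"
    proof eventually_elim
      fix t assume *: "\<forall>n. t \<notin> A n"
      show "\<psi> t * indicator {0..} t = 0"
      proof (rule ccontr)
        assume "\<psi> t * indicator {0..} t \<noteq> 0"
        then have t: "0 \<le> t" "0 < \<psi> t" by (auto simp: indicator_def less_le split: if_splits)
        have "(\<lambda>n. ennreal (1 / real (Suc n))) \<longlonglongrightarrow> ennreal 0"
          by (intro tendsto_ennrealI LIMSEQ_Suc lim_inverse_n')
        then have "eventually (\<lambda>n. ennreal (1 / real (Suc n)) < \<psi> t) sequentially"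
          using t(2) by (intro order_tendstoD(2)) auto
        then obtain n0 where n0: "\<And>n. n0 \<le> n \<Longrightarrow> ennreal (1 / real (Suc n)) < \<psi> t"
          by (auto simp: eventually_sequentially)
        obtain m where "t \<le> real m" using real_arch_simple by blast
        then have "t \<in> A (max n0 m)" using t n0[of "max n0 m"] by (auto simp: A_def)
        with * show False by blast
      qed
    qed
    then have "(\<integral>\<^sup>+t\<in>{0..}. \<psi> t \<partial>lborel) = 0" by (subst nn_integral_0_iff_AE) auto
    with pos show False by simp
  qed
  then obtain n where n: "0 < emeasure lborel (A n)" by blast
  have Abd: "A n \<subseteq> {0..real n}" by (auto simp: A_def)
  have "emeasure lborel (A n) \<le> emeasure lborel {0..real n}" by (intro emeasure_mono Abd) auto
  also have "\<dots> < \<infinity>" by (simp add: emeasure_lborel_Icc_eq)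
  finally have Afin: "emeasure lborel (A n) < \<infinity>" .
  define m where "m = measure lborel (A n)"
  have m: "emeasure lborel (A n) = ennreal m" using Afin by (simp add: m_def emeasure_eq_ennreal_measure)
  then have "0 < m" using n by (cases "m \<le> 0") (auto simp: ennreal_neg)
  obtain T where T: "closed T" "T \<subseteq> A n" "emeasure lebesgue (A n - T) < ennreal m"
    using sets_lebesgue_inner_closed[of "A n" m] \<open>0 < m\<close> by (metis \<open>\<And>n. A n \<in> sets borel\<close> sets_completionI_sets sets_lborel)
  have "compact T" using T(1,2) Abd by (metis bounded_closed_interval bounded_subset compact_eq_bounded_closed)
  have [measurable]: "T \<in> sets borel" using T(1) by (rule borel_closed)
  have Tpos: "0 < emeasure lborel T"
  proof (rule ccontr)
    assume "\<not> ?thesis"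
    then have "emeasure lborel T = 0" by simp
    moreover have "emeasure lborel (A n) \<le> emeasure lborel (A n - T) + emeasure lborel T"
      using emeasure_subadditive[of "A n - T" lborel T] T(2) by (auto simp: Un_absorb2 intro: order_trans[OF emeasure_mono])
    ultimately show False using T(3) m by (auto simp: not_le[symmetric])
  qed
  \<comment> \<open>Averaging: the measure of \<open>T \<inter> (\<tau> - T)\<close> integrates over
    \<open>\<tau>\<close> to the square of the measure of \<open>T\<close>, so it cannot vanish for
    all \<open>\<tau>\<close>.\<close>
  have "\<exists>\<tau>. 0 < emeasure lborel {s\<in>T. \<tau> - s \<in> T}"
  proof (rule ccontr)
    assume "\<not> ?thesis"
    then have zero: "emeasure lborel {s\<in>T. \<tau> - s \<in> T} = 0" for \<tau> by simp
    have "0 = (\<integral>\<^sup>+\<tau>. emeasure lborel {s\<in>T. \<tau> - s \<in> T} \<partial>lborel)" by (simp add: zero)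
    also have "\<dots> = (\<integral>\<^sup>+\<tau>. (\<integral>\<^sup>+s. indicator T s * indicator T (\<tau> - s) \<partial>lborel) \<partial>lborel)"
    proof (rule nn_integral_cong)
      fix \<tau> :: real
      have "{s\<in>T. \<tau> - s \<in> T} \<in> sets lborel" by measurable
      then have "emeasure lborel {s\<in>T. \<tau> - s \<in> T} = (\<integral>\<^sup>+s. indicator {s\<in>T. \<tau> - s \<in> T} s \<partial>lborel)"
        by simp
      also have "\<dots> = (\<integral>\<^sup>+s. indicator T s * indicator T (\<tau> - s) \<partial>lborel)"
        by (intro nn_integral_cong) (auto simp: indicator_def)
      finally show "emeasure lborel {s\<in>T. \<tau> - s \<in> T} = (\<integral>\<^sup>+s. indicator T s * indicator T (\<tau> - s) \<partial>lborel)" .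
    qed
    also have "\<dots> = (\<integral>\<^sup>+s. (\<integral>\<^sup>+\<tau>. indicator T s * indicator T (\<tau> - s) \<partial>lborel) \<partial>lborel)"
      by (rule lborel_pair.Fubini') measurable
    also have "\<dots> = (\<integral>\<^sup>+s. indicator T s * emeasure lborel T \<partial>lborel)"
    proof (rule nn_integral_cong)
      fix s :: real
      have "(\<integral>\<^sup>+\<tau>. indicator T \<tau> \<partial>lborel) = (\<integral>\<^sup>+\<tau>. indicator T (\<tau> - s) \<partial>lborel)"
        using nn_integral_real_affine[of "indicator T" 1 "- s"] by (simp add: add.commute[of "-s"])
      then have "(\<integral>\<^sup>+\<tau>. indicator T (\<tau> - s) \<partial>lborel) = emeasure lborel T" by simp
      then show "(\<integral>\<^sup>+\<tau>. indicator T s * indicator T (\<tau> - s) \<partial>lborel) = indicator T s * emeasure lborel T"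
        by (subst nn_integral_cmult) auto
    qed
    also have "\<dots> = emeasure lborel T * emeasure lborel T"
      by (subst nn_integral_multc) auto
    finally show False using Tpos by (simp add: eq_commute[of 0])
  qed
  then obtain \<tau> where \<tau>: "0 < emeasure lborel {s\<in>T. \<tau> - s \<in> T}" by blast
  have "closed ((\<lambda>s. \<tau> - s) -` T)" by (intro closed_vimage T(1) continuous_intros)
  from compact_Int_closed[OF \<open>compact T\<close> this] have "compact {s\<in>T. \<tau> - s \<in> T}"
    by (simp add: vimage_def Int_def)
  \<comment> \<open>Steinhaus applied to \<open>T \<inter> (\<tau> - T)\<close>: for some
    \<open>s\<close> both \<open>s\<close> and \<open>\<tau> + h - s\<close> are in
    \<open>T\<close>, so every \<open>\<tau> + h\<close> with
    \<open>\<bar>h\<bar> < \<delta>\<close> is a sum of two times in \<open>A n\<close>.\<close>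
  then obtain \<delta> where \<delta>: "0 < \<delta>" "\<And>h. \<bar>h\<bar> < \<delta> \<Longrightarrow> \<exists>s\<in>{s\<in>T. \<tau> - s \<in> T}. s - h \<in> {s\<in>T. \<tau> - s \<in> T}"
    using compact_meets_translate \<tau> by blast
  define c0 where "c0 = \<epsilon> * ennreal (1 / real (Suc n)) * ennreal (1 / real (Suc n))"
  have c0: "0 < c0" unfolding c0_def using \<epsilon> by (simp add: ennreal_zero_less_mult_iff)
  have base: "0 \<le> \<tau> + h \<and> c0 \<le> \<psi> (\<tau> + h + d)" if "\<bar>h\<bar> < \<delta>" for h
  proof -
    from \<delta>(2)[OF that] obtain s where "s \<in> T" "\<tau> - (s - h) \<in> T" by auto
    then have s: "s \<in> A n" "\<tau> + h - s \<in> A n" using T(2) by (auto simp: algebra_simps)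
    have "c0 \<le> \<epsilon> * \<psi> s * \<psi> (\<tau> + h - s)"
      unfolding c0_def using s by (intro mult_mono) (auto simp: A_def)
    also have "\<dots> \<le> \<psi> (s + d + (\<tau> + h - s))" using s by (intro super) (auto simp: A_def)
    finally show ?thesis using s by (auto simp: A_def algebra_simps)
  qed
  define \<alpha> where "\<alpha> = \<tau> - \<delta> / 2 + d"
  define \<beta> where "\<beta> = \<tau> + \<delta> / 2 + d"
  have \<alpha>\<beta>: "0 \<le> \<alpha>" "\<alpha> < \<beta>" using base[of "- \<delta> / 2"] \<delta>(1) d by (auto simp: \<alpha>_def \<beta>_def)
  have base': "c0 \<le> \<psi> t" if "\<alpha> \<le> t" "t \<le> \<beta>" for t
    using base[of "t - \<tau> - d"] that \<delta>(1) unfolding \<alpha>_def \<beta>_def by (auto simp: abs_less_iff)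
  \<comment> \<open>\<open>k + 1\<close> times from \<open>{\<alpha>..\<beta>}\<close> with
    \<open>k\<close> gaps \<open>d\<close> between them: the sums fill an interval whose length
    grows linearly in \<open>k\<close>.\<close>
  have "\<exists>c>0. \<forall>t. real (Suc k) * \<alpha> + real k * d \<le> t \<and> t \<le> real (Suc k) * \<beta> + real k * d \<longrightarrow> c \<le> \<psi> t" for k
  proof (induction k)
    case 0
    show ?case using base' c0 by (intro exI[of _ c0]) auto
  next
    case (Suc k)
    then obtain c where c: "0 < c"
      "\<And>t. real (Suc k) * \<alpha> + real k * d \<le> t \<Longrightarrow> t \<le> real (Suc k) * \<beta> + real k * d \<Longrightarrow> c \<le> \<psi> t" by blast
    show ?case
    proof (intro exI[of _ "\<epsilon> * c0 * c"] conjI allI impI)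
      show "0 < \<epsilon> * c0 * c" using \<epsilon> c0 c(1) by (simp add: ennreal_zero_less_mult_iff)
      fix t assume t: "real (Suc (Suc k)) * \<alpha> + real (Suc k) * d \<le> t \<and> t \<le> real (Suc (Suc k)) * \<beta> + real (Suc k) * d"
      \<comment> \<open>The smallest first summand that leaves a remainder not above the upper end
        of the range covered for \<open>k\<close>.\<close>
      define u where "u = max \<alpha> (t - d - (real (Suc k) * \<beta> + real k * d))"
      have ka: "real (Suc k) * \<alpha> \<le> real (Suc k) * \<beta>" using \<alpha>\<beta> by (intro mult_left_mono) auto
      have u: "\<alpha> \<le> u" "u \<le> \<beta>" using t \<alpha>\<beta> by (auto simp: u_def algebra_simps)
      have v: "real (Suc k) * \<alpha> + real k * d \<le> t - d - u" "t - d - u \<le> real (Suc k) * \<beta> + real k * d"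
        using t ka by (auto simp: u_def algebra_simps)
      have "0 \<le> real (Suc k) * \<alpha> + real k * d" using \<alpha>\<beta> d by auto
      then have v0: "0 \<le> t - d - u" using v(1) by linarith
      have "\<epsilon> * c0 * c \<le> \<epsilon> * \<psi> u * \<psi> (t - d - u)"
        using base'[OF u] c(2)[OF v] by (intro mult_mono) auto
      also have "\<dots> \<le> \<psi> (u + d + (t - d - u))" using u \<alpha>\<beta> v0 by (intro super) auto
      finally show "\<epsilon> * c0 * c \<le> \<psi> t" by simp
    qed
  qed
  note long = this
  obtain k where k: "L < real k * (\<beta> - \<alpha>)" using \<alpha>\<beta> reals_Archimedean3[of "\<beta> - \<alpha>"] by auto
  obtain c where c: "0 < c"
    "\<And>t. real (Suc k) * \<alpha> + real k * d \<le> t \<Longrightarrow> t \<le> real (Suc k) * \<beta> + real k * d \<Longrightarrow> c \<le> \<psi> t"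
    using long[of k] by blast
  show ?thesis
  proof (rule that[of "real (Suc k) * \<alpha> + real k * d" c])
    show "0 \<le> real (Suc k) * \<alpha> + real k * d" using \<alpha>\<beta> d by auto
    fix t assume t: "t \<in> {real (Suc k) * \<alpha> + real k * d..real (Suc k) * \<alpha> + real k * d + L}"
    have "L \<le> real (Suc k) * \<beta> - real (Suc k) * \<alpha>" using k \<alpha>\<beta> by (simp add: algebra_simps)
    with t show "c \<le> \<psi> t" by (intro c(2)) auto
  qed (rule c(1))
qed

subsection \<open>Small sets of a Markov semigroup\<close>

text \<open>Joint measurability in time and state is part of the interface because occupation times
  are integrated over both. The time argument ranges over the whole line, and negative times merely
  carry some probability kernel; the semigroup law is one for nonnegative times.\<close>

locale markov_semigroup =
  fixes p :: "real \<Rightarrow> 'a::topological_space \<Rightarrow> 'a measure"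
  assumes kernel: "(\<lambda>(t, x). p t x) \<in> borel \<Otimes>\<^sub>M borel \<rightarrow>\<^sub>M prob_algebra borel"
    and chapman_kolmogorov: "0 \<le> s \<Longrightarrow> 0 \<le> t \<Longrightarrow> p (s + t) x = p s x \<bind> p t"
begin

lemma kernel_at: "p t \<in> borel \<rightarrow>\<^sub>M prob_algebra borel"
proof -
  have "(\<lambda>x. (t, x)) \<in> borel \<rightarrow>\<^sub>M borel \<Otimes>\<^sub>M borel" by (intro measurable_Pair) auto
  from measurable_compose[OF this kernel] show ?thesis by simp
qed

lemma kernel_from: "(\<lambda>t. p t x) \<in> borel \<rightarrow>\<^sub>M prob_algebra borel"
proof -
  have "(\<lambda>t. (t, x)) \<in> borel \<rightarrow>\<^sub>M borel \<Otimes>\<^sub>M borel" by (intro measurable_Pair) auto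
  from measurable_compose[OF this kernel] show ?thesis by simp
qed

lemmas prob_p = kernelD_borel(1)[OF kernel_at]
lemmas sets_p [measurable_cong] = kernelD_borel(2)[OF kernel_at]

lemma space_p [simp]: "space (p t x) = UNIV"
  using sets_eq_imp_space_eq[OF sets_p] by simp

lemma emeasure_p_le_1: "emeasure (p t x) B \<le> 1"
  by (rule prob_space.measure_le_1) (rule prob_p)

lemma emeasure_p_UNIV [simp]: "emeasure (p t x) UNIV = 1"
  using prob_space.emeasure_space_1[OF prob_p, of t x] by simp

lemma measurable_nn_pair:
  assumes "f \<in> borel_measurable borel"
  shows "(\<lambda>(t, x). \<integral>\<^sup>+y. f y \<partial>p t x) \<in> borel_measurable (borel \<Otimes>\<^sub>M borel)"
  using measurable_kernel_nn_integral[OF kernel assms] by (simp add: split_beta)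

lemma measurable_nn [measurable]:
  assumes "f \<in> borel_measurable borel"
  shows "(\<lambda>x. \<integral>\<^sup>+y. f y \<partial>p t x) \<in> borel_measurable borel"
  using measurable_kernel_nn_integral[OF kernel_at assms] .

lemma measurable_nn_time [measurable]:
  assumes "f \<in> borel_measurable borel"
  shows "(\<lambda>t. \<integral>\<^sup>+y. f y \<partial>p t x) \<in> borel_measurable borel"
  using measurable_kernel_nn_integral[OF kernel_from assms] .

lemma measurable_emeasure_pair:
  assumes "B \<in> sets borel"
  shows "(\<lambda>(t, x). emeasure (p t x) B) \<in> borel_measurable (borel \<Otimes>\<^sub>M borel)"
  using measurable_kernel_emeasure[OF kernel assms] by (simp add: split_beta)

lemma measurable_emeasure_time [measurable]:
  assumes "B \<in> sets borel" shows "(\<lambda>t. emeasure (p t x) B) \<in> borel_measurable borel"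
  using measurable_kernel_emeasure[OF kernel_from assms] .

lemma measurable_emeasure_at [measurable]:
  assumes "B \<in> sets borel" shows "(\<lambda>x. emeasure (p t x) B) \<in> borel_measurable borel"
  using measurable_kernel_emeasure[OF kernel_at assms] .

lemma nn_integral_CK:
  assumes "0 \<le> s" "0 \<le> t" "f \<in> borel_measurable borel"
  shows "(\<integral>\<^sup>+y. f y \<partial>p (s + t) x) = (\<integral>\<^sup>+z. (\<integral>\<^sup>+y. f y \<partial>p t z) \<partial>p s x)"
  unfolding chapman_kolmogorov[OF assms(1,2)]
  by (rule nn_integral_bind[OF assms(3)])
     (use measurable_prob_algebraD[OF kernel_at, of t] in \<open>simp cong: measurable_cong_sets\<close>)

lemma emeasure_CK:
  assumes "0 \<le> s" "0 \<le> t" "B \<in> sets borel"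
  shows "emeasure (p (s + t) x) B = (\<integral>\<^sup>+z. emeasure (p t z) B \<partial>p s x)"
  using nn_integral_CK[OF assms(1,2), of "indicator B" x] assms(3) by simp

text \<open>The expected time that the process from \<open>x\<close> spends in \<open>B\<close> up
  to time \<open>L\<close>.\<close>

definition occ :: "real \<Rightarrow> 'a \<Rightarrow> 'a set \<Rightarrow> ennreal" where
  "occ L x B = (\<integral>\<^sup>+s\<in>{0..L}. emeasure (p s x) B \<partial>lborel)"

lemma measurable_occ [measurable]:
  assumes B: "B \<in> sets borel" shows "(\<lambda>x. occ L x B) \<in> borel_measurable borel"
proof -
  have [measurable]: "(\<lambda>q. emeasure (p (fst q) (snd q)) B) \<in> borel_measurable (borel \<Otimes>\<^sub>M borel)"
    using measurable_emeasure_pair[OF B] by (simp add: split_beta)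
  have "(\<lambda>q. (snd q, fst q)) \<in> (borel :: 'a measure) \<Otimes>\<^sub>M lborel \<rightarrow>\<^sub>M (borel :: real measure) \<Otimes>\<^sub>M borel"
    by measurable
  from measurable_compose[OF this \<open>(\<lambda>q. emeasure (p (fst q) (snd q)) B) \<in> _\<close>]
  have [measurable]: "(\<lambda>q. emeasure (p (snd q) (fst q)) B) \<in> borel_measurable (borel \<Otimes>\<^sub>M lborel)"
    by simp
  have "(\<lambda>x. \<integral>\<^sup>+s. emeasure (p (snd (x, s)) (fst (x, s))) B * indicator {0..L} s \<partial>lborel) \<in> borel_measurable borel"
    by measurable
  then show ?thesis by (simp add: occ_def)
qed

lemma occ_mono: "L \<le> L' \<Longrightarrow> occ L x B \<le> occ L' x B"
  unfolding occ_def by (intro nn_integral_mono) (auto simp: indicator_def)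

lemma occ_le: "0 \<le> L \<Longrightarrow> occ L x B \<le> ennreal L"
proof -
  assume "0 \<le> L"
  have "occ L x B \<le> (\<integral>\<^sup>+s. indicator {0..L} s \<partial>lborel)"
    unfolding occ_def using emeasure_p_le_1
    by (intro nn_integral_mono) (auto simp: indicator_def)
  then show ?thesis using \<open>0 \<le> L\<close> by simp
qed

lemma Fubini_kernel:
  assumes f[measurable]: "f \<in> borel_measurable borel" and \<mu>: "sigma_finite_measure \<mu>" "sets \<mu> = sets borel"
    and g[measurable]: "g \<in> borel_measurable borel"
  shows "(\<integral>\<^sup>+z. (\<integral>\<^sup>+u. g u * (\<integral>\<^sup>+y. f y \<partial>p u z) \<partial>lborel) \<partial>\<mu>) = (\<integral>\<^sup>+u. g u * (\<integral>\<^sup>+z. (\<integral>\<^sup>+y. f y \<partial>p u z) \<partial>\<mu>) \<partial>lborel)"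
proof -
  interpret \<mu>: sigma_finite_measure \<mu> by fact
  interpret pair_sigma_finite lborel \<mu> ..
  note [measurable_cong] = \<mu>(2)
  have [measurable]: "(\<lambda>q. \<integral>\<^sup>+y. f y \<partial>p (fst q) (snd q)) \<in> borel_measurable (lborel \<Otimes>\<^sub>M \<mu>)"
    using measurable_nn_pair[OF f] by (simp add: split_beta cong: measurable_cong_sets sets_pair_measure_cong)
  have "(\<integral>\<^sup>+z. (\<integral>\<^sup>+u. g u * (\<integral>\<^sup>+y. f y \<partial>p u z) \<partial>lborel) \<partial>\<mu>) = (\<integral>\<^sup>+u. (\<integral>\<^sup>+z. g u * (\<integral>\<^sup>+y. f y \<partial>p u z) \<partial>\<mu>) \<partial>lborel)"
    by (rule Fubini') (simp add: split_beta)
  also have "\<dots> = (\<integral>\<^sup>+u. g u * (\<integral>\<^sup>+z. (\<integral>\<^sup>+y. f y \<partial>p u z) \<partial>\<mu>) \<partial>lborel)"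
    by (intro nn_integral_cong nn_integral_cmult) measurable
  finally show ?thesis .
qed

text \<open>By the semigroup law the left side is the occupation during \<open>{r..r + L}\<close>
  alone.\<close>

lemma occ_CK_le:
  assumes r: "0 \<le> r" and B[measurable]: "B \<in> sets borel"
  shows "(\<integral>\<^sup>+z. occ L z B \<partial>p r x) \<le> occ (r + L) x B"
proof -
  interpret prob_space "p r x" by (rule prob_p)
  have "(\<integral>\<^sup>+z. occ L z B \<partial>p r x) = (\<integral>\<^sup>+z. (\<integral>\<^sup>+u. indicator {0..L} u * (\<integral>\<^sup>+y. indicator B y \<partial>p u z) \<partial>lborel) \<partial>p r x)"
    by (simp add: occ_def mult.commute)
  also have "\<dots> = (\<integral>\<^sup>+u. indicator {0..L} u * (\<integral>\<^sup>+z. (\<integral>\<^sup>+y. indicator B y \<partial>p u z) \<partial>p r x) \<partial>lborel)"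
    by (rule Fubini_kernel) (auto simp: sets_p intro: sigma_finite_measure_axioms)
  also have "\<dots> = (\<integral>\<^sup>+u. indicator {0..L} u * emeasure (p (r + u) x) B \<partial>lborel)"
    using r by (intro nn_integral_cong) (auto simp: indicator_def[of "{0..L}"] emeasure_CK)
  also have "\<dots> \<le> (\<integral>\<^sup>+u. (\<lambda>s. indicator {0..r + L} s * emeasure (p s x) B) (r + 1 * u) \<partial>lborel)"
    using r by (intro nn_integral_mono) (auto simp: indicator_def)
  also have "\<dots> = occ (r + L) x B"
    using nn_integral_real_affine[of "\<lambda>s. indicator {0..r + L} s * emeasure (p s x) B" 1 r]
    by (simp add: occ_def mult.commute)
  finally show ?thesis .
qed

end

section \<open>Drift inequality: decay of \<open>PV\<close> and time spent in
  \<open>C\<close>\<close>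

locale drift_semigroup = markov_semigroup p for p :: "real \<Rightarrow> 'a::topological_space \<Rightarrow> 'a measure" +
  fixes V :: "'a \<Rightarrow> real" and \<kappa> b :: real and C :: "'a set"
  assumes V_meas [measurable]: "V \<in> borel_measurable borel" and V_ge_1: "1 \<le> V x"
    and \<kappa>: "0 < \<kappa>" and b: "0 < b" and C_meas [measurable]: "C \<in> sets borel"
    and drift: "0 \<le> t \<Longrightarrow> (\<integral>\<^sup>+y. V y \<partial>p t x) + ennreal \<kappa> * (\<integral>\<^sup>+s\<in>{0..t}. (\<integral>\<^sup>+y. V y \<partial>p s x) \<partial>lborel)
          \<le> ennreal (V x) + ennreal b * occ t x C"
begin

abbreviation PV :: "real \<Rightarrow> 'a \<Rightarrow> ennreal" where
  "PV t x \<equiv> \<integral>\<^sup>+y. ennreal (V y) \<partial>p t x"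

lemma PV_ge_1: "1 \<le> PV t x"
proof -
  have "(\<integral>\<^sup>+y. 1 \<partial>p t x) \<le> PV t x"
    using V_ge_1 by (intro nn_integral_mono) (auto simp: ennreal_ge_1)
  then show ?thesis by simp
qed

lemma PV_linear: assumes "0 \<le> t" shows "PV t x \<le> ennreal (V x + b * t)"
proof -
  have "PV t x \<le> ennreal (V x) + ennreal b * occ t x C"
    using drift[OF assms, of x] by (meson le_iff_add order_trans)
  also have "\<dots> \<le> ennreal (V x) + ennreal b * ennreal t"
    by (intro add_left_mono mult_left_mono occ_le assms) auto
  also have "\<dots> = ennreal (V x + b * t)"
    using b assms V_ge_1[of x] by (simp add: ennreal_mult' ennreal_plus)
  finally show ?thesis .
qed

lemma PV_add_linear:
  assumes "0 \<le> s" "0 \<le> t" shows "PV (s + t) x \<le> PV s x + ennreal (b * t)"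
proof -
  interpret prob_space "p s x" by (rule prob_p)
  have "PV (s + t) x = (\<integral>\<^sup>+z. PV t z \<partial>p s x)" by (rule nn_integral_CK[OF assms]) simp
  also have "\<dots> \<le> (\<integral>\<^sup>+z. ennreal (V z) + ennreal (b * t) \<partial>p s x)"
    using PV_linear[OF assms(2)] b assms V_ge_1 order_trans[OF zero_le_one V_ge_1]
    by (intro nn_integral_mono) (simp add: ennreal_plus)
  also have "\<dots> = PV s x + ennreal (b * t)"
    by (subst nn_integral_add) auto
  finally show ?thesis .
qed

text \<open>Chosen so that \<open>\<kappa> * t1 = 2\<close>: dividing the integrated drift by this
  factor halves \<open>V\<close>.\<close>

definition t1 :: real where "t1 = 2 / \<kappa>"

lemma t1_pos: "0 < t1" using \<kappa> by (simp add: t1_def)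

text \<open>Averaging \<open>PV t1 x \<le> PV s x + b (t1 - s)\<close> over \<open>s \<in> [0, t1]\<close>.\<close>

lemma PV_t1: "PV t1 x \<le> ennreal (V x / 2 + 3 * (b / \<kappa>))"
proof -
  have occ: "occ t1 x C \<le> ennreal t1" using t1_pos by (intro occ_le) simp
  have "ennreal \<kappa> * (\<integral>\<^sup>+s\<in>{0..t1}. PV s x \<partial>lborel) \<le> ennreal (V x) + ennreal b * occ t1 x C"
    using t1_pos by (intro order_trans[OF _ drift]) (auto intro: add_increasing)
  also have "\<dots> \<le> ennreal (V x) + ennreal b * ennreal t1"
    by (intro add_left_mono mult_left_mono occ) auto
  also have "\<dots> = ennreal (V x + b * t1)"
    using b t1_pos V_ge_1[of x] by (simp add: ennreal_mult' ennreal_plus)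
  finally have 1: "ennreal \<kappa> * (\<integral>\<^sup>+s\<in>{0..t1}. PV s x \<partial>lborel) \<le> ennreal (V x + b * t1)" .
  have "ennreal t1 * PV t1 x = (\<integral>\<^sup>+s\<in>{0..t1}. PV t1 x \<partial>lborel)"
    using t1_pos by (subst nn_integral_cmult_indicator) (auto simp: mult.commute)
  also have "\<dots> \<le> (\<integral>\<^sup>+s. PV s x * indicator {0..t1} s + ennreal (b * t1) * indicator {0..t1} s \<partial>lborel)"
  proof (rule nn_integral_mono)
    fix s :: real
    show "PV t1 x * indicator {0..t1} s \<le> PV s x * indicator {0..t1} s + ennreal (b * t1) * indicator {0..t1} s"
    proof (cases "s \<in> {0..t1}")
      case True
      have "PV (s + (t1 - s)) x \<le> PV s x + ennreal (b * (t1 - s))"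
        using True by (intro PV_add_linear) auto
      also have "\<dots> \<le> PV s x + ennreal (b * t1)"
        using True b by (intro add_left_mono ennreal_leI mult_left_mono) auto
      finally show ?thesis using True by simp
    qed simp
  qed
  also have "\<dots> = (\<integral>\<^sup>+s\<in>{0..t1}. PV s x \<partial>lborel) + ennreal (b * t1) * ennreal t1"
    using t1_pos by (subst nn_integral_add) (auto simp: nn_integral_cmult_indicator)
  finally have 2: "ennreal t1 * PV t1 x \<le> (\<integral>\<^sup>+s\<in>{0..t1}. PV s x \<partial>lborel) + ennreal (b * t1) * ennreal t1" .
  obtain v where v: "PV t1 x = ennreal v" "0 \<le> v"
    using PV_linear[of t1 x] t1_pos by (cases "PV t1 x") (auto simp: top_unique)
  have "ennreal \<kappa> * (ennreal t1 * PV t1 x) \<le> ennreal \<kappa> * ((\<integral>\<^sup>+s\<in>{0..t1}. PV s x \<partial>lborel) + ennreal (b * t1) * ennreal t1)"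
    by (rule mult_left_mono[OF 2]) simp
  also have "\<dots> \<le> ennreal (V x + b * t1) + ennreal \<kappa> * (ennreal (b * t1) * ennreal t1)"
    unfolding distrib_left by (rule add_right_mono[OF 1])
  also have "\<dots> = ennreal (V x + b * t1 + \<kappa> * (b * t1 * t1))"
    using b \<kappa> t1_pos order_trans[OF zero_le_one V_ge_1, of x] by (simp add: ennreal_mult'[symmetric] ennreal_plus[symmetric] del: ennreal_plus)
  finally have "ennreal (\<kappa> * (t1 * v)) \<le> ennreal (V x + b * t1 + \<kappa> * (b * t1 * t1))"
    using v \<kappa> t1_pos by (simp add: ennreal_mult')
  moreover have "0 \<le> V x + b * t1 + \<kappa> * (b * t1 * t1)"
    using b \<kappa> t1_pos order_trans[OF zero_le_one V_ge_1, of x] by auto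
  ultimately have "\<kappa> * (t1 * v) \<le> V x + b * t1 + \<kappa> * (b * t1 * t1)"
    by (simp add: ennreal_le_iff)
  \<comment> \<open>With \<open>t1 = 2 / \<kappa>\<close>, the term \<open>b * t1\<close> is
    \<open>2 * (b / \<kappa>)\<close> and \<open>\<kappa> * (b * t1 * t1)\<close> is
    \<open>4 * (b / \<kappa>)\<close>.\<close>
  then have "2 * v \<le> V x + 6 * (b / \<kappa>)"
    using \<kappa> by (simp add: t1_def)
  then show ?thesis unfolding v(1) by (intro ennreal_leI) simp
qed

text \<open>\<open>6 * (b / \<kappa>)\<close> is the fixed point of
  \<open>c \<mapsto> c / 2 + 3 * (b / \<kappa>)\<close>, the recursion that one more step of length
  \<open>t1\<close> gives for the constant.\<close>

lemma PV_iterate: "PV (real n * t1) x \<le> ennreal (V x / 2 ^ n + 6 * (b / \<kappa>))"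
proof (induction n arbitrary: x)
  case 0
  have "0 \<le> b / \<kappa>" using b \<kappa> by simp
  then show ?case using PV_linear[of 0 x] by (auto intro!: order_trans[OF PV_linear] ennreal_leI)
next
  case (Suc n)
  interpret prob_space "p (real n * t1) x" by (rule prob_p)
  have pos: "0 \<le> b / \<kappa>" "0 \<le> V y" for y using b \<kappa> order_trans[OF zero_le_one V_ge_1] by auto
  have half: "ennreal (1/2) * ennreal a = ennreal (a / 2)" if "0 \<le> a" for a
    using ennreal_mult''[OF that, of "1/2"] by (simp add: mult.commute)
  have "PV (real (Suc n) * t1) x = PV (real n * t1 + t1) x" by (simp add: algebra_simps)
  also have "\<dots> = (\<integral>\<^sup>+z. PV t1 z \<partial>p (real n * t1) x)"
    using t1_pos by (intro nn_integral_CK) auto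
  also have "\<dots> \<le> (\<integral>\<^sup>+z. ennreal (1/2) * ennreal (V z) + ennreal (3 * (b / \<kappa>)) \<partial>p (real n * t1) x)"
  proof (rule nn_integral_mono)
    fix z
    have "ennreal (1/2) * ennreal (V z) + ennreal (3 * (b / \<kappa>)) = ennreal (V z / 2 + 3 * (b / \<kappa>))"
      using pos unfolding half[OF pos(2)] by (intro ennreal_plus[symmetric]) auto
    then show "PV t1 z \<le> ennreal (1/2) * ennreal (V z) + ennreal (3 * (b / \<kappa>))"
      using PV_t1[of z] by simp
  qed
  also have "\<dots> = ennreal (1/2) * PV (real n * t1) x + ennreal (3 * (b / \<kappa>))"
    by (subst nn_integral_add) (auto simp: nn_integral_cmult)
  also have "\<dots> \<le> ennreal (1/2) * ennreal (V x / 2 ^ n + 6 * (b / \<kappa>)) + ennreal (3 * (b / \<kappa>))"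
    by (intro add_right_mono mult_left_mono Suc) simp
  also have "\<dots> = ennreal (V x / 2 ^ Suc n + 6 * (b / \<kappa>))"
  proof -
    have "0 \<le> V x / 2 ^ n + 6 * (b / \<kappa>)" using pos(1) pos(2)[of x] by auto
    from half[OF this] have "ennreal (1/2) * ennreal (V x / 2 ^ n + 6 * (b / \<kappa>)) + ennreal (3 * (b / \<kappa>))
        = ennreal ((V x / 2 ^ n + 6 * (b / \<kappa>)) / 2 + 3 * (b / \<kappa>))"
      using \<open>0 \<le> V x / 2 ^ n + 6 * (b / \<kappa>)\<close> pos(1) by (simp add: ennreal_plus)
    also have "(V x / 2 ^ n + 6 * (b / \<kappa>)) / 2 + 3 * (b / \<kappa>) = V x / 2 ^ Suc n + 6 * (b / \<kappa>)"
      by (simp add: add_divide_distrib)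
    finally show ?thesis .
  qed
  finally show ?case .
qed

definition K0 :: real where "K0 = 8 * (b / \<kappa>) + 1"

lemma K0_pos: "0 < K0" using b \<kappa> by (simp add: K0_def add_pos_pos)

text \<open>\<open>T\<close> is \<open>n * t1 + r\<close> with \<open>n \<ge> 1\<close> and
  \<open>r \<le> t1\<close>; the remainder adds at most \<open>b * t1 = 2 * (b / \<kappa>)\<close>,
  hence the 8 in \<open>K0\<close>. All times \<open>T \<ge> t1\<close> are covered because the
  minorisation, not the drift, will fix \<open>T\<close>.\<close>

lemma PV_drift: assumes "t1 \<le> T" shows "PV T x \<le> ennreal (V x / 2 + K0)"
proof -
  define n where "n = nat \<lfloor>T / t1\<rfloor>"
  have "1 \<le> T / t1" using assms t1_pos by simp
  then have n: "1 \<le> n" "real n \<le> T / t1" "T / t1 < real n + 1" unfolding n_def by linarith+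
  define r where "r = T - real n * t1"
  have r: "0 \<le> r" "r \<le> t1" using n t1_pos by (auto simp: r_def field_simps)
  have pos: "0 \<le> b / \<kappa>" "0 \<le> V x" using b \<kappa> order_trans[OF zero_le_one V_ge_1] by auto
  have "PV T x = PV (real n * t1 + r) x" by (simp add: r_def)
  also have "\<dots> \<le> PV (real n * t1) x + ennreal (b * r)"
    using r t1_pos by (intro PV_add_linear) auto
  also have "\<dots> \<le> ennreal (V x / 2 ^ n + 6 * (b / \<kappa>)) + ennreal (b * t1)"
    using r b by (intro add_mono PV_iterate ennreal_leI mult_left_mono) auto
  also have "\<dots> = ennreal (V x / 2 ^ n + 6 * (b / \<kappa>) + b * t1)"
    using pos b t1_pos by (intro ennreal_plus[symmetric]) auto
  also have "\<dots> \<le> ennreal (V x / 2 + K0)"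
  proof (rule ennreal_leI)
    have "(2::real) ^ 1 \<le> 2 ^ n" using n(1) by (intro power_increasing) auto
    then have "V x / 2 ^ n \<le> V x / 2" using pos by (intro divide_left_mono) auto
    moreover have "b * t1 = 2 * (b / \<kappa>)" by (simp add: t1_def)
    ultimately show "V x / 2 ^ n + 6 * (b / \<kappa>) + b * t1 \<le> V x / 2 + K0"
      unfolding K0_def by linarith
  qed
  finally show ?thesis .
qed

text \<open>Because \<open>PV \<ge> 1\<close>, the drift inequality forces the process to spend time in \<open>C\<close>.\<close>

lemma occ_C_ge:
  assumes R: "0 \<le> R" and x: "V x \<le> R" shows "1 \<le> occ ((R + b) / \<kappa>) x C"
proof -
  \<comment> \<open>The horizon is chosen to make \<open>\<kappa> * ?a = R + b\<close>: after the
    bound \<open>R\<close> of \<open>V x\<close> has been cancelled, \<open>b\<close> remains on the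
    left.\<close>
  let ?a = "(R + b) / \<kappa>"
  have a: "0 \<le> ?a" using R b \<kappa> by simp
  have "ennreal (R + b) = ennreal \<kappa> * (\<integral>\<^sup>+s\<in>{0..?a}. 1 \<partial>lborel)"
    using a \<kappa> by (simp add: ennreal_mult'[symmetric])
  also have "\<dots> \<le> ennreal \<kappa> * (\<integral>\<^sup>+s\<in>{0..?a}. PV s x \<partial>lborel)"
    using PV_ge_1 by (intro mult_left_mono nn_integral_mono mult_right_mono) auto
  also have "\<dots> \<le> ennreal (V x) + ennreal b * occ ?a x C"
    by (rule order_trans[OF _ drift[OF a]]) (auto intro: add_increasing)
  also have "\<dots> \<le> ennreal R + ennreal b * occ ?a x C"
    by (intro add_right_mono ennreal_leI x)
  finally have "ennreal R + ennreal b \<le> ennreal R + ennreal b * occ ?a x C"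
    using R b by (simp add: ennreal_plus)
  then have le: "ennreal b * 1 \<le> ennreal b * occ ?a x C" by (simp add: ennreal_add_left_cancel_le)
  show ?thesis
  proof (rule ccontr)
    assume "\<not> 1 \<le> occ ?a x C"
    then have "occ ?a x C < 1" by simp
    then have "ennreal b * occ ?a x C < ennreal b * 1"
      using b by (intro ennreal_mult_strict_left_mono) auto
    with le show False by simp
  qed
qed

text \<open>After being in \<open>C\<close> at a time \<open>s \<le> a\<close> the process spends
  expected time at least \<open>c\<close> in \<open>B\<close> within the next \<open>N\<close>
  units. Different \<open>s\<close> may share that time, which the factor \<open>a\<close> accounts
  for.\<close>

lemma occ_ge_of_occ_C_ge:
  assumes B[measurable]: "B \<in> sets borel" and N: "\<And>y. y \<in> C \<Longrightarrow> c \<le> occ N y B" and a: "0 < a" and x: "1 \<le> occ a x C"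
  shows "c \<le> ennreal a * occ (a + N) x B"
proof -
  have "c = c * 1" by simp
  also have "\<dots> \<le> c * occ a x C" by (intro mult_left_mono x) auto
  also have "\<dots> = (\<integral>\<^sup>+s. c * (emeasure (p s x) C * indicator {0..a} s) \<partial>lborel)"
    unfolding occ_def by (subst nn_integral_cmult) auto
  also have "\<dots> \<le> (\<integral>\<^sup>+s. occ (a + N) x B * indicator {0..a} s \<partial>lborel)"
  proof (rule nn_integral_mono)
    fix s :: real
    show "c * (emeasure (p s x) C * indicator {0..a} s) \<le> occ (a + N) x B * indicator {0..a} s"
    proof (cases "s \<in> {0..a}")
      case True
      have "c * emeasure (p s x) C = (\<integral>\<^sup>+y. c * indicator C y \<partial>p s x)"
        by (subst nn_integral_cmult) auto
      also have "\<dots> \<le> (\<integral>\<^sup>+y. occ N y B \<partial>p s x)"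
        using N by (intro nn_integral_mono) (auto simp: indicator_def)
      also have "\<dots> \<le> occ (s + N) x B" using True by (intro occ_CK_le) auto
      also have "\<dots> \<le> occ (a + N) x B" using True by (intro occ_mono) auto
      finally show ?thesis using True by simp
    qed simp
  qed
  also have "\<dots> = ennreal a * occ (a + N) x B"
    using a by (subst nn_integral_cmult_indicator) (auto simp: mult.commute)
  finally show ?thesis .
qed

end

section \<open>Petite sets and expected occupation times\<close>

context markov_semigroup
begin

text \<open>Irreducibility makes the occupation of \<open>B\<close> positive from each point, but
  not uniformly. Integrated against the minorising measure it gives a positive number
  \<open>c0\<close> for some \<open>N\<close>, and petiteness makes that a bound valid from all of
  \<open>C\<close>, at a time drawn from the sampling law \<open>a\<close>. The late times of that
  law are cut off at \<open>m\<close>, beyond which they contribute at most \<open>N\<close> times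
  their probability.\<close>

lemma petite_occ:
  assumes B[measurable]: "B \<in> sets borel"
    and irr: "\<And>x. 0 < (\<integral>\<^sup>+s\<in>{0..}. emeasure (p s x) B \<partial>lborel)"
    and a: "prob_space a" "sets a = sets borel" "emeasure a {0<..} = 1"
    and \<nu>: "sets \<nu> = sets borel" "emeasure \<nu> UNIV \<noteq> 0"
    and pet: "\<And>x B. x \<in> C \<Longrightarrow> B \<in> sets borel \<Longrightarrow> emeasure \<nu> B \<le> (\<integral>\<^sup>+t\<in>{0<..}. emeasure (p t x) B \<partial>a)"
  obtains N c where "0 \<le> N" "0 < c" "\<And>x. x \<in> C \<Longrightarrow> c \<le> occ N x B"
proof -
  interpret a: prob_space a by fact
  note [measurable_cong] = a(2) \<nu>(1)
  have spa[simp]: "space a = UNIV" "space \<nu> = UNIV"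
    using sets_eq_imp_space_eq[OF a(2)] sets_eq_imp_space_eq[OF \<nu>(1)] by auto
  have pos: "\<exists>N. 0 < occ (real N) x B" for x
  proof -
    have "(\<integral>\<^sup>+s\<in>{0..}. emeasure (p s x) B \<partial>lborel) = (SUP N. occ (real N) x B)"
    proof -
      have "emeasure (p s x) B * indicator {0..} s = (SUP N. emeasure (p s x) B * indicator {0..real N} s)" for s
      proof (cases "0 \<le> s")
        case True
        obtain N0 where "s \<le> real N0" using real_arch_simple by blast
        then show ?thesis using True
          by (intro antisym SUP_upper2[of N0] SUP_least) (auto simp: indicator_def)
      qed (simp add: indicator_def)
      then show ?thesis
        unfolding occ_def
        by (subst nn_integral_monotone_convergence_SUP[symmetric])
           (auto simp: incseq_def le_fun_def indicator_def)
    qed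
    then have "0 < (SUP N. occ (real N) x B)" using irr[of x] by simp
    then show ?thesis by (simp add: less_SUP_iff)
  qed
  have "\<exists>N. 0 < (\<integral>\<^sup>+y. occ (real N) y B \<partial>\<nu>)"
  proof (rule ccontr)
    assume "\<not> ?thesis"
    then have "(\<integral>\<^sup>+y. occ (real N) y B \<partial>\<nu>) = 0" for N by simp
    then have "AE y in \<nu>. occ (real N) y B = 0" for N by (subst (asm) nn_integral_0_iff_AE) auto
    then have "AE y in \<nu>. \<forall>N. occ (real N) y B = 0" by (simp add: AE_all_countable)
    then have "AE y in \<nu>. False" by eventually_elim (metis pos less_irrefl)
    then show False using \<nu>(2) by (simp add: AE_iff_null null_sets_def)
  qed
  then obtain N where N: "0 < (\<integral>\<^sup>+y. occ (real N) y B \<partial>\<nu>)" by blast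
  define c0 where "c0 = (\<integral>\<^sup>+y. occ (real N) y B \<partial>\<nu>)"
  have lim: "(\<lambda>m. ennreal (real N) * emeasure a {real m<..}) \<longlonglongrightarrow> ennreal (real N) * 0"
  proof (rule tendsto_mult_ennreal)
    have "(\<lambda>m. emeasure a {real m<..}) \<longlonglongrightarrow> emeasure a (\<Inter>m. {real m<..})"
      by (intro Lim_emeasure_decseq) (auto simp: decseq_def a.emeasure_eq_measure)
    also have "(\<Inter>m. {real m<..}) = {}"
      using reals_Archimedean2 by (auto simp: not_less set_eq_iff) (metis less_imp_le real_arch_simple)
    finally show "(\<lambda>m. emeasure a {real m<..}) \<longlonglongrightarrow> 0" by simp
  qed auto
  have "eventually (\<lambda>m. ennreal (real N) * emeasure a {real m<..} < c0) sequentially"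
    using lim N unfolding c0_def[symmetric] by (intro order_tendstoD(2)[OF lim]) simp
  then obtain m where m: "ennreal (real N) * emeasure a {real m<..} < c0"
    by (auto simp: eventually_sequentially)
  define c where "c = c0 - ennreal (real N) * emeasure a {real m<..}"
  show ?thesis
  proof (rule that[of "real m + real N" c])
    show "0 < c" unfolding c_def using m by (intro diff_gr0_ennreal) (auto simp: a.emeasure_eq_measure ennreal_mult_eq_top_iff)
    fix x assume x: "x \<in> C"
    \<comment> \<open>The law of the process at a random time with law \<open>a\<close>; petiteness
      says that it dominates \<open>\<nu>\<close> on every Borel set.\<close>
    define \<mu> where "\<mu> = a \<bind> (\<lambda>s. p s x)"
    have k: "(\<lambda>s. p s x) \<in> a \<rightarrow>\<^sub>M subprob_algebra borel"
      using measurable_prob_algebraD[OF kernel_from] by (subst measurable_cong_sets[OF a(2) refl])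
    have s\<mu>: "sets \<mu> = sets borel" unfolding \<mu>_def
      using k by (intro sets_bind) (auto simp: sets_p)
    have AE0: "AE s in a. s \<in> {0<..}"
      using a(3) by (intro a.AE_prob_1) (auto simp: a.emeasure_eq_measure)
    have "1 * (\<integral>\<^sup>+y. occ (real N) y B \<partial>\<nu>) \<le> (\<integral>\<^sup>+y. occ (real N) y B \<partial>\<mu>)"
    proof (rule nn_integral_mono_setwise)
      fix B' assume "B' \<in> sets \<mu>"
      then have B': "B' \<in> sets borel" by (simp add: s\<mu>)
      have "emeasure \<nu> B' \<le> (\<integral>\<^sup>+t\<in>{0<..}. emeasure (p t x) B' \<partial>a)" by (rule pet[OF x B'])
      also have "\<dots> \<le> (\<integral>\<^sup>+t. emeasure (p t x) B' \<partial>a)" by (intro nn_integral_mono) (auto simp: indicator_def)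
      also have "\<dots> = emeasure \<mu> B'" unfolding \<mu>_def using k B' by (intro emeasure_bind[symmetric]) auto
      finally show "1 * emeasure \<nu> B' \<le> emeasure \<mu> B'" by simp
    qed (auto simp: s\<mu> \<nu> cong: measurable_cong_sets)
    then have "c0 \<le> (\<integral>\<^sup>+y. occ (real N) y B \<partial>\<mu>)" by (simp add: c0_def)
    also have "\<dots> = (\<integral>\<^sup>+s. (\<integral>\<^sup>+y. occ (real N) y B \<partial>p s x) \<partial>a)"
      unfolding \<mu>_def by (rule nn_integral_bind[OF _ k]) measurable
    also have "\<dots> \<le> (\<integral>\<^sup>+s. occ (real m + real N) x B + ennreal (real N) * indicator {real m<..} s \<partial>a)"
    proof (rule nn_integral_mono_AE)
      show "AE s in a. (\<integral>\<^sup>+y. occ (real N) y B \<partial>p s x) \<le> occ (real m + real N) x B + ennreal (real N) * indicator {real m<..} s"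
        using AE0
      proof eventually_elim
        fix s :: real assume s: "s \<in> {0<..}"
        show "(\<integral>\<^sup>+y. occ (real N) y B \<partial>p s x) \<le> occ (real m + real N) x B + ennreal (real N) * indicator {real m<..} s"
        proof (cases "s \<le> real m")
          case True
          have "(\<integral>\<^sup>+y. occ (real N) y B \<partial>p s x) \<le> occ (s + real N) x B" using s by (intro occ_CK_le) auto
          also have "\<dots> \<le> occ (real m + real N) x B" using True by (intro occ_mono) auto
          finally show ?thesis using True by (simp add: indicator_def)
        next
          case False
          have "(\<integral>\<^sup>+y. occ (real N) y B \<partial>p s x) \<le> (\<integral>\<^sup>+y. ennreal (real N) \<partial>p s x)"
            by (intro nn_integral_mono occ_le) auto
          then show ?thesis using False by (simp add: indicator_def add_increasing)
        qed
      qed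
    qed
    also have "\<dots> = occ (real m + real N) x B + ennreal (real N) * emeasure a {real m<..}"
    proof -
      have [measurable]: "{real m<..} \<in> sets a" by (simp add: a(2))
      show ?thesis
        using a.emeasure_space_1 by (subst nn_integral_add) (auto simp: nn_integral_cmult_indicator)
    qed
    finally show "c \<le> occ (real m + real N) x B"
      unfolding c_def by (auto simp: ennreal_minus_le_iff add.commute ennreal_mult_eq_top_iff a.emeasure_eq_measure)
  qed simp
qed

end

section \<open>A common minorisation time for a sublevel set of \<open>V\<close>\<close>

context drift_semigroup
begin

text \<open>A path from the sublevel set is in \<open>K\<close> at an uncertain time
  \<open>u \<le> L\<close>. It regenerates there with law \<open>\<rho>\<close>, then returns to
  \<open>K\<close> after \<open>w = q + L - u\<close> and regenerates once more, so that all
  contributions arrive at the common time \<open>T = u + d + w + d\<close>. The return at the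
  prescribed time \<open>w\<close> is possible because the probability of \<open>K\<close> under the
  flow from \<open>\<rho>\<close> is bounded below on all of \<open>{q..q + L}\<close>.\<close>

lemma sublevel_sets_small:
  assumes K[measurable]: "K \<in> sets borel"
    and irr: "\<And>x. 0 < (\<integral>\<^sup>+s\<in>{0..}. emeasure (p s x) K \<partial>lborel)"
    and C: "0 \<le> N" "0 < c" "\<And>x. x \<in> C \<Longrightarrow> c \<le> occ N x K"
    and \<rho>: "prob_space \<rho>" "sets \<rho> = sets borel"
    and d: "0 \<le> d" and \<epsilon>: "0 < \<epsilon>"
    and minor: "\<And>x B. x \<in> K \<Longrightarrow> B \<in> sets borel \<Longrightarrow> \<epsilon> * emeasure \<rho> B \<le> emeasure (p d x) B"
    and R: "0 \<le> R"
  obtains T \<delta> where "t1 \<le> T" "0 < \<delta>"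
    "\<And>x B. V x \<le> R \<Longrightarrow> B \<in> sets borel \<Longrightarrow> ennreal \<delta> * emeasure \<rho> B \<le> emeasure (p T x) B"
proof -
  interpret \<rho>: prob_space \<rho> by fact
  note [measurable_cong] = \<rho>(2)
  define \<phi> where "\<phi> t = (\<integral>\<^sup>+y. emeasure (p t y) K \<partial>\<rho>)" for t
  have [measurable]: "\<phi> \<in> borel_measurable borel"
  proof -
    have [measurable]: "(\<lambda>q. emeasure (p (fst q) (snd q)) K) \<in> borel_measurable (borel \<Otimes>\<^sub>M \<rho>)"
      using measurable_emeasure_pair[OF K] by (simp add: split_beta cong: measurable_cong_sets sets_pair_measure_cong)
    have "(\<lambda>t. \<integral>\<^sup>+y. emeasure (p (fst (t, y)) (snd (t, y))) K \<partial>\<rho>) \<in> borel_measurable borel"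
      by measurable
    then show ?thesis by (simp add: \<phi>_def[abs_def])
  qed
  \<comment> \<open>In \<open>K\<close> at time \<open>u\<close>, regenerated with law
    \<open>\<rho>\<close> at \<open>u + d\<close>, observed a time \<open>t\<close> later.\<close>
  have key: "emeasure (p u x) K * \<epsilon> * (\<integral>\<^sup>+z. (\<integral>\<^sup>+y. f y \<partial>p t z) \<partial>\<rho>) \<le> (\<integral>\<^sup>+y. f y \<partial>p (u + d + t) x)"
    if u: "0 \<le> u" and t: "0 \<le> t" and f[measurable]: "f \<in> borel_measurable borel" for u t x f
  proof -
    let ?g = "\<lambda>z. \<integral>\<^sup>+y. f y \<partial>p t z"
    have "emeasure (p u x) K * \<epsilon> * (\<integral>\<^sup>+z. ?g z \<partial>\<rho>) = (\<integral>\<^sup>+y. \<epsilon> * (\<integral>\<^sup>+z. ?g z \<partial>\<rho>) * indicator K y \<partial>p u x)"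
      by (subst nn_integral_cmult_indicator) (auto simp: sets_p ac_simps)
    also have "\<dots> \<le> (\<integral>\<^sup>+y. (\<integral>\<^sup>+z. ?g z \<partial>p d y) \<partial>p u x)"
    proof (rule nn_integral_mono)
      fix y
      show "\<epsilon> * (\<integral>\<^sup>+z. ?g z \<partial>\<rho>) * indicator K y \<le> (\<integral>\<^sup>+z. ?g z \<partial>p d y)"
      proof (cases "y \<in> K")
        case True
        have "\<epsilon> * (\<integral>\<^sup>+z. ?g z \<partial>\<rho>) \<le> (\<integral>\<^sup>+z. ?g z \<partial>p d y)"
          using minor[OF True] by (intro nn_integral_mono_setwise) (auto simp: \<rho> sets_p)
        then show ?thesis using True by simp
      qed simp
    qed
    also have "\<dots> = (\<integral>\<^sup>+z. ?g z \<partial>p (u + d) x)" using u d by (intro nn_integral_CK[symmetric]) auto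
    also have "\<dots> = (\<integral>\<^sup>+y. f y \<partial>p (u + d + t) x)" using u d t by (intro nn_integral_CK[symmetric]) auto
    finally show ?thesis .
  qed
  \<comment> \<open>A return to \<open>K\<close>, a regeneration lasting \<open>d\<close> and a
    second return; this is the inequality that the Steinhaus argument asks for.\<close>
  have super: "\<epsilon> * \<phi> s * \<phi> t \<le> \<phi> (s + d + t)" if st: "0 \<le> s" "0 \<le> t" for s t
  proof -
    have "\<epsilon> * \<phi> s * \<phi> t = (\<integral>\<^sup>+y. emeasure (p s y) K * (\<epsilon> * \<phi> t) \<partial>\<rho>)"
      by (subst nn_integral_multc) (auto simp: \<phi>_def[of s] ac_simps)
    also have "\<dots> \<le> (\<integral>\<^sup>+y. emeasure (p (s + d + t) y) K \<partial>\<rho>)"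
      using key[OF st, of "indicator K"] by (intro nn_integral_mono) (simp add: \<phi>_def mult.assoc)
    finally show ?thesis by (simp add: \<phi>_def[of "s + d + t"])
  qed
  have pos: "0 < (\<integral>\<^sup>+t\<in>{0..}. \<phi> t \<partial>lborel)"
  proof (rule ccontr)
    assume "\<not> ?thesis"
    then have "0 = (\<integral>\<^sup>+t. indicator {0..} t * (\<integral>\<^sup>+z. (\<integral>\<^sup>+y. indicator K y \<partial>p t z) \<partial>\<rho>) \<partial>lborel)"
      by (simp add: \<phi>_def mult.commute)
    also have "\<dots> = (\<integral>\<^sup>+z. (\<integral>\<^sup>+t. indicator {0..} t * (\<integral>\<^sup>+y. indicator K y \<partial>p t z) \<partial>lborel) \<partial>\<rho>)"
      by (rule Fubini_kernel[symmetric]) (auto simp: \<rho>(2) intro: \<rho>.sigma_finite_measure_axioms)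
    also have "\<dots> = (\<integral>\<^sup>+z. (\<integral>\<^sup>+t\<in>{0..}. emeasure (p t z) K \<partial>lborel) \<partial>\<rho>)"
      by (simp add: mult.commute)
    finally have z: "(\<integral>\<^sup>+z. (\<integral>\<^sup>+t\<in>{0..}. emeasure (p t z) K \<partial>lborel) \<partial>\<rho>) = 0" by simp
    have m: "(\<lambda>z. \<integral>\<^sup>+t\<in>{0..}. emeasure (p t z) K \<partial>lborel) \<in> borel_measurable \<rho>"
    proof -
      have "(\<lambda>q. (snd q, fst q)) \<in> \<rho> \<Otimes>\<^sub>M lborel \<rightarrow>\<^sub>M (borel :: real measure) \<Otimes>\<^sub>M (borel :: 'a measure)"
        by measurable
      from measurable_compose[OF this measurable_emeasure_pair[OF K]]
      have [measurable]: "(\<lambda>q. emeasure (p (snd q) (fst q)) K) \<in> borel_measurable (\<rho> \<Otimes>\<^sub>M lborel)" by simp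
      have "(\<lambda>z. \<integral>\<^sup>+t. emeasure (p (snd (z, t)) (fst (z, t))) K * indicator {0..} t \<partial>lborel) \<in> borel_measurable \<rho>"
        by measurable
      then show ?thesis by simp
    qed
    have "AE z in \<rho>. (\<integral>\<^sup>+t\<in>{0..}. emeasure (p t z) K \<partial>lborel) = 0"
      using z by (subst (asm) nn_integral_0_iff_AE[OF m]) simp
    then have "AE z in \<rho>. False" by eventually_elim (metis irr less_irrefl)
    then show False by (simp add: \<rho>.AE_False)
  qed
  define a where "a = (R + b) / \<kappa>"
  have a0: "0 < a" using R b \<kappa> by (simp add: a_def add_nonneg_pos)
  \<comment> \<open>Long enough to contain the occupation of \<open>K\<close> forced by the drift,
    and at least \<open>t1\<close> so that the drift applies at \<open>T\<close>.\<close>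
  define L where "L = max t1 (a + N)"
  have L0: "0 < L" "t1 \<le> L" "a + N \<le> L" using t1_pos by (auto simp: L_def)
  obtain q c2 where q: "0 \<le> q" "0 < c2" "\<And>t. t \<in> {q..q + L} \<Longrightarrow> c2 \<le> \<phi> t"
    using supermultiplicative_lower_bound[OF _ pos \<epsilon> d super] by (metis \<open>\<phi> \<in> borel_measurable borel\<close>)
  define T where "T = d + (q + L + d)"
  have step: "c * (\<epsilon> * (\<epsilon> * c2)) * emeasure \<rho> B \<le> ennreal (a * L) * emeasure (p T x) B"
    if x: "V x \<le> R" and B[measurable]: "B \<in> sets borel" for x B
  proof -
    have "c \<le> ennreal a * occ (a + N) x K"
      using occ_C_ge[OF R x] by (intro occ_ge_of_occ_C_ge C a0) (auto simp: a_def)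
    also have "\<dots> \<le> ennreal a * occ L x K" by (intro mult_left_mono occ_mono L0) simp
    finally have c: "c \<le> ennreal a * occ L x K" .
    have "occ L x K * (\<epsilon> * (\<epsilon> * c2 * emeasure \<rho> B)) =
        (\<integral>\<^sup>+u. emeasure (p u x) K * indicator {0..L} u * (\<epsilon> * (\<epsilon> * c2 * emeasure \<rho> B)) \<partial>lborel)"
      unfolding occ_def
      by (intro nn_integral_multc[symmetric] borel_measurable_times_ennreal)
         (use measurable_emeasure_time[OF K] in auto)
    also have "\<dots> \<le> (\<integral>\<^sup>+u. emeasure (p T x) B * indicator {0..L} u \<partial>lborel)"
    proof (rule nn_integral_mono)
      fix u :: real
      show "emeasure (p u x) K * indicator {0..L} u * (\<epsilon> * (\<epsilon> * c2 * emeasure \<rho> B)) \<le> emeasure (p T x) B * indicator {0..L} u"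
      proof (cases "u \<in> {0..L}")
        case True
        define w where "w = q + L - u"
        have w: "w \<in> {q..q + L}" "0 \<le> w" using True q(1) by (auto simp: w_def)
        have "\<epsilon> * c2 * emeasure \<rho> B \<le> \<epsilon> * \<phi> w * emeasure \<rho> B"
          using q(3)[OF w(1)] by (intro mult_right_mono mult_left_mono) auto
        also have "\<dots> = (\<integral>\<^sup>+z. emeasure (p w z) K * (\<epsilon> * emeasure \<rho> B) \<partial>\<rho>)"
          by (subst nn_integral_multc) (auto simp: \<phi>_def ac_simps)
        also have "\<dots> \<le> (\<integral>\<^sup>+z. emeasure (p (w + d) z) B \<partial>\<rho>)"
        proof (rule nn_integral_mono)
          fix z
          have "emeasure (p w z) K * (\<epsilon> * emeasure \<rho> B) = (\<integral>\<^sup>+y. \<epsilon> * emeasure \<rho> B * indicator K y \<partial>p w z)"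
            by (subst nn_integral_cmult_indicator) (auto simp: sets_p mult.commute)
          also have "\<dots> \<le> (\<integral>\<^sup>+y. emeasure (p d y) B \<partial>p w z)"
            using minor[OF _ B] by (intro nn_integral_mono) (auto simp: indicator_def)
          also have "\<dots> = emeasure (p (w + d) z) B" using w d by (intro emeasure_CK[symmetric]) auto
          finally show "emeasure (p w z) K * (\<epsilon> * emeasure \<rho> B) \<le> emeasure (p (w + d) z) B" .
        qed
        finally have "emeasure (p u x) K * (\<epsilon> * (\<epsilon> * c2 * emeasure \<rho> B)) \<le>
            emeasure (p u x) K * (\<epsilon> * (\<integral>\<^sup>+z. emeasure (p (w + d) z) B \<partial>\<rho>))"
          by (intro mult_left_mono) auto
        also have "\<dots> \<le> emeasure (p (u + d + (w + d)) x) B"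
          using key[of u "w + d" "indicator B" x] True w d by (simp add: mult.assoc)
        also have "u + d + (w + d) = T" by (simp add: T_def w_def)
        finally show ?thesis using True by simp
      qed simp
    qed
    also have "\<dots> = emeasure (p T x) B * ennreal L"
      using L0 by (subst nn_integral_cmult_indicator) auto
    finally have o: "occ L x K * (\<epsilon> * (\<epsilon> * c2 * emeasure \<rho> B)) \<le> emeasure (p T x) B * ennreal L" .
    have "c * (\<epsilon> * (\<epsilon> * c2)) * emeasure \<rho> B \<le> ennreal a * occ L x K * (\<epsilon> * (\<epsilon> * c2)) * emeasure \<rho> B"
      by (intro mult_right_mono c) auto
    also have "\<dots> = ennreal a * (occ L x K * (\<epsilon> * (\<epsilon> * c2 * emeasure \<rho> B)))" by (simp add: ac_simps)
    also have "\<dots> \<le> ennreal a * (emeasure (p T x) B * ennreal L)" by (intro mult_left_mono o) simp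
    also have "\<dots> = ennreal (a * L) * emeasure (p T x) B"
      using a0 L0 by (simp add: ennreal_mult' ac_simps)
    finally show ?thesis .
  qed
  \<comment> \<open>Capped at 1, since the constants live in \<open>[0,\<infinity>]\<close> and a
    real number is wanted.\<close>
  define c3 where "c3 = min 1 (c * (\<epsilon> * (\<epsilon> * c2)))"
  have c3: "0 < c3" unfolding c3_def using C(2) \<epsilon> q(2) by (simp add: ennreal_zero_less_mult_iff)
  have "c3 \<le> 1" by (simp add: c3_def)
  then obtain r where r: "c3 = ennreal r" "0 < r" using c3 by (cases c3) (auto simp: top_unique)
  show ?thesis
  proof (rule that[of T "r / (a * L)"])
    show "t1 \<le> T" using L0 d q(1) by (simp add: T_def)
    show "0 < r / (a * L)" using r a0 L0 by simp
    fix x and B :: "'a set" assume xB: "V x \<le> R" "B \<in> sets borel"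
    have "ennreal r * emeasure \<rho> B \<le> c * (\<epsilon> * (\<epsilon> * c2)) * emeasure \<rho> B"
      unfolding r(1)[symmetric] c3_def by (intro mult_right_mono) auto
    also have "\<dots> \<le> ennreal (a * L) * emeasure (p T x) B" by (rule step[OF xB])
    finally have "ennreal (1 / (a * L)) * (ennreal r * emeasure \<rho> B) \<le> ennreal (1 / (a * L)) * (ennreal (a * L) * emeasure (p T x) B)"
      by (intro mult_left_mono) auto
    also have "\<dots> = ennreal (1 / (a * L) * (a * L)) * emeasure (p T x) B"
      using a0 L0 by (subst ennreal_mult') (auto simp: mult.assoc)
    also have "1 / (a * L) * (a * L) = 1" using a0 L0 by simp
    finally show "ennreal (r / (a * L)) * emeasure \<rho> B \<le> emeasure (p T x) B"
      using a0 L0 r by (simp add: mult.assoc[symmetric] ennreal_mult'[symmetric] del: ennreal_1) simp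
  qed
qed

end

lemma abs_integral_le_integral:
  fixes f :: "'b \<Rightarrow> real"
  assumes "integrable M f" "integrable M g" "\<And>x. \<bar>f x\<bar> \<le> g x"
  shows "\<bar>\<integral>x. f x \<partial>M\<bar> \<le> (\<integral>x. g x \<partial>M)"
proof -
  have "\<bar>\<integral>x. f x \<partial>M\<bar> \<le> (\<integral>x. \<bar>f x\<bar> \<partial>M)" by (rule integral_abs_bound)
  also have "\<dots> \<le> (\<integral>x. g x \<partial>M)" using assms by (intro integral_mono) auto
  finally show ?thesis .
qed

section \<open>Invariant measures and geometric ergodicity\<close>

context drift_semigroup
begin

lemma V_pos: "0 \<le> V x" using order_trans[OF zero_le_one V_ge_1] .

lemma measure_p_UNIV [simp]: "measure (p t x) UNIV = 1"
  using prob_space.prob_space[OF prob_p, of t x] by simp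

lemma integrable_V_p: assumes "0 \<le> t" shows "integrable (p t x) V"
proof (rule integrableI_nonneg)
  show "PV t x < \<infinity>" using PV_linear[OF assms, of x] by (rule le_less_trans) simp
qed (auto simp: V_pos)

lemma integral_V_le: assumes "PV t x \<le> ennreal c" "0 \<le> t" "0 \<le> c" shows "(\<integral>y. V y \<partial>p t x) \<le> c"
proof -
  have "PV t x = ennreal (\<integral>y. V y \<partial>p t x)"
    by (rule nn_integral_eq_integral[OF integrable_V_p[OF assms(2)]]) (simp add: V_pos)
  then show ?thesis using assms(1,3) by (simp add: ennreal_le_iff)
qed

lemma integral_CK:
  fixes f :: "'a \<Rightarrow> real"
  assumes "0 \<le> s" "0 \<le> t" "f \<in> borel_measurable borel" "\<And>y. \<bar>f y\<bar> \<le> B"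
  shows "(\<integral>y. f y \<partial>p (s + t) x) = (\<integral>z. (\<integral>y. f y \<partial>p t z) \<partial>p s x)"
  unfolding chapman_kolmogorov[OF assms(1,2)]
proof (rule integral_bind_bounded)
  show "p t \<in> p s x \<rightarrow>\<^sub>M prob_algebra borel"
    by (subst measurable_cong_sets[OF sets_p refl]) (rule kernel_at)
qed (use assms prob_p in auto)

lemma measurable_integral [measurable]:
  fixes f :: "'a \<Rightarrow> real"
  assumes "f \<in> borel_measurable borel" shows "(\<lambda>x. \<integral>y. f y \<partial>p t x) \<in> borel_measurable borel"
  by (rule measurable_kernel_integral[OF kernel_at assms])

lemma abs_integral_p_le:
  fixes f :: "'a \<Rightarrow> real"
  assumes "f \<in> borel_measurable borel" "\<And>y. \<bar>f y\<bar> \<le> B" shows "\<bar>\<integral>y. f y \<partial>p t x\<bar> \<le> B"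
  using assms by (intro prob_space.abs_integral_le prob_p) auto

lemma abs_integral_p_le_V:
  fixes f :: "'a \<Rightarrow> real"
  assumes t: "0 \<le> t" and f[measurable]: "f \<in> borel_measurable borel" and fV: "\<And>y. \<bar>f y\<bar> \<le> c * V y" and c: "0 \<le> c"
  shows "\<bar>\<integral>y. f y \<partial>p t x\<bar> \<le> c * (V x + b * t)"
proof -
  have i: "integrable (p t x) (\<lambda>y. c * V y)" using integrable_V_p[OF t] by auto
  have "\<bar>\<integral>y. f y \<partial>p t x\<bar> \<le> (\<integral>y. c * V y \<partial>p t x)"
  proof (rule abs_integral_le_integral)
    show "integrable (p t x) (\<lambda>y. c * V y)" by (rule i)
    show "integrable (p t x) f"
      by (rule Bochner_Integration.integrable_bound[OF i])
        (use fV in \<open>auto intro!: AE_I2 intro: order_trans[OF _ abs_ge_self]\<close>)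
  qed (use fV in auto)
  also have "\<dots> = c * (\<integral>y. V y \<partial>p t x)" by simp
  also have "\<dots> \<le> c * (V x + b * t)"
    using PV_linear[OF t, of x] t b V_pos[of x] c by (intro mult_left_mono integral_V_le) auto
  finally show ?thesis .
qed

context
  fixes \<pi> :: "'a measure"
  assumes \<pi>: "prob_space \<pi>" and sets_\<pi> [measurable_cong]: "sets \<pi> = sets borel"
    and invariant: "\<And>t B. 0 \<le> t \<Longrightarrow> B \<in> sets borel \<Longrightarrow> (\<integral>\<^sup>+x. emeasure (p t x) B \<partial>\<pi>) = emeasure \<pi> B"
begin

lemma invariant_bind: assumes "0 \<le> t" shows "\<pi> \<bind> p t = \<pi>"
proof (rule measure_eqI)
  interpret \<pi>: prob_space \<pi> by (rule \<pi>)
  have k: "p t \<in> \<pi> \<rightarrow>\<^sub>M subprob_algebra borel"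
    using measurable_prob_algebraD[OF kernel_at] by (subst measurable_cong_sets[OF sets_\<pi> refl])
  show s: "sets (\<pi> \<bind> p t) = sets \<pi>"
    unfolding sets_\<pi> using \<pi>.not_empty by (intro sets_bind sets_p)
  fix B assume "B \<in> sets (\<pi> \<bind> p t)"
  then have B: "B \<in> sets borel" by (simp add: s sets_\<pi>)
  show "emeasure (\<pi> \<bind> p t) B = emeasure \<pi> B"
    using emeasure_bind[OF \<pi>.not_empty k B] invariant[OF assms B] by simp
qed

lemma nn_integral_invariant:
  assumes "0 \<le> t" "f \<in> borel_measurable borel"
  shows "(\<integral>\<^sup>+x. (\<integral>\<^sup>+y. f y \<partial>p t x) \<partial>\<pi>) = (\<integral>\<^sup>+x. f x \<partial>\<pi>)"
proof -
  have k: "p t \<in> \<pi> \<rightarrow>\<^sub>M subprob_algebra borel"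
    using measurable_prob_algebraD[OF kernel_at] by (subst measurable_cong_sets[OF sets_\<pi> refl])
  show ?thesis
    using nn_integral_bind[OF assms(2) k] invariant_bind[OF assms(1)] by simp
qed

lemma integral_invariant:
  fixes f :: "'a \<Rightarrow> real"
  assumes "0 \<le> t" "f \<in> borel_measurable borel" "\<And>y. \<bar>f y\<bar> \<le> B"
  shows "(\<integral>x. (\<integral>y. f y \<partial>p t x) \<partial>\<pi>) = (\<integral>x. f x \<partial>\<pi>)"
proof -
  have k: "p t \<in> \<pi> \<rightarrow>\<^sub>M prob_algebra borel"
    using kernel_at by (subst measurable_cong_sets[OF sets_\<pi> refl])
  show ?thesis
    using integral_bind_bounded[OF \<pi> k assms(2), of B] assms(3) invariant_bind[OF assms(1)] by simp
qed

text \<open>\<open>V\<close> may a priori have infinite mean, and then nothing cancels. For the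
  truncation at \<open>N\<close> invariance gives a finite identity, and where
  \<open>V \<le> N\<close> the pointwise bound
  \<open>min N (V / 2 + K0) + V / 2 \<le> min V N + K0\<close> shows that \<open>V / 2\<close> has
  an integral over that set bounded by \<open>K0\<close>, whatever \<open>N\<close>.\<close>

lemma integrable_V_invariant: "integrable \<pi> V"
proof -
  interpret \<pi>: prob_space \<pi> by (rule \<pi>)
  have spi: "space \<pi> = UNIV" using sets_eq_imp_space_eq[OF sets_\<pi>] by simp
  have bound: "(\<integral>\<^sup>+x. ennreal (V x / 2) * indicator {x. V x \<le> real N} x \<partial>\<pi>) \<le> ennreal K0" for N :: nat
  proof -
    let ?m = "\<integral>\<^sup>+x. ennreal (min (V x) (real N)) \<partial>\<pi>"
    have fin: "?m \<noteq> \<infinity>"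
    proof -
      have "?m \<le> (\<integral>\<^sup>+x. ennreal (real N) \<partial>\<pi>)" by (intro nn_integral_mono ennreal_leI) auto
      then show ?thesis by (auto simp: \<pi>.emeasure_space_1 top_unique)
    qed
    have "?m = (\<integral>\<^sup>+x. (\<integral>\<^sup>+y. ennreal (min (V y) (real N)) \<partial>p t1 x) \<partial>\<pi>)"
      using t1_pos by (intro nn_integral_invariant[symmetric]) auto
    also have "\<dots> \<le> (\<integral>\<^sup>+x. ennreal (min (real N) (V x / 2 + K0)) \<partial>\<pi>)"
    proof (rule nn_integral_mono)
      fix x
      have "(\<integral>\<^sup>+y. ennreal (min (V y) (real N)) \<partial>p t1 x) \<le> PV t1 x" by (intro nn_integral_mono ennreal_leI) auto
      also have "\<dots> \<le> ennreal (V x / 2 + K0)" by (rule PV_drift) simp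
      finally have 1: "(\<integral>\<^sup>+y. ennreal (min (V y) (real N)) \<partial>p t1 x) \<le> ennreal (V x / 2 + K0)" .
      have "(\<integral>\<^sup>+y. ennreal (min (V y) (real N)) \<partial>p t1 x) \<le> (\<integral>\<^sup>+y. ennreal (real N) \<partial>p t1 x)"
        by (intro nn_integral_mono ennreal_leI) auto
      also have "\<dots> = ennreal (real N)" by simp
      finally show "(\<integral>\<^sup>+y. ennreal (min (V y) (real N)) \<partial>p t1 x) \<le> ennreal (min (real N) (V x / 2 + K0))"
        using 1 by (auto simp: min_def)
    qed
    finally have "?m + (\<integral>\<^sup>+x. ennreal (V x / 2) * indicator {x. V x \<le> real N} x \<partial>\<pi>) \<le>
        (\<integral>\<^sup>+x. ennreal (min (real N) (V x / 2 + K0)) \<partial>\<pi>) + (\<integral>\<^sup>+x. ennreal (V x / 2) * indicator {x. V x \<le> real N} x \<partial>\<pi>)"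
      by (rule add_right_mono)
    also have "\<dots> = (\<integral>\<^sup>+x. ennreal (min (real N) (V x / 2 + K0)) + ennreal (V x / 2) * indicator {x. V x \<le> real N} x \<partial>\<pi>)"
      by (rule nn_integral_add[symmetric]) measurable
    also have "\<dots> \<le> (\<integral>\<^sup>+x. ennreal (min (V x) (real N)) + ennreal K0 \<partial>\<pi>)"
    proof (rule nn_integral_mono)
      fix x
      have "min (real N) (V x / 2 + K0) + (V x / 2) * indicator {x. V x \<le> real N} x \<le> min (V x) (real N) + K0"
        using K0_pos by (auto simp: min_def indicator_def)
      then have "ennreal (min (real N) (V x / 2 + K0) + (V x / 2) * indicator {x. V x \<le> real N} x) \<le> ennreal (min (V x) (real N) + K0)"
        by (rule ennreal_leI)
      then show "ennreal (min (real N) (V x / 2 + K0)) + ennreal (V x / 2) * indicator {x. V x \<le> real N} x \<le> ennreal (min (V x) (real N)) + ennreal K0"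
        using K0_pos V_pos[of x] by (subst (asm) (1 2) ennreal_plus) (auto simp: indicator_def)
    qed
    also have "\<dots> = ?m + ennreal K0"
      by (subst nn_integral_add) (auto simp: \<pi>.emeasure_space_1)
    finally show ?thesis using fin by (auto simp: ennreal_add_left_cancel_le)
  qed
  have "(\<integral>\<^sup>+x. ennreal (V x / 2) \<partial>\<pi>) = (\<integral>\<^sup>+x. (SUP N. ennreal (V x / 2) * indicator {x. V x \<le> real N} x) \<partial>\<pi>)"
  proof (rule nn_integral_cong)
    fix x
    obtain N where "V x \<le> real N" using real_arch_simple by blast
    then show "ennreal (V x / 2) = (SUP N. ennreal (V x / 2) * indicator {x. V x \<le> real N} x)"
      by (intro antisym SUP_upper2[of N] SUP_least) (auto simp: indicator_def)
  qed
  also have "\<dots> = (SUP N. (\<integral>\<^sup>+x. ennreal (V x / 2) * indicator {x. V x \<le> real N} x \<partial>\<pi>))"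
    by (rule nn_integral_monotone_convergence_SUP) (auto simp: incseq_def le_fun_def indicator_def)
  also have "\<dots> \<le> ennreal K0" by (intro SUP_least bound)
  finally have "(\<integral>\<^sup>+x. ennreal (V x / 2) \<partial>\<pi>) < \<infinity>" by (rule le_less_trans) simp
  then have "integrable \<pi> (\<lambda>x. V x / 2)" by (intro integrableI_nonneg) (auto simp: V_pos)
  from integrable_mult_right[OF this, of 2] show ?thesis by simp
qed

text \<open>
  Harris' contraction is iterated for bounded test functions, for which all integrals exist; the
  bounds do not involve the sup norm, so they pass to the limit.
\<close>

theorem geometric_ergodicity:
  assumes T: "t1 \<le> T" and \<delta>: "0 < \<delta>" "\<delta> \<le> 1" and \<rho>: "prob_space \<rho>" "sets \<rho> = sets borel"
    and minor: "\<And>x B. V x \<le> 8 * K0 \<Longrightarrow> B \<in> sets borel \<Longrightarrow> ennreal \<delta> * emeasure \<rho> B \<le> emeasure (p T x) B"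
  obtains M c where "0 < c"
    "\<And>x t f. 0 \<le> t \<Longrightarrow> f \<in> borel_measurable borel \<Longrightarrow> (\<And>y. \<bar>f y\<bar> \<le> V y) \<Longrightarrow>
        \<bar>(\<integral>y. f y \<partial>p t x) - (\<integral>y. f y \<partial>\<pi>)\<bar> \<le> M * V x * exp (- c * t)"
proof -
  interpret \<pi>: prob_space \<pi> by (rule \<pi>)
  have T0: "0 < T" using T t1_pos by simp
  define \<beta> where "\<beta> = \<delta> / (2 * K0)"
  have \<beta>: "0 < \<beta>" using \<delta> K0_pos by (simp add: \<beta>_def)
  define \<gamma> where "\<gamma> = 1 - \<delta> / 6"
  have \<gamma>: "0 < \<gamma>" "\<gamma> < 1" using \<delta> by (auto simp: \<gamma>_def)
  define \<Pi>V where "\<Pi>V = (\<integral>y. V y \<partial>\<pi>)"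
  have \<Pi>V: "0 \<le> \<Pi>V" unfolding \<Pi>V_def by (intro integral_nonneg_AE) (simp add: V_pos)
  have contract: "(\<integral>z. \<phi> z \<partial>p (real n * T) x) - (\<integral>z. \<phi> z \<partial>p (real n * T) y) \<le> \<gamma> ^ n * L * (2 + \<beta> * V x + \<beta> * V y)"
    if \<phi>[measurable]: "\<phi> \<in> borel_measurable borel" and bd: "\<And>y. \<bar>\<phi> y\<bar> \<le> B" and L: "0 \<le> L"
      and osc: "\<And>x y. \<phi> x - \<phi> y \<le> L * (2 + \<beta> * V x + \<beta> * V y)" for \<phi> B L n x y
    using \<phi> bd L osc
  proof (induction n arbitrary: \<phi> L x y)
    \<comment> \<open>The semigroup law does not say that \<open>p 0 x\<close> is the point mass at
      \<open>x\<close>; the drift inequality at time 0 bounds the mean of \<open>V\<close> under it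
      by \<open>V x\<close>, which suffices.\<close>
    case 0
    note [measurable] = 0(1)
    have "(\<integral>z. \<phi> z \<partial>p 0 x) - (\<integral>z. \<phi> z \<partial>p 0 y) \<le> L * (2 + \<beta> * (\<integral>z. V z \<partial>p 0 x) + \<beta> * (\<integral>z. V z \<partial>p 0 y))"
    proof -
      interpret px: prob_space "p 0 x" by (rule prob_p)
      interpret py: prob_space "p 0 y" by (rule prob_p)
      have i: "integrable (p 0 x) \<phi>" "integrable (p 0 y) \<phi>"
        using 0(2) by (auto intro!: px.integrable_bounded py.integrable_bounded)
      have "(\<integral>z. \<phi> z \<partial>p 0 x) \<le> (\<integral>z. \<phi> w + L * (2 + \<beta> * V z + \<beta> * V w) \<partial>p 0 x)" for w
        using i integrable_V_p[of 0 x] 0(4)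
        by (intro integral_mono) (auto simp: algebra_simps)
      then have 1: "(\<integral>z. \<phi> z \<partial>p 0 x) \<le> \<phi> w + L * (2 + \<beta> * (\<integral>z. V z \<partial>p 0 x) + \<beta> * V w)" for w
        using integrable_V_p[of 0 x] by (simp add: px.prob_space)
      have "(\<integral>w. (\<integral>z. \<phi> z \<partial>p 0 x) \<partial>p 0 y) \<le> (\<integral>w. \<phi> w + L * (2 + \<beta> * (\<integral>z. V z \<partial>p 0 x) + \<beta> * V w) \<partial>p 0 y)"
        using i integrable_V_p[of 0 y] 1 by (intro integral_mono) auto
      then show ?thesis using i integrable_V_p[of 0 y] by (simp add: py.prob_space)
    qed
    also have "\<dots> \<le> L * (2 + \<beta> * V x + \<beta> * V y)"
    proof -
      have "(\<integral>z. V z \<partial>p 0 x) \<le> V x" for x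
        using PV_linear[of 0 x] V_pos[of x] by (intro integral_V_le) auto
      then show ?thesis using 0(3) \<beta> by (intro mult_left_mono add_mono) auto
    qed
    finally show ?case by simp
  next
    case (Suc n)
    note [measurable] = Suc.prems(1)
    define \<phi>' where "\<phi>' x = (\<integral>z. \<phi> z \<partial>p T x)" for x
    have "(\<integral>z. \<phi> z \<partial>p (real (Suc n) * T) x) = (\<integral>z. \<phi>' z \<partial>p (real n * T) x)" for x
    proof -
      have "(\<integral>z. \<phi> z \<partial>p (real n * T + T) x) = (\<integral>z. \<phi>' z \<partial>p (real n * T) x)"
        unfolding \<phi>'_def using T0 Suc.prems by (intro integral_CK) auto
      then show ?thesis by (simp add: algebra_simps)
    qed
    moreover have "(\<integral>z. \<phi>' z \<partial>p (real n * T) x) - (\<integral>z. \<phi>' z \<partial>p (real n * T) y) \<le> \<gamma> ^ n * (\<gamma> * L) * (2 + \<beta> * V x + \<beta> * V y)"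
    proof (rule Suc.IH)
      show "\<phi>' \<in> borel_measurable borel" unfolding \<phi>'_def[abs_def] by measurable
      show "\<bar>\<phi>' y\<bar> \<le> B" for y unfolding \<phi>'_def using Suc.prems by (intro abs_integral_p_le) auto
      show "0 \<le> \<gamma> * L" using \<gamma> Suc.prems by simp
      show "\<phi>' x - \<phi>' y \<le> \<gamma> * L * (2 + \<beta> * V x + \<beta> * V y)" for x y
        unfolding \<phi>'_def \<gamma>_def
      proof (rule harris_contraction[where V = V and K = K0 and \<rho> = \<rho>])
        fix x
        have "PV T x \<le> ennreal (V x / 2 + K0)" by (rule PV_drift[OF T])
        then show "(\<integral>y. V y \<partial>p T x) \<le> V x / 2 + K0"
          using T0 V_pos[of x] K0_pos by (intro integral_V_le) auto
        show "integrable (p T x) V" using T0 by (intro integrable_V_p) simp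
      qed (use Suc.prems prob_p sets_p \<rho> \<delta> K0_pos V_pos minor in \<open>auto simp: \<beta>_def\<close>)
    qed
    ultimately show ?case by (simp add: algebra_simps)
  qed
  \<comment> \<open>\<open>(1 + b * T) / \<beta>\<close> is the oscillation constant of a function
    bounded by \<open>(1 + b * T) * V\<close>; the second factor comes from integrating
    \<open>2 + \<beta> * V x + \<beta> * V y\<close> over \<open>y\<close> and using
    \<open>V x \<ge> 1\<close>.\<close>
  define M0 where "M0 = (1 + b * T) / \<beta> * (2 + \<beta> + \<beta> * \<Pi>V)"
  have M0: "0 \<le> M0" unfolding M0_def using b T0 \<beta> \<Pi>V by auto
  have skeleton: "\<bar>(\<integral>z. \<phi> z \<partial>p (real n * T) x) - (\<integral>z. \<phi> z \<partial>\<pi>)\<bar> \<le> \<gamma> ^ n * M0 * V x"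
    if \<phi>[measurable]: "\<phi> \<in> borel_measurable borel" and bd: "\<And>y. \<bar>\<phi> y\<bar> \<le> B"
      and le: "\<And>y. \<bar>\<phi> y\<bar> \<le> (1 + b * T) * V y" for \<phi> B n x
  proof -
    define L where "L = (1 + b * T) / \<beta>"
    have L: "0 \<le> L" "L * \<beta> = 1 + b * T" using b T0 \<beta> by (auto simp: L_def)
    have osc: "\<phi> x - \<phi> y \<le> L * (2 + \<beta> * V x + \<beta> * V y)" for x y
    proof -
      have "\<phi> x - \<phi> y \<le> L * \<beta> * V x + L * \<beta> * V y"
        using le[of x] le[of y] unfolding L(2) by linarith
      then show ?thesis using L(1) by (simp add: algebra_simps)
    qed
    let ?F = "\<lambda>x. \<integral>z. \<phi> z \<partial>p (real n * T) x"
    have [measurable]: "?F \<in> borel_measurable borel" by measurable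
    have Fb: "\<bar>?F x\<bar> \<le> B" for x using bd by (intro abs_integral_p_le) auto
    have Fi: "integrable \<pi> ?F" using Fb by (intro \<pi>.integrable_bounded) auto
    have diff: "\<bar>?F x - ?F y\<bar> \<le> \<gamma> ^ n * L * (2 + \<beta> * V x + \<beta> * V y)" for y
    proof -
      have "?F x - ?F y \<le> \<gamma> ^ n * L * (2 + \<beta> * V x + \<beta> * V y)"
        by (rule contract[OF \<phi> bd L(1) osc])
      moreover have "?F y - ?F x \<le> \<gamma> ^ n * L * (2 + \<beta> * V y + \<beta> * V x)"
        by (rule contract[OF \<phi> bd L(1) osc])
      ultimately show ?thesis by (simp add: abs_le_iff algebra_simps)
    qed
    have "(\<integral>z. \<phi> z \<partial>\<pi>) = (\<integral>y. ?F y \<partial>\<pi>)"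
      using T0 bd by (intro integral_invariant[symmetric]) auto
    then have "?F x - (\<integral>z. \<phi> z \<partial>\<pi>) = (\<integral>y. ?F x - ?F y \<partial>\<pi>)"
      using Fi by (simp add: \<pi>.prob_space)
    then have "\<bar>?F x - (\<integral>z. \<phi> z \<partial>\<pi>)\<bar> = \<bar>\<integral>y. ?F x - ?F y \<partial>\<pi>\<bar>" by simp
    also have "\<dots> \<le> (\<integral>y. \<gamma> ^ n * L * (2 + \<beta> * V x + \<beta> * V y) \<partial>\<pi>)"
      using Fi integrable_V_invariant diff by (intro abs_integral_le_integral) auto
    also have "\<dots> = \<gamma> ^ n * L * (2 + \<beta> * V x + \<beta> * \<Pi>V)"
      using integrable_V_invariant by (simp add: \<pi>.prob_space \<Pi>V_def)
    also have "\<dots> \<le> \<gamma> ^ n * L * ((2 + \<beta> + \<beta> * \<Pi>V) * V x)"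
    proof (rule mult_left_mono)
      have "2 * 1 \<le> 2 * V x" "\<beta> * \<Pi>V * 1 \<le> \<beta> * \<Pi>V * V x"
        using V_ge_1[of x] \<beta> \<Pi>V by (intro mult_left_mono mult_nonneg_nonneg; simp)+
      then show "2 + \<beta> * V x + \<beta> * \<Pi>V \<le> (2 + \<beta> + \<beta> * \<Pi>V) * V x"
        by (simp add: algebra_simps)
      show "0 \<le> \<gamma> ^ n * L" using \<gamma> L by simp
    qed
    also have "\<dots> = \<gamma> ^ n * M0 * V x" by (simp add: M0_def L_def)
    finally show ?thesis .
  qed
  \<comment> \<open>\<open>\<gamma> ^ n\<close> is at most \<open>exp (- c * t) / \<gamma>\<close>
    because \<open>n > t / T - 1\<close>; this is the origin of
    \<open>M0 / \<gamma>\<close>.\<close>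
  define c where "c = - ln \<gamma> / T"
  have c: "0 < c" unfolding c_def using \<gamma> T0 by (intro divide_pos_pos) auto
  have bounded_f: "\<bar>(\<integral>y. f y \<partial>p t x) - (\<integral>y. f y \<partial>\<pi>)\<bar> \<le> M0 / \<gamma> * V x * exp (- c * t)"
    if t: "0 \<le> t" and f[measurable]: "f \<in> borel_measurable borel" and bd: "\<And>y. \<bar>f y\<bar> \<le> B"
      and fV: "\<And>y. \<bar>f y\<bar> \<le> V y" for t f B x
  proof -
    define n where "n = nat \<lfloor>t / T\<rfloor>"
    have "0 \<le> t / T" using t T0 by simp
    then have n: "real n \<le> t / T" "t / T < real n + 1" unfolding n_def by linarith+
    define r where "r = t - real n * T"
    have r: "0 \<le> r" "r \<le> T" using n T0 by (auto simp: r_def field_simps)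
    \<comment> \<open>The remainder \<open>r\<close> is put at the end of the path, into the test
      function: over a time at most \<open>T\<close> this costs the factor
      \<open>1 + b * T\<close>.\<close>
    define \<phi> where "\<phi> x = (\<integral>y. f y \<partial>p r x)" for x
    have [measurable]: "\<phi> \<in> borel_measurable borel" unfolding \<phi>_def[abs_def] by measurable
    have "\<bar>\<phi> y\<bar> \<le> (1 + b * T) * V y" for y
    proof -
      have "\<bar>\<phi> y\<bar> \<le> 1 * (V y + b * r)" unfolding \<phi>_def using fV r by (intro abs_integral_p_le_V) auto
      also have "\<dots> \<le> V y + b * T * V y"
        using b r V_ge_1[of y] T0 mult_mono[of "b * r" "b * T" 1 "V y"] by simp
      finally show ?thesis by (simp add: algebra_simps)
    qed
    moreover have "\<bar>\<phi> y\<bar> \<le> B" for y unfolding \<phi>_def using bd by (intro abs_integral_p_le) auto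
    ultimately have "\<bar>(\<integral>z. \<phi> z \<partial>p (real n * T) x) - (\<integral>z. \<phi> z \<partial>\<pi>)\<bar> \<le> \<gamma> ^ n * M0 * V x"
      by (intro skeleton) auto
    moreover have "(\<integral>z. \<phi> z \<partial>p (real n * T) x) = (\<integral>y. f y \<partial>p t x)"
      using integral_CK[of "real n * T" r f B x] r T0 bd by (simp add: \<phi>_def r_def)
    moreover have "(\<integral>z. \<phi> z \<partial>\<pi>) = (\<integral>z. f z \<partial>\<pi>)"
      unfolding \<phi>_def using r bd by (intro integral_invariant) auto
    ultimately have 1: "\<bar>(\<integral>y. f y \<partial>p t x) - (\<integral>y. f y \<partial>\<pi>)\<bar> \<le> \<gamma> ^ n * M0 * V x" by simp
    have "\<gamma> ^ n = exp (ln \<gamma> * real n)" using \<gamma> by (simp add: powr_realpow[symmetric] powr_def mult.commute)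
    also have "\<dots> \<le> exp (ln \<gamma> * (t / T - 1))"
      using n \<gamma> by (intro exp_le_cancel_iff[THEN iffD2] mult_left_mono_neg) auto
    also have "\<dots> = exp (- c * t) / \<gamma>"
      using \<gamma> by (simp add: c_def right_diff_distrib exp_diff)
    finally have "\<gamma> ^ n * (M0 * V x) \<le> exp (- c * t) / \<gamma> * (M0 * V x)"
      using M0 V_pos[of x] by (intro mult_right_mono) auto
    with 1 show ?thesis by (simp add: mult_ac)
  qed
  show ?thesis
  proof (rule that[OF c, of "M0 / \<gamma>"])
    fix x and t :: real and f :: "'a \<Rightarrow> real"
    assume t: "0 \<le> t" and f[measurable]: "f \<in> borel_measurable borel" and fV: "\<And>y. \<bar>f y\<bar> \<le> V y"
    define g where "g n y = max (- real n) (min (real n) (f y))" for n y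
    have [measurable]: "g n \<in> borel_measurable borel" for n unfolding g_def[abs_def] by measurable
    have gV: "\<bar>g n y\<bar> \<le> V y" for n y using fV[of y] by (auto simp: g_def)
    have glim: "(\<lambda>n. g n y) \<longlonglongrightarrow> f y" for y
    proof (rule tendsto_eventually)
      obtain N where "\<bar>f y\<bar> \<le> real N" using real_arch_simple by blast
      then show "eventually (\<lambda>n. g n y = f y) sequentially"
        unfolding eventually_sequentially g_def by (intro exI[of _ N]) (auto simp: max_def min_def)
    qed
    have l1: "(\<lambda>n. \<integral>y. g n y \<partial>p t x) \<longlonglongrightarrow> (\<integral>y. f y \<partial>p t x)"
      by (rule integral_dominated_convergence[where w = V])
         (use integrable_V_p[OF t] gV glim in auto)
    have l2: "(\<lambda>n. \<integral>y. g n y \<partial>\<pi>) \<longlonglongrightarrow> (\<integral>y. f y \<partial>\<pi>)"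
      by (rule integral_dominated_convergence[where w = V])
         (use integrable_V_invariant gV glim in auto)
    have "\<bar>(\<integral>y. g n y \<partial>p t x) - (\<integral>y. g n y \<partial>\<pi>)\<bar> \<le> M0 / \<gamma> * V x * exp (- c * t)" for n
    proof (rule bounded_f[OF t _ _ gV])
      show "\<bar>g n y\<bar> \<le> real n" for y by (auto simp: g_def)
    qed measurable
    then show "\<bar>(\<integral>y. f y \<partial>p t x) - (\<integral>y. f y \<partial>\<pi>)\<bar> \<le> M0 / \<gamma> * V x * exp (- c * t)"
      by (intro LIMSEQ_le_const2[OF tendsto_rabs[OF tendsto_diff[OF l1 l2]]]) auto
  qed
qed

end

end

subsection \<open>Resolvents of Feller semigroups\<close>

text \<open>The exponential weight is cut off to a function on the whole line, so that Laplace
  transforms are plain integrals over \<open>lborel\<close>; \<open>\<theta> * expw \<theta>\<close>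
  is the exponential density.\<close>

definition expw :: "real \<Rightarrow> real \<Rightarrow> real" where
  "expw \<theta> s = indicator {0..} s * exp (- \<theta> * s)"

lemma expw_nonneg: "0 \<le> expw \<theta> s"
  by (simp add: expw_def indicator_def)

lemma measurable_expw [measurable]: "expw \<theta> \<in> borel_measurable borel"
  unfolding expw_def[abs_def] by measurable

lemma exponential_density_expw: "exponential_density \<theta> s = \<theta> * expw \<theta> s"
  by (simp add: exponential_density_def expw_def indicator_def mult.commute)

lemma expw_integral:
  assumes "0 < \<theta>" shows "integrable lborel (expw \<theta>)" "(\<integral>s. expw \<theta> s \<partial>lborel) = 1 / \<theta>"
proof -
  interpret prob_space "density lborel (exponential_density \<theta>)"
    by (rule prob_space_exponential_density[OF assms])
  have nn: "(\<integral>\<^sup>+s. ennreal (\<theta> * expw \<theta> s) \<partial>lborel) = 1"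
    using emeasure_space_1 by (simp add: emeasure_density exponential_density_expw)
  then have "integrable lborel (\<lambda>s. \<theta> * expw \<theta> s)"
    using assms by (intro integrableI_nonneg) (auto simp: expw_nonneg)
  then show i: "integrable lborel (expw \<theta>)" using assms by simp
  have "(\<integral>s. \<theta> * expw \<theta> s \<partial>lborel) = 1"
    using nn assms by (subst integral_eq_nn_integral) (auto simp: expw_nonneg)
  then show "(\<integral>s. expw \<theta> s \<partial>lborel) = 1 / \<theta>" using assms by (simp add: field_simps)
qed

lemma expw_integrable_times:
  fixes h :: "real \<Rightarrow> real"
  assumes "0 < \<theta>" "h \<in> borel_measurable borel" "\<And>s. \<bar>h s\<bar> \<le> B"
  shows "integrable lborel (\<lambda>s. expw \<theta> s * h s)"
proof (rule Bochner_Integration.integrable_bound[OF integrable_mult_left[OF expw_integral(1)[OF assms(1)], of B]])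
  show "AE s in lborel. norm (expw \<theta> s * h s) \<le> norm (expw \<theta> s * B)"
  proof (rule AE_I2)
    fix s
    have "\<bar>h s\<bar> \<le> \<bar>B\<bar>" using assms(3)[of s] by linarith
    then show "norm (expw \<theta> s * h s) \<le> norm (expw \<theta> s * B)"
      by (simp add: abs_mult mult_left_mono)
  qed
qed (use assms in simp)

lemma expw_integral_bound:
  fixes h :: "real \<Rightarrow> real"
  assumes "0 < \<theta>" "h \<in> borel_measurable borel" "\<And>s. \<bar>h s\<bar> \<le> B"
  shows "\<bar>\<integral>s. expw \<theta> s * h s \<partial>lborel\<bar> \<le> B / \<theta>"
proof -
  have "\<bar>\<integral>s. expw \<theta> s * h s \<partial>lborel\<bar> \<le> (\<integral>s. expw \<theta> s * B \<partial>lborel)"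
    using assms expw_integral(1)[OF assms(1)]
    by (intro abs_integral_le_integral expw_integrable_times)
       (auto simp: abs_mult expw_nonneg mult_left_mono)
  also have "\<dots> = B / \<theta>" using expw_integral[OF assms(1)] by simp
  finally show ?thesis .
qed

lemma C0D:
  assumes "f \<in> C0 S" shows "continuous_on S f" "x \<notin> S \<Longrightarrow> f x = 0"
    "0 < \<epsilon> \<Longrightarrow> \<exists>K. compact K \<and> K \<subseteq> S \<and> (\<forall>x. x \<notin> K \<longrightarrow> \<bar>f x\<bar> < \<epsilon>)"
proof -
  show "continuous_on S f" "x \<notin> S \<Longrightarrow> f x = 0" using assms by (auto simp: C0_def)
  assume "0 < \<epsilon>"
  then obtain K where "compact K" "K \<subseteq> S" "\<forall>x\<in>S - K. \<bar>f x\<bar> < \<epsilon>"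
    using assms unfolding C0_def by blast
  moreover have "\<forall>x. x \<notin> S \<longrightarrow> \<bar>f x\<bar> < \<epsilon>" using assms \<open>0 < \<epsilon>\<close> by (auto simp: C0_def)
  ultimately show "\<exists>K. compact K \<and> K \<subseteq> S \<and> (\<forall>x. x \<notin> K \<longrightarrow> \<bar>f x\<bar> < \<epsilon>)" by blast
qed

lemma C0_bounded: assumes "f \<in> C0 S" obtains B where "0 \<le> B" "\<And>x. \<bar>f x\<bar> \<le> B"
proof -
  obtain K where K: "compact K" "K \<subseteq> S" "\<And>x. x \<notin> K \<Longrightarrow> \<bar>f x\<bar> < 1"
    using C0D(3)[OF assms, of 1] by auto
  have "compact (f ` K)" using K C0D(1)[OF assms] by (intro compact_continuous_image) (auto intro: continuous_on_subset)
  from compact_imp_bounded[OF this] obtain B where "\<forall>y\<in>f ` K. norm y \<le> B"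
    unfolding bounded_iff by blast
  then have B: "\<And>x. x \<in> K \<Longrightarrow> \<bar>f x\<bar> \<le> B" by simp
  show ?thesis
  proof (rule that[of "max 1 B"])
    show "\<bar>f x\<bar> \<le> max 1 B" for x
      using B[of x] K(3)[of x] by (cases "x \<in> K") auto
  qed simp
qed

lemma C0_measurable: assumes "f \<in> C0 S" "S \<in> sets borel" shows "f \<in> borel_measurable borel"
proof -
  have "(\<lambda>x. indicator S x *\<^sub>R f x) \<in> borel_measurable borel"
    by (rule borel_measurable_continuous_on_indicator[OF assms(2) C0D(1)[OF assms(1)]])
  moreover have "(\<lambda>x. indicator S x *\<^sub>R f x) = f"
    using C0D(2)[OF assms(1)] by (auto simp: fun_eq_iff indicator_def)
  ultimately show ?thesis by simp
qed

text \<open>The limit is unique pointwise on \<open>S\<close>, and off \<open>S\<close> both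
  candidates vanish because members of \<open>C0 S\<close> are extended by zero. This makes the
  definite description in \<open>gen\<close> meaningful.\<close>

lemma gen_eqI:
  assumes "gen_rel S T f h" shows "gen S T f = h"
  unfolding gen_def
proof (rule the_equality[where P = "gen_rel S T f"])
  show "gen_rel S T f h" by fact
  fix h' assume h': "gen_rel S T f h'"
  show "h' = h"
  proof (rule ext)
    fix x
    show "h' x = h x"
    proof (cases "x \<in> S")
      case True
      have "((\<lambda>t. (T t f x - f x) / t) \<longlongrightarrow> h x) (at_right 0)" "((\<lambda>t. (T t f x - f x) / t) \<longlongrightarrow> h' x) (at_right 0)"
        using assms h' by (auto simp: gen_rel_def intro: tendsto_uniform_limitI[OF _ True])
      from tendsto_unique[OF _ this(2,1)] show ?thesis by simp
    next
      case False
      then show ?thesis using assms h' by (auto simp: gen_rel_def C0_def)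
    qed
  qed
qed

locale feller_family =
  fixes S :: "'a::metric_space set" and Q :: "'a \<Rightarrow> (real \<Rightarrow> 'a) measure"
  assumes S_borel: "S \<in> sets borel"
    and Q_kernel: "Q \<in> restrict_space borel S \<rightarrow>\<^sub>M prob_algebra (path_space S)"
    and C0_semigroup: "C0_contraction_semigroup S (semigroup_of S Q)"
begin

abbreviation T where "T \<equiv> semigroup_of S Q"

lemma Q_prob: assumes "x \<in> S" shows "prob_space (Q x)" "sets (Q x) = sets (path_space S)"
  using prob_kernelD[OF Q_kernel, of x] assms by (auto simp: space_restrict_space)

lemma T_C0: "0 \<le> t \<Longrightarrow> f \<in> C0 S \<Longrightarrow> T t f \<in> C0 S"
  and T_linear: "0 \<le> t \<Longrightarrow> f \<in> C0 S \<Longrightarrow> h \<in> C0 S \<Longrightarrow> T t (\<lambda>x. a * f x + b * h x) = (\<lambda>x. a * T t f x + b * T t h x)"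
  and T_0: "f \<in> C0 S \<Longrightarrow> T 0 f = f"
  and T_add: "0 \<le> s \<Longrightarrow> 0 \<le> t \<Longrightarrow> f \<in> C0 S \<Longrightarrow> T (s + t) f = T s (T t f)"
  and T_cont: "f \<in> C0 S \<Longrightarrow> uniform_limit S (\<lambda>t. T t f) f (at_right 0)"
  using C0_semigroup unfolding C0_contraction_semigroup_def by blast+

lemma T_outside: "x \<notin> S \<Longrightarrow> T t f x = 0"
  by (simp add: semigroup_of_def restrict0_def)

lemma T_bound:
  assumes t: "0 \<le> t" and f: "f \<in> borel_measurable borel" and B: "\<And>x. \<bar>f x\<bar> \<le> B"
  shows "\<bar>T t f x\<bar> \<le> B"
proof (cases "x \<in> S")
  case True
  interpret prob_space "Q x" by (rule Q_prob[OF True])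
  have "(\<lambda>\<eta>. f (\<eta> t)) \<in> borel_measurable (Q x)"
    using measurable_compose[OF measurable_path_eval[OF t] f]
    by (subst measurable_cong_sets[OF Q_prob(2)[OF True] refl])
  then have "\<bar>\<integral>\<eta>. f (\<eta> t) \<partial>Q x\<bar> \<le> B" using B by (intro abs_integral_le) auto
  then show ?thesis using True by (simp add: semigroup_of_def restrict0_def)
next
  case False
  then show ?thesis using order_trans[OF abs_ge_zero B[of x]] by (simp add: T_outside)
qed

lemma C0_lin: "f \<in> C0 S \<Longrightarrow> h \<in> C0 S \<Longrightarrow> (\<lambda>x. a * f x + b * h x) \<in> C0 S"
proof -
  assume f: "f \<in> C0 S" and h: "h \<in> C0 S"
  show ?thesis unfolding C0_def
  proof (intro CollectI conjI allI impI)
    show "continuous_on S (\<lambda>x. a * f x + b * h x)" using C0D(1)[OF f] C0D(1)[OF h] by (intro continuous_intros)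
    show "a * f x + b * h x = 0" if "x \<notin> S" for x using that C0D(2)[OF f] C0D(2)[OF h] by simp
    fix \<epsilon> :: real assume "0 < \<epsilon>"
    define d where "d = \<epsilon> / (\<bar>a\<bar> + \<bar>b\<bar> + 1)"
    have d: "0 < d" using \<open>0 < \<epsilon>\<close> by (simp add: d_def add_nonneg_pos)
    obtain K where K: "compact K" "K \<subseteq> S" "\<And>x. x \<notin> K \<Longrightarrow> \<bar>f x\<bar> < d" using C0D(3)[OF f d] by blast
    obtain K' where K': "compact K'" "K' \<subseteq> S" "\<And>x. x \<notin> K' \<Longrightarrow> \<bar>h x\<bar> < d" using C0D(3)[OF h d] by blast
    show "\<exists>K. compact K \<and> K \<subseteq> S \<and> (\<forall>x\<in>S - K. \<bar>a * f x + b * h x\<bar> < \<epsilon>)"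
    proof (intro exI[of _ "K \<union> K'"] conjI ballI compact_Un K(1) K'(1))
      fix x assume "x \<in> S - (K \<union> K')"
      then have x: "\<bar>f x\<bar> < d" "\<bar>h x\<bar> < d" using K(3) K'(3) by auto
      have "\<bar>a * f x + b * h x\<bar> \<le> \<bar>a\<bar> * \<bar>f x\<bar> + \<bar>b\<bar> * \<bar>h x\<bar>"
        by (metis abs_mult abs_triangle_ineq)
      also have "\<dots> \<le> \<bar>a\<bar> * d + \<bar>b\<bar> * d" using x by (intro add_mono mult_left_mono) auto
      also have "\<dots> < (\<bar>a\<bar> + \<bar>b\<bar> + 1) * d" using d by (simp add: algebra_simps)
      also have "\<dots> = \<epsilon>" by (simp add: d_def)
      finally show "\<bar>a * f x + b * h x\<bar> < \<epsilon>" .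
    qed (use K K' in auto)
  qed
qed

text \<open>\<open>T (s + h) f - T s f\<close> is \<open>T s\<close> applied to
  \<open>T h f - f\<close>, and \<open>T s\<close> does not increase sup norms; so strong continuity
  at 0 yields a modulus uniform in \<open>s\<close> and \<open>x\<close>.\<close>

lemma T_equicontinuous:
  assumes f: "f \<in> C0 S" and \<epsilon>: "0 < \<epsilon>"
  obtains \<delta> where "0 < \<delta>" "\<And>s h x. 0 \<le> s \<Longrightarrow> 0 \<le> h \<Longrightarrow> h < \<delta> \<Longrightarrow> \<bar>T (s + h) f x - T s f x\<bar> \<le> \<epsilon>"
proof -
  have "\<forall>\<^sub>F t in at_right 0. \<forall>x\<in>S. dist (T t f x) (f x) < \<epsilon>"
    using uniform_limitD[OF T_cont[OF f] \<epsilon>] .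
  then obtain \<delta> where \<delta>: "0 < \<delta>" "\<And>t x. 0 < t \<Longrightarrow> t < \<delta> \<Longrightarrow> x \<in> S \<Longrightarrow> dist (T t f x) (f x) < \<epsilon>"
    unfolding eventually_at_right_field by auto
  have 1: "\<bar>T h f x - f x\<bar> \<le> \<epsilon>" if "0 \<le> h" "h < \<delta>" for h x
  proof (cases "h = 0 \<or> x \<notin> S")
    case True
    then show ?thesis using \<epsilon> T_0[OF f] C0D(2)[OF f] by (auto simp: T_outside)
  next
    case False
    then show ?thesis using \<delta>(2)[of h x] that by (auto simp: dist_real_def)
  qed
  show ?thesis
  proof (rule that[OF \<delta>(1)])
    fix s h :: real and x assume s: "0 \<le> s" and h: "0 \<le> h" "h < \<delta>"
    let ?g = "\<lambda>x. 1 * T h f x + (- 1) * f x"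
    have g: "?g \<in> C0 S" by (intro C0_lin T_C0 f h)
    have "T s ?g = (\<lambda>x. 1 * T s (T h f) x + (- 1) * T s f x)"
      by (intro T_linear T_C0 f h s)
    then have "T (s + h) f x - T s f x = T s ?g x"
      by (simp add: T_add[OF s h(1) f])
    also have "\<bar>\<dots>\<bar> \<le> \<epsilon>"
      using 1[OF h] C0_measurable[OF g S_borel] by (intro T_bound[OF s]) auto
    finally show "\<bar>T (s + h) f x - T s f x\<bar> \<le> \<epsilon>" .
  qed
qed

lemma T_right_continuous:
  assumes f: "f \<in> C0 S" and t: "0 \<le> t"
  shows "((\<lambda>s. T s f x) \<longlongrightarrow> T t f x) (at_right t)"
proof (rule tendstoI)
  fix e :: real assume "0 < e"
  then obtain \<delta> where \<delta>: "0 < \<delta>" "\<And>s h x. 0 \<le> s \<Longrightarrow> 0 \<le> h \<Longrightarrow> h < \<delta> \<Longrightarrow> \<bar>T (s + h) f x - T s f x\<bar> \<le> e / 2"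
    using T_equicontinuous[OF f, of "e/2"] by auto
  show "\<forall>\<^sub>F s in at_right t. dist (T s f x) (T t f x) < e"
    unfolding eventually_at_right_field
  proof (intro exI[of _ "t + \<delta>"] conjI allI impI)
    fix s assume "t < s" "s < t + \<delta>"
    then show "dist (T s f x) (T t f x) < e"
      using \<delta>(2)[of t "s - t" x] t \<open>0 < e\<close> by (simp add: dist_real_def)
  qed (use \<delta> in auto)
qed

lemma T_jointly_measurable:
  assumes f: "f \<in> C0 S" shows "(\<lambda>(t, x). T (max 0 t) f x) \<in> borel_measurable (borel \<Otimes>\<^sub>M borel)"
  by (rule measurable_right_continuous[where F = "\<lambda>t. T t f"])
     (use T_right_continuous[OF f] C0_measurable[OF T_C0[OF _ f] S_borel] in auto)

lemma T_measurable_time: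
  assumes f: "f \<in> C0 S" shows "(\<lambda>t. T (max 0 t) f x) \<in> borel_measurable borel"
proof -
  have "(\<lambda>t. (t, x)) \<in> borel \<rightarrow>\<^sub>M borel \<Otimes>\<^sub>M borel" by (intro measurable_Pair) auto
  from measurable_compose[OF this T_jointly_measurable[OF f]] show ?thesis by simp
qed

text \<open>The resolvent, not normalised: \<open>\<theta> * Res \<theta> g\<close> is the
  expectation of \<open>g\<close> at an independent exponential time.\<close>

definition Res :: "real \<Rightarrow> ('a \<Rightarrow> real) \<Rightarrow> 'a \<Rightarrow> real" where
  "Res \<theta> g x = (\<integral>s. expw \<theta> s * T (max 0 s) g x \<partial>lborel)"

context
  fixes \<theta> :: real and g :: "'a \<Rightarrow> real" and B :: real
  assumes \<theta>: "0 < \<theta>" and g: "g \<in> C0 S" and B: "\<And>x. \<bar>g x\<bar> \<le> B"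
begin

lemma g_meas: "g \<in> borel_measurable borel" by (rule C0_measurable[OF g S_borel])

lemma T_le_B: "\<bar>T (max 0 s) g x\<bar> \<le> B" by (intro T_bound g_meas B) auto

lemma T_le_B': "0 \<le> s \<Longrightarrow> \<bar>T s g x\<bar> \<le> B" by (intro T_bound g_meas B)

lemma Res_integrable: "integrable lborel (\<lambda>s. expw \<theta> s * T (max 0 s) g x)"
  by (rule expw_integrable_times[OF \<theta> T_measurable_time[OF g] T_le_B])

lemma Res_bound: "\<bar>Res \<theta> g x\<bar> \<le> B / \<theta>"
  unfolding Res_def by (rule expw_integral_bound[OF \<theta> T_measurable_time[OF g] T_le_B])

text \<open>For decay at infinity the integral is cut at a large time \<open>N\<close>; up to
  \<open>N\<close>, finitely many grid times and equicontinuity control all times, and each grid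
  time contributes one compact set.\<close>

lemma Res_C0: "Res \<theta> g \<in> C0 S"
  unfolding C0_def
proof (intro CollectI conjI allI impI)
  have B0: "0 \<le> B" using order_trans[OF abs_ge_zero B] .
  show "continuous_on S (Res \<theta> g)"
    unfolding continuous_on_sequentially comp_def
  proof (intro allI ballI impI, elim conjE)
    fix y x assume x: "x \<in> S" "\<forall>n. y n \<in> S" "y \<longlonglongrightarrow> x"
    show "(\<lambda>n. Res \<theta> g (y n)) \<longlonglongrightarrow> Res \<theta> g x"
      unfolding Res_def
    proof (rule integral_dominated_convergence[where w = "\<lambda>s. expw \<theta> s * B"])
      show "AE s in lborel. (\<lambda>n. expw \<theta> s * T (max 0 s) g (y n)) \<longlonglongrightarrow> expw \<theta> s * T (max 0 s) g x"
      proof (intro AE_I2 tendsto_mult tendsto_const)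
        fix s
        have "continuous_on S (T (max 0 s) g)" by (intro C0D(1) T_C0 g) simp
        then show "(\<lambda>n. T (max 0 s) g (y n)) \<longlonglongrightarrow> T (max 0 s) g x"
          using x unfolding continuous_on_sequentially comp_def by blast
      qed
      show "AE s in lborel. norm (expw \<theta> s * T (max 0 s) g (y n)) \<le> expw \<theta> s * B" for n
        using T_le_B by (auto simp: abs_mult expw_nonneg intro!: mult_left_mono)
      show "integrable lborel (\<lambda>s. expw \<theta> s * B)" using expw_integral(1)[OF \<theta>] by simp
      show "(\<lambda>s. expw \<theta> s * T (max 0 s) g x) \<in> borel_measurable lborel"
        using T_measurable_time[OF g] by simp
      show "(\<lambda>s. expw \<theta> s * T (max 0 s) g (y n)) \<in> borel_measurable lborel" for n
        using T_measurable_time[OF g] by simp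
    qed
  qed
  show "Res \<theta> g x = 0" if "x \<notin> S" for x using that by (simp add: Res_def T_outside)
  fix \<epsilon> :: real assume \<epsilon>: "0 < \<epsilon>"
  \<comment> \<open>\<open>2 * e\<close> integrates against the exponential weight to
    \<open>2 * e / \<theta> = \<epsilon> / 2\<close>; the tail after \<open>N\<close> takes the
    other half.\<close>
  define e where "e = \<epsilon> * \<theta> / 4"
  have e: "0 < e" using \<epsilon> \<theta> by (simp add: e_def)
  have "(\<lambda>n. \<integral>s. expw \<theta> s * (indicator {real n..} s * B) \<partial>lborel) \<longlonglongrightarrow> (\<integral>s. (0::real) \<partial>(lborel :: real measure))"
  proof (rule integral_dominated_convergence[where w = "\<lambda>s. expw \<theta> s * B"])
    show "AE s in lborel. (\<lambda>n. expw \<theta> s * (indicator {real n..} s * B)) \<longlonglongrightarrow> 0"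
    proof (intro AE_I2 tendsto_eventually)
      fix s :: real
      obtain N where "s < real N" using reals_Archimedean2 by blast
      then show "\<forall>\<^sub>F n in sequentially. expw \<theta> s * (indicator {real n..} s * B) = 0"
        unfolding eventually_sequentially by (intro exI[of _ N]) (auto simp: indicator_def)
    qed
    show "AE s in lborel. norm (expw \<theta> s * (indicator {real n..} s * B)) \<le> expw \<theta> s * B" for n
      using B0 by (auto simp: abs_mult expw_nonneg indicator_def)
    show "integrable lborel (\<lambda>s. expw \<theta> s * B)" using expw_integral(1)[OF \<theta>] by simp
  qed auto
  then have "\<forall>\<^sub>F n in sequentially. (\<integral>s. expw \<theta> s * (indicator {real n..} s * B) \<partial>lborel) < \<epsilon> / 2"
    using \<epsilon> by (intro order_tendstoD(2)) auto
  then obtain N where N: "(\<integral>s. expw \<theta> s * (indicator {real N..} s * B) \<partial>lborel) < \<epsilon> / 2"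
    by (auto simp: eventually_sequentially)
  obtain \<delta> where \<delta>: "0 < \<delta>" "\<And>s h x. 0 \<le> s \<Longrightarrow> 0 \<le> h \<Longrightarrow> h < \<delta> \<Longrightarrow> \<bar>T (s + h) g x - T s g x\<bar> \<le> e"
    using T_equicontinuous[OF g e] by blast
  obtain m where m: "1 / real (Suc m) < \<delta>" using \<delta>(1) reals_Archimedean by (auto simp: inverse_eq_divide)
  \<comment> \<open>The largest grid index needed for the times up to \<open>N\<close>, with mesh
    1/(m+1).\<close>
  define M where "M = nat \<lceil>real N * real (Suc m)\<rceil>"
  have "\<exists>K. compact K \<and> K \<subseteq> S \<and> (\<forall>x. x \<notin> K \<longrightarrow> \<bar>T (real k / real (Suc m)) g x\<bar> < e)" for k
    by (intro C0D(3) T_C0 g e) auto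
  then obtain K where K: "\<And>k. compact (K k)" "\<And>k. K k \<subseteq> S"
    "\<And>k x. x \<notin> K k \<Longrightarrow> \<bar>T (real k / real (Suc m)) g x\<bar> < e" by metis
  show "\<exists>K. compact K \<and> K \<subseteq> S \<and> (\<forall>x\<in>S - K. \<bar>Res \<theta> g x\<bar> < \<epsilon>)"
  proof (intro exI[of _ "\<Union>k\<le>M. K k"] conjI ballI)
    show "compact (\<Union>k\<le>M. K k)" using K(1) by (intro compact_UN) auto
    show "(\<Union>k\<le>M. K k) \<subseteq> S" using K(2) by auto
    fix x assume x: "x \<in> S - (\<Union>k\<le>M. K k)"
    have ptw: "\<bar>T (max 0 s) g x\<bar> \<le> 2 * e + indicator {real N..} s * B" for s
    proof (cases "s \<in> {real N..}")
      case True
      then show ?thesis using T_le_B[of s x] e by simp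
    next
      case False
      define r where "r = max 0 s"
      have r: "0 \<le> r" "r \<le> real N" using False by (auto simp: r_def)
      define k where "k = nat \<lfloor>r * real (Suc m)\<rfloor>"
      have r0: "0 \<le> r * real (Suc m)" using r by simp
      have k: "real k \<le> r * real (Suc m)" "r * real (Suc m) < real k + 1"
        unfolding k_def using r0 by linarith+
      have "r * real (Suc m) \<le> real N * real (Suc m)" using r by (intro mult_right_mono) auto
      then have "k \<le> M" unfolding k_def M_def by (intro nat_mono) linarith
      then have 1: "\<bar>T (real k / real (Suc m)) g x\<bar> < e" using x by (intro K(3)) auto
      have "0 \<le> r - real k / real (Suc m)" using k(1) by (simp add: field_simps)
      moreover have "r - real k / real (Suc m) < \<delta>"
      proof -
        have "r \<le> (real k + 1) / real (Suc m)" using k(2) by (subst pos_le_divide_eq) auto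
        then show ?thesis using m unfolding add_divide_distrib by linarith
      qed
      ultimately have "\<bar>T (real k / real (Suc m) + (r - real k / real (Suc m))) g x - T (real k / real (Suc m)) g x\<bar> \<le> e"
        by (intro \<delta>(2)) auto
      then show ?thesis using 1 False by (simp add: r_def)
    qed
    have iN: "integrable lborel (\<lambda>s. expw \<theta> s * (indicator {real N..} s * B))"
      using B0 by (intro expw_integrable_times[where B = B] \<theta>) (auto simp: indicator_def)
    have i2: "integrable lborel (\<lambda>s. expw \<theta> s * (2 * e))" using expw_integral(1)[OF \<theta>] by simp
    have "\<bar>Res \<theta> g x\<bar> \<le> (\<integral>s. expw \<theta> s * (2 * e) + expw \<theta> s * (indicator {real N..} s * B) \<partial>lborel)"
      unfolding Res_def using iN i2 ptw
      by (intro abs_integral_le_integral Res_integrable Bochner_Integration.integrable_add)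
         (auto simp: abs_mult expw_nonneg distrib_left[symmetric] intro!: mult_left_mono)
    also have "\<dots> = 2 * e / \<theta> + (\<integral>s. expw \<theta> s * (indicator {real N..} s * B) \<partial>lborel)"
      using iN i2 expw_integral[OF \<theta>] by simp
    also have "\<dots> < \<epsilon> / 2 + \<epsilon> / 2" using N \<theta> by (simp add: e_def)
    finally show "\<bar>Res \<theta> g x\<bar> < \<epsilon>" by simp
  qed
qed

text \<open>Fubini and the semigroup law turn \<open>T h\<close> into a time shift by
  \<open>h\<close> under the integral; the substitution produces the factor
  \<open>exp (\<theta> * h)\<close> and loses the piece \<open>{0..<h}\<close>.\<close>

lemma T_Res:
  assumes h: "0 \<le> h" and x: "x \<in> S"
  shows "T h (Res \<theta> g) x = exp (\<theta> * h) * (Res \<theta> g x - (\<integral>s. indicator {0..<h} s * exp (- \<theta> * s) * T (max 0 s) g x \<partial>lborel))"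
proof -
  interpret Qx: prob_space "Q x" by (rule Q_prob[OF x])
  define q where "q = distr (Q x) borel (\<lambda>\<eta>. \<eta> h)"
  have ev: "(\<lambda>\<eta>. \<eta> h) \<in> Q x \<rightarrow>\<^sub>M borel"
    using measurable_path_eval[OF h] by (subst measurable_cong_sets[OF Q_prob(2)[OF x] refl])
  interpret q: prob_space q unfolding q_def by (rule Qx.prob_space_distr[OF ev])
  have [measurable_cong]: "sets q = sets borel" by (simp add: q_def)
  interpret pair_sigma_finite lborel q ..
  have T_q: "T h f x = (\<integral>y. f y \<partial>q)" if "f \<in> borel_measurable borel" for f :: "'a \<Rightarrow> real"
    using x by (simp add: semigroup_of_def restrict0_def q_def integral_distr[OF ev that])
  have [measurable]: "(\<lambda>p. T (max 0 (fst p)) g (snd p)) \<in> borel_measurable (lborel \<Otimes>\<^sub>M q)"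
    using T_jointly_measurable[OF g] by (simp add: split_beta cong: measurable_cong_sets sets_pair_measure_cong)
  have int: "integrable (lborel \<Otimes>\<^sub>M q) (\<lambda>(s, y). expw \<theta> s * T (max 0 s) g y)"
  proof (rule integrableI_bounded)
    show "(\<lambda>(s, y). expw \<theta> s * T (max 0 s) g y) \<in> borel_measurable (lborel \<Otimes>\<^sub>M q)"
      unfolding split_beta by measurable
    have "(\<integral>\<^sup>+p. ennreal (norm (case p of (s, y) \<Rightarrow> expw \<theta> s * T (max 0 s) g y)) \<partial>(lborel \<Otimes>\<^sub>M q))
        = (\<integral>\<^sup>+s. (\<integral>\<^sup>+y. ennreal (norm (expw \<theta> s * T (max 0 s) g y)) \<partial>q) \<partial>lborel)"
      by (subst q.nn_integral_fst[symmetric]) (auto simp: split_beta)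
    also have "\<dots> \<le> (\<integral>\<^sup>+s. (\<integral>\<^sup>+y. ennreal (expw \<theta> s * B) \<partial>q) \<partial>lborel)"
      using T_le_B by (intro nn_integral_mono ennreal_leI) (auto simp: abs_mult expw_nonneg intro!: mult_left_mono)
    also have "\<dots> = (\<integral>\<^sup>+s. ennreal (expw \<theta> s * B) \<partial>lborel)" by (simp add: q.emeasure_space_1)
    also have "\<dots> < \<infinity>"
      using expw_integral(1)[OF \<theta>] order_trans[OF abs_ge_zero B] 
      by (subst nn_integral_eq_integral) (auto simp: expw_nonneg)
    finally show "(\<integral>\<^sup>+p. ennreal (norm (case p of (s, y) \<Rightarrow> expw \<theta> s * T (max 0 s) g y)) \<partial>(lborel \<Otimes>\<^sub>M q)) < \<infinity>" .
  qed
  have "T h (Res \<theta> g) x = (\<integral>y. (\<integral>s. expw \<theta> s * T (max 0 s) g y \<partial>lborel) \<partial>q)"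
    by (subst T_q[OF C0_measurable[OF Res_C0 S_borel]]) (simp add: Res_def[abs_def])
  also have "\<dots> = (\<integral>s. (\<integral>y. expw \<theta> s * T (max 0 s) g y \<partial>q) \<partial>lborel)"
    by (rule Fubini_integral[OF int])
  also have "\<dots> = (\<integral>s. expw \<theta> s * T (h + max 0 s) g x \<partial>lborel)"
  proof (rule Bochner_Integration.integral_cong[OF refl])
    fix s :: real
    have "(\<integral>y. T (max 0 s) g y \<partial>q) = T h (T (max 0 s) g) x"
      by (rule T_q[symmetric]) (intro C0_measurable[OF T_C0 S_borel] g, simp)
    also have "\<dots> = T (h + max 0 s) g x" using T_add[OF h _ g, of "max 0 s"] by simp
    finally show "(\<integral>y. expw \<theta> s * T (max 0 s) g y \<partial>q) = expw \<theta> s * T (h + max 0 s) g x" by simp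
  qed
  \<comment> \<open>After the substitution the time \<open>h + max 0 (s - h)\<close> is
    \<open>s\<close> for \<open>s \<ge> h\<close>, and for smaller \<open>s\<close> the weight is
    0.\<close>
  also have "\<dots> = (\<integral>s. expw \<theta> (- h + 1 * s) * T (h + max 0 (- h + 1 * s)) g x \<partial>lborel)"
    using lborel_integral_real_affine[of 1 "\<lambda>s. expw \<theta> s * T (h + max 0 s) g x" "- h"] by simp
  also have "\<dots> = (\<integral>s. exp (\<theta> * h) * (expw \<theta> s * T (max 0 s) g x - indicator {0..<h} s * exp (- \<theta> * s) * T (max 0 s) g x) \<partial>lborel)"
  proof (rule Bochner_Integration.integral_cong[OF refl])
    fix s :: real
    show "expw \<theta> (- h + 1 * s) * T (h + max 0 (- h + 1 * s)) g x =
        exp (\<theta> * h) * (expw \<theta> s * T (max 0 s) g x - indicator {0..<h} s * exp (- \<theta> * s) * T (max 0 s) g x)"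
    proof (cases "h \<le> s")
      case True
      then have "h + max 0 (- h + 1 * s) = max 0 s" using h by simp
      moreover have "expw \<theta> (- h + 1 * s) = exp (\<theta> * h) * expw \<theta> s"
        using True h by (simp add: expw_def mult_exp_exp algebra_simps)
      ultimately show ?thesis using True by simp
    next
      case False
      then show ?thesis by (simp add: expw_def indicator_def)
    qed
  qed
  also have "\<dots> = exp (\<theta> * h) * (Res \<theta> g x - (\<integral>s. indicator {0..<h} s * exp (- \<theta> * s) * T (max 0 s) g x \<partial>lborel))"
  proof -
    have "integrable lborel (\<lambda>s. expw \<theta> s * (indicator {0..<h} s * T (max 0 s) g x))"
      using T_le_B' order_trans[OF abs_ge_zero B] T_measurable_time[OF g]
      by (intro expw_integrable_times[where B = B] \<theta>) (auto simp: indicator_def)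
    also have "(\<lambda>s. expw \<theta> s * (indicator {0..<h} s * T (max 0 s) g x)) = (\<lambda>s. indicator {0..<h} s * exp (- \<theta> * s) * T (max 0 s) g x)"
      by (auto simp: expw_def indicator_def fun_eq_iff)
    finally show ?thesis using Res_integrable by (simp add: Res_def)
  qed
  finally show ?thesis .
qed

text \<open>The equation \<open>(\<theta> - L) f = g\<close> for \<open>f = Res \<theta> g\<close>,
  read off from \<open>T_Res\<close> as \<open>h\<close> tends to 0: the exponential factor gives
  \<open>\<theta> * f\<close>, the lost piece gives \<open>- g\<close>.\<close>

lemma Res_gen_rel: "gen_rel S T (Res \<theta> g) (\<lambda>x. \<theta> * Res \<theta> g x - g x)"
  unfolding gen_rel_def
proof (intro conjI)
  show "Res \<theta> g \<in> C0 S" by (rule Res_C0)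
  show "(\<lambda>x. \<theta> * Res \<theta> g x - g x) \<in> C0 S"
    using C0_lin[OF Res_C0 g, of \<theta> "- 1"] by simp
  have B0: "0 \<le> B" using order_trans[OF abs_ge_zero B] .
  show "uniform_limit S (\<lambda>h x. (T h (Res \<theta> g) x - Res \<theta> g x) / h) (\<lambda>x. \<theta> * Res \<theta> g x - g x) (at_right 0)"
  proof (rule uniform_limitI)
    fix \<epsilon> :: real assume \<epsilon>: "0 < \<epsilon>"
    obtain \<delta> where \<delta>: "0 < \<delta>" "\<And>s h x. 0 \<le> s \<Longrightarrow> 0 \<le> h \<Longrightarrow> h < \<delta> \<Longrightarrow> \<bar>T (s + h) g x - T s g x\<bar> \<le> \<epsilon> / 4"
      using T_equicontinuous[OF g, of "\<epsilon> / 4"] \<epsilon> by auto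
    \<comment> \<open>The part of the error that is explicit in \<open>h\<close>; equicontinuity
      supplies the remaining \<open>\<epsilon> / 4\<close>.\<close>
    define c where "c h = \<bar>(exp (\<theta> * h) - 1) / h - \<theta>\<bar> * (B / \<theta>) + (exp (\<theta> * h) - 1) * B" for h
    have "((\<lambda>h. (exp (\<theta> * h) - 1) / h) \<longlongrightarrow> \<theta>) (at 0)"
    proof -
      have "((\<lambda>h. exp (\<theta> * h)) has_field_derivative \<theta>) (at 0)"
        by (auto intro!: derivative_eq_intros)
      then show ?thesis by (simp add: has_field_derivative_iff)
    qed
    then have "((\<lambda>h. (exp (\<theta> * h) - 1) / h) \<longlongrightarrow> \<theta>) (at_right 0)"
      by (rule tendsto_within_subset) auto
    moreover have "((\<lambda>h. exp (\<theta> * h)) \<longlongrightarrow> exp (\<theta> * 0)) (at_right 0)" by (intro tendsto_intros)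
    ultimately have "(c \<longlongrightarrow> \<bar>\<theta> - \<theta>\<bar> * (B / \<theta>) + (exp (\<theta> * 0) - 1) * B) (at_right 0)"
      unfolding c_def[abs_def] by (intro tendsto_intros)
    then have "(c \<longlongrightarrow> 0) (at_right 0)" by simp
    then have "\<forall>\<^sub>F h in at_right 0. c h < \<epsilon> / 2" using \<epsilon> by (intro order_tendstoD(2)) auto
    moreover have "\<forall>\<^sub>F h in at_right 0. h \<in> {0<..<\<delta>}"
      using \<delta>(1) by (rule eventually_at_right_real)
    ultimately show "\<forall>\<^sub>F h in at_right 0. \<forall>x\<in>S. dist ((T h (Res \<theta> g) x - Res \<theta> g x) / h) (\<theta> * Res \<theta> g x - g x) < \<epsilon>"
    proof eventually_elim
      fix h assume ch: "c h < \<epsilon> / 2" and h: "h \<in> {0<..<\<delta>}"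
      show "\<forall>x\<in>S. dist ((T h (Res \<theta> g) x - Res \<theta> g x) / h) (\<theta> * Res \<theta> g x - g x) < \<epsilon>"
      proof
        fix x assume x: "x \<in> S"
        define J where "J = (\<integral>s. indicator {0..<h} s * exp (- \<theta> * s) * T (max 0 s) g x \<partial>lborel)"
        have iJ: "integrable lborel (\<lambda>s. indicator {0..<h} s * exp (- \<theta> * s) * T (max 0 s) g x)"
        proof -
          have "integrable lborel (\<lambda>s. expw \<theta> s * (indicator {0..<h} s * T (max 0 s) g x))"
            using T_le_B' B0 T_measurable_time[OF g]
            by (intro expw_integrable_times[where B = B] \<theta>) (auto simp: indicator_def)
          also have "(\<lambda>s. expw \<theta> s * (indicator {0..<h} s * T (max 0 s) g x)) = (\<lambda>s. indicator {0..<h} s * exp (- \<theta> * s) * T (max 0 s) g x)"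
            by (auto simp: expw_def indicator_def fun_eq_iff)
          finally show ?thesis .
        qed
        have ind: "integrable lborel (\<lambda>s. indicator {0..<h} s * a)" "(\<integral>s. indicator {0..<h} s * a \<partial>lborel) = h * a" for a :: real
          using h by (auto simp: emeasure_lborel_Ico)
        have "\<bar>exp (\<theta> * h) * J - h * g x\<bar> \<le> h * ((exp (\<theta> * h) - 1) * B + \<epsilon> / 4)"
        proof -
          have e1: "exp (\<theta> * h) * J - h * g x = (\<integral>s. exp (\<theta> * h) * (indicator {0..<h} s * exp (- \<theta> * s) * T (max 0 s) g x) - indicator {0..<h} s * g x \<partial>lborel)"
          proof -
            have "(\<integral>s. exp (\<theta> * h) * (indicator {0..<h} s * exp (- \<theta> * s) * T (max 0 s) g x) - indicator {0..<h} s * g x \<partial>lborel)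
                = (\<integral>s. exp (\<theta> * h) * (indicator {0..<h} s * exp (- \<theta> * s) * T (max 0 s) g x) \<partial>lborel) - (\<integral>s. indicator {0..<h} s * g x \<partial>lborel)"
              by (intro Bochner_Integration.integral_diff integrable_mult_right iJ ind(1))
            also have "\<dots> = exp (\<theta> * h) * J - h * g x"
              unfolding ind(2) J_def integral_mult_right_zero ..
            finally show ?thesis ..
          qed
          have e2: "\<bar>\<integral>s. exp (\<theta> * h) * (indicator {0..<h} s * exp (- \<theta> * s) * T (max 0 s) g x) - indicator {0..<h} s * g x \<partial>lborel\<bar> \<le> (\<integral>s. indicator {0..<h} s * ((exp (\<theta> * h) - 1) * B + \<epsilon> / 4) \<partial>lborel)"
          proof (rule abs_integral_le_integral)
            fix s
            show "\<bar>exp (\<theta> * h) * (indicator {0..<h} s * exp (- \<theta> * s) * T (max 0 s) g x) - indicator {0..<h} s * g x\<bar>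
              \<le> indicator {0..<h} s * ((exp (\<theta> * h) - 1) * B + \<epsilon> / 4)"
            proof (cases "s \<in> {0..<h}")
              case True
              \<comment> \<open>The factor \<open>exp (\<theta> * h) * exp (- \<theta> * s)\<close>
                left by the substitution; for \<open>0 \<le> s < h\<close> it lies between 1 and
                \<open>exp (\<theta> * h)\<close>.\<close>
              define a where "a = exp (\<theta> * (h - s))"
              have a: "1 \<le> a" "a \<le> exp (\<theta> * h)" using True \<theta> by (auto simp: a_def)
              have "\<bar>T s g x - g x\<bar> \<le> \<epsilon> / 4" using \<delta>(2)[of 0 s x] True h T_0[OF g] by simp
              moreover have "\<bar>(a - 1) * T s g x\<bar> \<le> (exp (\<theta> * h) - 1) * B"
                unfolding abs_mult using a T_le_B[of s x] True \<theta> by (intro mult_mono) auto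
              moreover have "a * T s g x - g x = (a - 1) * T s g x + (T s g x - g x)" by (simp add: algebra_simps)
              ultimately have "\<bar>a * T s g x - g x\<bar> \<le> (exp (\<theta> * h) - 1) * B + \<epsilon> / 4" by linarith
              moreover have "exp (\<theta> * h) * exp (- \<theta> * s) = a" by (simp add: a_def mult_exp_exp algebra_simps)
              ultimately show ?thesis using True by (simp add: mult.assoc[symmetric])
            qed simp
          next
            show "integrable lborel (\<lambda>s. exp (\<theta> * h) * (indicator {0..<h} s * exp (- \<theta> * s) * T (max 0 s) g x) - indicator {0..<h} s * g x)"
              by (intro Bochner_Integration.integrable_diff integrable_mult_right iJ ind(1))
            show "integrable lborel (\<lambda>s. indicator {0..<h} s * ((exp (\<theta> * h) - 1) * B + \<epsilon> / 4))"
              by (rule ind(1))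
          qed
          show ?thesis unfolding e1 using e2 unfolding ind(2) .
        qed
        then have 1: "\<bar>(exp (\<theta> * h) * J - h * g x) / h\<bar> \<le> (exp (\<theta> * h) - 1) * B + \<epsilon> / 4"
          using h by (simp add: abs_divide pos_divide_le_eq mult.commute)
        have 2: "\<bar>((exp (\<theta> * h) - 1) / h - \<theta>) * Res \<theta> g x\<bar> \<le> \<bar>(exp (\<theta> * h) - 1) / h - \<theta>\<bar> * (B / \<theta>)"
          unfolding abs_mult by (intro mult_left_mono Res_bound) auto
        have "(T h (Res \<theta> g) x - Res \<theta> g x) / h - (\<theta> * Res \<theta> g x - g x)
            = ((exp (\<theta> * h) - 1) / h - \<theta>) * Res \<theta> g x - (exp (\<theta> * h) * J - h * g x) / h"
        proof -
          have "(exp (\<theta> * h) * J - h * g x) / h = exp (\<theta> * h) * J / h - g x"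
            using h by (simp add: diff_divide_distrib)
          moreover have "T h (Res \<theta> g) x = exp (\<theta> * h) * (Res \<theta> g x - J)"
            unfolding J_def using h x by (intro T_Res) auto
          ultimately show ?thesis
            by (simp add: diff_divide_distrib left_diff_distrib right_diff_distrib)
        qed
        then show "dist ((T h (Res \<theta> g) x - Res \<theta> g x) / h) (\<theta> * Res \<theta> g x - g x) < \<epsilon>"
        proof -
          have "\<bar>w\<bar> < \<epsilon>" if "w = u - v" "\<bar>v\<bar> \<le> a + \<epsilon> / 4" "\<bar>u\<bar> \<le> b" "b + a < \<epsilon> / 2" for u v w a b
            using that \<epsilon> by linarith
          from this[OF _ 1 2 ch[unfolded c_def]] show ?thesis
            unfolding dist_real_def \<open>(T h (Res \<theta> g) x - Res \<theta> g x) / h - (\<theta> * Res \<theta> g x - g x) = _\<close> by blast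
        qed
      qed
    qed
  qed
qed

end

end

subsection \<open>The resolvent and jump kernels\<close>

definition exp_time :: "real \<Rightarrow> real measure" where
  "exp_time \<theta> = density lborel (exponential_density \<theta>)"

lemma prob_exp_time: "0 < \<theta> \<Longrightarrow> prob_space (exp_time \<theta>)"
  unfolding exp_time_def by (rule prob_space_exponential_density)

lemma sets_exp_time [measurable_cong]: "sets (exp_time \<theta>) = sets borel"
  by (simp add: exp_time_def)

lemma integral_exp_time:
  assumes "0 < \<theta>" "h \<in> borel_measurable borel"
  shows "(\<integral>t. h t \<partial>exp_time \<theta>) = \<theta> * (\<integral>t. expw \<theta> t * h t \<partial>lborel)"
proof -
  have "(\<integral>t. h t \<partial>exp_time \<theta>) = (\<integral>t. exponential_density \<theta> t * h t \<partial>lborel)"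
    unfolding exp_time_def using assms
    by (subst integral_density) (auto simp: exponential_density_nonneg)
  then show ?thesis by (simp add: exponential_density_expw mult.assoc)
qed

locale jump_diffusion =
  fixes I :: "'i set" and S :: "'i \<Rightarrow> 'a::metric_space set" and Q :: "'i \<Rightarrow> 'a \<Rightarrow> (real \<Rightarrow> 'a) measure"
    and C :: "'i \<Rightarrow> ('a \<Rightarrow> real) set" and Edges :: "'e set" and tail head :: "'e \<Rightarrow> 'i"
    and K :: "'e \<Rightarrow> 'a \<Rightarrow> 'a measure" and rate :: "'e \<Rightarrow> 'a \<Rightarrow> real"
  assumes I: "countable I" and disj: "disjoint_family_on S I" and cover: "(\<Union>\<alpha>\<in>I. S \<alpha>) = UNIV"
    and S: "\<And>\<alpha>. \<alpha> \<in> I \<Longrightarrow> S \<alpha> \<in> sets borel"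
    and D: "assumption_D I S Q C" and J: "assumption_J I S Edges tail head K rate"
begin

abbreviation str where "str \<equiv> stratum_of I S"

lemma str_eq: assumes "\<alpha> \<in> I" "x \<in> S \<alpha>" shows "str x = \<alpha>"
  unfolding stratum_of_def using assms disj by (intro the_equality) (auto simp: disjoint_family_on_def)

lemma str_in: "str x \<in> I" "x \<in> S (str x)"
proof -
  have "x \<in> (\<Union>\<alpha>\<in>I. S \<alpha>)" by (simp add: cover)
  then obtain \<alpha> where "\<alpha> \<in> I" "x \<in> S \<alpha>" by blast
  then show "str x \<in> I" "x \<in> S (str x)" using str_eq by auto
qed

lemma feller: assumes "\<alpha> \<in> I" shows "feller_family (S \<alpha>) (Q \<alpha>)"
  using assms D S unfolding assumption_D_def feller_family_def by blast

lemma measurable_strata: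
  assumes "\<And>\<alpha>. \<alpha> \<in> I \<Longrightarrow> f \<in> restrict_space borel (S \<alpha>) \<rightarrow>\<^sub>M M"
  shows "f \<in> borel \<rightarrow>\<^sub>M M"
proof (rule measurable_piecewise_restrict[where C = "S ` I"])
  show "countable (S ` I)" using I by (rule countable_image)
  show "space borel \<subseteq> \<Union> (S ` I)" by (simp add: cover)
qed (use assms S in auto)

text \<open>The diffusion is run in the stratum of its starting point, which makes one kernel on the
  whole space out of the family; without jumps that stratum is never left.\<close>

definition diff_kernel :: "real \<Rightarrow> 'a \<Rightarrow> 'a measure" where
  "diff_kernel t x = distr (Q (str x) x) borel (\<lambda>\<eta>. \<eta> (max 0 t))"

lemma Q_eval:
  assumes "\<alpha> \<in> I" "x \<in> S \<alpha>"
  shows "(\<lambda>\<eta>. \<eta> (max 0 t)) \<in> Q \<alpha> x \<rightarrow>\<^sub>M borel"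
proof -
  interpret feller_family "S \<alpha>" "Q \<alpha>" by (rule feller[OF assms(1)])
  show ?thesis
    using measurable_path_eval[of "max 0 t" "S \<alpha>"]
    by (subst measurable_cong_sets[OF Q_prob(2)[OF assms(2)] refl]) simp
qed

lemma diff_kernel_measurable:
  "(\<lambda>(t, x). diff_kernel t x) \<in> borel \<Otimes>\<^sub>M borel \<rightarrow>\<^sub>M prob_algebra borel"
proof (rule measurable_piecewise_restrict[where C = "(\<lambda>\<alpha>. UNIV \<times> S \<alpha>) ` I"])
  show "countable ((\<lambda>\<alpha>. UNIV \<times> S \<alpha>) ` I)" using I by (rule countable_image)
  show "space (borel \<Otimes>\<^sub>M borel) \<subseteq> \<Union> ((\<lambda>\<alpha>. (UNIV :: real set) \<times> S \<alpha>) ` I)"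
    using str_in by (auto simp: space_pair_measure)
  fix \<Omega> assume "\<Omega> \<in> (\<lambda>\<alpha>. (UNIV :: real set) \<times> S \<alpha>) ` I"
  then obtain \<alpha> where \<alpha>: "\<alpha> \<in> I" and \<Omega>: "\<Omega> = UNIV \<times> S \<alpha>" by auto
  interpret feller_family "S \<alpha>" "Q \<alpha>" by (rule feller[OF \<alpha>])
  show "\<Omega> \<inter> space (borel \<Otimes>\<^sub>M borel) \<in> sets (borel \<Otimes>\<^sub>M borel)"
    unfolding \<Omega> using S[OF \<alpha>] by (simp add: space_pair_measure)
  let ?L = "restrict_space (borel \<Otimes>\<^sub>M borel) (UNIV \<times> S \<alpha>) :: (real \<times> 'a) measure"
  have "snd \<in> ?L \<rightarrow>\<^sub>M restrict_space borel (S \<alpha>)"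
    by (rule measurable_restrict_space3) auto
  from measurable_compose[OF this Q_kernel]
  have g: "(\<lambda>q. Q \<alpha> (snd q)) \<in> ?L \<rightarrow>\<^sub>M prob_algebra (path_space (S \<alpha>))" .
  have "(\<lambda>z. (fst (fst z), snd z)) \<in> ?L \<Otimes>\<^sub>M path_space (S \<alpha>) \<rightarrow>\<^sub>M borel \<Otimes>\<^sub>M path_space (S \<alpha>)"
    by (intro measurable_Pair measurable_compose[OF measurable_fst measurable_restrict_space1[OF measurable_fst]] measurable_snd)
  from measurable_compose[OF this measurable_path_eval_pair]
  have f: "(\<lambda>(q, \<eta>). \<eta> (max 0 (fst q))) \<in> ?L \<Otimes>\<^sub>M path_space (S \<alpha>) \<rightarrow>\<^sub>M borel"
    by (simp add: split_beta)
  have "(\<lambda>q. distr (Q \<alpha> (snd q)) borel (\<lambda>\<eta>. \<eta> (max 0 (fst q)))) \<in> ?L \<rightarrow>\<^sub>M prob_algebra borel"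
    by (rule measurable_distr_prob_space2[OF g f])
  then show "(\<lambda>(t, x). diff_kernel t x) \<in> restrict_space (borel \<Otimes>\<^sub>M borel) \<Omega> \<rightarrow>\<^sub>M prob_algebra borel"
    unfolding \<Omega>
    by (subst measurable_cong[where g = "\<lambda>q. distr (Q \<alpha> (snd q)) borel (\<lambda>\<eta>. \<eta> (max 0 (fst q)))"])
       (auto simp: space_restrict_space diff_kernel_def str_eq[OF \<alpha>])
qed

text \<open>The resolvent of the diffusion times \<open>\<theta>\<close>: the law at an independent
  exponential time of rate \<open>\<theta>\<close>.\<close>

definition res_kernel :: "real \<Rightarrow> 'a \<Rightarrow> 'a measure" where
  "res_kernel \<theta> x = exp_time \<theta> \<bind> (\<lambda>t. diff_kernel t x)"

lemma res_kernel_measurable: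
  assumes "0 < \<theta>" shows "res_kernel \<theta> \<in> borel \<rightarrow>\<^sub>M prob_algebra borel"
  unfolding res_kernel_def[abs_def]
proof (rule measurable_bind_prob_space2[where N = borel])
  show "(\<lambda>x. exp_time \<theta>) \<in> borel \<rightarrow>\<^sub>M prob_algebra borel"
    using prob_exp_time[OF assms] by (intro measurable_const) (simp add: space_prob_algebra sets_exp_time)
  have "(\<lambda>q. (snd q, fst q)) \<in> (borel :: 'a measure) \<Otimes>\<^sub>M borel \<rightarrow>\<^sub>M (borel :: real measure) \<Otimes>\<^sub>M borel" by measurable
  from measurable_compose[OF this diff_kernel_measurable]
  show "(\<lambda>(x, t). diff_kernel t x) \<in> borel \<Otimes>\<^sub>M borel \<rightarrow>\<^sub>M prob_algebra borel" by (simp add: split_beta)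
qed

lemma diff_kernel_from: "(\<lambda>t. diff_kernel t x) \<in> borel \<rightarrow>\<^sub>M prob_algebra borel"
proof -
  have "(\<lambda>t. (t, x)) \<in> borel \<rightarrow>\<^sub>M borel \<Otimes>\<^sub>M borel" by (intro measurable_Pair) auto
  from measurable_compose[OF this diff_kernel_measurable] show ?thesis by simp
qed

text \<open>Outside \<open>S \<alpha>\<close> both sides vanish: the paths stay in their own
  stratum, which is disjoint from \<open>S \<alpha>\<close>, and \<open>g\<close> is extended by
  zero.\<close>

lemma integral_diff_kernel:
  assumes \<alpha>: "\<alpha> \<in> I" and g: "g \<in> C0 (S \<alpha>)"
  shows "(\<integral>y. g y \<partial>diff_kernel t x) = semigroup_of (S \<alpha>) (Q \<alpha>) (max 0 t) g x"
proof -
  interpret feller_family "S (str x)" "Q (str x)" by (rule feller[OF str_in(1)])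
  have gm: "g \<in> borel_measurable borel" by (rule C0_measurable[OF g S[OF \<alpha>]])
  have "(\<integral>y. g y \<partial>diff_kernel t x) = (\<integral>\<eta>. g (\<eta> (max 0 t)) \<partial>Q (str x) x)"
    unfolding diff_kernel_def by (rule integral_distr[OF Q_eval[OF str_in] gm])
  also have "\<dots> = semigroup_of (S \<alpha>) (Q \<alpha>) (max 0 t) g x"
  proof (cases "str x = \<alpha>")
    case True
    then show ?thesis using str_in(2)[of x] by (simp add: semigroup_of_def restrict0_def)
  next
    case False
    then have x: "x \<notin> S \<alpha>" using str_eq[OF \<alpha>] by auto
    have "(\<integral>\<eta>. g (\<eta> (max 0 t)) \<partial>Q (str x) x) = (\<integral>\<eta>. 0 \<partial>Q (str x) x)"
    proof (rule Bochner_Integration.integral_cong[OF refl])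
      fix \<eta> assume "\<eta> \<in> space (Q (str x) x)"
      then have "\<eta> \<in> cadlag_paths (S (str x))"
        using sets_eq_imp_space_eq[OF Q_prob(2)[OF str_in(2)]] by simp
      then have "\<eta> (max 0 t) \<in> S (str x)" by (rule cadlag_pathsD) simp
      then have "\<eta> (max 0 t) \<notin> S \<alpha>" using False str_eq[OF \<alpha>] str_eq[OF str_in(1)] by metis
      then show "g (\<eta> (max 0 t)) = 0" by (rule C0D(2)[OF g])
    qed
    then show ?thesis using x by (simp add: semigroup_of_def restrict0_def)
  qed
  finally show ?thesis .
qed

lemma integral_res_kernel:
  assumes \<theta>: "0 < \<theta>" and \<alpha>: "\<alpha> \<in> I" and g: "g \<in> C0 (S \<alpha>)"
  shows "(\<integral>y. g y \<partial>res_kernel \<theta> x) = \<theta> * feller_family.Res (S \<alpha>) (Q \<alpha>) \<theta> g x"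
proof -
  interpret feller_family "S \<alpha>" "Q \<alpha>" by (rule feller[OF \<alpha>])
  obtain B where B: "\<And>x. \<bar>g x\<bar> \<le> B" using C0_bounded[OF g] by blast
  have k: "(\<lambda>t. diff_kernel t x) \<in> exp_time \<theta> \<rightarrow>\<^sub>M prob_algebra borel"
    using diff_kernel_from by (subst measurable_cong_sets[OF sets_exp_time refl])
  have "(\<integral>y. g y \<partial>res_kernel \<theta> x) = (\<integral>t. T (max 0 t) g x \<partial>exp_time \<theta>)"
    unfolding res_kernel_def
    using integral_bind_bounded[OF prob_exp_time[OF \<theta>] k C0_measurable[OF g S[OF \<alpha>]], of B] B
    by (simp add: integral_diff_kernel[OF \<alpha> g])
  also have "\<dots> = \<theta> * Res \<theta> g x"
    unfolding Res_def by (rule integral_exp_time[OF \<theta> T_measurable_time[OF g]])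
  finally show ?thesis .
qed

section \<open>The jump measure and its uniformisation\<close>

abbreviation out :: "'a \<Rightarrow> 'e set" where "out x \<equiv> out_edges Edges tail (str x)"
abbreviation jm :: "'a \<Rightarrow> 'a measure" where "jm \<equiv> jump_measure I S Edges tail K rate"
abbreviation tr :: "'a \<Rightarrow> ennreal" where "tr \<equiv> total_rate I S Edges tail rate"

lemma countable_out: "countable (out_edges Edges tail \<alpha>)"
  using J unfolding assumption_J_def out_edges_def by (auto intro: countable_subset)

lemma out_D:
  assumes "e \<in> out_edges Edges tail \<alpha>" "x \<in> S \<alpha>"
  shows "prob_space (K e x)" "sets (K e x) = sets borel" "emeasure (K e x) UNIV = 1"
proof -
  have e: "e \<in> Edges" "tail e = \<alpha>" using assms by (auto simp: out_edges_def)
  then have k: "K e \<in> restrict_space borel (S \<alpha>) \<rightarrow>\<^sub>M prob_algebra borel"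
    using J unfolding assumption_J_def by blast
  show 1: "prob_space (K e x)" and 2: "sets (K e x) = sets borel"
    using prob_kernelD[OF k, of x] assms(2) by (auto simp: space_restrict_space)
  show "emeasure (K e x) UNIV = 1"
    using prob_space.emeasure_space_1[OF 1] sets_eq_imp_space_eq[OF 2] by simp
qed

lemma sets_jm [measurable_cong]: "sets (jm x) = sets borel"
  unfolding jump_measure_def using sets.sigma_sets_eq[of "borel :: 'a measure"]
  by (simp add: sets_measure_of_conv)

lemma space_jm [simp]: "space (jm x) = UNIV"
  using sets_eq_imp_space_eq[OF sets_jm] by simp

text \<open>\<open>measure_of\<close> falls back to the zero measure unless the set function is
  countably additive; so the sum over the edges has to be interchanged with countable unions
  first.\<close>

lemma emeasure_jm:
  assumes "B \<in> sets borel"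
  shows "emeasure (jm x) B = (\<integral>\<^sup>+e. ennreal (rate e x) * emeasure (K e x) B \<partial>count_space (out x))"
proof -
  let ?\<mu> = "\<lambda>B. \<integral>\<^sup>+e. ennreal (rate e x) * emeasure (K e x) B \<partial>count_space (out x)"
  have "emeasure (measure_of UNIV (sets borel) ?\<mu>) B = ?\<mu> B"
  proof (rule emeasure_measure_of_sigma)
    show "sigma_algebra UNIV (sets (borel :: 'a measure))"
      using sets.sigma_algebra_axioms[of "borel :: 'a measure"] by simp
    show "positive (sets borel) ?\<mu>" by (simp add: positive_def)
    show "countably_additive (sets borel) ?\<mu>"
    proof (rule countably_additiveI)
      fix A :: "nat \<Rightarrow> 'a set" assume A: "range A \<subseteq> sets borel" "disjoint_family A"
      have "(\<Sum>i. ?\<mu> (A i)) = (\<integral>\<^sup>+e. (\<Sum>i. ennreal (rate e x) * emeasure (K e x) (A i)) \<partial>count_space (out x))"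
        by (rule nn_integral_suminf[symmetric]) simp
      also have "\<dots> = ?\<mu> (\<Union>i. A i)"
      proof (rule nn_integral_cong)
        fix e assume "e \<in> space (count_space (out x))"
        then have "sets (K e x) = sets borel" using out_D(2)[OF _ str_in(2)] by simp
        then show "(\<Sum>i. ennreal (rate e x) * emeasure (K e x) (A i)) = ennreal (rate e x) * emeasure (K e x) (\<Union>i. A i)"
          using A by (simp add: ennreal_suminf_cmult suminf_emeasure)
      qed
      finally show "(\<Sum>i. ?\<mu> (A i)) = ?\<mu> (\<Union>i. A i)" .
    qed
  qed fact
  then show ?thesis by (simp add: jump_measure_def)
qed

lemma emeasure_jm_UNIV: "emeasure (jm x) UNIV = tr x"
  unfolding total_rate_def by (subst emeasure_jm) (auto intro!: nn_integral_cong simp: out_D(3)[OF _ str_in(2)])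

lemma measurable_emeasure_jm:
  assumes B: "B \<in> sets borel" shows "(\<lambda>x. emeasure (jm x) B) \<in> borel_measurable borel"
proof (rule measurable_strata)
  fix \<alpha> assume \<alpha>: "\<alpha> \<in> I"
  let ?O = "out_edges Edges tail \<alpha>"
  interpret sigma_finite_measure "count_space ?O"
    by (rule sigma_finite_measure_count_space_countable[OF countable_out])
  have "(\<lambda>(e, x). ennreal (rate e x) * emeasure (K e x) B) \<in> borel_measurable (count_space ?O \<Otimes>\<^sub>M restrict_space borel (S \<alpha>))"
  proof (rule measurable_pair_measure_countable1[OF countable_out])
    fix e assume "e \<in> ?O"
    then have e: "e \<in> Edges" "tail e = \<alpha>" by (auto simp: out_edges_def)
    then have k: "K e \<in> restrict_space borel (S \<alpha>) \<rightarrow>\<^sub>M prob_algebra borel"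
      and [measurable]: "rate e \<in> borel_measurable (restrict_space borel (S \<alpha>))"
      using J unfolding assumption_J_def by blast+
    have [measurable]: "(\<lambda>x. emeasure (K e x) B) \<in> borel_measurable (restrict_space borel (S \<alpha>))"
      by (rule measurable_kernel_emeasure[OF k B])
    show "(\<lambda>x. case (e, x) of (e, x) \<Rightarrow> ennreal (rate e x) * emeasure (K e x) B) \<in> borel_measurable (restrict_space borel (S \<alpha>))"
      by simp
  qed
  from measurable_compose[OF measurable_pair_swap' this]
  have "(\<lambda>(x, e). ennreal (rate e x) * emeasure (K e x) B) \<in> borel_measurable (restrict_space borel (S \<alpha>) \<Otimes>\<^sub>M count_space ?O)"
    by (simp add: split_beta)
  then have "(\<lambda>x. \<integral>\<^sup>+e. ennreal (rate e x) * emeasure (K e x) B \<partial>count_space ?O) \<in> borel_measurable (restrict_space borel (S \<alpha>))"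
    by (rule borel_measurable_nn_integral)
  then show "(\<lambda>x. emeasure (jm x) B) \<in> borel_measurable (restrict_space borel (S \<alpha>))"
    by (subst measurable_cong[where g = "\<lambda>x. \<integral>\<^sup>+e. ennreal (rate e x) * emeasure (K e x) B \<partial>count_space ?O"])
       (auto simp: emeasure_jm[OF B] space_restrict_space str_eq[OF \<alpha>])
qed

text \<open>The maximum with 1 makes division by the bound harmless even if there are no jumps at
  all.\<close>

definition Rb :: real where "Rb = max 1 (SOME R. \<forall>x. tr x \<le> ennreal R)"

lemma tr_le: "tr x \<le> ennreal Rb"
proof -
  have "\<exists>R::real. \<forall>x. tr x \<le> ennreal R" using J unfolding assumption_J_def by blast
  then have "\<forall>x. tr x \<le> ennreal (SOME R. \<forall>x. tr x \<le> ennreal R)" by (rule someI_ex)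
  then show ?thesis unfolding Rb_def by (meson ennreal_leI max.cobounded2 order_trans)
qed

lemma Rb_ge_1: "1 \<le> Rb" by (simp add: Rb_def)

definition w :: "'a \<Rightarrow> real" where "w x = enn2real (tr x)"

lemma w: "tr x = ennreal (w x)" "0 \<le> w x" "w x \<le> Rb"
proof -
  have "tr x < \<infinity>" using tr_le by (rule le_less_trans) simp
  then show 1: "tr x = ennreal (w x)" by (simp add: w_def)
  show "0 \<le> w x" by (simp add: w_def)
  then show "w x \<le> Rb" using tr_le[of x] Rb_ge_1 unfolding 1 by (simp add: ennreal_le_iff)
qed

text \<open>
  Uniformisation: the jumps of rate \<open>\<nu>(x, dy)\<close> are those of the probability kernel below at
  the constant rate \<open>Rb\<close>, fictitious jumps from \<open>x\<close> to \<open>x\<close> included.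
\<close>

definition jump_kernel :: "'a \<Rightarrow> 'a measure" where
  "jump_kernel x = count_space (UNIV :: bool set) \<bind>
     (\<lambda>b. if b then scale_measure (ennreal (1 / Rb)) (jm x)
          else scale_measure (ennreal (1 - w x / Rb)) (return borel x))"

text \<open>Binding over counting measure on two points adds the two scaled measures. Each is only a
  subprobability; the weight \<open>1 - w x / Rb\<close> is what completes the total mass to
  1.\<close>

lemma nn_integral_jump_kernel:
  assumes f: "f \<in> borel_measurable borel"
  shows "(\<integral>\<^sup>+y. f y \<partial>jump_kernel x) = ennreal (1 / Rb) * (\<integral>\<^sup>+y. f y \<partial>jm x) + ennreal (1 - w x / Rb) * f x"
proof -
  let ?k = "\<lambda>b. if b then scale_measure (ennreal (1 / Rb)) (jm x)
          else scale_measure (ennreal (1 - w x / Rb)) (return borel x)"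
  have wR: "0 \<le> 1 - w x / Rb" "1 - w x / Rb \<le> 1" using w[of x] Rb_ge_1 by (auto simp: field_simps)
  have "subprob_space (scale_measure (ennreal (1 / Rb)) (jm x))"
  proof (rule subprob_spaceI)
    have "emeasure (scale_measure (ennreal (1 / Rb)) (jm x)) UNIV \<le> ennreal (1 / Rb) * ennreal Rb"
      using tr_le by (simp add: emeasure_jm_UNIV mult_left_mono)
    also have "\<dots> = 1" using Rb_ge_1 by (simp add: ennreal_mult''[symmetric])
    finally show "emeasure (scale_measure (ennreal (1 / Rb)) (jm x)) (space (scale_measure (ennreal (1 / Rb)) (jm x))) \<le> 1"
      by (simp add: space_scale_measure)
  qed (simp add: space_scale_measure)
  moreover have "subprob_space (scale_measure (ennreal (1 - w x / Rb)) (return borel x))"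
    using wR by (intro subprob_spaceI) (auto simp: space_scale_measure)
  ultimately have k: "?k \<in> count_space UNIV \<rightarrow>\<^sub>M subprob_algebra borel"
    by (auto simp: space_subprob_algebra sets_jm)
  have fj: "f \<in> borel_measurable (jm x)" using f by simp
  have "(\<integral>\<^sup>+y. f y \<partial>jump_kernel x) = (\<integral>\<^sup>+b. (\<integral>\<^sup>+y. f y \<partial>?k b) \<partial>count_space UNIV)"
    unfolding jump_kernel_def by (rule nn_integral_bind[OF f k])
  also have "\<dots> = (\<integral>\<^sup>+y. f y \<partial>?k True) + (\<integral>\<^sup>+y. f y \<partial>?k False)"
    by (subst nn_integral_count_space_finite) (auto simp: UNIV_bool)
  also have "\<dots> = ennreal (1 / Rb) * (\<integral>\<^sup>+y. f y \<partial>jm x) + ennreal (1 - w x / Rb) * f x"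
    using f by (simp add: nn_integral_scale_measure[OF fj] nn_integral_scale_measure nn_integral_return)
  finally show ?thesis .
qed

lemma sets_jump_kernel: "sets (jump_kernel x) = sets borel"
  unfolding jump_kernel_def by (rule sets_bind) (auto simp: sets_jm)

lemma emeasure_jump_kernel:
  assumes "B \<in> sets borel"
  shows "emeasure (jump_kernel x) B = ennreal (1 / Rb) * emeasure (jm x) B + ennreal (1 - w x / Rb) * indicator B x"
  using nn_integral_jump_kernel[of "indicator B" x] assms by (simp add: sets_jump_kernel sets_jm)

lemma jump_kernel_measurable: "jump_kernel \<in> borel \<rightarrow>\<^sub>M prob_algebra borel"
proof (rule measurable_prob_algebraI)
  show "prob_space (jump_kernel x)" for x
  proof (rule prob_spaceI)
    have "space (jump_kernel x) = UNIV" using sets_eq_imp_space_eq[OF sets_jump_kernel] by simp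
    moreover have "emeasure (jump_kernel x) UNIV = ennreal (1 / Rb) * ennreal (w x) + ennreal (1 - w x / Rb)"
      by (simp add: emeasure_jump_kernel emeasure_jm_UNIV w(1))
    moreover have "\<dots> = ennreal (w x / Rb + (1 - w x / Rb))"
      using w[of x] Rb_ge_1 by (subst ennreal_plus) (auto simp: ennreal_mult''[symmetric] divide_le_eq_1)
    ultimately show "emeasure (jump_kernel x) (space (jump_kernel x)) = 1" by simp
  qed
  then have sp: "subprob_space (jump_kernel x)" for x by (rule prob_space_imp_subprob_space)
  have [measurable]: "w \<in> borel_measurable borel"
    unfolding w_def[abs_def] emeasure_jm_UNIV[symmetric]
    by (intro borel_measurable_enn2real measurable_emeasure_jm) auto
  show "jump_kernel \<in> borel \<rightarrow>\<^sub>M subprob_algebra borel"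
  proof (rule measurable_subprob_algebra[OF sp sets_jump_kernel])
    fix B :: "'a set" assume B[measurable]: "B \<in> sets borel"
    note measurable_emeasure_jm[OF B, measurable]
    show "(\<lambda>x. emeasure (jump_kernel x) B) \<in> borel_measurable borel"
      unfolding emeasure_jump_kernel[OF B] by measurable
  qed
qed

text \<open>Fictitious jumps contribute \<open>f x - f x\<close>, so replacing the rates by the
  constant \<open>Rb\<close> does not change the operator. A shift by \<open>B\<close> makes the
  integrand nonnegative, as the formula for the jump kernel is one for nonnegative
  functions.\<close>

lemma jump_operator:
  fixes f :: "'a \<Rightarrow> real"
  assumes f[measurable]: "f \<in> borel_measurable borel" and B: "\<And>y. \<bar>f y\<bar> \<le> B"
  shows "(\<integral>y. (f y - f x) \<partial>jm x) = Rb * ((\<integral>y. f y \<partial>jump_kernel x) - f x)"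
proof -
  interpret N: prob_space "jump_kernel x" by (rule kernelD_borel[OF jump_kernel_measurable])
  interpret jm: finite_measure "jm x"
    by (rule finite_measureI) (simp add: emeasure_jm_UNIV w(1))
  note [measurable_cong] = sets_jump_kernel
  define h where "h y = f y + B" for y
  have h0: "0 \<le> h y" for y using B[of y] by (simp add: h_def)
  have hB: "\<bar>h y\<bar> \<le> 2 * B" for y using B[of y] by (simp add: h_def)
  have [measurable]: "h \<in> borel_measurable borel" unfolding h_def[abs_def] by measurable
  have ih: "integrable (jm x) h" "integrable (jump_kernel x) h"
    using hB by (auto intro!: jm.integrable_const_bound[where B = "2 * B"] N.integrable_const_bound[where B = "2 * B"])
  have mw: "measure (jm x) UNIV = w x" using w(2)[of x] by (simp add: measure_def emeasure_jm_UNIV w(1))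
  have wR: "0 \<le> 1 - w x / Rb" using w[of x] Rb_ge_1 by (auto simp: field_simps)
  have "ennreal (\<integral>y. h y \<partial>jump_kernel x) = (\<integral>\<^sup>+y. ennreal (h y) \<partial>jump_kernel x)"
    using ih h0 by (intro nn_integral_eq_integral[symmetric]) auto
  also have "\<dots> = ennreal (1 / Rb) * (\<integral>\<^sup>+y. ennreal (h y) \<partial>jm x) + ennreal (1 - w x / Rb) * ennreal (h x)"
    by (rule nn_integral_jump_kernel) measurable
  also have "(\<integral>\<^sup>+y. ennreal (h y) \<partial>jm x) = ennreal (\<integral>y. h y \<partial>jm x)"
    using ih h0 by (intro nn_integral_eq_integral) auto
  also have "ennreal (1 / Rb) * ennreal (\<integral>y. h y \<partial>jm x) + ennreal (1 - w x / Rb) * ennreal (h x)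
      = ennreal (1 / Rb * (\<integral>y. h y \<partial>jm x) + (1 - w x / Rb) * h x)"
  proof -
    have j0: "0 \<le> (\<integral>y. h y \<partial>jm x)" using h0 by (intro integral_nonneg_AE) auto
    show ?thesis
      unfolding ennreal_mult''[OF j0, symmetric] ennreal_mult''[OF h0, symmetric]
      using j0 h0[of x] wR Rb_ge_1 by (intro ennreal_plus[symmetric]) auto
  qed
  finally have e: "(\<integral>y. h y \<partial>jump_kernel x) = 1 / Rb * (\<integral>y. h y \<partial>jm x) + (1 - w x / Rb) * h x"
    using h0 wR Rb_ge_1 by (subst (asm) ennreal_inj) (auto intro!: integral_nonneg_AE add_nonneg_nonneg mult_nonneg_nonneg)
  have "(\<integral>y. (f y - f x) \<partial>jm x) = (\<integral>y. (h y - h x) \<partial>jm x)" by (simp add: h_def)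
  also have "\<dots> = (\<integral>y. h y \<partial>jm x) - w x * h x" using ih by (simp add: mw)
  also have "\<dots> = Rb * ((\<integral>y. h y \<partial>jump_kernel x) - h x)"
    unfolding e using Rb_ge_1 by (simp add: field_simps)
  also have "(\<integral>y. h y \<partial>jump_kernel x) - h x = (\<integral>y. f y \<partial>jump_kernel x) - f x"
  proof -
    have "integrable (jump_kernel x) f" using B by (auto intro!: N.integrable_const_bound[where B = B])
    then have "(\<integral>y. h y \<partial>jump_kernel x) = (\<integral>y. f y \<partial>jump_kernel x) + B"
      unfolding h_def using N.prob_space by simp
    then show ?thesis by (simp add: h_def)
  qed
  finally show ?thesis .
qed

end

subsection \<open>The forward equation\<close>

text \<open>Integration by parts in Fubini form: the weight after time \<open>s\<close> integrates
  to \<open>expw \<theta> s / \<theta>\<close>, so measurability and boundedness of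
  \<open>\<phi>\<close> are enough.\<close>

lemma laplace_primitive:
  fixes \<phi> :: "real \<Rightarrow> real"
  assumes \<theta>: "0 < \<theta>" and \<phi>[measurable]: "\<phi> \<in> borel_measurable borel" and B: "\<And>s. \<bar>\<phi> s\<bar> \<le> B"
  shows "\<theta> * (\<integral>t. expw \<theta> t * (\<integral>s. indicator {0..t} s * \<phi> s \<partial>lborel) \<partial>lborel) = (\<integral>s. expw \<theta> s * \<phi> s \<partial>lborel)"
proof -
  have B0: "0 \<le> B" using order_trans[OF abs_ge_zero B] .
  have tail: "(\<integral>\<^sup>+t. ennreal (expw \<theta> t * indicator {0..t} s) \<partial>lborel) = ennreal (expw \<theta> s / \<theta>)" for s
  proof (cases "0 \<le> s")
    case True
    have "(\<integral>\<^sup>+t. ennreal (expw \<theta> t * indicator {0..t} s) \<partial>lborel) = (\<integral>\<^sup>+t. ennreal (expw \<theta> (s + 1 * t) * indicator {0..s + 1 * t} s) \<partial>lborel)"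
      using nn_integral_real_affine[of "\<lambda>t. ennreal (expw \<theta> t * indicator {s..} t)" 1 s] True
      by (simp add: indicator_def of_bool_def cong: if_cong)
    also have "\<dots> = (\<integral>\<^sup>+t. ennreal (exp (- \<theta> * s)) * ennreal (expw \<theta> t) \<partial>lborel)"
      using True by (intro nn_integral_cong) (auto simp: expw_def indicator_def ennreal_mult''[symmetric] mult_exp_exp algebra_simps)
    also have "\<dots> = ennreal (exp (- \<theta> * s)) * ennreal (1 / \<theta>)"
      using expw_integral[OF \<theta>] by (subst nn_integral_cmult) (auto simp: nn_integral_eq_integral expw_nonneg)
    also have "\<dots> = ennreal (expw \<theta> s / \<theta>)"
      using \<theta> True by (simp add: expw_def ennreal_mult''[symmetric])
    finally show ?thesis .
  next
    case False
    then show ?thesis by (simp add: expw_def indicator_def)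
  qed
  have meas: "(\<lambda>(t, s). expw \<theta> t * (indicator {0..t} s * \<phi> s)) \<in> borel_measurable (lborel \<Otimes>\<^sub>M lborel)"
  proof -
    have "(\<lambda>p. expw \<theta> (fst p) * ((if 0 \<le> snd p \<and> snd p \<le> fst p then 1 else 0) * \<phi> (snd p))) \<in> borel_measurable (lborel \<Otimes>\<^sub>M lborel)"
      by measurable
    then show ?thesis by (simp add: split_beta indicator_def of_bool_def cong: if_cong)
  qed
  have meas2: "(\<lambda>(t, s). ennreal (expw \<theta> t * indicator {0..t} s)) \<in> borel_measurable (lborel \<Otimes>\<^sub>M lborel)"
  proof -
    have "(\<lambda>p. ennreal (expw \<theta> (fst p) * (if 0 \<le> snd p \<and> snd p \<le> fst p then 1 else 0))) \<in> borel_measurable (lborel \<Otimes>\<^sub>M lborel)"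
      by measurable
    then show ?thesis by (simp add: split_beta indicator_def of_bool_def cong: if_cong)
  qed
  have int: "integrable (lborel \<Otimes>\<^sub>M lborel) (\<lambda>(t, s). expw \<theta> t * (indicator {0..t} s * \<phi> s))"
  proof (rule integrableI_bounded[OF meas])
    have "(\<integral>\<^sup>+p. ennreal (norm (case p of (t, s) \<Rightarrow> expw \<theta> t * (indicator {0..t} s * \<phi> s))) \<partial>(lborel \<Otimes>\<^sub>M lborel))
        \<le> (\<integral>\<^sup>+p. (case p of (t, s) \<Rightarrow> ennreal (expw \<theta> t * indicator {0..t} s)) * ennreal B \<partial>(lborel \<Otimes>\<^sub>M lborel))"
    proof (rule nn_integral_mono)
      fix p :: "real \<times> real"
      obtain t s where p: "p = (t, s)" by (cases p)
      show "ennreal (norm (case p of (t, s) \<Rightarrow> expw \<theta> t * (indicator {0..t} s * \<phi> s))) \<le> (case p of (t, s) \<Rightarrow> ennreal (expw \<theta> t * indicator {0..t} s)) * ennreal B"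
        using B[of s] B0 unfolding p
        by (auto simp: indicator_def abs_mult expw_nonneg ennreal_mult''[symmetric] intro!: ennreal_leI mult_left_mono)
    qed
    also have "\<dots> = (\<integral>\<^sup>+p. (case p of (t, s) \<Rightarrow> ennreal (expw \<theta> t * indicator {0..t} s)) \<partial>(lborel \<Otimes>\<^sub>M lborel)) * ennreal B"
      by (rule nn_integral_multc[OF meas2])
    also have "(\<integral>\<^sup>+p. (case p of (t, s) \<Rightarrow> ennreal (expw \<theta> t * indicator {0..t} s)) \<partial>(lborel \<Otimes>\<^sub>M lborel)) =
        (\<integral>\<^sup>+s. (\<integral>\<^sup>+t. ennreal (expw \<theta> t * indicator {0..t} s) \<partial>lborel) \<partial>lborel)"
      using lborel_pair.nn_integral_snd[OF meas2] by simp
    also have "\<dots> = (\<integral>\<^sup>+s. ennreal (expw \<theta> s / \<theta>) \<partial>lborel)" by (simp add: tail)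
    also have "\<dots> = ennreal (\<integral>s. expw \<theta> s / \<theta> \<partial>lborel)"
      using expw_integral(1)[OF \<theta>] \<theta> by (intro nn_integral_eq_integral) (auto simp: expw_nonneg)
    finally show "(\<integral>\<^sup>+p. ennreal (norm (case p of (t, s) \<Rightarrow> expw \<theta> t * (indicator {0..t} s * \<phi> s))) \<partial>(lborel \<Otimes>\<^sub>M lborel)) < \<infinity>"
      by (rule le_less_trans) (simp add: ennreal_mult_less_top)
  qed
  have "(\<integral>t. expw \<theta> t * (\<integral>s. indicator {0..t} s * \<phi> s \<partial>lborel) \<partial>lborel) = (\<integral>t. (\<integral>s. expw \<theta> t * (indicator {0..t} s * \<phi> s) \<partial>lborel) \<partial>lborel)"
    by simp
  also have "\<dots> = (\<integral>s. (\<integral>t. expw \<theta> t * (indicator {0..t} s * \<phi> s) \<partial>lborel) \<partial>lborel)"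
    by (rule lborel_pair.Fubini_integral[OF int, symmetric])
  also have "\<dots> = (\<integral>s. (expw \<theta> s / \<theta>) * \<phi> s \<partial>lborel)"
  proof (rule Bochner_Integration.integral_cong[OF refl])
    fix s
    have "(\<integral>t. expw \<theta> t * (indicator {0..t} s * \<phi> s) \<partial>lborel) = (\<integral>t. (expw \<theta> t * indicator {0..t} s) * \<phi> s \<partial>lborel)"
      by (simp add: mult.assoc)
    also have "\<dots> = (\<integral>t. expw \<theta> t * indicator {0..t} s \<partial>lborel) * \<phi> s" by simp
    also have "(\<integral>t. expw \<theta> t * indicator {0..t} s \<partial>lborel) = expw \<theta> s / \<theta>"
    proof -
      have "(\<lambda>t. expw \<theta> t * (if 0 \<le> s \<and> s \<le> t then 1 else 0)) \<in> borel_measurable lborel" by measurable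
      then have "(\<lambda>t. expw \<theta> t * indicator {0..t} s) \<in> borel_measurable lborel"
        by (simp add: indicator_def of_bool_def cong: if_cong)
      then have "(\<integral>t. expw \<theta> t * indicator {0..t} s \<partial>lborel) = enn2real (\<integral>\<^sup>+t. ennreal (expw \<theta> t * indicator {0..t} s) \<partial>lborel)"
        by (intro integral_eq_nn_integral) (auto simp: expw_nonneg)
      then show ?thesis using \<theta> by (simp add: tail expw_nonneg)
    qed
    finally show "(\<integral>t. expw \<theta> t * (indicator {0..t} s * \<phi> s) \<partial>lborel) = (expw \<theta> s / \<theta>) * \<phi> s" .
  qed
  also have "\<dots> = (\<integral>s. expw \<theta> s * \<phi> s \<partial>lborel) / \<theta>" by simp
  finally show ?thesis using \<theta> by simp
qed

lemma integrable_interval: "integrable lborel (\<lambda>s. indicator {0..t::real} s * (c::real))"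
  by (intro integrable_mult_left integrable_real_indicator) (auto simp: emeasure_lborel_Icc_eq)

context jump_diffusion
begin

abbreviation sg where "sg \<alpha> \<equiv> semigroup_of (S \<alpha>) (Q \<alpha>)"
abbreviation Lg where "Lg \<alpha> \<equiv> gen (S \<alpha>) (sg \<alpha>)"
abbreviation AA where "AA \<equiv> full_generator I S Q (jump_measure I S Edges tail K rate)"

definition jop :: "('a \<Rightarrow> real) \<Rightarrow> 'a \<Rightarrow> real" where
  "jop f x = Rb * ((\<integral>y. f y \<partial>jump_kernel x) - f x)"

lemma jop_measurable [measurable]:
  "f \<in> borel_measurable borel \<Longrightarrow> jop f \<in> borel_measurable borel"
  unfolding jop_def[abs_def] using measurable_kernel_integral[OF jump_kernel_measurable] by measurable

lemma jump_kernel_integral_bound: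
  fixes f :: "'a \<Rightarrow> real"
  assumes "f \<in> borel_measurable borel" "\<And>y. \<bar>f y\<bar> \<le> B"
  shows "\<bar>\<integral>y. f y \<partial>jump_kernel x\<bar> \<le> B"
  using assms by (intro prob_space.abs_integral_le kernelD_borel[OF jump_kernel_measurable])
    (auto cong: measurable_cong_sets simp: sets_jump_kernel)

lemma jop_bound:
  assumes "f \<in> borel_measurable borel" "\<And>y. \<bar>f y\<bar> \<le> B"
  shows "\<bar>jop f x\<bar> \<le> Rb * (2 * B)"
proof -
  have "\<bar>(\<integral>y. f y \<partial>jump_kernel x) - f x\<bar> \<le> 2 * B"
    using jump_kernel_integral_bound[OF assms, of x] assms(2)[of x] by linarith
  then show ?thesis using Rb_ge_1 by (simp add: jop_def abs_mult mult_left_mono)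
qed

lemma jop_diff:
  assumes f: "f \<in> borel_measurable borel" "\<And>y. \<bar>f y\<bar> \<le> B" and g: "g \<in> borel_measurable borel" "\<And>y. \<bar>g y\<bar> \<le> B'"
  shows "jop f x - jop g x = jop (\<lambda>y. f y - g y) x"
proof -
  interpret N: prob_space "jump_kernel x" by (rule kernelD_borel[OF jump_kernel_measurable])
  note [measurable_cong] = sets_jump_kernel
  have "integrable (jump_kernel x) f" "integrable (jump_kernel x) g"
    using f g by (auto intro!: N.integrable_bounded)
  then show ?thesis by (simp add: jop_def algebra_simps)
qed

lemma gen_domD:
  assumes "f \<in> gen_dom (S \<alpha>) (sg \<alpha>)"
  shows "gen_rel (S \<alpha>) (sg \<alpha>) f (Lg \<alpha> f)" "f \<in> C0 (S \<alpha>)" "Lg \<alpha> f \<in> C0 (S \<alpha>)"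
proof -
  obtain h where h: "gen_rel (S \<alpha>) (sg \<alpha>) f h" using assms by (auto simp: gen_dom_def)
  then show 1: "gen_rel (S \<alpha>) (sg \<alpha>) f (Lg \<alpha> f)" by (simp add: gen_eqI)
  then show "f \<in> C0 (S \<alpha>)" "Lg \<alpha> f \<in> C0 (S \<alpha>)" by (auto simp: gen_rel_def)
qed

lemma D_facts:
  assumes "\<alpha> \<in> I"
  shows "linear_subspace (C \<alpha>)" "is_core (S \<alpha>) (sg \<alpha>) (C \<alpha>)" "measure_determining (S \<alpha>) (C \<alpha>)"
    "C \<alpha> \<subseteq> gen_dom (S \<alpha>) (sg \<alpha>)"
  using D assms unfolding assumption_D_def is_core_def by blast+

lemma gen_zero: "Lg \<alpha> (\<lambda>_. 0) = (\<lambda>_. 0)"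
proof (rule gen_eqI)
  have z: "(\<lambda>_. 0) \<in> C0 (S \<alpha>)" unfolding C0_def by (auto intro!: exI[of _ "{}"])
  have "sg \<alpha> t (\<lambda>_. 0) = (\<lambda>_. 0)" for t by (auto simp: semigroup_of_def restrict0_def fun_eq_iff)
  then show "gen_rel (S \<alpha>) (sg \<alpha>) (\<lambda>_. 0) (\<lambda>_. 0)"
    using z by (simp add: gen_rel_def uniform_limit_const)
qed

text \<open>Extension by zero makes a core function of one stratum a global test function. Off
  \<open>S \<alpha>\<close> its generator term is that of the zero function, which leaves the jump
  term alone.\<close>

lemma core_in_D0:
  assumes \<alpha>: "\<alpha> \<in> I" and u: "u \<in> C \<alpha>"
  shows "u \<in> D0 I S C" "AA u x = Lg \<alpha> u x + jop u x"
proof -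
  have dom: "u \<in> gen_dom (S \<alpha>) (sg \<alpha>)" using D_facts(4)[OF \<alpha>] u by blast
  note gd = gen_domD[OF dom]
  have out0: "u x = 0" if "x \<notin> S \<alpha>" for x using C0D(2)[OF gd(2) that] .
  have um: "u \<in> borel_measurable borel" by (rule C0_measurable[OF gd(2) S[OF \<alpha>]])
  obtain B where B: "\<And>x. \<bar>u x\<bar> \<le> B" using C0_bounded[OF gd(2)] by blast
  have same: "restrict0 u (S \<alpha>) = u" using out0 by (auto simp: restrict0_def fun_eq_iff)
  have other: "restrict0 u (S \<beta>) = (\<lambda>_. 0)" if "\<beta> \<in> I" "\<beta> \<noteq> \<alpha>" for \<beta>
  proof (rule ext)
    fix x
    have "x \<notin> S \<alpha>" if "x \<in> S \<beta>"
      using str_eq[OF \<alpha>, of x] str_eq[OF \<open>\<beta> \<in> I\<close> that] \<open>\<beta> \<noteq> \<alpha>\<close> by auto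
    then show "restrict0 u (S \<beta>) x = 0" using out0 by (simp add: restrict0_def)
  qed
  show "u \<in> D0 I S C"
    unfolding D0_def
  proof (intro CollectI conjI ballI)
    show "bounded (range u)" using B by (auto simp: bounded_iff)
    show "restrict0 u (S \<beta>) \<in> C \<beta>" if "\<beta> \<in> I" for \<beta>
      using same other[OF that] u D_facts(1)[OF that] by (cases "\<beta> = \<alpha>") (auto simp: linear_subspace_def)
    have "{\<beta> \<in> I. \<exists>x\<in>S \<beta>. u x \<noteq> 0} \<subseteq> {\<alpha>}"
    proof
      fix \<beta> assume "\<beta> \<in> {\<beta> \<in> I. \<exists>x\<in>S \<beta>. u x \<noteq> 0}"
      then obtain x where x: "\<beta> \<in> I" "x \<in> S \<beta>" "u x \<noteq> 0" by blast
      then have "x \<in> S \<alpha>" using out0 by blast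
      then show "\<beta> \<in> {\<alpha>}" using str_eq[OF \<alpha>, of x] str_eq[OF x(1,2)] by simp
    qed
    then show "finite {\<beta> \<in> I. \<exists>x\<in>S \<beta>. u x \<noteq> 0}" by (rule finite_subset) simp
  qed (rule um)
  have "Lg (str x) (restrict0 u (S (str x))) x = Lg \<alpha> u x"
  proof (cases "str x = \<alpha>")
    case False
    then have "x \<notin> S \<alpha>" using str_eq[OF \<alpha>] by blast
    then show ?thesis using other[OF str_in(1) False] C0D(2)[OF gd(3)] gen_zero by simp
  qed (simp add: same)
  then show "AA u x = Lg \<alpha> u x + jop u x"
    unfolding full_generator_def Let_def jop_def jump_operator[OF um B] by simp
qed

text \<open>A weak Kolmogorov equation for a flow of one-dimensional laws, detached from any
  process: it can be restarted at any time and asked of any initial law.\<close>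

definition forward :: "(real \<Rightarrow> 'a measure) \<Rightarrow> bool" where
  "forward m \<longleftrightarrow> m \<in> borel \<rightarrow>\<^sub>M prob_algebra borel \<and>
     (\<forall>\<alpha>\<in>I. \<forall>f\<in>C \<alpha>. \<forall>t\<ge>0. (\<integral>y. f y \<partial>m t) = (\<integral>y. f y \<partial>m 0) + (\<integral>s. indicator {0..t} s * (\<integral>y. AA f y \<partial>m s) \<partial>lborel))"

context
  fixes m :: "real \<Rightarrow> 'a measure"
  assumes m: "forward m"
begin

lemma m_kernel: "m \<in> borel \<rightarrow>\<^sub>M prob_algebra borel"
  using m by (simp add: forward_def)

lemmas prob_m = kernelD_borel(1)[OF m_kernel]
lemmas sets_m [measurable_cong] = kernelD_borel(2)[OF m_kernel]

lemma m_bound: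
  fixes f :: "'a \<Rightarrow> real"
  assumes "f \<in> borel_measurable borel" "\<And>y. \<bar>f y\<bar> \<le> B"
  shows "\<bar>\<integral>y. f y \<partial>m t\<bar> \<le> B"
  using assms by (intro prob_space.abs_integral_le prob_m) auto

lemma m_integrable:
  fixes f :: "'a \<Rightarrow> real"
  assumes "f \<in> borel_measurable borel" "\<And>y. \<bar>f y\<bar> \<le> B"
  shows "integrable (m t) f"
  using assms by (intro prob_space.integrable_bounded prob_m) auto

lemma m_measurable [measurable]:
  fixes f :: "'a \<Rightarrow> real"
  assumes "f \<in> borel_measurable borel" shows "(\<lambda>t. \<integral>y. f y \<partial>m t) \<in> borel_measurable borel"
  by (rule measurable_kernel_integral[OF m_kernel assms])

lemma m_diff_bound:
  fixes f g :: "'a \<Rightarrow> real"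
  assumes "f \<in> borel_measurable borel" "\<And>y. \<bar>f y\<bar> \<le> B" "g \<in> borel_measurable borel" "\<And>y. \<bar>g y\<bar> \<le> B'"
    and "\<And>y. \<bar>f y - g y\<bar> \<le> \<epsilon>"
  shows "\<bar>(\<integral>y. f y \<partial>m t) - (\<integral>y. g y \<partial>m t)\<bar> \<le> \<epsilon>"
proof -
  have "(\<integral>y. f y \<partial>m t) - (\<integral>y. g y \<partial>m t) = (\<integral>y. f y - g y \<partial>m t)"
    using m_integrable[OF assms(1,2)] m_integrable[OF assms(3,4)] by simp
  also have "\<bar>\<dots>\<bar> \<le> \<epsilon>" using assms by (intro m_bound) auto
  finally show ?thesis .
qed

lemma time_integral_diff_bound:
  fixes \<phi> \<psi> :: "real \<Rightarrow> real"
  assumes "\<phi> \<in> borel_measurable borel" "\<And>s. \<bar>\<phi> s\<bar> \<le> B" "\<psi> \<in> borel_measurable borel" "\<And>s. \<bar>\<psi> s\<bar> \<le> B'"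
    and "\<And>s. \<bar>\<phi> s - \<psi> s\<bar> \<le> \<epsilon>" and t: "0 \<le> t"
  shows "\<bar>(\<integral>s. indicator {0..t} s * \<phi> s \<partial>lborel) - (\<integral>s. indicator {0..t} s * \<psi> s \<partial>lborel)\<bar> \<le> t * \<epsilon>"
proof -
  have i: "integrable lborel (\<lambda>s. indicator {0..t} s * \<phi> s)" if "\<phi> \<in> borel_measurable borel" "\<And>s. \<bar>\<phi> s\<bar> \<le> B" for \<phi> :: "real \<Rightarrow> real" and B
  proof (rule Bochner_Integration.integrable_bound[of _ "\<lambda>s. indicator {0..t} s * B"])
    show "AE s in lborel. norm (indicator {0..t} s * \<phi> s) \<le> norm (indicator {0..t} s * B)"
      using that(2) by (auto simp: indicator_def intro: order_trans[OF _ abs_ge_self])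
    show "integrable lborel (\<lambda>s. indicator {0..t} s * B)" by (rule integrable_interval)
  qed (use that(1) in simp)
  have "(\<integral>s. indicator {0..t} s * \<phi> s \<partial>lborel) - (\<integral>s. indicator {0..t} s * \<psi> s \<partial>lborel) =
      (\<integral>s. indicator {0..t} s * (\<phi> s - \<psi> s) \<partial>lborel)"
    using i[OF assms(1,2)] i[OF assms(3,4)] by (simp add: right_diff_distrib)
  also have "\<bar>\<dots>\<bar> \<le> (\<integral>s. indicator {0..t} s * \<epsilon> \<partial>lborel)"
  proof (rule abs_integral_le_integral)
    show "integrable lborel (\<lambda>s. indicator {0..t} s * (\<phi> s - \<psi> s))"
      using i[OF assms(1,2)] i[OF assms(3,4)] by (simp add: right_diff_distrib)
    show "integrable lborel (\<lambda>s. indicator {0..t} s * \<epsilon>)" by (rule integrable_interval)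
    show "\<bar>indicator {0..t} s * (\<phi> s - \<psi> s)\<bar> \<le> indicator {0..t} s * \<epsilon>" for s
      using assms(5)[of s] by (auto simp: indicator_def)
  qed
  also have "\<dots> = t * \<epsilon>" using t by simp
  finally show ?thesis .
qed

text \<open>Both sides are continuous in the graph norm of the generator, in which a core is dense.
  The extension matters because resolvents lie in the domain but need not lie in
  \<open>C \<alpha>\<close>.\<close>

lemma forward_domain:
  assumes \<alpha>: "\<alpha> \<in> I" and f: "f \<in> gen_dom (S \<alpha>) (sg \<alpha>)" and t: "0 \<le> t"
  shows "(\<integral>y. f y \<partial>m t) = (\<integral>y. f y \<partial>m 0) + (\<integral>s. indicator {0..t} s * (\<integral>y. Lg \<alpha> f y + jop f y \<partial>m s) \<partial>lborel)"
proof -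
  note gf = gen_domD[OF f]
  have meas[measurable]: "h \<in> borel_measurable borel" if "h \<in> C0 (S \<alpha>)" for h
    by (rule C0_measurable[OF that S[OF \<alpha>]])
  note [measurable] = meas[OF gf(2)] meas[OF gf(3)]
  obtain Bf where Bf: "\<And>y. \<bar>f y\<bar> \<le> Bf" using C0_bounded[OF gf(2)] by blast
  obtain BL where BL: "\<And>y. \<bar>Lg \<alpha> f y\<bar> \<le> BL" using C0_bounded[OF gf(3)] by blast
  have BA: "\<bar>Lg \<alpha> f y + jop f y\<bar> \<le> BL + Rb * (2 * Bf)" for y
    using BL[of y] jop_bound[OF meas[OF gf(2)] Bf, of y] by linarith
  obtain u where u: "\<And>k. u k \<in> C \<alpha>" and lim: "uniform_limit (S \<alpha>) u f sequentially"
    "uniform_limit (S \<alpha>) (\<lambda>k. Lg \<alpha> (u k)) (Lg \<alpha> f) sequentially"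
    using D_facts(2)[OF \<alpha>] f unfolding is_core_def by blast
  define E where "E = (\<integral>y. f y \<partial>m t) - (\<integral>y. f y \<partial>m 0) - (\<integral>s. indicator {0..t} s * (\<integral>y. Lg \<alpha> f y + jop f y \<partial>m s) \<partial>lborel)"
  \<comment> \<open>An error \<open>\<epsilon>\<close> in \<open>f\<close> counts at the times
    \<open>t\<close> and 0; over \<open>{0..t}\<close> the generator contributes
    \<open>\<epsilon>\<close> and the jump operator, of norm at most \<open>2 * Rb\<close>, the
    rest.\<close>
  have "\<bar>E\<bar> \<le> \<epsilon> * (2 + t * (1 + 2 * Rb))" if \<epsilon>: "0 < \<epsilon>" for \<epsilon>
  proof -
    have "\<forall>\<^sub>F k in sequentially. (\<forall>x\<in>S \<alpha>. dist (u k x) (f x) < \<epsilon>) \<and> (\<forall>x\<in>S \<alpha>. dist (Lg \<alpha> (u k) x) (Lg \<alpha> f x) < \<epsilon>)"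
      using uniform_limitD[OF lim(1) \<epsilon>] uniform_limitD[OF lim(2) \<epsilon>] by (rule eventually_conj)
    then obtain k where k: "\<And>x. x \<in> S \<alpha> \<Longrightarrow> dist (u k x) (f x) < \<epsilon>" "\<And>x. x \<in> S \<alpha> \<Longrightarrow> dist (Lg \<alpha> (u k) x) (Lg \<alpha> f x) < \<epsilon>"
      by (auto simp: eventually_sequentially)
    have dom: "u k \<in> gen_dom (S \<alpha>) (sg \<alpha>)" using D_facts(4)[OF \<alpha>] u by blast
    note gu = gen_domD[OF dom]
    note [measurable] = meas[OF gu(2)] meas[OF gu(3)]
    have d1: "\<bar>f x - u k x\<bar> \<le> \<epsilon>" and d2: "\<bar>Lg \<alpha> f x - Lg \<alpha> (u k) x\<bar> \<le> \<epsilon>" for x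
      using k[of x] C0D(2)[OF gf(2), of x] C0D(2)[OF gf(3), of x] C0D(2)[OF gu(2), of x] C0D(2)[OF gu(3), of x] \<epsilon>
      by (cases "x \<in> S \<alpha>"; simp add: dist_real_def abs_minus_commute less_imp_le)+
    obtain Bu where Bu: "\<And>y. \<bar>u k y\<bar> \<le> Bu" using C0_bounded[OF gu(2)] by blast
    obtain BLu where BLu: "\<And>y. \<bar>Lg \<alpha> (u k) y\<bar> \<le> BLu" using C0_bounded[OF gu(3)] by blast
    have BAu: "\<bar>Lg \<alpha> (u k) y + jop (u k) y\<bar> \<le> BLu + Rb * (2 * Bu)" for y
      using BLu[of y] jop_bound[OF meas[OF gu(2)] Bu, of y] by linarith
    have Am: "(\<lambda>y. Lg \<alpha> f y + jop f y) \<in> borel_measurable borel"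
      by (intro borel_measurable_add jop_measurable meas gf)
    have Aum: "(\<lambda>y. Lg \<alpha> (u k) y + jop (u k) y) \<in> borel_measurable borel"
      by (intro borel_measurable_add jop_measurable meas gu)
    have d3: "\<bar>(Lg \<alpha> f y + jop f y) - (Lg \<alpha> (u k) y + jop (u k) y)\<bar> \<le> \<epsilon> * (1 + 2 * Rb)" for y
    proof -
      have "\<bar>jop (\<lambda>y. f y - u k y) y\<bar> \<le> Rb * (2 * \<epsilon>)"
        using d1 by (intro jop_bound) measurable
      then show ?thesis
        using d2[of y] jop_diff[OF meas[OF gf(2)] Bf meas[OF gu(2)] Bu, of y] by (simp add: algebra_simps)
    qed
    have eq: "(\<integral>y. u k y \<partial>m t) = (\<integral>y. u k y \<partial>m 0) + (\<integral>s. indicator {0..t} s * (\<integral>y. Lg \<alpha> (u k) y + jop (u k) y \<partial>m s) \<partial>lborel)"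
    proof -
      have "(\<integral>y. u k y \<partial>m t) = (\<integral>y. u k y \<partial>m 0) + (\<integral>s. indicator {0..t} s * (\<integral>y. AA (u k) y \<partial>m s) \<partial>lborel)"
        using m \<alpha> u t unfolding forward_def by blast
      then show ?thesis unfolding core_in_D0(2)[OF \<alpha> u] .
    qed
    have b1: "\<bar>(\<integral>y. f y \<partial>m r) - (\<integral>y. u k y \<partial>m r)\<bar> \<le> \<epsilon>" for r
      by (rule m_diff_bound[OF meas[OF gf(2)] Bf meas[OF gu(2)] Bu d1])
    have b2: "\<bar>(\<integral>s. indicator {0..t} s * (\<integral>y. Lg \<alpha> f y + jop f y \<partial>m s) \<partial>lborel)
        - (\<integral>s. indicator {0..t} s * (\<integral>y. Lg \<alpha> (u k) y + jop (u k) y \<partial>m s) \<partial>lborel)\<bar> \<le> t * (\<epsilon> * (1 + 2 * Rb))"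
    proof (rule time_integral_diff_bound[OF _ _ _ _ _ t])
      show "\<bar>\<integral>y. Lg \<alpha> f y + jop f y \<partial>m s\<bar> \<le> BL + Rb * (2 * Bf)" for s
        by (rule m_bound[OF Am BA])
      show "\<bar>\<integral>y. Lg \<alpha> (u k) y + jop (u k) y \<partial>m s\<bar> \<le> BLu + Rb * (2 * Bu)" for s
        by (rule m_bound[OF Aum BAu])
      show "\<bar>(\<integral>y. Lg \<alpha> f y + jop f y \<partial>m s) - (\<integral>y. Lg \<alpha> (u k) y + jop (u k) y \<partial>m s)\<bar> \<le> \<epsilon> * (1 + 2 * Rb)" for s
        by (rule m_diff_bound[OF Am BA Aum BAu d3])
      show "(\<lambda>s. \<integral>y. Lg \<alpha> f y + jop f y \<partial>m s) \<in> borel_measurable borel" by (rule m_measurable[OF Am])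
      show "(\<lambda>s. \<integral>y. Lg \<alpha> (u k) y + jop (u k) y \<partial>m s) \<in> borel_measurable borel" by (rule m_measurable[OF Aum])
    qed
    show ?thesis unfolding E_def using eq b1[of t] b1[of 0] b2 by (simp add: algebra_simps)
  qed
  note small = this
  have "E = 0"
  proof (rule ccontr)
    assume "E \<noteq> 0"
    define c where "c = 2 + t * (1 + 2 * Rb)"
    have "0 \<le> t * (1 + 2 * Rb)" using t Rb_ge_1 by simp
    then have c: "0 < c" by (simp add: c_def)
    have "\<bar>E\<bar> \<le> \<bar>E\<bar> / (2 * c) * c" using small[of "\<bar>E\<bar> / (2 * c)"] c \<open>E \<noteq> 0\<close> by (simp add: c_def[symmetric])
    then show False using c \<open>E \<noteq> 0\<close> by simp
  qed
  then show ?thesis by (simp add: E_def)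
qed

text \<open>The flow sampled at an independent exponential time. Its integrals are
  \<open>\<theta>\<close> times Laplace transforms, but being a measure it can be composed with
  kernels.\<close>

definition U :: "real \<Rightarrow> 'a measure" where "U \<theta> = exp_time \<theta> \<bind> m"

lemma m_from_exp_time: "m \<in> exp_time \<theta> \<rightarrow>\<^sub>M prob_algebra borel"
  using m_kernel by (subst measurable_cong_sets[OF sets_exp_time refl])

lemma U_in: assumes "0 < \<theta>" shows "U \<theta> \<in> space (prob_algebra borel)"
proof -
  have "(\<lambda>_::unit. exp_time \<theta>) \<in> count_space UNIV \<rightarrow>\<^sub>M prob_algebra borel"
    using prob_exp_time[OF assms] by (simp add: space_prob_algebra sets_exp_time)
  from measurable_space[OF measurable_bind_prob_space[OF this m_kernel], of "()"] show ?thesis by (simp add: U_def)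
qed

lemma prob_U: "0 < \<theta> \<Longrightarrow> prob_space (U \<theta>)" and sets_U: "0 < \<theta> \<Longrightarrow> sets (U \<theta>) = sets borel"
  using U_in by (auto simp: space_prob_algebra)

lemma integral_U:
  fixes f :: "'a \<Rightarrow> real"
  assumes \<theta>: "0 < \<theta>" and f: "f \<in> borel_measurable borel" "\<And>y. \<bar>f y\<bar> \<le> B"
  shows "(\<integral>y. f y \<partial>U \<theta>) = \<theta> * (\<integral>t. expw \<theta> t * (\<integral>y. f y \<partial>m t) \<partial>lborel)"
proof -
  have "(\<integral>y. f y \<partial>U \<theta>) = (\<integral>t. (\<integral>y. f y \<partial>m t) \<partial>exp_time \<theta>)"
    unfolding U_def by (rule integral_bind_bounded[OF prob_exp_time[OF \<theta>] m_from_exp_time f(1)]) (rule f(2))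
  also have "\<dots> = \<theta> * (\<integral>t. expw \<theta> t * (\<integral>y. f y \<partial>m t) \<partial>lborel)"
    by (rule integral_exp_time[OF \<theta> m_measurable[OF f(1)]])
  finally show ?thesis .
qed

text \<open>The test function is the resolvent \<open>f\<close> of \<open>g\<close>, for which the
  generator is \<open>\<theta> * f - g\<close>. In the Laplace transform of the forward equation the
  integral of \<open>f\<close> under \<open>U \<theta>\<close> then cancels, and what remains is an
  equation for \<open>g\<close>.\<close>

lemma resolvent_equation_C0:
  assumes \<theta>: "0 < \<theta>" and \<alpha>: "\<alpha> \<in> I" and g: "g \<in> C0 (S \<alpha>)"
  shows "(\<integral>y. g y \<partial>U \<theta>) = (\<integral>x. (\<integral>y. g y \<partial>res_kernel \<theta> x) \<partial>m 0)
    + (\<integral>x. jop (\<lambda>x. \<integral>y. g y \<partial>res_kernel \<theta> x) x \<partial>U \<theta>) / \<theta>"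
proof -
  note ff = feller[OF \<alpha>]
  obtain B where B: "\<And>x. \<bar>g x\<bar> \<le> B" using C0_bounded[OF g] by blast
  define f where "f = feller_family.Res (S \<alpha>) (Q \<alpha>) \<theta> g"
  have rel: "gen_rel (S \<alpha>) (sg \<alpha>) f (\<lambda>x. \<theta> * f x - g x)"
    unfolding f_def by (rule feller_family.Res_gen_rel[OF ff \<theta> g B])
  have dom: "f \<in> gen_dom (S \<alpha>) (sg \<alpha>)" using rel by (auto simp: gen_dom_def)
  have Lf: "Lg \<alpha> f = (\<lambda>x. \<theta> * f x - g x)" by (rule gen_eqI[OF rel])
  have fC0: "f \<in> C0 (S \<alpha>)" using rel by (simp add: gen_rel_def)
  have [measurable]: "f \<in> borel_measurable borel" "g \<in> borel_measurable borel"
    using C0_measurable[OF fC0 S[OF \<alpha>]] C0_measurable[OF g S[OF \<alpha>]] by auto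
  have fB: "\<bar>f x\<bar> \<le> B / \<theta>" for x unfolding f_def by (rule feller_family.Res_bound[OF ff \<theta> g B])
  define h where "h x = \<theta> * f x - g x + jop f x" for x
  have [measurable]: "h \<in> borel_measurable borel" unfolding h_def[abs_def] by measurable
  define Bh where "Bh = B + B + Rb * (2 * (B / \<theta>))"
  have hB: "\<bar>h x\<bar> \<le> Bh" for x
  proof -
    have "\<bar>\<theta> * f x\<bar> \<le> B" using fB[of x] \<theta> by (simp add: abs_mult field_simps)
    then show ?thesis
      unfolding h_def Bh_def using B[of x] jop_bound[of f "B / \<theta>" x] fB by (auto simp: abs_le_iff) 
  qed
  have fwd: "(\<integral>y. f y \<partial>m t) = (\<integral>y. f y \<partial>m 0) + (\<integral>s. indicator {0..t} s * (\<integral>y. h y \<partial>m s) \<partial>lborel)" if "0 \<le> t" for t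
    using forward_domain[OF \<alpha> dom that] by (simp add: Lf h_def)
  have "(\<integral>y. f y \<partial>U \<theta>) = \<theta> * (\<integral>t. expw \<theta> t * (\<integral>y. f y \<partial>m t) \<partial>lborel)"
    by (rule integral_U[OF \<theta> _ fB]) measurable
  also have "(\<integral>t. expw \<theta> t * (\<integral>y. f y \<partial>m t) \<partial>lborel) =
      (\<integral>t. expw \<theta> t * (\<integral>y. f y \<partial>m 0) + expw \<theta> t * (\<integral>s. indicator {0..t} s * (\<integral>y. h y \<partial>m s) \<partial>lborel) \<partial>lborel)"
  proof (rule Bochner_Integration.integral_cong[OF refl])
    fix t
    show "expw \<theta> t * (\<integral>y. f y \<partial>m t) = expw \<theta> t * (\<integral>y. f y \<partial>m 0) + expw \<theta> t * (\<integral>s. indicator {0..t} s * (\<integral>y. h y \<partial>m s) \<partial>lborel)"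
      by (cases "0 \<le> t") (simp_all add: fwd[of t] distrib_left expw_def)
  qed
  also have "\<dots> = (\<integral>t. expw \<theta> t * (\<integral>y. f y \<partial>m 0) \<partial>lborel) + (\<integral>t. expw \<theta> t * (\<integral>s. indicator {0..t} s * (\<integral>y. h y \<partial>m s) \<partial>lborel) \<partial>lborel)"
  proof (rule Bochner_Integration.integral_add)
    show i1: "integrable lborel (\<lambda>t. expw \<theta> t * (\<integral>y. f y \<partial>m 0))" using expw_integral(1)[OF \<theta>] by simp
    \<comment> \<open>Integrability of the time integral term is read off from the other two terms
      of the forward equation, which are bounded.\<close>
    have i2: "integrable lborel (\<lambda>t. expw \<theta> t * (\<integral>y. f y \<partial>m t))"
      by (rule expw_integrable_times[OF \<theta>, where B = "B / \<theta>"]) (use fB in \<open>auto intro!: m_bound\<close>)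
    have "integrable lborel (\<lambda>t. expw \<theta> t * (\<integral>y. f y \<partial>m t) - expw \<theta> t * (\<integral>y. f y \<partial>m 0))"
      by (rule Bochner_Integration.integrable_diff[OF i2 i1])
    also have "(\<lambda>t. expw \<theta> t * (\<integral>y. f y \<partial>m t) - expw \<theta> t * (\<integral>y. f y \<partial>m 0)) = (\<lambda>t. expw \<theta> t * (\<integral>s. indicator {0..t} s * (\<integral>y. h y \<partial>m s) \<partial>lborel))"
    proof (rule ext)
      fix t
      show "expw \<theta> t * (\<integral>y. f y \<partial>m t) - expw \<theta> t * (\<integral>y. f y \<partial>m 0) = expw \<theta> t * (\<integral>s. indicator {0..t} s * (\<integral>y. h y \<partial>m s) \<partial>lborel)"
        by (cases "0 \<le> t") (simp_all add: fwd[of t] distrib_left expw_def)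
    qed
    finally show "integrable lborel (\<lambda>t. expw \<theta> t * (\<integral>s. indicator {0..t} s * (\<integral>y. h y \<partial>m s) \<partial>lborel))" .
  qed
  finally have "(\<integral>y. f y \<partial>U \<theta>) = (\<integral>y. f y \<partial>m 0) + \<theta> * (\<integral>t. expw \<theta> t * (\<integral>s. indicator {0..t} s * (\<integral>y. h y \<partial>m s) \<partial>lborel) \<partial>lborel)"
    using expw_integral[OF \<theta>] \<theta> by (simp add: distrib_left)
  also have "\<theta> * (\<integral>t. expw \<theta> t * (\<integral>s. indicator {0..t} s * (\<integral>y. h y \<partial>m s) \<partial>lborel) \<partial>lborel) = (\<integral>s. expw \<theta> s * (\<integral>y. h y \<partial>m s) \<partial>lborel)"
    by (rule laplace_primitive[OF \<theta>, where B = Bh]) (use hB in \<open>auto intro!: m_bound\<close>)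
  also have "\<dots> = (\<integral>y. h y \<partial>U \<theta>) / \<theta>"
    using integral_U[OF \<theta> _ hB] \<theta> by simp
  finally have e: "(\<integral>y. f y \<partial>U \<theta>) = (\<integral>y. f y \<partial>m 0) + (\<integral>y. h y \<partial>U \<theta>) / \<theta>" .
  interpret U: prob_space "U \<theta>" by (rule prob_U[OF \<theta>])
  note [measurable_cong] = sets_U[OF \<theta>]
  have iU: "integrable (U \<theta>) f" "integrable (U \<theta>) g" "integrable (U \<theta>) (jop f)"
  proof -
    have fm: "f \<in> borel_measurable borel" by measurable
    show "integrable (U \<theta>) f" using fB by (intro U.integrable_bounded) auto
    show "integrable (U \<theta>) g" using B by (intro U.integrable_bounded) auto
    show "integrable (U \<theta>) (jop f)" by (rule U.integrable_bounded[OF _ jop_bound[OF fm fB]]) measurable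
  qed
  have "(\<integral>y. h y \<partial>U \<theta>) = \<theta> * (\<integral>y. f y \<partial>U \<theta>) - (\<integral>y. g y \<partial>U \<theta>) + (\<integral>y. jop f y \<partial>U \<theta>)"
    unfolding h_def using iU by simp
  with e have e2: "(\<integral>y. g y \<partial>U \<theta>) = \<theta> * (\<integral>y. f y \<partial>m 0) + (\<integral>y. jop f y \<partial>U \<theta>)"
    using \<theta> by (simp add: field_simps)
  have rf: "(\<lambda>x. \<integral>y. g y \<partial>res_kernel \<theta> x) = (\<lambda>x. \<theta> * f x)"
    by (simp add: integral_res_kernel[OF \<theta> \<alpha> g] f_def)
  have "jop (\<lambda>x. \<theta> * f x) = (\<lambda>x. \<theta> * jop f x)" by (auto simp: jop_def fun_eq_iff algebra_simps)
  then show ?thesis unfolding rf using e2 \<theta> by simp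
qed

end

end

section \<open>The resolvent equation for bounded Borel functions\<close>

definition mixture :: "real \<Rightarrow> 'a measure \<Rightarrow> 'a measure \<Rightarrow> 'a measure" where
  "mixture q \<mu> \<nu> = measure_pmf (bernoulli_pmf q) \<bind> (\<lambda>b. if b then \<mu> else \<nu>)"

lemma mixture_facts:
  assumes \<mu>: "\<mu> \<in> space (prob_algebra N)" "\<nu> \<in> space (prob_algebra N)" and q: "0 \<le> q" "q \<le> 1"
  shows "mixture q \<mu> \<nu> \<in> space (prob_algebra N)"
    and "f \<in> borel_measurable N \<Longrightarrow> (\<And>y. \<bar>f y\<bar> \<le> B) \<Longrightarrow>
      (\<integral>y. f y \<partial>mixture q \<mu> \<nu>) = q * (\<integral>y. f y \<partial>\<mu>) + (1 - q) * (\<integral>y. f y \<partial>\<nu>)"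
proof -
  let ?k = "\<lambda>b. if b then \<mu> else \<nu>"
  let ?b = "measure_pmf (bernoulli_pmf q)"
  have k: "?k \<in> ?b \<rightarrow>\<^sub>M prob_algebra N" using \<mu> by simp
  have k': "?k \<in> count_space UNIV \<rightarrow>\<^sub>M prob_algebra N" using \<mu> by simp
  have "(\<lambda>_::unit. ?b) \<in> count_space UNIV \<rightarrow>\<^sub>M prob_algebra (count_space UNIV)"
    by (simp add: space_prob_algebra prob_space_measure_pmf)
  from measurable_space[OF measurable_bind_prob_space[OF this k'], of "()"]
  show "mixture q \<mu> \<nu> \<in> space (prob_algebra N)" by (simp add: mixture_def)
  assume f: "f \<in> borel_measurable N" "\<And>y. \<bar>f y\<bar> \<le> B"
  have "(\<integral>y. f y \<partial>mixture q \<mu> \<nu>) = (\<integral>b. (\<integral>y. f y \<partial>?k b) \<partial>?b)"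
    unfolding mixture_def using f by (intro integral_bind_bounded[OF prob_space_measure_pmf k, of f B]) auto
  also have "\<dots> = q * (\<integral>y. f y \<partial>\<mu>) + (1 - q) * (\<integral>y. f y \<partial>\<nu>)"
    using q by (subst integral_bernoulli_pmf) auto
  finally show "(\<integral>y. f y \<partial>mixture q \<mu> \<nu>) = q * (\<integral>y. f y \<partial>\<mu>) + (1 - q) * (\<integral>y. f y \<partial>\<nu>)" .
qed

lemma bind_in_prob_algebra:
  assumes "\<mu> \<in> space (prob_algebra N)" "k \<in> N \<rightarrow>\<^sub>M prob_algebra R"
  shows "\<mu> \<bind> k \<in> space (prob_algebra R)"
proof -
  have "(\<lambda>_::unit. \<mu>) \<in> count_space UNIV \<rightarrow>\<^sub>M prob_algebra N" using assms(1) by simp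
  from measurable_space[OF measurable_bind_prob_space[OF this assms(2)], of "()"] show ?thesis by simp
qed

lemma integral_bind_prob_algebra:
  fixes f :: "'b \<Rightarrow> real"
  assumes "\<mu> \<in> space (prob_algebra N)" "k \<in> N \<rightarrow>\<^sub>M prob_algebra R" "f \<in> borel_measurable R" "\<And>y. \<bar>f y\<bar> \<le> B"
  shows "(\<integral>y. f y \<partial>(\<mu> \<bind> k)) = (\<integral>x. (\<integral>y. f y \<partial>k x) \<partial>\<mu>)"
proof -
  have "prob_space \<mu>" "sets \<mu> = sets N" using assms(1) by (auto simp: space_prob_algebra)
  moreover have "k \<in> \<mu> \<rightarrow>\<^sub>M prob_algebra R" using assms(2) by (subst measurable_cong_sets[OF \<open>sets \<mu> = sets N\<close> refl])
  ultimately show ?thesis using assms(3,4) by (intro integral_bind_bounded) auto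
qed

context jump_diffusion
begin

text \<open>Each core determines measures on its own stratum only. Restricting to the strata and
  summing over the countable partition recovers the measure.\<close>

lemma measure_eq_of_cores:
  assumes \<mu>: "\<mu> \<in> space (prob_algebra borel)" and \<nu>: "\<nu> \<in> space (prob_algebra borel)"
    and eq: "\<And>\<alpha> g. \<alpha> \<in> I \<Longrightarrow> g \<in> C \<alpha> \<Longrightarrow> (\<integral>y. g y \<partial>\<mu>) = (\<integral>y. g y \<partial>\<nu>)"
  shows "\<mu> = \<nu>"
proof -
  interpret \<mu>: prob_space \<mu> using \<mu> by (simp add: space_prob_algebra)
  interpret \<nu>: prob_space \<nu> using \<nu> by (simp add: space_prob_algebra)
  have s: "sets \<mu> = sets borel" "sets \<nu> = sets borel" using \<mu> \<nu> by (auto simp: space_prob_algebra)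
  have sp: "space \<mu> = UNIV" "space \<nu> = UNIV" using s[THEN sets_eq_imp_space_eq] by auto
  have restr: "restrict_space \<mu> (S \<alpha>) = restrict_space \<nu> (S \<alpha>)" if \<alpha>: "\<alpha> \<in> I" for \<alpha>
  proof -
    have Sm: "S \<alpha> \<in> sets \<mu>" "S \<alpha> \<in> sets \<nu>" using S[OF \<alpha>] s by auto
    have fin: "finite_measure (restrict_space \<mu> (S \<alpha>))" "finite_measure (restrict_space \<nu> (S \<alpha>))"
      using Sm by (auto intro!: finite_measureI simp: emeasure_restrict_space space_restrict_space sp
          \<mu>.emeasure_eq_measure \<nu>.emeasure_eq_measure)
    have ints: "\<forall>f\<in>C \<alpha>. (\<integral>x. f x \<partial>restrict_space \<mu> (S \<alpha>)) = (\<integral>x. f x \<partial>restrict_space \<nu> (S \<alpha>))"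
    proof
      fix f assume f: "f \<in> C \<alpha>"
      then have "f \<in> C0 (S \<alpha>)" using gen_domD(2) D_facts(4)[OF \<alpha>] by blast
      then have "(\<lambda>x. indicator (S \<alpha>) x *\<^sub>R f x) = f" using C0D(2)[OF \<open>f \<in> C0 (S \<alpha>)\<close>] by (auto simp: indicator_def fun_eq_iff)
      then show "(\<integral>x. f x \<partial>restrict_space \<mu> (S \<alpha>)) = (\<integral>x. f x \<partial>restrict_space \<nu> (S \<alpha>))"
        using eq[OF \<alpha> f] Sm by (simp add: integral_restrict_space sp)
    qed
    have "sets (restrict_space \<mu> (S \<alpha>)) = sets (restrict_space borel (S \<alpha>))"
      "sets (restrict_space \<nu> (S \<alpha>)) = sets (restrict_space borel (S \<alpha>))"
      by (rule sets_restrict_space_cong[OF s(1)], rule sets_restrict_space_cong[OF s(2)])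
    with D_facts(3)[OF \<alpha>] fin ints show ?thesis unfolding measure_determining_def by blast
  qed
  show ?thesis
  proof (rule measure_eqI)
    fix B assume "B \<in> sets \<mu>"
    then have B: "B \<in> sets borel" by (simp add: s)
    have BS: "B \<inter> S \<alpha> \<in> sets borel" if "\<alpha> \<in> I" for \<alpha> using B S[OF that] by auto
    have dj: "disjoint_family_on (\<lambda>\<alpha>. B \<inter> S \<alpha>) I" using disj by (auto simp: disjoint_family_on_def)
    have Beq: "B = (\<Union>\<alpha>\<in>I. B \<inter> S \<alpha>)" using cover by auto
    have "emeasure \<mu> (\<Union>\<alpha>\<in>I. B \<inter> S \<alpha>) = (\<integral>\<^sup>+\<alpha>. emeasure \<mu> (B \<inter> S \<alpha>) \<partial>count_space I)"
      using BS by (intro emeasure_UN_countable I dj) (auto simp: s)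
    also have "\<dots> = (\<integral>\<^sup>+\<alpha>. emeasure \<nu> (B \<inter> S \<alpha>) \<partial>count_space I)"
    proof (rule nn_integral_cong)
      fix \<alpha> assume "\<alpha> \<in> space (count_space I)"
      then have \<alpha>: "\<alpha> \<in> I" by simp
      have "emeasure (restrict_space \<mu> (S \<alpha>)) (B \<inter> S \<alpha>) = emeasure (restrict_space \<nu> (S \<alpha>)) (B \<inter> S \<alpha>)"
        by (simp add: restr[OF \<alpha>])
      then show "emeasure \<mu> (B \<inter> S \<alpha>) = emeasure \<nu> (B \<inter> S \<alpha>)"
        using S[OF \<alpha>] by (simp add: emeasure_restrict_space s sp)
    qed
    also have "\<dots> = emeasure \<nu> (\<Union>\<alpha>\<in>I. B \<inter> S \<alpha>)"
      using BS by (intro emeasure_UN_countable[symmetric] I dj) (auto simp: s)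
    finally show "emeasure \<mu> B = emeasure \<nu> B" using Beq by simp
  qed (simp add: s)
qed

definition rop :: "real \<Rightarrow> ('a \<Rightarrow> real) \<Rightarrow> 'a \<Rightarrow> real" where
  "rop \<theta> g x = (\<integral>y. g y \<partial>res_kernel \<theta> x)"

lemma rop_measurable:
  assumes "0 < \<theta>" "g \<in> borel_measurable borel" shows "rop \<theta> g \<in> borel_measurable borel"
  unfolding rop_def[abs_def] by (rule measurable_kernel_integral[OF res_kernel_measurable[OF assms(1)] assms(2)])

lemma rop_bound:
  assumes "0 < \<theta>" "g \<in> borel_measurable borel" "\<And>y. \<bar>g y\<bar> \<le> B" shows "\<bar>rop \<theta> g x\<bar> \<le> B"
  unfolding rop_def using assms kernelD_borel(2)[OF res_kernel_measurable[OF assms(1)]]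
  by (intro prob_space.abs_integral_le kernelD_borel(1)[OF res_kernel_measurable[OF assms(1)]])
     (auto cong: measurable_cong_sets)

text \<open>
  Both sides of the resolvent equation become positive functionals once the negative part of the
  jump operator is moved to the left; normalised, they are probability measures.
\<close>

lemma resolvent_equation:
  assumes m: "forward m" and \<theta>: "0 < \<theta>" and g: "g \<in> borel_measurable borel" "\<And>y. \<bar>g y\<bar> \<le> B"
  shows "(\<integral>y. g y \<partial>U m \<theta>) = (\<integral>x. rop \<theta> g x \<partial>m 0) + (\<integral>x. jop (rop \<theta> g) x \<partial>U m \<theta>) / \<theta>"
proof -
  \<comment> \<open>Multiplying the equation by \<open>q\<close> makes the weights \<open>q\<close>
    and \<open>q * Rb / \<theta> = 1 - q\<close> add up to 1 on either side.\<close>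
  define q where "q = \<theta> / (\<theta> + Rb)"
  have q: "0 \<le> q" "q \<le> 1" "0 < q" using \<theta> Rb_ge_1 by (auto simp: q_def)
  have q1: "1 - q = q * Rb / \<theta>"
  proof -
    have n: "\<theta> + Rb \<noteq> 0" using \<theta> Rb_ge_1 by linarith
    have "1 - q = Rb / (\<theta> + Rb)" using n by (simp add: q_def diff_divide_eq_iff field_simps)
    also have "\<dots> = q * Rb / \<theta>" using \<theta> by (simp add: q_def)
    finally show ?thesis .
  qed
  note r = res_kernel_measurable[OF \<theta>]
  note Uin = U_in[OF m \<theta>]
  interpret U: prob_space "U m \<theta>" by (rule prob_U[OF m \<theta>])
  note [measurable_cong] = sets_U[OF m \<theta>]
  have m0: "m 0 \<in> space (prob_algebra borel)"
    using measurable_space[OF m_kernel[OF m], of 0] by simp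
  note UN = bind_in_prob_algebra[OF Uin jump_kernel_measurable]
  \<comment> \<open>Up to the factor \<open>q\<close>, the two measures are the sides of
    \<open>U + (Rb / \<theta>) U R = m0 R + (Rb / \<theta>) U N R\<close>, where \<open>R\<close> is
    the resolvent kernel, \<open>N\<close> the jump kernel, and products are read from left to right
    in time.\<close>
  define \<mu> where "\<mu> = mixture q (U m \<theta>) (U m \<theta> \<bind> res_kernel \<theta>)"
  define \<nu> where "\<nu> = mixture q (m 0 \<bind> res_kernel \<theta>) ((U m \<theta> \<bind> jump_kernel) \<bind> res_kernel \<theta>)"
  have in1: "\<mu> \<in> space (prob_algebra borel)" "\<nu> \<in> space (prob_algebra borel)"
    unfolding \<mu>_def \<nu>_def using q by (intro mixture_facts(1) bind_in_prob_algebra[OF _ r] Uin UN m0; simp)+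
  have i\<mu>: "(\<integral>y. g y \<partial>\<mu>) = q * (\<integral>y. g y \<partial>U m \<theta>) + (1 - q) * (\<integral>x. rop \<theta> g x \<partial>U m \<theta>)"
    and i\<nu>: "(\<integral>y. g y \<partial>\<nu>) = q * (\<integral>x. rop \<theta> g x \<partial>m 0) + (1 - q) * (\<integral>x. (\<integral>y. rop \<theta> g y \<partial>jump_kernel x) \<partial>U m \<theta>)"
    if g: "g \<in> borel_measurable borel" "\<And>y. \<bar>g y\<bar> \<le> B" for g B
  proof -
    have "(\<integral>y. g y \<partial>\<mu>) = q * (\<integral>y. g y \<partial>U m \<theta>) + (1 - q) * (\<integral>y. g y \<partial>(U m \<theta> \<bind> res_kernel \<theta>))"
      unfolding \<mu>_def by (rule mixture_facts(2)[OF Uin bind_in_prob_algebra[OF Uin r] q(1,2) g])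
    then show "(\<integral>y. g y \<partial>\<mu>) = q * (\<integral>y. g y \<partial>U m \<theta>) + (1 - q) * (\<integral>x. rop \<theta> g x \<partial>U m \<theta>)"
      unfolding integral_bind_prob_algebra[OF Uin r g] rop_def .
    have "(\<integral>y. g y \<partial>\<nu>) = q * (\<integral>y. g y \<partial>(m 0 \<bind> res_kernel \<theta>)) + (1 - q) * (\<integral>y. g y \<partial>((U m \<theta> \<bind> jump_kernel) \<bind> res_kernel \<theta>))"
      unfolding \<nu>_def by (rule mixture_facts(2)[OF bind_in_prob_algebra[OF m0 r] bind_in_prob_algebra[OF UN r] q(1,2) g])
    also have "(\<integral>y. g y \<partial>(m 0 \<bind> res_kernel \<theta>)) = (\<integral>x. rop \<theta> g x \<partial>m 0)"
      unfolding integral_bind_prob_algebra[OF m0 r g] rop_def ..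
    also have "(\<integral>y. g y \<partial>((U m \<theta> \<bind> jump_kernel) \<bind> res_kernel \<theta>)) = (\<integral>x. rop \<theta> g x \<partial>(U m \<theta> \<bind> jump_kernel))"
      unfolding integral_bind_prob_algebra[OF UN r g] rop_def ..
    also have "\<dots> = (\<integral>x. (\<integral>y. rop \<theta> g y \<partial>jump_kernel x) \<partial>U m \<theta>)"
      by (rule integral_bind_prob_algebra[OF Uin jump_kernel_measurable rop_measurable[OF \<theta> g(1)] rop_bound[OF \<theta> g]])
    finally show "(\<integral>y. g y \<partial>\<nu>) = q * (\<integral>x. rop \<theta> g x \<partial>m 0) + (1 - q) * (\<integral>x. (\<integral>y. rop \<theta> g y \<partial>jump_kernel x) \<partial>U m \<theta>)" .
  qed
  have ij: "(\<integral>x. jop (rop \<theta> g) x \<partial>U m \<theta>) = Rb * ((\<integral>x. (\<integral>y. rop \<theta> g y \<partial>jump_kernel x) \<partial>U m \<theta>) - (\<integral>x. rop \<theta> g x \<partial>U m \<theta>))"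
    if g: "g \<in> borel_measurable borel" "\<And>y. \<bar>g y\<bar> \<le> B" for g B
  proof -
    note rm = rop_measurable[OF \<theta> g(1)]
    have "integrable (U m \<theta>) (rop \<theta> g)"
    proof (rule U.integrable_bounded[OF _ rop_bound[OF \<theta> g]])
      show "rop \<theta> g \<in> borel_measurable (U m \<theta>)" using rm by (subst measurable_cong_sets[OF sets_U[OF m \<theta>] refl])
    qed
    moreover have "integrable (U m \<theta>) (\<lambda>x. \<integral>y. rop \<theta> g y \<partial>jump_kernel x)"
    proof (rule U.integrable_bounded)
      have "(\<lambda>x. \<integral>y. rop \<theta> g y \<partial>jump_kernel x) \<in> borel_measurable borel"
        by (rule measurable_kernel_integral[OF jump_kernel_measurable rm])
      then show "(\<lambda>x. \<integral>y. rop \<theta> g y \<partial>jump_kernel x) \<in> borel_measurable (U m \<theta>)"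
        by (subst measurable_cong_sets[OF sets_U[OF m \<theta>] refl])
      show "\<bar>\<integral>y. rop \<theta> g y \<partial>jump_kernel x\<bar> \<le> B" for x
        by (rule jump_kernel_integral_bound[OF rm rop_bound[OF \<theta> g]])
    qed
    ultimately show ?thesis by (simp add: jop_def)
  qed
  have iff: "(\<integral>y. g y \<partial>\<mu>) = (\<integral>y. g y \<partial>\<nu>) \<longleftrightarrow>
      (\<integral>y. g y \<partial>U m \<theta>) = (\<integral>x. rop \<theta> g x \<partial>m 0) + (\<integral>x. jop (rop \<theta> g) x \<partial>U m \<theta>) / \<theta>"
    if g: "g \<in> borel_measurable borel" "\<And>y. \<bar>g y\<bar> \<le> B" for g B
  proof -
    have "q * a + q * Rb / \<theta> * b = q * c + q * Rb / \<theta> * d \<longleftrightarrow> a = c + Rb * (d - b) / \<theta>" for a b c d :: real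
    proof -
      have "q * a + q * Rb / \<theta> * b = q * c + q * Rb / \<theta> * d \<longleftrightarrow> q * (a + Rb / \<theta> * b) = q * (c + Rb / \<theta> * d)"
        by (simp add: algebra_simps)
      also have "\<dots> \<longleftrightarrow> a + Rb / \<theta> * b = c + Rb / \<theta> * d" using q(3) by simp
      also have "\<dots> \<longleftrightarrow> a = c + Rb * (d - b) / \<theta>" using \<theta> by (simp add: field_simps)
      finally show ?thesis .
    qed
    then show ?thesis unfolding i\<mu>[OF g] i\<nu>[OF g] ij[OF g] q1 .
  qed
  \<comment> \<open>The known case \<open>g \<in> C0 (S \<alpha>)\<close> covers the cores; so the
    two probability measures agree, and with them the integrals of every bounded Borel
    function.\<close>
  have "\<mu> = \<nu>"
  proof (rule measure_eq_of_cores[OF in1])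
    fix \<alpha> g assume \<alpha>: "\<alpha> \<in> I" and "g \<in> C \<alpha>"
    then have g: "g \<in> C0 (S \<alpha>)" using gen_domD(2) D_facts(4)[OF \<alpha>] by blast
    obtain B where B: "\<And>x. \<bar>g x\<bar> \<le> B" using C0_bounded[OF g] by blast
    show "(\<integral>y. g y \<partial>\<mu>) = (\<integral>y. g y \<partial>\<nu>)"
      unfolding iff[OF C0_measurable[OF g S[OF \<alpha>]] B]
      using resolvent_equation_C0[OF m \<theta> \<alpha> g] by (simp add: rop_def[abs_def])
  qed
  then have "(\<integral>y. g y \<partial>\<mu>) = (\<integral>y. g y \<partial>\<nu>)" by simp
  then show ?thesis unfolding iff[OF g] .
qed

text \<open>The resolvent equation reads \<open>U g = m0 (rop g) + U (Kop g)\<close>, so iterating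
  it expands \<open>U g\<close> in powers of \<open>Kop\<close>.\<close>

definition Kop :: "real \<Rightarrow> ('a \<Rightarrow> real) \<Rightarrow> 'a \<Rightarrow> real" where
  "Kop \<theta> g x = jop (rop \<theta> g) x / \<theta>"

text \<open>The Neumann series of that expansion; it refers only to the resolvent and jump kernels,
  not to a flow.\<close>

definition Psi :: "real \<Rightarrow> ('a \<Rightarrow> real) \<Rightarrow> 'a \<Rightarrow> real" where
  "Psi \<theta> g x = (\<Sum>k. rop \<theta> ((Kop \<theta> ^^ k) g) x)"

text \<open>\<open>jop\<close> has norm at most \<open>2 * Rb\<close> and \<open>rop\<close> is a
  contraction, so \<open>Kop\<close> has norm at most \<open>2 * Rb / \<theta>\<close>; the
  threshold \<open>4 * Rb\<close> makes this at most 1/2.\<close>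

lemma Kop_iterate:
  assumes \<theta>: "4 * Rb \<le> \<theta>" and g: "g \<in> borel_measurable borel" "\<And>y. \<bar>g y\<bar> \<le> B"
  shows "(Kop \<theta> ^^ k) g \<in> borel_measurable borel" "\<bar>(Kop \<theta> ^^ k) g y\<bar> \<le> B * (1/2) ^ k"
proof -
  have \<theta>0: "0 < \<theta>" using \<theta> Rb_ge_1 by linarith
  have B0: "0 \<le> B" using order_trans[OF abs_ge_zero g(2)] .
  have "(Kop \<theta> ^^ k) g \<in> borel_measurable borel \<and> (\<forall>y. \<bar>(Kop \<theta> ^^ k) g y\<bar> \<le> B * (1/2) ^ k)"
  proof (induction k)
    case 0
    then show ?case using g by simp
  next
    case (Suc k)
    let ?h = "(Kop \<theta> ^^ k) g"
    have h: "?h \<in> borel_measurable borel" "\<And>y. \<bar>?h y\<bar> \<le> B * (1/2) ^ k" using Suc by auto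
    note rm = rop_measurable[OF \<theta>0 h(1)]
    have "\<bar>jop (rop \<theta> ?h) y / \<theta>\<bar> \<le> B * (1/2) ^ Suc k" for y
    proof -
      have "\<bar>jop (rop \<theta> ?h) y\<bar> \<le> Rb * (2 * (B * (1/2) ^ k))"
        by (rule jop_bound[OF rm rop_bound[OF \<theta>0 h]])
      also have "\<dots> = 4 * Rb * (B * (1/2) ^ Suc k)" by simp
      also have "\<dots> \<le> \<theta> * (B * (1/2) ^ Suc k)" using \<theta> B0 by (intro mult_right_mono) auto
      finally show ?thesis using \<theta>0 by (simp add: abs_divide pos_divide_le_eq mult.commute)
    qed
    moreover have "(\<lambda>x. jop (rop \<theta> ?h) x / \<theta>) \<in> borel_measurable borel"
      using jop_measurable[OF rm] by measurable
    ultimately show ?case by (simp add: Kop_def[abs_def])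
  qed
  then show "(Kop \<theta> ^^ k) g \<in> borel_measurable borel" "\<bar>(Kop \<theta> ^^ k) g y\<bar> \<le> B * (1/2) ^ k" by auto
qed

text \<open>Uniqueness and measurability at once: the Laplace transform of a flow depends only on
  its initial law, and does so through the integral of a fixed Borel function.\<close>

lemma resolvent_solution:
  assumes \<theta>: "4 * Rb \<le> \<theta>" and g: "g \<in> borel_measurable borel" "\<And>y. \<bar>g y\<bar> \<le> B"
  shows "Psi \<theta> g \<in> borel_measurable borel"
    and "forward m \<Longrightarrow> (\<integral>y. g y \<partial>U m \<theta>) = (\<integral>x. Psi \<theta> g x \<partial>m 0)"
proof -
  have \<theta>0: "0 < \<theta>" using \<theta> Rb_ge_1 by linarith
  have B0: "0 \<le> B" using order_trans[OF abs_ge_zero g(2)] .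
  define r where "r k x = rop \<theta> ((Kop \<theta> ^^ k) g) x" for k x
  note Km = Kop_iterate(1)[OF \<theta> g] and Kb = Kop_iterate(2)[OF \<theta> g]
  have rm: "r k \<in> borel_measurable borel" for k
    unfolding r_def[abs_def] by (rule rop_measurable[OF \<theta>0 Km])
  have rb: "\<bar>r k x\<bar> \<le> B * (1/2) ^ k" for k x
    unfolding r_def by (rule rop_bound[OF \<theta>0 Km Kb])
  have geo: "summable (\<lambda>k. B * (1/2::real) ^ k)" by (intro summable_mult summable_geometric) simp
  have summ: "summable (\<lambda>k. r k x)" for x
    by (rule summable_comparison_test'[OF geo, of 0]) (use rb in auto)
  have lim: "(\<lambda>n. \<Sum>k<n. r k x) \<longlonglongrightarrow> Psi \<theta> g x" for x
    using summable_LIMSEQ[OF summ[of x]] by (simp add: Psi_def r_def)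
  have partial_m: "(\<lambda>x. \<Sum>k<n. r k x) \<in> borel_measurable borel" for n
    using rm by (intro borel_measurable_sum) auto
  show Pm: "Psi \<theta> g \<in> borel_measurable borel"
    by (rule borel_measurable_LIMSEQ_real[OF lim partial_m])
  have partial_b: "\<bar>\<Sum>k<n. r k x\<bar> \<le> 2 * B" for n x
  proof -
    have "\<bar>\<Sum>k<n. r k x\<bar> \<le> (\<Sum>k<n. B * (1/2) ^ k)"
      by (rule order_trans[OF sum_abs sum_mono[OF rb]])
    also have "\<dots> \<le> (\<Sum>k. B * (1/2) ^ k)" using B0 by (intro sum_le_suminf geo) auto
    also have "\<dots> = 2 * B"
      by (subst suminf_mult) (auto simp: suminf_geometric)
    finally show ?thesis .
  qed
  assume m: "forward m"
  interpret m0: prob_space "m 0" by (rule prob_m[OF m])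
  interpret U: prob_space "U m \<theta>" by (rule prob_U[OF m \<theta>0])
  note [measurable_cong] = sets_m[OF m] sets_U[OF m \<theta>0]
  have ri: "integrable (m 0) (r k)" for k
  proof (rule m0.integrable_bounded[OF _ rb])
    show "r k \<in> borel_measurable (m 0)" using rm[of k] by (subst measurable_cong_sets[OF sets_m[OF m] refl])
  qed
  have step: "(\<integral>y. (Kop \<theta> ^^ n) g y \<partial>U m \<theta>) = (\<integral>x. r n x \<partial>m 0) + (\<integral>y. (Kop \<theta> ^^ Suc n) g y \<partial>U m \<theta>)" for n
  proof -
    have "(\<integral>y. (Kop \<theta> ^^ Suc n) g y \<partial>U m \<theta>) = (\<integral>x. jop (rop \<theta> ((Kop \<theta> ^^ n) g)) x \<partial>U m \<theta>) / \<theta>"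
      by (simp add: Kop_def[abs_def])
    then show ?thesis
      using resolvent_equation[OF m \<theta>0 Km Kb, of n] by (simp add: r_def)
  qed
  \<comment> \<open>The \<open>n\<close>-fold iterate: a partial sum of the series plus a remainder
    of size at most \<open>B / 2 ^ n\<close>.\<close>
  have "(\<integral>y. g y \<partial>U m \<theta>) = (\<integral>x. (\<Sum>k<n. r k x) \<partial>m 0) + (\<integral>y. (Kop \<theta> ^^ n) g y \<partial>U m \<theta>)" for n
  proof (induction n)
    case (Suc n)
    have "(\<integral>x. (\<Sum>k<Suc n. r k x) \<partial>m 0) = (\<integral>x. (\<Sum>k<n. r k x) \<partial>m 0) + (\<integral>x. r n x \<partial>m 0)"
      using ri by simp
    with Suc step[of n] show ?case by linarith
  qed simp
  note const = this
  have "(\<lambda>n. (\<integral>x. (\<Sum>k<n. r k x) \<partial>m 0) + (\<integral>y. (Kop \<theta> ^^ n) g y \<partial>U m \<theta>)) \<longlonglongrightarrow> (\<integral>x. Psi \<theta> g x \<partial>m 0) + 0"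
  proof (rule tendsto_add)
    show "(\<lambda>n. \<integral>x. (\<Sum>k<n. r k x) \<partial>m 0) \<longlonglongrightarrow> (\<integral>x. Psi \<theta> g x \<partial>m 0)"
    proof (rule integral_dominated_convergence[where w = "\<lambda>_. 2 * B"])
      show "Psi \<theta> g \<in> borel_measurable (m 0)" using Pm by (subst measurable_cong_sets[OF sets_m[OF m] refl])
      show "(\<lambda>x. \<Sum>k<n. r k x) \<in> borel_measurable (m 0)" for n
        using partial_m by (subst measurable_cong_sets[OF sets_m[OF m] refl])
      show "AE x in m 0. (\<lambda>n. \<Sum>k<n. r k x) \<longlonglongrightarrow> Psi \<theta> g x" using lim by simp
      show "AE x in m 0. norm (\<Sum>k<n. r k x) \<le> 2 * B" for n using partial_b by simp
    qed simp
    show "(\<lambda>n. \<integral>y. (Kop \<theta> ^^ n) g y \<partial>U m \<theta>) \<longlonglongrightarrow> 0"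
    proof (rule Lim_null_comparison[where g = "\<lambda>n. B * (1/2) ^ n"])
      have "\<bar>\<integral>y. (Kop \<theta> ^^ n) g y \<partial>U m \<theta>\<bar> \<le> B * (1/2) ^ n" for n
      proof (rule U.abs_integral_le[OF _ Kb])
        show "(Kop \<theta> ^^ n) g \<in> borel_measurable (U m \<theta>)" using Km by (subst measurable_cong_sets[OF sets_U[OF m \<theta>0] refl])
      qed
      then show "\<forall>\<^sub>F n in sequentially. norm (\<integral>y. (Kop \<theta> ^^ n) g y \<partial>U m \<theta>) \<le> B * (1/2) ^ n" by simp
      show "(\<lambda>n. B * (1/2::real) ^ n) \<longlonglongrightarrow> 0"
        by (intro tendsto_mult_right_zero LIMSEQ_power_zero) simp
    qed
  qed
  then show "(\<integral>y. g y \<partial>U m \<theta>) = (\<integral>x. Psi \<theta> g x \<partial>m 0)"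
    unfolding const[symmetric] LIMSEQ_const_iff by simp
qed

end

subsection \<open>Inversion of the Laplace transform\<close>

text \<open>The variable in which Laplace transforms become moments: for nonnegative times it is
  \<open>exp (- t)\<close>, and the clamp keeps it in the unit interval on the whole line.\<close>

definition etime :: "real \<Rightarrow> real" where "etime t = exp (- max 0 t)"

lemma etime: "0 \<le> etime t" "etime t \<le> 1" "0 \<le> t \<Longrightarrow> etime t = exp (- t)"
  by (auto simp: etime_def)

lemma measurable_etime [measurable]: "etime \<in> borel_measurable borel"
  unfolding etime_def[abs_def] by measurable

text \<open>An integral against the exponential weight with a further test function of
  \<open>exp (- t)\<close>; for a monomial it is again a Laplace transform, with shifted
  parameter.\<close>

definition lap :: "real \<Rightarrow> (real \<Rightarrow> real) \<Rightarrow> (real \<Rightarrow> real) \<Rightarrow> real" where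
  "lap \<theta> \<phi> k = (\<integral>t. expw \<theta> t * (\<phi> (etime t) * k t) \<partial>lborel)"

context
  fixes \<theta> B :: real
  assumes \<theta>: "0 < \<theta>"
begin

definition admissible :: "(real \<Rightarrow> real) \<Rightarrow> bool" where
  "admissible k \<longleftrightarrow> k \<in> borel_measurable borel \<and> (\<forall>t. \<bar>k t\<bar> \<le> B)"

lemma lap_bounds:
  assumes k: "admissible k" and \<phi>: "continuous_on UNIV \<phi>" "\<And>v. 0 \<le> v \<Longrightarrow> v \<le> 1 \<Longrightarrow> \<bar>\<phi> v\<bar> \<le> c"
  shows "integrable lborel (\<lambda>t. expw \<theta> t * (\<phi> (etime t) * k t))" "\<bar>lap \<theta> \<phi> k\<bar> \<le> c * B / \<theta>"
proof -
  have [measurable]: "\<phi> \<in> borel_measurable borel" using \<phi>(1) by (rule borel_measurable_continuous_onI)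
  have km[measurable]: "k \<in> borel_measurable borel" using k by (simp add: admissible_def)
  have m: "(\<lambda>t. \<phi> (etime t) * k t) \<in> borel_measurable borel" by measurable
  have b: "\<bar>\<phi> (etime t) * k t\<bar> \<le> c * B" for t
    unfolding abs_mult using \<phi>(2)[OF etime(1,2)] k order_trans[OF abs_ge_zero \<phi>(2)[of 0]]
    by (intro mult_mono) (auto simp: admissible_def)
  show "integrable lborel (\<lambda>t. expw \<theta> t * (\<phi> (etime t) * k t))"
    by (rule expw_integrable_times[OF \<theta> m b])
  show "\<bar>lap \<theta> \<phi> k\<bar> \<le> c * B / \<theta>"
    unfolding lap_def by (rule expw_integral_bound[OF \<theta> m b])
qed

lemma continuous_bounded_01:
  fixes \<phi> :: "real \<Rightarrow> real"
  assumes "continuous_on UNIV \<phi>" obtains c where "\<And>v. 0 \<le> v \<Longrightarrow> v \<le> 1 \<Longrightarrow> \<bar>\<phi> v\<bar> \<le> c"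
proof -
  have "compact (\<phi> ` {0..1})" using assms by (intro compact_continuous_image continuous_on_subset[OF assms]) auto
  from compact_imp_bounded[OF this] obtain c where "\<forall>y\<in>\<phi> ` {0..1}. norm y \<le> c"
    unfolding bounded_iff by blast
  then show ?thesis using that[of c] by auto
qed

lemma lap_diff:
  assumes k: "admissible k" and "continuous_on UNIV \<phi>" "continuous_on UNIV \<psi>"
    and d: "\<And>v. 0 \<le> v \<Longrightarrow> v \<le> 1 \<Longrightarrow> \<bar>\<phi> v - \<psi> v\<bar> \<le> \<epsilon>"
  shows "\<bar>lap \<theta> \<phi> k - lap \<theta> \<psi> k\<bar> \<le> \<epsilon> * B / \<theta>"
proof -
  obtain c where c: "\<And>v. 0 \<le> v \<Longrightarrow> v \<le> 1 \<Longrightarrow> \<bar>\<phi> v\<bar> \<le> c" using continuous_bounded_01[OF assms(2)] by blast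
  obtain c' where c': "\<And>v. 0 \<le> v \<Longrightarrow> v \<le> 1 \<Longrightarrow> \<bar>\<psi> v\<bar> \<le> c'" using continuous_bounded_01[OF assms(3)] by blast
  have "lap \<theta> \<phi> k - lap \<theta> \<psi> k = (\<integral>t. expw \<theta> t * (\<phi> (etime t) * k t) - expw \<theta> t * (\<psi> (etime t) * k t) \<partial>lborel)"
    unfolding lap_def
    by (rule Bochner_Integration.integral_diff[symmetric, OF lap_bounds(1)[OF k assms(2) c] lap_bounds(1)[OF k assms(3) c']])
  also have "\<dots> = lap \<theta> (\<lambda>v. \<phi> v - \<psi> v) k" by (simp add: lap_def algebra_simps)
  finally show ?thesis
    using lap_bounds(2)[OF k continuous_on_diff[OF assms(2,3)] d] by simp
qed

lemma lap_poly:
  assumes k: "admissible k"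
  shows "lap \<theta> (\<lambda>v. \<Sum>i\<le>n. a i * v ^ i) k = (\<Sum>i\<le>n. a i * (\<integral>t. expw (\<theta> + real i) t * k t \<partial>lborel))"
proof -
  have e: "expw \<theta> t * etime t ^ i = expw (\<theta> + real i) t" for t i
  proof (cases "0 \<le> t")
    case True
    then show ?thesis
      by (simp add: etime(3) expw_def exp_of_nat_mult[symmetric] mult_exp_exp algebra_simps)
  qed (simp add: expw_def)
  have i: "integrable lborel (\<lambda>t. expw (\<theta> + real i) t * k t)" for i
    using \<theta> k by (intro expw_integrable_times[where B = B]) (auto simp: admissible_def)
  have "lap \<theta> (\<lambda>v. \<Sum>i\<le>n. a i * v ^ i) k = (\<integral>t. (\<Sum>i\<le>n. a i * (expw (\<theta> + real i) t * k t)) \<partial>lborel)"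
    unfolding lap_def e[symmetric] by (simp add: sum_distrib_left sum_distrib_right mult_ac)
  also have "\<dots> = (\<Sum>i\<le>n. a i * (\<integral>t. expw (\<theta> + real i) t * k t \<partial>lborel))"
    using i by (subst Bochner_Integration.integral_sum) auto
  finally show ?thesis .
qed

text \<open>As a function of \<open>exp (- t)\<close> it is positive exactly for \<open>t\<close>
  strictly between \<open>t0\<close> and \<open>t0 + d\<close>. Two linear factors suffice, as only
  continuity and the support matter.\<close>

definition bump :: "real \<Rightarrow> real \<Rightarrow> real \<Rightarrow> real" where
  "bump t0 d v = max 0 ((v - exp (- (t0 + d))) * (exp (- t0) - v))"

lemma bump_continuous: "continuous_on UNIV (bump t0 d)"
  unfolding bump_def[abs_def] by (intro continuous_intros)

lemma bump_pos_iff: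
  assumes "0 \<le> t" "0 \<le> d" shows "0 < bump t0 d (etime t) \<longleftrightarrow> t0 < t \<and> t < t0 + d"
proof -
  have "exp (- (t0 + d)) \<le> exp (- t0)" using assms by simp
  then have "0 < (v - exp (- (t0 + d))) * (exp (- t0) - v) \<longleftrightarrow> exp (- (t0 + d)) < v \<and> v < exp (- t0)" for v
    unfolding zero_less_mult_iff by (smt (verit))
  from this[of "exp (- t)"] show ?thesis
    unfolding bump_def etime(3)[OF assms(1)] less_max_iff_disj by auto
qed

text \<open>The normalised bumps concentrate immediately to the right of \<open>t0\<close>, so right
  continuity of \<open>k\<close> alone identifies the limit. \<open>1 \<le> B\<close> makes the
  constant function 1 admissible for the normalisation.\<close>

lemma lap_bump:
  assumes t0: "0 \<le> t0" and k: "admissible k" and rc: "(k \<longlongrightarrow> k t0) (at_right t0)" and B: "1 \<le> B"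
  shows "(\<lambda>n. lap \<theta> (bump t0 (1 / real (Suc n))) k / lap \<theta> (bump t0 (1 / real (Suc n))) (\<lambda>_. 1)) \<longlonglongrightarrow> k t0"
    and "0 < d \<Longrightarrow> 0 < lap \<theta> (bump t0 d) (\<lambda>_. 1)"
    and "0 < d \<Longrightarrow> \<bar>lap \<theta> (bump t0 d) k\<bar> \<le> B * lap \<theta> (bump t0 d) (\<lambda>_. 1)"
proof -
  have one: "admissible (\<lambda>_. 1)" using B by (simp add: admissible_def)
  define W where "W d t = expw \<theta> t * bump t0 d (etime t)" for d t
  have W0: "0 \<le> W d t" for d t by (simp add: W_def expw_nonneg bump_def)
  have int: "integrable lborel (\<lambda>t. W d t * k t)" if "admissible k" for d k
  proof -
    obtain c where "\<And>v. 0 \<le> v \<Longrightarrow> v \<le> 1 \<Longrightarrow> \<bar>bump t0 d v\<bar> \<le> c" using continuous_bounded_01[OF bump_continuous] by blast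
    from lap_bounds(1)[OF that bump_continuous this] show ?thesis by (simp add: W_def mult.assoc)
  qed
  have lapW: "lap \<theta> (bump t0 d) k = (\<integral>t. W d t * k t \<partial>lborel)" for d k
    by (simp add: lap_def W_def mult.assoc)
  have W_pos: "0 < W d t \<longleftrightarrow> t0 < t \<and> t < t0 + d" if "0 < d" for d t
  proof (cases "0 \<le> t")
    case True
    then show ?thesis using bump_pos_iff[OF True, of d t0] that by (simp add: W_def expw_def zero_less_mult_iff)
  next
    case False
    then show ?thesis using t0 by (simp add: W_def expw_def)
  qed
  have c_pos: "0 < lap \<theta> (bump t0 d) (\<lambda>_. 1)" if d: "0 < d" for d
  proof (rule ccontr)
    assume "\<not> ?thesis"
    moreover have "0 \<le> (\<integral>t. W d t \<partial>lborel)" by (rule integral_nonneg_AE) (simp add: W0)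
    ultimately have "(\<integral>t. W d t \<partial>lborel) = 0" by (simp add: lapW)
    then have "AE t in lborel. W d t = 0"
      using int[OF one, of d] W0 by (subst (asm) integral_nonneg_eq_0_iff_AE) auto
    then have "AE t in lborel. t \<notin> {t0<..<t0 + d}"
    proof eventually_elim
      fix t assume "W d t = 0"
      then show "t \<notin> {t0<..<t0 + d}" using W_pos[OF d, of t] by auto
    qed
    then have "{t0<..<t0 + d} \<in> null_sets lborel" by (subst AE_iff_null_sets) auto
    then show False using d by (auto simp: null_sets_def)
  qed
  show "0 < d \<Longrightarrow> 0 < lap \<theta> (bump t0 d) (\<lambda>_. 1)" by (rule c_pos)
  show "\<bar>lap \<theta> (bump t0 d) k\<bar> \<le> B * lap \<theta> (bump t0 d) (\<lambda>_. 1)"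
  proof -
    have "\<bar>\<integral>t. W d t * k t \<partial>lborel\<bar> \<le> (\<integral>t. B * (W d t * 1) \<partial>lborel)"
    proof (rule abs_integral_le_integral)
      show "integrable lborel (\<lambda>t. B * (W d t * 1))" by (rule integrable_mult_right[OF int[OF one]])
      fix t
      have "\<bar>k t\<bar> \<le> B" using k by (simp add: admissible_def)
      then have "W d t * \<bar>k t\<bar> \<le> W d t * B" by (rule mult_left_mono) (rule W0)
      then show "\<bar>W d t * k t\<bar> \<le> B * (W d t * 1)" using W0[of d t] by (simp add: abs_mult mult.commute)
    qed (rule int[OF k])
    then show ?thesis unfolding lapW integral_mult_right_zero .
  qed
  show "(\<lambda>n. lap \<theta> (bump t0 (1 / real (Suc n))) k / lap \<theta> (bump t0 (1 / real (Suc n))) (\<lambda>_. 1)) \<longlonglongrightarrow> k t0"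
  proof (rule LIMSEQ_I)
    fix r :: real assume r: "0 < r"
    have "\<forall>\<^sub>F t in at_right t0. dist (k t) (k t0) < r / 2" using rc r by (intro tendstoD) auto
    then obtain b where b: "t0 < b" "\<And>t. t0 < t \<Longrightarrow> t < b \<Longrightarrow> \<bar>k t - k t0\<bar> < r / 2"
      unfolding eventually_at_right_field by (auto simp: dist_real_def)
    obtain N where N: "1 / real (Suc N) < b - t0" using b(1) reals_Archimedean[of "b - t0"] by (auto simp: inverse_eq_divide)
    show "\<exists>no. \<forall>n\<ge>no. norm (lap \<theta> (bump t0 (1 / real (Suc n))) k / lap \<theta> (bump t0 (1 / real (Suc n))) (\<lambda>_. 1) - k t0) < r"
    proof (intro exI[of _ N] allI impI)
      fix n assume "N \<le> n"
      define d where "d = 1 / real (Suc n)"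
      define c where "c = lap \<theta> (bump t0 d) (\<lambda>_. 1)"
      have d: "0 < d" by (simp add: d_def)
      have c: "0 < c" unfolding c_def by (rule c_pos[OF d])
      have "d \<le> 1 / real (Suc N)" using \<open>N \<le> n\<close> by (simp add: d_def frac_le)
      then have db: "t0 + d \<le> b" using N by linarith
      have i1: "integrable lborel (\<lambda>t. W d t * 1)" by (rule int[OF one])
      have c_eq: "c = (\<integral>t. W d t * 1 \<partial>lborel)" by (simp only: c_def lapW)
      have "\<bar>lap \<theta> (bump t0 d) k - k t0 * c\<bar> = \<bar>\<integral>t. W d t * k t - k t0 * (W d t * 1) \<partial>lborel\<bar>"
        unfolding lapW[of d k] c_eq integral_mult_right_zero[symmetric]
        by (subst Bochner_Integration.integral_diff[OF int[OF k] integrable_mult_right[OF i1]]) simp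
      also have "\<dots> \<le> (\<integral>t. (r / 2) * (W d t * 1) \<partial>lborel)"
      proof (rule abs_integral_le_integral)
        show "integrable lborel (\<lambda>t. W d t * k t - k t0 * (W d t * 1))"
          by (rule Bochner_Integration.integrable_diff[OF int[OF k] integrable_mult_right[OF i1]])
        show "integrable lborel (\<lambda>t. (r / 2) * (W d t * 1))" by (rule integrable_mult_right[OF i1])
        fix t
        have "W d t * \<bar>k t - k t0\<bar> \<le> W d t * (r / 2)"
        proof (cases "0 < W d t")
          case True
          then have "t0 < t" "t < b" using W_pos[OF d] db by auto
          from b(2)[OF this] True show ?thesis by (intro mult_left_mono) auto
        next
          case False
          then have "W d t = 0" using W0[of d t] by linarith
          then show ?thesis by simp
        qed
        moreover have "W d t * k t - k t0 * (W d t * 1) = W d t * (k t - k t0)" by (simp add: algebra_simps)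
        ultimately show "\<bar>W d t * k t - k t0 * (W d t * 1)\<bar> \<le> (r / 2) * (W d t * 1)"
          using W0[of d t] by (simp add: abs_mult mult.commute)
      qed
      also have "\<dots> = r / 2 * c" unfolding c_eq integral_mult_right_zero ..
      finally have "\<bar>lap \<theta> (bump t0 d) k - k t0 * c\<bar> \<le> r / 2 * c" .
      moreover have "lap \<theta> (bump t0 d) k / c - k t0 = (lap \<theta> (bump t0 d) k - k t0 * c) / c"
        using c by (simp add: diff_divide_distrib)
      ultimately have "\<bar>lap \<theta> (bump t0 d) k / c - k t0\<bar> \<le> r / 2"
        using c by (simp add: abs_divide pos_divide_le_eq)
      then show "norm (lap \<theta> (bump t0 (1 / real (Suc n))) k / lap \<theta> (bump t0 (1 / real (Suc n))) (\<lambda>_. 1) - k t0) < r"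
        using r unfolding d_def[symmetric] c_def[symmetric] real_norm_def by linarith
    qed
  qed
qed

text \<open>Equality of the transforms at all \<open>\<theta> + i\<close> is equality for
  polynomials in \<open>exp (- t)\<close>; Stone--Weierstrass on the unit interval extends it to
  continuous test functions, and the bumps localise at \<open>t0\<close>. Measurability in
  \<open>y\<close> passes through both limits, and so does the integral over \<open>M\<close>, by
  dominated convergence.\<close>

theorem laplace_inversion:
  fixes h :: "'b \<Rightarrow> real \<Rightarrow> real" and H :: "real \<Rightarrow> real"
  assumes M: "prob_space M" and B: "1 \<le> B"
    and h: "\<And>y. admissible (h y)" and H: "admissible H"
    and rch: "\<And>y. (h y \<longlongrightarrow> h y t0) (at_right t0)" and rcH: "(H \<longlongrightarrow> H t0) (at_right t0)"
    and meas: "\<And>i. (\<lambda>y. \<integral>t. expw (\<theta> + real i) t * h y t \<partial>lborel) \<in> borel_measurable M"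
    and ex: "\<And>i. (\<integral>t. expw (\<theta> + real i) t * H t \<partial>lborel) = (\<integral>y. (\<integral>t. expw (\<theta> + real i) t * h y t \<partial>lborel) \<partial>M)"
    and t0: "0 \<le> t0"
  shows "(\<lambda>y. h y t0) \<in> borel_measurable M" "H t0 = (\<integral>y. h y t0 \<partial>M)"
proof -
  interpret prob_space M by fact
  have B0: "0 \<le> B" using B by linarith
  have cont: "(\<lambda>y. lap \<theta> \<phi> (h y)) \<in> borel_measurable M \<and> lap \<theta> \<phi> H = (\<integral>y. lap \<theta> \<phi> (h y) \<partial>M)"
    if \<phi>: "continuous_on UNIV \<phi>" for \<phi>
  proof -
    have "\<exists>a N. \<forall>v\<in>{0..1}. \<bar>\<phi> v - (\<Sum>i\<le>N. a i * v ^ i)\<bar> < 1 / real (Suc n)" for n :: nat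
    proof -
      obtain g where g: "real_polynomial_function g" "\<And>v. v \<in> {0..1} \<Longrightarrow> \<bar>\<phi> v - g v\<bar> < 1 / real (Suc n)"
        using Stone_Weierstrass_real_polynomial_function[of "{0..1::real}" \<phi> "1 / real (Suc n)"]
          continuous_on_subset[OF \<phi>] by auto
      obtain a N where "g = (\<lambda>x. \<Sum>i\<le>N. a i * x ^ i)"
        using g(1) unfolding real_polynomial_function_iff_sum by blast
      then show ?thesis using g(2) by (intro exI[of _ a] exI[of _ N]) auto
    qed
    then obtain a N where aN: "\<And>n v. v \<in> {0..1} \<Longrightarrow> \<bar>\<phi> v - (\<Sum>i\<le>N n. a n i * v ^ i)\<bar> < 1 / real (Suc n)" by metis
    define q where "q n v = (\<Sum>i\<le>N n. a n i * v ^ i)" for n v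
    have qc: "continuous_on UNIV (q n)" for n unfolding q_def[abs_def] by (intro continuous_intros)
    have close: "\<bar>lap \<theta> \<phi> k - lap \<theta> (q n) k\<bar> \<le> 1 / real (Suc n) * B / \<theta>" if "admissible k" for n k
      by (rule lap_diff[OF that \<phi> qc]) (use aN[of _ n] in \<open>auto simp: q_def intro: less_imp_le\<close>)
    have conv: "(\<lambda>n. lap \<theta> (q n) k) \<longlonglongrightarrow> lap \<theta> \<phi> k" if "admissible k" for k
    proof (rule Lim_transform[OF tendsto_const])
      show "(\<lambda>n. lap \<theta> (q n) k - lap \<theta> \<phi> k) \<longlonglongrightarrow> 0"
      proof (rule Lim_null_comparison[where g = "\<lambda>n. 1 / real (Suc n) * B / \<theta>"])
        show "\<forall>\<^sub>F n in sequentially. norm (lap \<theta> (q n) k - lap \<theta> \<phi> k) \<le> 1 / real (Suc n) * B / \<theta>"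
          using close[OF that] by (simp add: abs_minus_commute)
        have "(\<lambda>n. 1 / real (Suc n) * (B / \<theta>)) \<longlonglongrightarrow> 0 * (B / \<theta>)"
          by (intro tendsto_intros LIMSEQ_Suc lim_inverse_n')
        then show "(\<lambda>n. 1 / real (Suc n) * B / \<theta>) \<longlonglongrightarrow> 0" by simp
      qed
    qed
    have qm: "(\<lambda>y. lap \<theta> (q n) (h y)) \<in> borel_measurable M" for n
      unfolding q_def[abs_def] lap_poly[OF h] by (intro borel_measurable_sum borel_measurable_times borel_measurable_const meas)
    obtain c where c: "\<And>v. 0 \<le> v \<Longrightarrow> v \<le> 1 \<Longrightarrow> \<bar>\<phi> v\<bar> \<le> c" using continuous_bounded_01[OF \<phi>] by blast
    \<comment> \<open>Uniform in \<open>n\<close>, as the approximations stay within distance 1 of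
      \<open>\<phi>\<close>; this is the dominating constant.\<close>
    have qb: "\<bar>lap \<theta> (q n) (h y)\<bar> \<le> (c + 1) * B / \<theta>" for n y
    proof (rule lap_bounds(2)[OF h qc])
      fix v :: real assume "0 \<le> v" "v \<le> 1"
      then have "\<bar>\<phi> v - q n v\<bar> < 1 / real (Suc n)" "\<bar>\<phi> v\<bar> \<le> c" using aN[of v n] c[of v] by (auto simp: q_def)
      moreover have "1 / real (Suc n) \<le> 1" by simp
      ultimately show "\<bar>q n v\<bar> \<le> c + 1" by linarith
    qed
    have bounded_i: "integrable M (\<lambda>y. \<integral>t. expw (\<theta> + real i) t * h y t \<partial>lborel)" for i
    proof (rule integrable_bounded[OF meas])
      show "\<bar>\<integral>t. expw (\<theta> + real i) t * h y t \<partial>lborel\<bar> \<le> B / (\<theta> + real i)" for y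
        using h[of y] \<theta> by (intro expw_integral_bound) (auto simp: admissible_def)
    qed
    have qe: "lap \<theta> (q n) H = (\<integral>y. lap \<theta> (q n) (h y) \<partial>M)" for n
      unfolding q_def[abs_def] lap_poly[OF h] lap_poly[OF H] ex
      using bounded_i by (subst Bochner_Integration.integral_sum) auto
    have pm: "(\<lambda>y. lap \<theta> \<phi> (h y)) \<in> borel_measurable M"
      by (rule borel_measurable_LIMSEQ_real[OF conv[OF h] qm])
    have "(\<lambda>n. \<integral>y. lap \<theta> (q n) (h y) \<partial>M) \<longlonglongrightarrow> (\<integral>y. lap \<theta> \<phi> (h y) \<partial>M)"
      by (rule integral_dominated_convergence[where w = "\<lambda>_. (c + 1) * B / \<theta>"])
         (use pm qm conv[OF h] qb in auto)
    with conv[OF H] have "lap \<theta> \<phi> H = (\<integral>y. lap \<theta> \<phi> (h y) \<partial>M)"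
      unfolding qe by (rule LIMSEQ_unique)
    with pm show ?thesis by simp
  qed
  define \<beta> where "\<beta> n = bump t0 (1 / real (Suc n))" for n
  define c where "c n = lap \<theta> (\<beta> n) (\<lambda>_. 1)" for n
  have c: "0 < c n" for n unfolding c_def \<beta>_def by (rule lap_bump(2)[OF t0 H rcH B]) simp
  have conv: "(\<lambda>n. lap \<theta> (\<beta> n) (h y) / c n) \<longlonglongrightarrow> h y t0" for y
    unfolding c_def \<beta>_def by (rule lap_bump(1)[OF t0 h rch B])
  have convH: "(\<lambda>n. lap \<theta> (\<beta> n) H / c n) \<longlonglongrightarrow> H t0"
    unfolding c_def \<beta>_def by (rule lap_bump(1)[OF t0 H rcH B])
  have bm: "(\<lambda>y. lap \<theta> (\<beta> n) (h y) / c n) \<in> borel_measurable M" for n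
    unfolding \<beta>_def
    by (intro borel_measurable_divide borel_measurable_const conjunct1[OF cont[OF bump_continuous]])
  have bb: "\<bar>lap \<theta> (\<beta> n) (h y) / c n\<bar> \<le> B" for n y
  proof -
    have "\<bar>lap \<theta> (\<beta> n) (h y)\<bar> \<le> B * c n"
      unfolding c_def \<beta>_def by (rule lap_bump(3)[OF t0 h rch B]) simp
    then show ?thesis using c[of n] by (simp add: abs_divide pos_divide_le_eq)
  qed
  have e: "lap \<theta> (\<beta> n) H / c n = (\<integral>y. lap \<theta> (\<beta> n) (h y) / c n \<partial>M)" for n
    using cont[OF bump_continuous, of t0 "1 / real (Suc n)"] unfolding \<beta>_def by simp
  show hm: "(\<lambda>y. h y t0) \<in> borel_measurable M" by (rule borel_measurable_LIMSEQ_real[OF conv bm])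
  have "(\<lambda>n. \<integral>y. lap \<theta> (\<beta> n) (h y) / c n \<partial>M) \<longlonglongrightarrow> (\<integral>y. h y t0 \<partial>M)"
    by (rule integral_dominated_convergence[where w = "\<lambda>_. B"]) (use hm bm conv bb in auto)
  with convH show "H t0 = (\<integral>y. h y t0 \<partial>M)" unfolding e by (rule LIMSEQ_unique)
qed

end

subsection \<open>The transition semigroup\<close>

text \<open>The whole space is excluded because its complement is empty and the distance to the
  empty set is 0 by convention, which would make every approximation vanish.\<close>

lemma open_approx:
  fixes G :: "'a::metric_space set"
  assumes G: "open G" "G \<noteq> UNIV"
  defines "g \<equiv> \<lambda>k y. min 1 (real k * infdist y (- G))"
  shows "continuous_on UNIV (g k)" "\<bar>g k y\<bar> \<le> 1" "(\<lambda>k. g k y) \<longlonglongrightarrow> indicator G y"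
proof -
  show "continuous_on UNIV (g k)" unfolding g_def by (intro continuous_intros)
  show "\<bar>g k y\<bar> \<le> 1" using infdist_nonneg[of y "- G"] by (auto simp: g_def min_def)
  show "(\<lambda>k. g k y) \<longlonglongrightarrow> indicator G y"
  proof (cases "y \<in> G")
    case True
    have "closed (- G)" "- G \<noteq> {}" using G by auto
    then have "infdist y (- G) \<noteq> 0" using True by (simp add: in_closed_iff_infdist_zero[symmetric])
    then have "0 < infdist y (- G)" using infdist_nonneg[of y "- G"] by linarith
    then obtain N where N: "1 < real N * infdist y (- G)" using reals_Archimedean3 by blast
    have "g k y = 1" if "N \<le> k" for k
    proof -
      have "real N * infdist y (- G) \<le> real k * infdist y (- G)"
        using that infdist_nonneg by (intro mult_right_mono) auto
      then show ?thesis using N by (simp add: g_def)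
    qed
    then have "\<forall>\<^sub>F k in sequentially. g k y = indicator G y"
      using True unfolding eventually_sequentially by (intro exI[of _ N]) auto
    then show ?thesis by (rule tendsto_eventually)
  next
    case False
    then show ?thesis by (simp add: g_def)
  qed
qed

lemma open_approx_integral:
  fixes G :: "'a::metric_space set"
  assumes \<mu>: "prob_space \<mu>" "sets \<mu> = sets borel" and G: "open G" "G \<noteq> UNIV"
  shows "(\<lambda>k. \<integral>y. min 1 (real k * infdist y (- G)) \<partial>\<mu>) \<longlonglongrightarrow> measure \<mu> G"
proof -
  interpret prob_space \<mu> by fact
  note [measurable_cong] = \<mu>(2)
  have sp: "space \<mu> = UNIV" using sets_eq_imp_space_eq[OF \<mu>(2)] by simp
  have "(\<lambda>k. \<integral>y. min 1 (real k * infdist y (- G)) \<partial>\<mu>) \<longlonglongrightarrow> (\<integral>y. indicator G y \<partial>\<mu>)"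
  proof (rule integral_dominated_convergence[where w = "\<lambda>_. 1"])
    show "(\<lambda>y. min 1 (real k * infdist y (- G))) \<in> borel_measurable \<mu>" for k
      using borel_measurable_continuous_onI[OF open_approx(1)[OF G, of k]]
      by (subst measurable_cong_sets[OF \<mu>(2) refl])
    show "indicator G \<in> borel_measurable \<mu>"
      using borel_open[OF G(1)] by (subst measurable_cong_sets[OF \<mu>(2) refl]) simp
  qed (use open_approx(2,3)[OF G] in auto)
  then show ?thesis using borel_open[OF G(1)] by (simp add: sp \<mu>(2))
qed

lemma prob_measure_eq_of_continuous:
  fixes \<mu> \<nu> :: "'a::metric_space measure"
  assumes \<mu>: "prob_space \<mu>" "sets \<mu> = sets borel" and \<nu>: "prob_space \<nu>" "sets \<nu> = sets borel"
    and eq: "\<And>g :: 'a \<Rightarrow> real. continuous_on UNIV g \<Longrightarrow> (\<And>y. \<bar>g y\<bar> \<le> 1) \<Longrightarrow> (\<integral>y. g y \<partial>\<mu>) = (\<integral>y. g y \<partial>\<nu>)"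
  shows "\<mu> = \<nu>"
proof -
  interpret \<mu>: prob_space \<mu> by fact
  interpret \<nu>: prob_space \<nu> by fact
  have sp: "space \<mu> = UNIV" "space \<nu> = UNIV"
    using sets_eq_imp_space_eq[OF \<mu>(2)] sets_eq_imp_space_eq[OF \<nu>(2)] by auto
  have op: "emeasure \<mu> G = emeasure \<nu> G" if "open G" for G
  proof (cases "G = UNIV")
    case True
    then show ?thesis using \<mu>.emeasure_space_1 \<nu>.emeasure_space_1 by (simp add: sp)
  next
    case False
    have "(\<integral>y. min 1 (real k * infdist y (- G)) \<partial>\<mu>) = (\<integral>y. min 1 (real k * infdist y (- G)) \<partial>\<nu>)" for k
      by (rule eq) (rule open_approx(1)[OF that False], rule open_approx(2)[OF that False])
    then have "measure \<mu> G = measure \<nu> G"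
      using open_approx_integral[OF \<mu> that False] open_approx_integral[OF \<nu> that False]
      by (intro LIMSEQ_unique) auto
    then show ?thesis by (simp add: \<mu>.emeasure_eq_measure \<nu>.emeasure_eq_measure)
  qed
  show ?thesis
  proof (rule measure_eqI_generator_eq[where E = "Collect open" and \<Omega> = UNIV and A = "\<lambda>_. UNIV"])
    show "Int_stable (Collect open :: 'a set set)" by (auto simp: Int_stable_def)
    show "sets \<mu> = sigma_sets UNIV (Collect open)" "sets \<nu> = sigma_sets UNIV (Collect open)"
      using \<mu>(2) \<nu>(2) by (auto simp: borel_def sets_measure_of_conv)
  qed (use op in \<open>auto simp: \<mu>.emeasure_eq_measure\<close>)
qed

lemma interval_integral_shift:
  fixes \<phi> :: "real \<Rightarrow> real"
  assumes \<phi>[measurable]: "\<phi> \<in> borel_measurable borel" and B: "\<And>r. \<bar>\<phi> r\<bar> \<le> B" and s: "0 \<le> s" and t: "0 \<le> t"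
  shows "(\<integral>r. indicator {0..s + t} r * \<phi> r \<partial>lborel) =
    (\<integral>r. indicator {0..s} r * \<phi> r \<partial>lborel) + (\<integral>r. indicator {0..t} r * \<phi> (s + max 0 r) \<partial>lborel)"
proof -
  have i: "integrable lborel (\<lambda>r. indicator {a..b} r * \<phi> r)" for a b :: real
  proof (rule Bochner_Integration.integrable_bound[of _ "\<lambda>r. indicator {a..b} r * B"])
    show "integrable lborel (\<lambda>r. indicator {a..b} r * B)"
      by (intro integrable_mult_left integrable_real_indicator) (auto simp: emeasure_lborel_Icc_eq)
    show "AE r in lborel. norm (indicator {a..b} r * \<phi> r) \<le> norm (indicator {a..b} r * B)"
      using B by (auto simp: indicator_def intro: order_trans[OF _ abs_ge_self])
  qed measurable
  have "(\<integral>r. indicator {0..t} r * \<phi> (s + max 0 r) \<partial>lborel) = (\<integral>r. indicator {s..s + t} (s + 1 * r) * \<phi> (s + 1 * r) \<partial>lborel)"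
    by (intro Bochner_Integration.integral_cong) (auto simp: indicator_def max_def)
  also have "\<dots> = (\<integral>r. indicator {s..s + t} r * \<phi> r \<partial>lborel)"
    using lborel_integral_real_affine[of 1 "\<lambda>r. indicator {s..s + t} r * \<phi> r" s] by simp
  finally have 1: "(\<integral>r. indicator {0..t} r * \<phi> (s + max 0 r) \<partial>lborel) = (\<integral>r. indicator {s..s + t} r * \<phi> r \<partial>lborel)" .
  have "(\<integral>r. indicator {0..s + t} r * \<phi> r \<partial>lborel) = (\<integral>r. indicator {0..s} r * \<phi> r + indicator {s..s + t} r * \<phi> r \<partial>lborel)"
  proof (rule integral_cong_AE)
    show "AE r in lborel. indicator {0..s + t} r * \<phi> r = indicator {0..s} r * \<phi> r + indicator {s..s + t} r * \<phi> r"
      using AE_lborel_singleton[of s] by eventually_elim (use s t in \<open>auto simp: indicator_def\<close>)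
  qed measurable
  then show ?thesis unfolding 1 using i by simp
qed

lemma path_Fubini:
  fixes g :: "'a::metric_space \<Rightarrow> real"
  assumes M: "prob_space M" "sets M = sets (path_space UNIV)"
    and g: "g \<in> borel_measurable borel" "\<And>y. \<bar>g y\<bar> \<le> B" and t: "0 \<le> t"
  shows "integrable M (\<lambda>\<omega>. LBINT r:{0..t}. g (\<omega> r))"
    and "(\<integral>\<omega>. (LBINT r:{0..t}. g (\<omega> r)) \<partial>M) = (\<integral>r. indicator {0..t} r * (\<integral>\<omega>. g (\<omega> (max 0 r)) \<partial>M) \<partial>lborel)"
proof -
  interpret prob_space M by fact
  interpret pair_sigma_finite lborel M ..
  have B0: "0 \<le> B" using order_trans[OF abs_ge_zero g(2)] .
  have ev: "(\<lambda>q. g (snd q (max 0 (fst q)))) \<in> borel_measurable (lborel \<Otimes>\<^sub>M M)"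
  proof -
    have "(\<lambda>q. snd q (max 0 (fst q))) \<in> borel \<Otimes>\<^sub>M path_space UNIV \<rightarrow>\<^sub>M (borel :: 'a measure)"
      using measurable_path_eval_pair[where S = "UNIV :: 'a set"] by (simp add: split_beta')
    then have "(\<lambda>q. g (snd q (max 0 (fst q)))) \<in> borel_measurable (borel \<Otimes>\<^sub>M path_space UNIV)"
      by (rule measurable_compose) (rule g(1))
    moreover have "sets (lborel \<Otimes>\<^sub>M M) = sets (borel \<Otimes>\<^sub>M path_space UNIV)"
      by (intro sets_pair_measure_cong M(2)) simp
    ultimately show ?thesis using measurable_cong_sets[of "lborel \<Otimes>\<^sub>M M" _ borel borel] by blast
  qed
  define f where "f q = indicator {0..t} (fst q) * g (snd q (max 0 (fst q)))" for q
  have fm: "f \<in> borel_measurable (lborel \<Otimes>\<^sub>M M)"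
    unfolding f_def[abs_def] by (rule borel_measurable_times[OF _ ev]) measurable
  have fi: "integrable (lborel \<Otimes>\<^sub>M M) f"
  proof (rule integrableI_bounded[OF fm])
    have "(\<integral>\<^sup>+q. ennreal (norm (f q)) \<partial>(lborel \<Otimes>\<^sub>M M)) \<le> (\<integral>\<^sup>+q. ennreal B * indicator ({0..t} \<times> space M) q \<partial>(lborel \<Otimes>\<^sub>M M))"
      using g(2) B0 by (intro nn_integral_mono) (auto simp: f_def indicator_def space_pair_measure intro!: ennreal_leI)
    also have "\<dots> = ennreal B * emeasure (lborel \<Otimes>\<^sub>M M) ({0..t} \<times> space M)"
      by (rule nn_integral_cmult_indicator) (rule pair_measureI, simp_all)
    also have "\<dots> = ennreal B * ennreal t"
      proof -
      have "sigma_finite_measure M" by unfold_locales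
      from sigma_finite_measure.emeasure_pair_measure_Times[OF this, of "{0..t}" lborel "space M"]
      show ?thesis using t emeasure_space_1 by simp
    qed
    also have "\<dots> < \<infinity>" by (simp add: ennreal_mult_less_top)
    finally show "(\<integral>\<^sup>+q. ennreal (norm (f q)) \<partial>(lborel \<Otimes>\<^sub>M M)) < \<infinity>" .
  qed
  have fi': "integrable (lborel \<Otimes>\<^sub>M M) (\<lambda>(r, \<omega>). f (r, \<omega>))" using fi by simp
  have e: "(\<lambda>\<omega>. LBINT r:{0..t}. g (\<omega> r)) = (\<lambda>\<omega>. \<integral>r. f (r, \<omega>) \<partial>lborel)"
    unfolding set_lebesgue_integral_def f_def
    by (intro ext Bochner_Integration.integral_cong) (auto simp: indicator_def)
  show "integrable M (\<lambda>\<omega>. LBINT r:{0..t}. g (\<omega> r))"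
    unfolding e using integrable_snd[OF fi'] by simp
  have "(\<integral>\<omega>. (LBINT r:{0..t}. g (\<omega> r)) \<partial>M) = (\<integral>r. (\<integral>\<omega>. f (r, \<omega>) \<partial>M) \<partial>lborel)"
    unfolding e by (rule Fubini_integral[OF fi'])
  then show "(\<integral>\<omega>. (LBINT r:{0..t}. g (\<omega> r)) \<partial>M) = (\<integral>r. indicator {0..t} r * (\<integral>\<omega>. g (\<omega> (max 0 r)) \<partial>M) \<partial>lborel)"
    by (simp add: f_def)
qed

text \<open>Conditioning on time 0 preserves the mean; what has to be seen is that the natural
  filtration at time 0 is a subalgebra of the path sigma-algebra.\<close>

lemma martingale_mean:
  assumes M: "prob_space M" "sets M = sets (path_space UNIV)" and Y: "martingale M Y" and t: "0 \<le> t"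
  shows "(\<integral>\<omega>. Y t \<omega> \<partial>M) = (\<integral>\<omega>. Y 0 \<omega> \<partial>M)" "integrable M (Y t)"
proof -
  interpret prob_space M by fact
  have spM: "space M = cadlag_paths UNIV" using sets_eq_imp_space_eq[OF M(2)] by simp
  let ?G = "{(\<lambda>\<omega>. \<omega> s) -` B \<inter> space M | s B. s \<in> {0..0::real} \<and> B \<in> sets borel}"
  have G: "?G \<subseteq> sets M"
  proof (rule subsetI)
    fix A assume "A \<in> ?G"
    then obtain B where "B \<in> sets borel" "A = (\<lambda>\<omega>. \<omega> 0) -` B \<inter> space M" by auto
    moreover have "(\<lambda>\<omega>. \<omega> 0) \<in> M \<rightarrow>\<^sub>M borel"
      using measurable_path_eval[of 0 UNIV] by (subst measurable_cong_sets[OF M(2) refl]) simp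
    ultimately show "A \<in> sets M" by (simp add: measurable_sets)
  qed
  have "subalgebra M (natural_filtration M 0)"
    unfolding subalgebra_def natural_filtration_def
  proof
    have P: "?G \<subseteq> Pow (space M)" by auto
    show "space (sigma (space M) ?G) = space M" by (rule space_measure_of[OF P])
    show "sets (sigma (space M) ?G) \<subseteq> sets M"
      unfolding sets_measure_of[OF P] by (rule sets.sigma_sets_subset[OF G])
  qed
  then interpret finite_measure_subalgebra M "natural_filtration M 0"
    by unfold_locales
  show i: "integrable M (Y t)" using Y t by (simp add: martingale_def)
  have ae: "AE \<omega> in M. real_cond_exp M (natural_filtration M 0) (Y t) \<omega> = Y 0 \<omega>"
    using Y t unfolding martingale_def by blast
  have "integrable M (Y 0)" using Y by (simp add: martingale_def)
  then have "(\<integral>\<omega>. real_cond_exp M (natural_filtration M 0) (Y t) \<omega> \<partial>M) = (\<integral>\<omega>. Y 0 \<omega> \<partial>M)"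
    using ae by (intro integral_cong_AE) auto
  then show "(\<integral>\<omega>. Y t \<omega> \<partial>M) = (\<integral>\<omega>. Y 0 \<omega> \<partial>M)"
    using real_cond_exp_int(2)[OF i] by simp
qed

section \<open>Transition kernels of the jump-diffusion\<close>

locale martingale_family = jump_diffusion I S Q C Edges tail head K rate
  for I :: "'i set" and S :: "'i \<Rightarrow> 'a::metric_space set" and Q :: "'i \<Rightarrow> 'a \<Rightarrow> (real \<Rightarrow> 'a) measure"
    and C :: "'i \<Rightarrow> ('a \<Rightarrow> real) set" and Edges :: "'e set" and tail head :: "'e \<Rightarrow> 'i"
    and K :: "'e \<Rightarrow> 'a \<Rightarrow> 'a measure" and rate :: "'e \<Rightarrow> 'a \<Rightarrow> real" +
  fixes P :: "'a \<Rightarrow> (real \<Rightarrow> 'a) measure"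
  assumes P: "stratified_jump_diffusion I S Q C Edges tail K rate P"
begin

lemma P_facts: "prob_space (P x)" "sets (P x) = sets (path_space UNIV)" "AE \<omega> in P x. \<omega> 0 = x"
  "f \<in> D0 I S C \<Longrightarrow> martingale (P x) (\<lambda>t \<omega>. f (\<omega> t) - f (\<omega> 0) - (LBINT s:{0..t}. AA f (\<omega> s)))"
  using P unfolding stratified_jump_diffusion_def solves_martingale_problem_def by auto

text \<open>Clamped because paths are \<open>undefined\<close> at negative times, while the
  semigroup interface has all of the reals as time.\<close>

definition p :: "real \<Rightarrow> 'a \<Rightarrow> 'a measure" where "p t x = trans_prob P (max 0 t) x"

lemma P_eval: "0 \<le> t \<Longrightarrow> (\<lambda>\<omega>. \<omega> t) \<in> P x \<rightarrow>\<^sub>M borel"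
  using measurable_path_eval[of t UNIV] by (subst measurable_cong_sets[OF P_facts(2) refl])

lemma prob_pt: "prob_space (p t x)" and sets_pt: "sets (p t x) = sets borel"
  unfolding p_def trans_prob_def
  by (auto intro!: prob_space.prob_space_distr P_facts(1) P_eval)

lemma integral_p:
  fixes f :: "'a \<Rightarrow> real"
  assumes "f \<in> borel_measurable borel" shows "(\<integral>y. f y \<partial>p t x) = (\<integral>\<omega>. f (\<omega> (max 0 t)) \<partial>P x)"
  unfolding p_def trans_prob_def by (rule integral_distr[OF P_eval assms]) simp

lemma p_kernel_time: "(\<lambda>t. p t x) \<in> borel \<rightarrow>\<^sub>M prob_algebra borel"
  unfolding p_def[abs_def] trans_prob_def
proof (rule measurable_distr_prob_space2)
  show "(\<lambda>t. P x) \<in> borel \<rightarrow>\<^sub>M prob_algebra (path_space UNIV)"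
    using P_facts(1,2) by (intro measurable_const) (simp add: space_prob_algebra)
  show "(\<lambda>(t, \<omega>). \<omega> (max 0 t)) \<in> borel \<Otimes>\<^sub>M path_space UNIV \<rightarrow>\<^sub>M (borel :: 'a measure)"
    by (rule measurable_path_eval_pair)
qed

lemma core_bounds:
  assumes \<alpha>: "\<alpha> \<in> I" and u: "u \<in> C \<alpha>"
  obtains B where "u \<in> borel_measurable borel" "\<And>y. \<bar>u y\<bar> \<le> B" "AA u \<in> borel_measurable borel" "\<And>y. \<bar>AA u y\<bar> \<le> B"
proof -
  have dom: "u \<in> gen_dom (S \<alpha>) (sg \<alpha>)" using D_facts(4)[OF \<alpha>] u by blast
  note gu = gen_domD[OF dom]
  have um: "u \<in> borel_measurable borel" by (rule C0_measurable[OF gu(2) S[OF \<alpha>]])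
  have Lm: "Lg \<alpha> u \<in> borel_measurable borel" by (rule C0_measurable[OF gu(3) S[OF \<alpha>]])
  obtain B1 where B1: "\<And>y. \<bar>u y\<bar> \<le> B1" using C0_bounded[OF gu(2)] by blast
  obtain B2 where B2: "\<And>y. \<bar>Lg \<alpha> u y\<bar> \<le> B2" using C0_bounded[OF gu(3)] by blast
  have A: "AA u = (\<lambda>y. Lg \<alpha> u y + jop u y)" by (rule ext) (rule core_in_D0(2)[OF \<alpha> u])
  show ?thesis
  proof (rule that[of "max B1 (B2 + Rb * (2 * B1))", OF um])
    show "\<bar>u y\<bar> \<le> max B1 (B2 + Rb * (2 * B1))" for y using B1[of y] by simp
    show "AA u \<in> borel_measurable borel" unfolding A by (intro borel_measurable_add Lm jop_measurable um)
    have "\<bar>Lg \<alpha> u y + jop u y\<bar> \<le> B2 + Rb * (2 * B1)" for y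
      using B2[of y] jop_bound[OF um B1, of y] by linarith
    then show "\<bar>AA u y\<bar> \<le> max B1 (B2 + Rb * (2 * B1))" for y
      unfolding A by (rule order_trans) simp
  qed
qed

lemma p_forward_equation:
  assumes \<alpha>: "\<alpha> \<in> I" and u: "u \<in> C \<alpha>" and t: "0 \<le> t"
  shows "(\<integral>y. u y \<partial>p t x) = (\<integral>y. u y \<partial>p 0 x) + (\<integral>s. indicator {0..t} s * (\<integral>y. AA u y \<partial>p s x) \<partial>lborel)"
proof -
  interpret prob_space "P x" by (rule P_facts(1))
  obtain B where B: "u \<in> borel_measurable borel" "\<And>y. \<bar>u y\<bar> \<le> B" "AA u \<in> borel_measurable borel" "\<And>y. \<bar>AA u y\<bar> \<le> B"
    using core_bounds[OF \<alpha> u] by blast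
  define J where "J t \<omega> = (LBINT s:{0..t}. AA u (\<omega> s))" for t and \<omega> :: "real \<Rightarrow> 'a"
  have mart: "martingale (P x) (\<lambda>t \<omega>. u (\<omega> t) - u (\<omega> 0) - J t \<omega>)"
    unfolding J_def by (rule P_facts(4)[OF core_in_D0(1)[OF \<alpha> u]])
  have J0: "J 0 \<omega> = 0" for \<omega>
  proof -
    have "AE s in lborel. indicator {0..0} s *\<^sub>R AA u (\<omega> s) = 0"
      using AE_lborel_singleton[of 0] by eventually_elim auto
    then show ?thesis unfolding J_def set_lebesgue_integral_def by (rule integral_eq_zero_AE)
  qed
  have iu: "integrable (P x) (\<lambda>\<omega>. u (\<omega> s))" if "0 \<le> s" for s
    by (rule integrable_bounded[OF measurable_compose[OF P_eval[OF that] B(1)] B(2)])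
  note iJ = path_Fubini[OF P_facts(1,2) B(3,4) t, of x, folded J_def]
  have "(\<integral>\<omega>. u (\<omega> t) - u (\<omega> 0) - J t \<omega> \<partial>P x) = 0"
    using martingale_mean(1)[OF P_facts(1,2) mart t] by (simp add: J0)
  moreover have "(\<integral>\<omega>. u (\<omega> t) - u (\<omega> 0) - J t \<omega> \<partial>P x) = (\<integral>\<omega>. u (\<omega> t) \<partial>P x) - (\<integral>\<omega>. u (\<omega> 0) \<partial>P x) - (\<integral>\<omega>. J t \<omega> \<partial>P x)"
    using iu[OF t] iu[of 0] iJ(1) by simp
  ultimately show ?thesis
    using iJ(2) t by (simp add: integral_p[OF B(1)] integral_p[OF B(3)])
qed

text \<open>Restarting at time \<open>s\<close> needs no Markov property: the forward equations up
  to \<open>s + t\<close> and up to \<open>s\<close> are subtracted. The law at time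
  \<open>s\<close> takes the role of the initial law.\<close>

lemma forward_shifted:
  assumes s: "0 \<le> s" shows "forward (\<lambda>t. p (s + max 0 t) x)"
  unfolding forward_def
proof (intro conjI ballI allI impI)
  have "(\<lambda>t::real. s + max 0 t) \<in> borel \<rightarrow>\<^sub>M borel" by measurable
  from measurable_compose[OF this p_kernel_time]
  show "(\<lambda>t. p (s + max 0 t) x) \<in> borel \<rightarrow>\<^sub>M prob_algebra borel" .
  fix \<alpha> u and t :: real assume \<alpha>: "\<alpha> \<in> I" and u: "u \<in> C \<alpha>" and t: "0 \<le> t"
  obtain B where B: "u \<in> borel_measurable borel" "\<And>y. \<bar>u y\<bar> \<le> B" "AA u \<in> borel_measurable borel" "\<And>y. \<bar>AA u y\<bar> \<le> B"
    using core_bounds[OF \<alpha> u] by blast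
  define \<phi> where "\<phi> r = (\<integral>y. AA u y \<partial>p r x)" for r
  have \<phi>m: "\<phi> \<in> borel_measurable borel"
    unfolding \<phi>_def[abs_def] by (rule measurable_kernel_integral[OF p_kernel_time B(3)])
  have \<phi>b: "\<bar>\<phi> r\<bar> \<le> B" for r
    unfolding \<phi>_def
    by (rule prob_space.abs_integral_le[OF prob_pt _ B(4)]) (use B(3) in \<open>simp cong: measurable_cong_sets add: sets_pt\<close>)
  have "(\<integral>y. u y \<partial>p (s + t) x) = (\<integral>y. u y \<partial>p s x) + (\<integral>r. indicator {0..t} r * \<phi> (s + max 0 r) \<partial>lborel)"
    using p_forward_equation[OF \<alpha> u, of "s + t" x] p_forward_equation[OF \<alpha> u s, of x] s t
      interval_integral_shift[OF \<phi>m \<phi>b s t] by (simp add: \<phi>_def)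
  then show "(\<integral>y. u y \<partial>p (s + max 0 t) x) = (\<integral>y. u y \<partial>p (s + max 0 0) x) +
      (\<integral>r. indicator {0..t} r * (\<integral>y. AA u y \<partial>p (s + max 0 r) x) \<partial>lborel)"
    using t by (simp add: \<phi>_def)
qed

lemma p_max: "p (max 0 t) x = p t x"
  by (simp add: p_def)

lemma integral_p_0:
  fixes f :: "'a \<Rightarrow> real"
  assumes "f \<in> borel_measurable borel" shows "(\<integral>y. f y \<partial>p 0 x) = f x"
proof -
  interpret prob_space "P x" by (rule P_facts(1))
  have "(\<integral>\<omega>. f (\<omega> 0) \<partial>P x) = (\<integral>\<omega>. f x \<partial>P x)"
  proof (rule integral_cong_AE)
    show "(\<lambda>\<omega>. f (\<omega> 0)) \<in> borel_measurable (P x)" by (rule measurable_compose[OF P_eval assms]) simp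
    show "AE \<omega> in P x. f (\<omega> 0) = f x" using P_facts(3)[of x] by eventually_elim simp
  qed simp
  then show ?thesis by (simp add: integral_p[OF assms] prob_space)
qed

lemma p_right_continuous:
  fixes g :: "'a \<Rightarrow> real"
  assumes g: "continuous_on UNIV g" "\<And>y. \<bar>g y\<bar> \<le> B" and s: "0 \<le> s" and t: "0 \<le> t"
  shows "((\<lambda>r. \<integral>y. g y \<partial>p (s + max 0 r) x) \<longlongrightarrow> (\<integral>y. g y \<partial>p (s + max 0 t) x)) (at_right t)"
  unfolding tendsto_at_iff_sequentially comp_def
proof (intro allI impI)
  interpret prob_space "P x" by (rule P_facts(1))
  have gm: "g \<in> borel_measurable borel" using g(1) by (rule borel_measurable_continuous_onI)
  fix X :: "nat \<Rightarrow> real" assume X: "\<forall>i. X i \<in> {t<..} - {t}" "X \<longlonglongrightarrow> t"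
  have Xt: "max 0 (s + max 0 (X i)) = s + X i" "t < X i" for i using X(1)[rule_format, of i] s t by auto
  have tt: "max 0 (s + max 0 t) = s + t" using s t by auto
  have e: "(\<integral>y. g y \<partial>p (s + max 0 (X i)) x) = (\<integral>\<omega>. g (\<omega> (s + X i)) \<partial>P x)" for i
    unfolding integral_p[OF gm] Xt ..
  have "filterlim (\<lambda>i. s + X i) (at_right (s + t)) sequentially"
    unfolding filterlim_at
  proof
    show "(\<lambda>i. s + X i) \<longlonglongrightarrow> s + t" by (intro tendsto_intros X(2))
    show "\<forall>\<^sub>F i in sequentially. s + X i \<in> {s + t<..} \<and> s + X i \<noteq> s + t"
      using Xt(2) by (auto simp: less_imp_neq[symmetric])
  qed
  note fl = this
  have "(\<lambda>i. \<integral>\<omega>. g (\<omega> (s + X i)) \<partial>P x) \<longlonglongrightarrow> (\<integral>\<omega>. g (\<omega> (s + t)) \<partial>P x)"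
  proof (rule integral_dominated_convergence[where w = "\<lambda>_. B"])
    show "(\<lambda>\<omega>. g (\<omega> (s + t))) \<in> borel_measurable (P x)" by (rule measurable_compose[OF P_eval gm]) (use s t in simp)
    show "(\<lambda>\<omega>. g (\<omega> (s + X i))) \<in> borel_measurable (P x)" for i
      by (rule measurable_compose[OF P_eval gm]) (use s t Xt(2)[of i] in simp)
    show "AE \<omega> in P x. (\<lambda>i. g (\<omega> (s + X i))) \<longlonglongrightarrow> g (\<omega> (s + t))"
    proof (rule AE_I2)
      fix \<omega> assume "\<omega> \<in> space (P x)"
      then have "\<omega> \<in> cadlag_paths UNIV" using sets_eq_imp_space_eq[OF P_facts(2)] by simp
      then have "(\<omega> \<longlongrightarrow> \<omega> (s + t)) (at_right (s + t))" using s t by (intro cadlag_pathsD) auto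
      from filterlim_compose[OF this fl] have "(\<lambda>i. \<omega> (s + X i)) \<longlonglongrightarrow> \<omega> (s + t)" .
      then show "(\<lambda>i. g (\<omega> (s + X i))) \<longlonglongrightarrow> g (\<omega> (s + t))"
        by (rule continuous_on_tendsto_compose[OF g(1)]) auto
    qed
    show "AE \<omega> in P x. norm (g (\<omega> (s + X i))) \<le> B" for i using g(2) by simp
  qed simp
  then show "(\<lambda>i. \<integral>y. g y \<partial>p (s + max 0 (X i)) x) \<longlonglongrightarrow> (\<integral>y. g y \<partial>p (s + max 0 t) x)"
    unfolding e integral_p[OF gm, of "s + max 0 t"] tt .
qed

text \<open>Two kinds of flow are compared: the flow from \<open>x\<close> restarted at
  \<open>s\<close>, and the flow from each \<open>y\<close>. Both have Laplace transforms given by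
  \<open>Psi\<close>, integrated against the law at time \<open>s\<close> in the first case and
  evaluated at \<open>y\<close> in the second. Inversion gives measurability in \<open>y\<close> and
  the Chapman--Kolmogorov equation together.\<close>

lemma p_continuous_functions:
  fixes g :: "'a \<Rightarrow> real"
  assumes g: "continuous_on UNIV g" "\<And>y. \<bar>g y\<bar> \<le> 1" and s: "0 \<le> s" and t: "0 \<le> t"
  shows "(\<lambda>y. \<integral>z. g z \<partial>p t y) \<in> borel_measurable borel"
    and "(\<integral>z. g z \<partial>p (s + t) x) = (\<integral>y. (\<integral>z. g z \<partial>p t y) \<partial>p s x)"
proof -
  have gm: "g \<in> borel_measurable borel" using g(1) by (rule borel_measurable_continuous_onI)
  \<comment> \<open>The smallest parameter covered by \<open>resolvent_solution\<close>; the
    inversion uses all \<open>\<theta> + i\<close>.\<close>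
  define \<theta> where "\<theta> = 4 * Rb"
  have \<theta>: "0 < \<theta>" using Rb_ge_1 by (simp add: \<theta>_def)
  have \<theta>i: "0 < \<theta> + real i" "4 * Rb \<le> \<theta> + real i" for i using \<theta> by (auto simp: \<theta>_def)
  \<comment> \<open>Written with the shift 0, so that it is literally a restarted flow like
    \<open>H\<close>.\<close>
  define h where "h y r = (\<integral>z. g z \<partial>p (0 + max 0 r) y)" for y r
  define H where "H r = (\<integral>z. g z \<partial>p (s + max 0 r) x)" for r
  have adm: "admissible 1 (\<lambda>r. \<integral>z. g z \<partial>p (s + max 0 r) y)" if "0 \<le> s" for s y
    unfolding admissible_def[OF \<theta>]
    using m_measurable[OF forward_shifted[OF that, of y] gm] m_bound[OF forward_shifted[OF that, of y] gm g(2)] by (intro conjI allI)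
  have trans: "(\<integral>r. expw (\<theta> + real i) r * (\<integral>z. g z \<partial>p (s + max 0 r) y) \<partial>lborel)
      = (\<integral>z. Psi (\<theta> + real i) g z \<partial>p s y) / (\<theta> + real i)" if "0 \<le> s" for s y i
  proof -
    note fw = forward_shifted[OF that, of y]
    have "(\<theta> + real i) * (\<integral>r. expw (\<theta> + real i) r * (\<integral>z. g z \<partial>p (s + max 0 r) y) \<partial>lborel) = (\<integral>z. Psi (\<theta> + real i) g z \<partial>p (s + max 0 0) y)"
      using integral_U[OF fw \<theta>i(1) gm g(2)] resolvent_solution(2)[OF \<theta>i(2) gm g(2) fw] by simp
    then show ?thesis using \<theta>i(1)[of i] by (simp add: field_simps)
  qed
  have Pm: "Psi (\<theta> + real i) g \<in> borel_measurable borel" for i by (rule resolvent_solution(1)[OF \<theta>i(2) gm g(2)])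
  have hi: "(\<integral>r. expw (\<theta> + real i) r * h y r \<partial>lborel) = Psi (\<theta> + real i) g y / (\<theta> + real i)" for i y
    unfolding h_def trans[OF order_refl] integral_p_0[OF Pm] ..
  have sp: "sets (p s x) = sets borel" by (rule sets_pt)
  have h_adm: "admissible 1 (h y)" for y
    unfolding h_def[abs_def] by (rule adm) simp
  have H_adm: "admissible 1 H" unfolding H_def[abs_def] by (rule adm[OF s])
  have h_rc: "(h y \<longlongrightarrow> h y t) (at_right t)" for y
    unfolding h_def[abs_def] by (rule p_right_continuous[OF g order_refl t])
  have H_rc: "(H \<longlongrightarrow> H t) (at_right t)"
    unfolding H_def[abs_def] by (rule p_right_continuous[OF g s t])
  have h_lap: "(\<lambda>y. \<integral>r. expw (\<theta> + real i) r * h y r \<partial>lborel) \<in> borel_measurable (p s x)" for i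
    unfolding hi measurable_cong_sets[OF sp refl] using Pm by (intro borel_measurable_divide) auto
  have H_lap: "(\<integral>r. expw (\<theta> + real i) r * H r \<partial>lborel) = (\<integral>y. (\<integral>r. expw (\<theta> + real i) r * h y r \<partial>lborel) \<partial>p s x)" for i
    unfolding hi H_def trans[OF s] by simp
  note inv = laplace_inversion[OF \<theta> prob_pt order_refl h_adm H_adm h_rc H_rc h_lap H_lap t]
  \<comment> \<open>The measurability statement of the inversion concerns \<open>p s x\<close>, but
    depends only on its sigma-algebra, the Borel one.\<close>
  show "(\<lambda>y. \<integral>z. g z \<partial>p t y) \<in> borel_measurable borel"
    using inv(1) unfolding measurable_cong_sets[OF sp refl] by (simp add: h_def p_max)
  show "(\<integral>z. g z \<partial>p (s + t) x) = (\<integral>y. (\<integral>z. g z \<partial>p t y) \<partial>p s x)"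
    using inv(2) t by (simp add: h_def H_def p_max)
qed

text \<open>Open sets generate, and their probabilities are limits of integrals of continuous
  functions, which are measurable in the state at each time and right continuous in time.\<close>

lemma p_kernel: "(\<lambda>(t, x). p t x) \<in> borel \<Otimes>\<^sub>M borel \<rightarrow>\<^sub>M prob_algebra borel"
proof (rule measurable_prob_algebra_generated[where G = "Collect open" and \<Omega> = UNIV])
  show "sets (borel :: 'a measure) = sigma_sets UNIV (Collect open)"
    by (simp add: borel_def sets_measure_of_conv)
  show "Int_stable (Collect open :: 'a set set)" by (auto simp: Int_stable_def)
  fix G :: "'a set" assume "G \<in> Collect open"
  then have G: "open G" by simp
  show "(\<lambda>a. emeasure (case a of (t, x) \<Rightarrow> p t x) G) \<in> borel_measurable (borel \<Otimes>\<^sub>M borel)"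
  proof (cases "G = UNIV")
    case True
    have "emeasure (p t x) UNIV = 1" for t x
      using prob_space.emeasure_space_1[OF prob_pt, of t x] sets_eq_imp_space_eq[OF sets_pt, of t x] by simp
    then show ?thesis unfolding True by (simp add: split_beta)
  next
    case False
    define g where "g k y = min 1 (real k * infdist y (- G))" for k and y :: 'a
    note gc = open_approx(1,2)[OF G False, folded g_def]
    have "(\<lambda>a. measure (p (fst a) (snd a)) G) \<in> borel_measurable (borel \<Otimes>\<^sub>M borel)"
    proof (rule borel_measurable_LIMSEQ_real)
      show "(\<lambda>k. \<integral>y. g k y \<partial>p (fst a) (snd a)) \<longlonglongrightarrow> measure (p (fst a) (snd a)) G" for a
        unfolding g_def by (rule open_approx_integral[OF prob_pt sets_pt G False])
      fix k
      have "(\<lambda>(t, x). \<integral>y. g k y \<partial>p (max 0 t) x) \<in> borel_measurable (borel \<Otimes>\<^sub>M borel)"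
      proof (rule measurable_right_continuous[where F = "\<lambda>t x. \<integral>y. g k y \<partial>p t x"])
        show "(\<lambda>x. \<integral>y. g k y \<partial>p t x) \<in> borel_measurable borel" if "0 \<le> t" for t
          by (rule p_continuous_functions(1)[OF gc order_refl that])
        show "((\<lambda>s. \<integral>y. g k y \<partial>p s x) \<longlongrightarrow> (\<integral>y. g k y \<partial>p t x)) (at_right t)" if "0 \<le> t" for t x
          using p_right_continuous[OF gc order_refl that, of x] by (simp add: p_max)
      qed
      then show "(\<lambda>a. \<integral>y. g k y \<partial>p (fst a) (snd a)) \<in> borel_measurable (borel \<Otimes>\<^sub>M borel)"
        by (simp add: p_max split_beta)
    qed
    moreover have "emeasure (p t x) G = ennreal (measure (p t x) G)" for t x
    proof -
      interpret prob_space "p t x" by (rule prob_pt)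
      show ?thesis by (rule emeasure_eq_measure)
    qed
    ultimately show ?thesis by (simp add: split_beta)
  qed
qed (auto simp: prob_pt sets_pt)

sublocale semi: markov_semigroup p
proof
  show k: "(\<lambda>(t, x). p t x) \<in> borel \<Otimes>\<^sub>M borel \<rightarrow>\<^sub>M prob_algebra borel" by (rule p_kernel)
  fix s t x assume st: "0 \<le> (s::real)" "0 \<le> (t::real)"
  have pin: "p s x \<in> space (prob_algebra borel)" by (simp add: space_prob_algebra prob_pt sets_pt)
  have kt: "p t \<in> borel \<rightarrow>\<^sub>M prob_algebra borel"
  proof -
    have "(\<lambda>x. (t, x)) \<in> borel \<rightarrow>\<^sub>M borel \<Otimes>\<^sub>M borel" by (intro measurable_Pair) auto
    from measurable_compose[OF this k] show ?thesis by simp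
  qed
  have bin: "p s x \<bind> p t \<in> space (prob_algebra borel)" by (rule bind_in_prob_algebra[OF pin kt])
  show "p (s + t) x = p s x \<bind> p t"
  proof (rule prob_measure_eq_of_continuous[OF prob_pt sets_pt])
    show "prob_space (p s x \<bind> p t)" "sets (p s x \<bind> p t) = sets borel"
      using bin by (auto simp: space_prob_algebra)
    fix g :: "'a \<Rightarrow> real" assume g: "continuous_on UNIV g" "\<And>y. \<bar>g y\<bar> \<le> 1"
    show "(\<integral>y. g y \<partial>p (s + t) x) = (\<integral>y. g y \<partial>(p s x \<bind> p t))"
      unfolding integral_bind_prob_algebra[OF pin kt borel_measurable_continuous_onI[OF g(1)] g(2)]
      by (rule p_continuous_functions(2)[OF g st])
  qed
qed

lemma trans_prob_p: "0 \<le> t \<Longrightarrow> trans_prob P t x = p t x"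
  by (simp add: p_def)

text \<open>Irreducibility is stated for paths; this turns it into a statement about the
  kernels.\<close>

lemma occupation:
  assumes B[measurable]: "B \<in> sets borel"
  shows "(\<integral>\<^sup>+\<omega>. (\<integral>\<^sup>+t\<in>{0..}. indicator B (\<omega> t) \<partial>lborel) \<partial>P x) = (\<integral>\<^sup>+t\<in>{0..}. emeasure (p t x) B \<partial>lborel)"
proof -
  interpret prob_space "P x" by (rule P_facts(1))
  interpret pair_sigma_finite "P x" lborel ..
  have ev: "(\<lambda>q. fst q (max 0 (snd q))) \<in> P x \<Otimes>\<^sub>M lborel \<rightarrow>\<^sub>M borel"
  proof -
    have "(\<lambda>q. (snd q, fst q)) \<in> P x \<Otimes>\<^sub>M lborel \<rightarrow>\<^sub>M borel \<Otimes>\<^sub>M P x" by measurable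
    then have "(\<lambda>q. (snd q, fst q)) \<in> P x \<Otimes>\<^sub>M lborel \<rightarrow>\<^sub>M borel \<Otimes>\<^sub>M path_space UNIV"
      by (subst measurable_cong_sets[OF refl sets_pair_measure_cong[OF refl P_facts(2)[symmetric]]])
    from measurable_compose[OF this measurable_path_eval_pair] show ?thesis by (simp add: split_beta)
  qed
  have "(\<integral>\<^sup>+\<omega>. (\<integral>\<^sup>+t\<in>{0..}. indicator B (\<omega> t) \<partial>lborel) \<partial>P x) =
      (\<integral>\<^sup>+\<omega>. (\<integral>\<^sup>+t. indicator B (\<omega> (max 0 t)) * indicator {0..} t \<partial>lborel) \<partial>P x)"
    by (intro nn_integral_cong) (auto simp: indicator_def max_def)
  also have "\<dots> = (\<integral>\<^sup>+t. (\<integral>\<^sup>+\<omega>. indicator B (\<omega> (max 0 t)) * indicator {0..} t \<partial>P x) \<partial>lborel)"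
  proof (rule Fubini'[symmetric])
    have "(\<lambda>q. indicator B (fst q (max 0 (snd q))) * indicator {0..} (snd q) :: ennreal) \<in> borel_measurable (P x \<Otimes>\<^sub>M lborel)"
      by (rule borel_measurable_times_ennreal[OF measurable_compose[OF ev]]) measurable
    then show "(\<lambda>(\<omega>, t). indicator B (\<omega> (max 0 t)) * indicator {0..} t :: ennreal) \<in> borel_measurable (P x \<Otimes>\<^sub>M lborel)"
      by (simp add: split_beta)
  qed
  also have "\<dots> = (\<integral>\<^sup>+t\<in>{0..}. emeasure (p t x) B \<partial>lborel)"
  proof (rule nn_integral_cong)
    fix t :: real
    have "(\<integral>\<^sup>+\<omega>. indicator B (\<omega> (max 0 t)) \<partial>P x) = emeasure (p t x) B"
    proof -
      have "(\<integral>\<^sup>+\<omega>. indicator B (\<omega> (max 0 t)) \<partial>P x) = (\<integral>\<^sup>+y. indicator B y \<partial>p t x)"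
        unfolding p_def trans_prob_def using P_eval[of "max 0 t" x] by (subst nn_integral_distr) auto
      then show ?thesis by (simp add: sets_pt)
    qed
    moreover have "(\<lambda>\<omega>. indicator B (\<omega> (max 0 t)) :: ennreal) \<in> borel_measurable (P x)"
      by (rule measurable_compose[OF P_eval]) auto
    ultimately show "(\<integral>\<^sup>+\<omega>. indicator B (\<omega> (max 0 t)) * indicator {0..} t \<partial>P x) = emeasure (p t x) B * indicator {0..} t"
      by (subst nn_integral_multc) auto
  qed
  finally show ?thesis .
qed

section \<open>V-uniform ergodicity of the jump-diffusion\<close>

theorem V_uniform_ergodicity:
  assumes Om: "exhaustion Om" and L: "assumption_L P Om V" and \<pi>: "invariant_prob P \<pi>" and ap: "aperiodic P"
  shows "V_uniformly_geometrically_ergodic P \<pi> V"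
proof -
  have V: "V \<in> borel_measurable borel" "\<And>x. 1 \<le> V x" using L by (auto simp: assumption_L_def)
  have V0: "0 \<le> V x" for x using order_trans[OF zero_le_one V(2)] .
  obtain C' \<kappa> b where C': "closed C'" "petite P C'" and \<kappa>: "0 < \<kappa>" and b: "0 < b"
    and drift: "\<And>m. 1 \<le> m \<Longrightarrow> \<exists>G. trunc_ext_gen P (Om m) V G \<and> (\<forall>x\<in>Om m. G x \<le> - \<kappa> * V x + b * indicator C' x)"
    using L unfolding assumption_L_def by blast
  have C'm: "C' \<in> sets borel" using C'(1) by (rule borel_closed)
  interpret dr: drift_semigroup p V \<kappa> b C'
  proof
    fix t x assume t: "0 \<le> (t::real)"
    have 1: "(\<integral>\<^sup>+s\<in>{0..t}. (\<integral>\<^sup>+y. ennreal (V y) \<partial>trans_prob P s x) \<partial>lborel) = (\<integral>\<^sup>+s\<in>{0..t}. (\<integral>\<^sup>+y. ennreal (V y) \<partial>p s x) \<partial>lborel)"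
      by (intro nn_integral_cong) (auto simp: indicator_def trans_prob_p)
    have 2: "(\<integral>\<^sup>+s\<in>{0..t}. emeasure (trans_prob P s x) C' \<partial>lborel) = semi.occ t x C'"
      unfolding semi.occ_def by (intro nn_integral_cong) (auto simp: indicator_def trans_prob_p)
    show "(\<integral>\<^sup>+y. ennreal (V y) \<partial>p t x) + ennreal \<kappa> * (\<integral>\<^sup>+s\<in>{0..t}. (\<integral>\<^sup>+y. ennreal (V y) \<partial>p s x) \<partial>lborel)
        \<le> ennreal (V x) + ennreal b * semi.occ t x C'"
      using drift_integrated[where P = P and x = x, OF P_facts(1,2) Om t V(1) V0 C'm less_imp_le[OF \<kappa>] less_imp_le[OF b] drift]
      unfolding 1 2 trans_prob_p[OF t] .
  qed (use V \<kappa> b C'm in auto)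
  \<comment> \<open>The compact set of the aperiodicity condition serves as regeneration set; its
    positive \<open>\<psi>\<close> measure makes it accessible from every point.\<close>
  obtain \<psi> d \<epsilon> Ks \<rho> where \<psi>: "psi_irreducible P \<psi>" and d: "0 < d" and \<epsilon>: "0 < (\<epsilon>::real)" and Ks: "compact Ks" "0 < emeasure \<psi> Ks"
    and \<rho>: "prob_space \<rho>" "sets \<rho> = sets borel"
    and minor: "\<And>x B. x \<in> Ks \<Longrightarrow> B \<in> sets borel \<Longrightarrow> ennreal \<epsilon> * emeasure \<rho> B \<le> emeasure (trans_prob P d x) B"
    using ap unfolding aperiodic_def by blast
  have Km: "Ks \<in> sets borel" using Ks(1) by (intro borel_closed compact_imp_closed)
  have irr: "0 < (\<integral>\<^sup>+s\<in>{0..}. emeasure (p s x) Ks \<partial>lborel)" for x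
    using \<psi> Ks(2) Km unfolding psi_irreducible_def occupation[OF Km, symmetric] by blast
  obtain a \<nu> where a: "prob_space a" "sets a = sets borel" "emeasure a {0<..} = 1"
    and \<nu>: "sets \<nu> = sets borel" "emeasure \<nu> UNIV \<noteq> 0"
    and pet: "\<And>x B. x \<in> C' \<Longrightarrow> B \<in> sets borel \<Longrightarrow> emeasure \<nu> B \<le> (\<integral>\<^sup>+t\<in>{0<..}. emeasure (trans_prob P t x) B \<partial>a)"
    using C'(2) unfolding petite_def by blast
  have pet': "emeasure \<nu> B \<le> (\<integral>\<^sup>+t\<in>{0<..}. emeasure (p t x) B \<partial>a)" if "x \<in> C'" "B \<in> sets borel" for x B
  proof -
    have "(\<integral>\<^sup>+t\<in>{0<..}. emeasure (trans_prob P t x) B \<partial>a) = (\<integral>\<^sup>+t\<in>{0<..}. emeasure (p t x) B \<partial>a)"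
      by (intro nn_integral_cong) (auto simp: indicator_def trans_prob_p)
    then show ?thesis using pet[OF that] by simp
  qed
  obtain N c where Nc: "0 \<le> N" "0 < c" "\<And>x. x \<in> C' \<Longrightarrow> c \<le> semi.occ N x Ks"
    using semi.petite_occ[OF Km irr a \<nu> pet'] by blast
  have minor': "ennreal \<epsilon> * emeasure \<rho> B \<le> emeasure (p d x) B" if "x \<in> Ks" "B \<in> sets borel" for x B
    using minor[OF that] d by (simp add: trans_prob_p)
  have \<epsilon>': "0 < ennreal \<epsilon>" using \<epsilon> by simp
  \<comment> \<open>\<open>8 * dr.K0\<close> is the level at which Harris' theorem asks for a
    minorisation when the drift constant is \<open>K0\<close>.\<close>
  have R: "0 \<le> 8 * dr.K0" using dr.K0_pos by simp
  obtain T \<delta> where T: "dr.t1 \<le> T" "0 < \<delta>"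
    "\<And>x B. V x \<le> 8 * dr.K0 \<Longrightarrow> B \<in> sets borel \<Longrightarrow> ennreal \<delta> * emeasure \<rho> B \<le> emeasure (p T x) B"
    using dr.sublevel_sets_small[OF Km irr Nc \<rho> less_imp_le[OF d] \<epsilon>' minor' R] by blast
  \<comment> \<open>The contraction is formulated for \<open>\<delta> \<le> 1\<close>; lowering the
    constant keeps the minorisation.\<close>
  have small: "ennreal (min \<delta> 1) * emeasure \<rho> B \<le> emeasure (p T x) B" if "V x \<le> 8 * dr.K0" "B \<in> sets borel" for x B
    by (rule order_trans[OF mult_right_mono T(3)[OF that]]) (auto intro: ennreal_leI)
  have \<delta>: "0 < min \<delta> 1" "min \<delta> 1 \<le> 1" using T(2) by auto
  have \<pi>1: "prob_space \<pi>" "sets \<pi> = sets borel" using \<pi> by (auto simp: invariant_prob_def)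
  have \<pi>2: "(\<integral>\<^sup>+x. emeasure (p t x) B \<partial>\<pi>) = emeasure \<pi> B" if "0 \<le> t" "B \<in> sets borel" for t B
    using \<pi> that unfolding invariant_prob_def trans_prob_p[OF that(1), symmetric] by blast
  obtain M c' where c': "0 < c'" and erg: "\<And>x t f. 0 \<le> t \<Longrightarrow> f \<in> borel_measurable borel \<Longrightarrow> (\<And>y. \<bar>f y\<bar> \<le> V y) \<Longrightarrow>
        \<bar>(\<integral>y. f y \<partial>p t x) - (\<integral>y. f y \<partial>\<pi>)\<bar> \<le> M * V x * exp (- c' * t)"
  proof (rule dr.geometric_ergodicity[of \<pi> T "min \<delta> 1" \<rho>])
    fix M c assume "0 < c" and "\<And>x t f. 0 \<le> t \<Longrightarrow> f \<in> borel_measurable borel \<Longrightarrow> (\<And>y. \<bar>f y\<bar> \<le> V y) \<Longrightarrow>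
        \<bar>(\<integral>y. f y \<partial>p t x) - (\<integral>y. f y \<partial>\<pi>)\<bar> \<le> M * V x * exp (- c * t)"
    then show thesis by (rule that)
  qed (assumption | rule \<pi>1 \<pi>2 T(1) \<delta> \<rho> small)+
  show ?thesis
    unfolding V_uniformly_geometrically_ergodic_def
  proof (intro conjI allI impI)
    show "integrable \<pi> V" by (rule dr.integrable_V_invariant) (assumption | rule \<pi>1 \<pi>2)+
    show "integrable (trans_prob P t x) V" if "0 \<le> t" for t x
      unfolding trans_prob_p[OF that] by (rule dr.integrable_V_p[OF that])
    have "V_dist V (trans_prob P t x) \<pi> \<le> ennreal (M * V x * exp (- c' * t))" if "0 \<le> t" for t x
      unfolding V_dist_def trans_prob_p[OF that] using erg[OF that] by (intro SUP_least ennreal_leI) auto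
    then show "\<exists>M c. 0 < c \<and> (\<forall>x. \<forall>t\<ge>0. V_dist V (trans_prob P t x) \<pi> \<le> ennreal (M * V x * exp (- c * t)))"
      using c' by blast
  qed
qed

end

theorem corollary1:
  fixes I :: "'i set"
    and S :: "'i \<Rightarrow> 'a::{metric_space,second_countable_topology} set"
    and sdim :: "'i \<Rightarrow> nat"
    and atlas :: "'i \<Rightarrow> 'a chart set"
    and g :: "'i \<Rightarrow> 'a chart \<Rightarrow> 'a \<Rightarrow> nat \<Rightarrow> nat \<Rightarrow> real"
    and Q :: "'i \<Rightarrow> 'a \<Rightarrow> (real \<Rightarrow> 'a) measure"
    and C :: "'i \<Rightarrow> ('a \<Rightarrow> real) set"
    and Edges :: "'e set"
    and tail head :: "'e \<Rightarrow> 'i"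
    and K :: "'e \<Rightarrow> 'a \<Rightarrow> 'a measure"
    and rate :: "'e \<Rightarrow> 'a \<Rightarrow> real"
    and P :: "'a \<Rightarrow> (real \<Rightarrow> 'a) measure"
    and U :: "nat \<Rightarrow> 'a set"
    and V :: "'a \<Rightarrow> real"
    and \<pi> :: "'a measure"
  assumes "stratified_riemannian_space I S sdim atlas g"
    and "assumption_D I S Q C"
    and "assumption_J I S Edges tail head K rate"
    and "stratified_jump_diffusion I S Q C Edges tail K rate P"
    and "exhaustion U"
    and "assumption_L P U V"
    and "invariant_prob P \<pi>"
    and "\<exists>G. G \<in> borel_measurable borel \<and>
           (\<forall>m\<ge>1. \<exists>H. trunc_ext_gen P (U m) V H \<and> (\<forall>x\<in>U m. H x = G x))"
    and "aperiodic P"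
  shows "V_uniformly_geometrically_ergodic P \<pi> V"
proof -
  have sp: "countable I" "disjoint_family_on S I" "(\<Union>\<alpha>\<in>I. S \<alpha>) = UNIV" "\<And>\<alpha>. \<alpha> \<in> I \<Longrightarrow> S \<alpha> \<in> sets borel"
    using assms(1) unfolding stratified_riemannian_space_def by blast+
  have "martingale_family I S Q C Edges tail head K rate P"
    using sp assms(2-4) by unfold_locales auto
  then show ?thesis
    using assms(5,6,7,9) by (rule martingale_family.V_uniform_ergodicity)
qed

end
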